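(* Let $(\mathbb{X},\mathbb{R}^d)$ be a non-periodic topological tiling dynamical system with pure-point spectrum generated by a primitive inflation rule, with transversal $\mathbb{X}_0$. Then $\mathrm{OSD}(\mathbb{X},\mathbb{R}^d)$ coincides with the upper box counting dimension of the metric space $\bigl([\mathbb{X}_0],D\bigr)$.
   Context: **Tilings.** A tile is a compact subset of $\mathbb{R}^d$ that is the closure of its interior, has boundary of Lebesgue measure $0$, and carries a type label; tiles of the same type are translates of each other and there are finitely many types. A tiling is a covering of $\mathbb{R}^d$ by tiles that overlap at most on their boundaries. For a tiling $x$, $x\sqcap B_r(a)$ is the set of tiles of $x$ meeting the closed ball $B_r(a)$; finite local complexity (FLC) means that, for each $r$, there are finitely many such patches up to translation. The tiling metric is $d(x_1,x_2)=\min\{\widetilde d(x_1,x_2),2^{-1/2}\}$ with $\widetilde d(x_1,x_2)=\inf\{\varepsilon>0:\exists\,t_1,t_2\in B_\varepsilon(0)\text{ with }(x_1-t_1)\sqcap B_{1/\varepsilon}(0)=(x_2-t_2)\sqcap B_{1/\varepsilon}(0)\}$. **Inflation.** A (stone) inflation $\varrho$ with factor $\lambda>1$ scales a tile, patch or tiling by $\lambda$ (about the origin) and dissects each scaled tile into tiles of the original sizes, in a way depending only on the tile type. It is primitive if some power of $\varrho$ maps every tile to a patch containing tiles of all types. $\mathbb{X}$ is the space of all tilings generated by $\varrho$ (a compact, strictly ergodic $\mathbb{R}^d$-system under translation). Standing assumptions: the tilings are FLC and non-periodic ($x+t=x$ only for $t=0$), and the translation action has pure-point dynamical spectrum with respect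 to the unique invariant probability measure. **Control points and transversal.** A return vector is a $t\in\mathbb{R}^d$ such that tiles $\tau$ and $\tau+t$ of the same type occur in one tiling of $\mathbb{X}$; $R$ is the $\mathbb{Z}$-span of all return vectors and $R_{\mathrm{ev}}=\bigcup_{n\ge0}\lambda^{-n}R$. Each tile $\tau$ is given a control point $\mathrm{cp}(\tau)$ with $\mathrm{cp}(\tau+t)=\mathrm{cp}(\tau)+t$, chosen such that differences of control points within a tiling lie in $R_{\mathrm{ev}}$, $\lambda\,\mathrm{cp}(\tau)$ is the control point of one of the tiles in the inflated tile $\varrho(\tau)$, and distinct tiles of a tiling have distinct control points. $\mathrm{cp}(x)$ is the set of control points of $x$, and $\mathbb{X}_0=\{x\in\mathbb{X}:0\in\mathrm{cp}(x)\}$. **OSD.** Fix a Følner sequence $\mathcal F=\{F_n\}$ in $\mathbb{R}^d$ (the choice is immaterial); $|\cdot|$ is Lebesgue measure. For $\delta>0$, $D_\delta(x,y)=\limsup_n|\{t:d(x+t,y+t)\ge\delta\}\cap F_n|/|F_n|$. A set $S\subseteq\mathbb{X}$ is $(\delta,\nu)$-separated if $D_\delta(x,y)\ge\nu$ for all distinct $x,y\in S$; $\mathrm{Sep}(\mathbb{X},\delta,\nu)$ is the maximal cardinality of such a set. $\mathrm{OSD}(\mathbb{X},\mathbb{R}^d)=\sup_{\delta>0}\limsup_{\nu\searrow0}\frac{\log\mathrm{Sep}(\mathbb{X},\delta,\nu)}{-\log\nu}$. **The metric space $([\mathbb{X}_0],D)$.** For $x,y\in\mathbb{X}_0$, $\mathrm{disc}(x,y)$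 is the union of the supports of all tiles of $x$ or $y$ that do not occur in both tilings, and $D(x,y)=\limsup_n|\mathrm{disc}(x,y)\cap F_n|/|F_n|$, a pseudometric on $\mathbb{X}_0$. On $\mathbb{X}$ let $x\sim y$ iff $D_{\mathrm W}(x,y)=0$, where $D_{\mathrm W}(x,y)=\sup_{\mathcal F}\limsup_n\frac1{|F_n|}\int_{F_n}d(x+t,y+t)\,\mathrm dt$, the supremum being over all Følner sequences; $[x]$ is the class of $x$ and $[\mathbb{X}_0]=\{[x]:x\in\mathbb{X}_0\}$. For $x,y\in\mathbb{X}_0$, $x\sim y$ iff $D(x,y)=0$, so $D([x],[y])=D(x,y)$ ($x,y\in\mathbb{X}_0$) is a well-defined metric on $[\mathbb{X}_0]$. The upper box counting dimension of a metric space is $\limsup_{\nu\searrow0}\log N(\nu)/(-\log\nu)$, with $N(\nu)$ the maximal cardinality of a subset whose distinct points have distance $\ge\nu$. *)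

theory Defs
  imports "HOL-Probability.Probability"
begin

text \<open>
  Euclidean space is a type of class \<open>euclidean_space\<close>, the finitely many tile types are the
  elements of a finite type. A tile is encoded as a pair \<open>(v, i)\<close> of a position and a type:
  it is the prototile of type \<open>i\<close> translated by \<open>v\<close>. As prototiles are compact and nonempty,
  the position is determined by the support and the type of the tile.
  Patches and tilings are sets of tiles.
\<close>

type_synonym ('a, 'l) tile = "'a \<times> 'l"

definition supp :: "('l \<Rightarrow> 'a::euclidean_space set) \<Rightarrow> ('a, 'l) tile \<Rightarrow> 'a set" where
  "supp shape \<tau> = (+) (fst \<tau>) ` shape (snd \<tau>)"

definition prototiles :: "('l::finite \<Rightarrow> 'a::euclidean_space set) \<Rightarrow> bool" where
  "prototiles shape \<longleftrightarrow>
     (\<forall>i. shape i \<noteq> {} \<and> compact (shape i) \<and> closure (interior (shape i)) = shape i \<and>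
          negligible (frontier (shape i)))"

definition shift_tile :: "'a::euclidean_space \<Rightarrow> ('a, 'l) tile \<Rightarrow> ('a, 'l) tile" where
  "shift_tile t \<tau> = (fst \<tau> + t, snd \<tau>)"

definition shift :: "'a::euclidean_space \<Rightarrow> ('a, 'l) tile set \<Rightarrow> ('a, 'l) tile set" where
  "shift t x = shift_tile t ` x"

definition nonoverlapping ::
    "('l \<Rightarrow> 'a::euclidean_space set) \<Rightarrow> ('a, 'l) tile set \<Rightarrow> bool" where
  "nonoverlapping shape P \<longleftrightarrow>
     (\<forall>\<sigma>\<in>P. \<forall>\<tau>\<in>P. \<sigma> \<noteq> \<tau> \<longrightarrow>
        supp shape \<sigma> \<inter> supp shape \<tau> \<subseteq> frontier (supp shape \<sigma>) \<inter> frontier (supp shape \<tau>))"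

definition tiling :: "('l \<Rightarrow> 'a::euclidean_space set) \<Rightarrow> ('a, 'l) tile set \<Rightarrow> bool" where
  "tiling shape x \<longleftrightarrow> (\<Union>\<tau>\<in>x. supp shape \<tau>) = UNIV \<and> nonoverlapping shape x"

definition patch_at ::
    "('l \<Rightarrow> 'a::euclidean_space set) \<Rightarrow> ('a, 'l) tile set \<Rightarrow> 'a \<Rightarrow> real \<Rightarrow> ('a, 'l) tile set" where
  "patch_at shape x a r = {\<tau> \<in> x. supp shape \<tau> \<inter> cball a r \<noteq> {}}"

definition flc :: "('l \<Rightarrow> 'a::euclidean_space set) \<Rightarrow> ('a, 'l) tile set set \<Rightarrow> bool" where
  "flc shape X \<longleftrightarrow>
     (\<forall>r. \<exists>\<P>. finite \<P> \<and> (\<forall>x\<in>X. \<forall>a. \<exists>P\<in>\<P>. \<exists>t. patch_at shape x a r = shift t P))"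

definition non_periodic :: "('a::euclidean_space, 'l) tile set set \<Rightarrow> bool" where
  "non_periodic X \<longleftrightarrow> (\<forall>x\<in>X. \<forall>t. shift t x = x \<longrightarrow> t = 0)"

text \<open>
  The cut-off \<open>2 powr (-1/2)\<close> is inserted into the set instead of taking a minimum afterwards,
  so that an empty set of admissible \<open>\<epsilon>\<close> counts as having infinite infimum.
\<close>

definition tdist ::
    "('l \<Rightarrow> 'a::euclidean_space set) \<Rightarrow> ('a, 'l) tile set \<Rightarrow> ('a, 'l) tile set \<Rightarrow> real" where
  "tdist shape x y = Inf (insert (2 powr (-1/2))
     {\<epsilon>. \<epsilon> > 0 \<and> (\<exists>s\<in>cball 0 \<epsilon>. \<exists>t\<in>cball 0 \<epsilon>.
        patch_at shape (shift (- s) x) 0 (1 / \<epsilon>) = patch_at shape (shift (- t) y) 0 (1 / \<epsilon>))})"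

text \<open>
  \<open>rho i\<close> is the patch that dissects the prototile of type \<open>i\<close>, scaled about the origin.
  The inflation acts on every other tile of type \<open>i\<close> by equivariance.
\<close>

definition stone_inflation ::
    "('l \<Rightarrow> 'a::euclidean_space set) \<Rightarrow> real \<Rightarrow> ('l \<Rightarrow> ('a, 'l) tile set) \<Rightarrow> bool" where
  "stone_inflation shape lam rho \<longleftrightarrow> lam > 1 \<and>
     (\<forall>i. finite (rho i) \<and> nonoverlapping shape (rho i) \<and>
          (\<Union>\<tau>\<in>rho i. supp shape \<tau>) = (*\<^sub>R) lam ` shape i)"

definition inflate ::
    "real \<Rightarrow> ('l \<Rightarrow> ('a::euclidean_space, 'l) tile set) \<Rightarrow> ('a, 'l) tile set \<Rightarrow> ('a, 'l) tile set"
  where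
  "inflate lam rho P = (\<Union>\<tau>\<in>P. shift (lam *\<^sub>R fst \<tau>) (rho (snd \<tau>)))"

definition primitive_inflation ::
    "real \<Rightarrow> ('l \<Rightarrow> ('a::euclidean_space, 'l) tile set) \<Rightarrow> bool" where
  "primitive_inflation lam rho \<longleftrightarrow>
     (\<exists>n\<ge>1. \<forall>\<tau>. snd ` (inflate lam rho ^^ n) {\<tau>} = UNIV)"

text \<open>
  A tiling is generated by the inflation if each of its finite patches occurs in some iterated
  inflation of a single tile. As \<open>\<tau>\<close> has an arbitrary position, this is up to translation.
\<close>

definition inflation_hull ::
    "('l \<Rightarrow> 'a::euclidean_space set) \<Rightarrow> real \<Rightarrow> ('l \<Rightarrow> ('a, 'l) tile set) \<Rightarrow> ('a, 'l) tile set set"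
  where
  "inflation_hull shape lam rho =
     {x. tiling shape x \<and>
         (\<forall>P. finite P \<and> P \<subseteq> x \<longrightarrow> (\<exists>n \<tau>. P \<subseteq> (inflate lam rho ^^ n) {\<tau>}))}"

definition invariant_prob ::
    "('l \<Rightarrow> 'a::euclidean_space set) \<Rightarrow> ('a, 'l) tile set set \<Rightarrow> ('a, 'l) tile set measure \<Rightarrow> bool"
  where
  "invariant_prob shape X \<mu> \<longleftrightarrow>
     prob_space \<mu> \<and>
     sets \<mu> = sigma_sets X {U. openin (Metric_space.mtopology X (tdist shape)) U} \<and>
     (\<forall>t. shift t \<in> measurable \<mu> \<mu> \<and> distr \<mu> \<mu> (shift t) = \<mu>)"

definition unique_invariant_prob ::
    "('l \<Rightarrow> 'a::euclidean_space set) \<Rightarrow> ('a, 'l) tile set set \<Rightarrow> ('a, 'l) tile set measure \<Rightarrow> bool"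
  where
  "unique_invariant_prob shape X \<mu> \<longleftrightarrow>
     invariant_prob shape X \<mu> \<and> (\<forall>\<mu>'. invariant_prob shape X \<mu>' \<longrightarrow> \<mu>' = \<mu>)"

definition square_integrable :: "'x measure \<Rightarrow> ('x \<Rightarrow> complex) \<Rightarrow> bool" where
  "square_integrable \<mu> f \<longleftrightarrow>
     f \<in> borel_measurable \<mu> \<and> integrable \<mu> (\<lambda>x. (norm (f x))\<^sup>2)"

definition eigenfunction ::
    "('a::euclidean_space, 'l) tile set measure \<Rightarrow> (('a, 'l) tile set \<Rightarrow> complex) \<Rightarrow> bool" where
  "eigenfunction \<mu> f \<longleftrightarrow>
     square_integrable \<mu> f \<and> \<not> (AE x in \<mu>. f x = 0) \<and>
     (\<exists>k. \<forall>t. AE x in \<mu>. f (shift t x) = cis (2 * pi * (k \<bullet> t)) * f x)"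

text \<open>
  Pure-point spectrum: the linear span of the eigenfunctions is dense in \<open>L\<^sup>2(\<mu>)\<close>.
\<close>

definition pure_point_spectrum :: "('a::euclidean_space, 'l) tile set measure \<Rightarrow> bool" where
  "pure_point_spectrum \<mu> \<longleftrightarrow>
     (\<forall>g \<epsilon>. square_integrable \<mu> g \<and> \<epsilon> > 0 \<longrightarrow>
        (\<exists>E c. finite E \<and> (\<forall>f\<in>E. eigenfunction \<mu> f) \<and>
           (\<integral>x. (norm (g x - (\<Sum>f\<in>E. c f * f x)))\<^sup>2 \<partial>\<mu>) < \<epsilon>))"

definition return_vectors :: "('a::euclidean_space, 'l) tile set set \<Rightarrow> 'a set" where
  "return_vectors X = {t. \<exists>x\<in>X. \<exists>\<tau>. \<tau> \<in> x \<and> shift_tile t \<tau> \<in> x}"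

definition int_span :: "'a::real_vector set \<Rightarrow> 'a set" where
  "int_span A = {\<Sum>r\<in>B. real_of_int (c r) *\<^sub>R r | B c. finite B \<and> B \<subseteq> A}"

definition R_ev :: "real \<Rightarrow> ('a::euclidean_space, 'l) tile set set \<Rightarrow> 'a set" where
  "R_ev lam X = (\<Union>n::nat. (*\<^sub>R) (1 / lam ^ n) ` int_span (return_vectors X))"

definition control_points ::
    "real \<Rightarrow> ('l \<Rightarrow> ('a::euclidean_space, 'l) tile set) \<Rightarrow> ('a, 'l) tile set set \<Rightarrow>
     (('a, 'l) tile \<Rightarrow> 'a) \<Rightarrow> bool" where
  "control_points lam rho X cp \<longleftrightarrow>
     (\<forall>\<tau> t. cp (shift_tile t \<tau>) = cp \<tau> + t) \<and>
     (\<forall>x\<in>X. \<forall>\<sigma>\<in>x. \<forall>\<tau>\<in>x. cp \<sigma> - cp \<tau> \<in> R_ev lam X) \<and>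
     (\<forall>\<tau>. \<exists>\<sigma>\<in>inflate lam rho {\<tau>}. cp \<sigma> = lam *\<^sub>R cp \<tau>) \<and>
     (\<forall>x\<in>X. inj_on cp x)"

definition transversal ::
    "('a::euclidean_space, 'l) tile set set \<Rightarrow> (('a, 'l) tile \<Rightarrow> 'a) \<Rightarrow> ('a, 'l) tile set set" where
  "transversal X cp = {x \<in> X. 0 \<in> cp ` x}"

text \<open>
  The sets are only required to have finite positive measure, and the invariance is required
  for each translation separately. This covers the stronger variants (compact sets, uniform
  invariance under compact sets of translations) as special cases.
\<close>

definition folner :: "(nat \<Rightarrow> 'a::euclidean_space set) \<Rightarrow> bool" where
  "folner F \<longleftrightarrow>
     (\<forall>n. F n \<in> lmeasurable \<and> measure lebesgue (F n) > 0) \<and>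
     (\<forall>t. (\<lambda>n. measure lebesgue (sym_diff (F n) ((+) t ` F n)) / measure lebesgue (F n))
            \<longlonglongrightarrow> 0)"

definition upper_density :: "(nat \<Rightarrow> 'a::euclidean_space set) \<Rightarrow> 'a set \<Rightarrow> ereal" where
  "upper_density F A =
     limsup (\<lambda>n. ereal (measure lebesgue (A \<inter> F n) / measure lebesgue (F n)))"

text \<open>
  The supremum over finite separated sets is the maximal cardinality if this is finite, and
  \<open>\<infinity>\<close> if there are infinite or arbitrarily large finite separated sets.
\<close>

definition sep_number :: "'p set \<Rightarrow> ('p \<Rightarrow> 'p \<Rightarrow> ereal) \<Rightarrow> real \<Rightarrow> enat" where
  "sep_number M \<rho> \<nu> =
     (SUP S\<in>{S. S \<subseteq> M \<and> finite S \<and> (\<forall>x\<in>S. \<forall>y\<in>S. x \<noteq> y \<longrightarrow> \<rho> x y \<ge> ereal \<nu>)}. enat (card S))"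

definition log_enat :: "enat \<Rightarrow> ereal" where
  "log_enat N = (case N of enat k \<Rightarrow> if k = 0 then - \<infinity> else ereal (ln (real k)) | \<infinity> \<Rightarrow> \<infinity>)"

definition upper_box_dim :: "'p set \<Rightarrow> ('p \<Rightarrow> 'p \<Rightarrow> ereal) \<Rightarrow> ereal" where
  "upper_box_dim M \<rho> =
     Limsup (at_right 0) (\<lambda>\<nu>. log_enat (sep_number M \<rho> \<nu>) / ereal (- ln \<nu>))"

definition D_sep ::
    "('l \<Rightarrow> 'a::euclidean_space set) \<Rightarrow> (nat \<Rightarrow> 'a set) \<Rightarrow> real \<Rightarrow>
     ('a, 'l) tile set \<Rightarrow> ('a, 'l) tile set \<Rightarrow> ereal" where
  "D_sep shape F \<delta> x y = upper_density F {t. tdist shape (shift t x) (shift t y) \<ge> \<delta>}"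

definition OSD ::
    "('l \<Rightarrow> 'a::euclidean_space set) \<Rightarrow> (nat \<Rightarrow> 'a set) \<Rightarrow> ('a, 'l) tile set set \<Rightarrow> ereal" where
  "OSD shape F X =
     (SUP \<delta>\<in>{0<..}.
        Limsup (at_right 0) (\<lambda>\<nu>. log_enat (sep_number X (D_sep shape F \<delta>) \<nu>) / ereal (- ln \<nu>)))"

definition disc ::
    "('l \<Rightarrow> 'a::euclidean_space set) \<Rightarrow> ('a, 'l) tile set \<Rightarrow> ('a, 'l) tile set \<Rightarrow> 'a set" where
  "disc shape x y = (\<Union>\<tau>\<in>sym_diff x y. supp shape \<tau>)"

definition D_disc ::
    "('l \<Rightarrow> 'a::euclidean_space set) \<Rightarrow> (nat \<Rightarrow> 'a set) \<Rightarrow>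
     ('a, 'l) tile set \<Rightarrow> ('a, 'l) tile set \<Rightarrow> ereal" where
  "D_disc shape F x y = upper_density F (disc shape x y)"

definition D_W ::
    "('l \<Rightarrow> 'a::euclidean_space set) \<Rightarrow> ('a, 'l) tile set \<Rightarrow> ('a, 'l) tile set \<Rightarrow> ereal" where
  "D_W shape x y =
     (SUP F\<in>Collect folner. limsup (\<lambda>n.
        ereal ((LINT t:F n|lebesgue. tdist shape (shift t x) (shift t y)) / measure lebesgue (F n))))"

definition W_class ::
    "('l \<Rightarrow> 'a::euclidean_space set) \<Rightarrow> ('a, 'l) tile set set \<Rightarrow>
     ('a, 'l) tile set \<Rightarrow> ('a, 'l) tile set set" where
  "W_class shape X x = {y \<in> X. D_W shape x y = 0}"

text \<open>
  The distance of two classes is the common value of \<open>D_disc\<close> on their representatives in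
  the transversal \<open>X0\<close>.
\<close>

definition class_dist ::
    "('l \<Rightarrow> 'a::euclidean_space set) \<Rightarrow> (nat \<Rightarrow> 'a set) \<Rightarrow> ('a, 'l) tile set set \<Rightarrow>
     ('a, 'l) tile set set \<Rightarrow> ('a, 'l) tile set set \<Rightarrow> ereal" where
  "class_dist shape F X0 A B =
     (THE r. \<forall>x\<in>A \<inter> X0. \<forall>y\<in>B \<inter> X0. D_disc shape F x y = r)"

end

theory Submission
  imports Defs "HOL-Computational_Algebra.Fundamental_Theorem_Algebra"
begin

text \<open>
  Pure-point spectrum enters through two rigidity properties. First, an eigenvalue \<open>k\<close> satisfies
  \<open>k \<bullet> \<lambda>\<^sup>n v \<rightarrow> 0\<close> modulo 1 for every return vector \<open>v\<close>. As \<open>\<lambda>\<close> is algebraic, the convergence is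
  geometric, and since every element of the set \<open>\<Delta>\<close> of differences of control points within a tiling
  is a difference of two finite sums \<open>\<Sum> \<lambda>\<^sup>j e\<^sub>j\<close> with digits from a finite set, it is uniform over \<open>\<Delta>\<close>.
  The eigenvalues span the space, so a sum of boundedly many elements of \<open>\<Delta>\<close> is \<open>0\<close> or bounded away
  from \<open>0\<close> (the Meyer property). Second, translation by \<open>\<lambda>\<^sup>n v\<close> with \<open>v \<in> \<Delta>\<close> converges strongly to the
  identity, so every overlap of a tile of \<open>x\<close> with a tile of \<open>x + v\<close> produces a common tile after some
  number of inflations. By the Meyer property there are only finitely many overlaps up to translation, hence
  the non-coincident part decays geometrically, and \<open>disc(x, x + \<lambda>\<^sup>n v)\<close> has small density in all
  large balls, uniformly in \<open>v \<in> \<Delta>\<close>. Since \<open>\<lambda>\<^sup>n \<Delta>\<close> is relatively dense, \<open>disc(x, y)\<close> has almost the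
  same density in all large balls, and therefore the same density along all Folner sequences. This
  is needed because the orbit separation at \<open>t\<close> sees \<open>disc(x, y)\<close> at \<open>- t\<close>.

  For \<open>x\<close>, \<open>y\<close> in the transversal, tilings that agree near \<open>p\<close> up to a small shift agree
  exactly near \<open>p\<close>, by the Meyer property; hence \<open>x - p\<close> and \<open>y - p\<close> have distance at least a constant
  \<open>\<delta>\<^sub>0\<close> for all \<open>p \<in> disc(x, y)\<close>, which bounds the box dimension by the orbit separation dimension.
  Conversely, every tiling is a translate of one in the transversal by a vector of bounded length. Up to
  a finite net of such vectors, \<open>\<delta>\<close>-separation at \<open>t\<close> forces a tile of \<open>disc(x, y)\<close> near \<open>- t\<close>.
\<close>

section \<open>Tilings and the tiling metric\<close>

text \<open>Eigenfunctions are only square-integrable classes, so an eigenvalue is tested on a set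
  of tilings whose measure is bounded below independently of \<open>n\<close>, with a uniformly
  continuous function close to the eigenfunction in the mean. The lower bound comes from covering
  \<open>X\<close> by a fixed number of translates of that set, and uniqueness of the invariant
  measure supplies ergodicity. Level-\<open>n\<close> supertiles of a tiling are read off from the
  definition of the hull: a large patch lies in some \<open>infl N {\<tau>}\<close> with
  \<open>N\<close> at least \<open>n\<close>, and its tiles are grouped by their ancestors
  \<open>n\<close> generations back. The Meyer property is formulated for four summands because an
  overlap is described by an element of \<open>\<Delta> + \<Delta>\<close>, and finiteness of the
  overlaps asks for separation of two such elements. The decay constants have to be uniform in the
  tilings, in the vector of \<open>\<Delta>\<close> and in the centre of the ball, since the
  comparison of two balls first fixes the number of inflations and only then takes the radius
  large.\<close>

lemma shift_tile_0 [simp]: "shift_tile 0 \<tau> = \<tau>"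
  by (simp add: shift_tile_def)

lemma shift_tile_shift_tile [simp]: "shift_tile s (shift_tile t \<tau>) = shift_tile (s + t) \<tau>"
  by (simp add: shift_tile_def algebra_simps)

lemma fst_shift_tile [simp]: "fst (shift_tile t \<tau>) = fst \<tau> + t"
  and snd_shift_tile [simp]: "snd (shift_tile t \<tau>) = snd \<tau>"
  by (simp_all add: shift_tile_def)

lemma shift_0 [simp]: "shift 0 x = x"
  by (simp add: shift_def)

lemma shift_shift [simp]: "shift s (shift t x) = shift (s + t) x"
  by (simp add: shift_def image_image)

lemma mem_shift: "\<tau> \<in> shift t x \<longleftrightarrow> shift_tile (- t) \<tau> \<in> x"
proof
  assume "shift_tile (- t) \<tau> \<in> x"
  then have "shift_tile t (shift_tile (- t) \<tau>) \<in> shift t x"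
    unfolding shift_def by (rule imageI)
  then show "\<tau> \<in> shift t x" by simp
qed (auto simp: shift_def)

lemma inj_shift_tile: "inj (shift_tile t)"
  by (rule inj_on_inverseI[where g = "shift_tile (- t)"]) simp

lemma shift_tile_mem_shift [simp]: "shift_tile t \<tau> \<in> shift t x \<longleftrightarrow> \<tau> \<in> x"
  by (simp add: mem_shift)

lemma shift_mono: "x \<subseteq> y \<Longrightarrow> shift t x \<subseteq> shift t y"
  by (auto simp: shift_def)

lemma finite_shift [simp]: "finite (shift t x) \<longleftrightarrow> finite x"
  unfolding shift_def by (rule finite_image_iff) (rule inj_on_subset[OF inj_shift_tile subset_UNIV])

lemma shift_singleton [simp]: "shift t {\<tau>} = {shift_tile t \<tau>}"
  by (simp add: shift_def)

lemma supp_shift_tile: "supp shape (shift_tile t \<tau>) = (+) t ` supp shape \<tau>"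
  by (auto simp: supp_def image_image algebra_simps)

lemma mem_supp_shift_tile [simp]: "p \<in> supp shape (shift_tile t \<tau>) \<longleftrightarrow> p - t \<in> supp shape \<tau>"
  unfolding supp_shift_tile by (auto intro: image_eqI[where x = "p - t"])

lemma supp_shift_Int_cball:
  "supp shape (shift_tile t \<tau>) \<inter> cball a r \<noteq> {} \<longleftrightarrow> supp shape \<tau> \<inter> cball (a - t) r \<noteq> {}"
proof -
  have "supp shape (shift_tile t \<tau>) \<inter> cball a r = (+) t ` (supp shape \<tau> \<inter> cball (a - t) r)"
  proof -
    have "cball a r = (+) t ` cball (a - t) r"
      by (metis cball_translation diff_add_cancel add.commute)
    then show ?thesis
      by (simp add: supp_shift_tile image_Int)
  qed
  then show ?thesis by simp
qed

lemma patch_at_shift: "patch_at shape (shift t x) a r = shift t (patch_at shape x (a - t) r)"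
  by (rule set_eqI) (simp add: patch_at_def mem_shift supp_shift_Int_cball)

lemma shift_eq_iff: "shift t x = shift t y \<longleftrightarrow> x = y"
  by (metis add.right_inverse add.commute shift_0 shift_shift)

lemma patch_at_mono_eq:
  assumes "patch_at shape x a R = patch_at shape y a R" "cball b r \<subseteq> cball a R"
  shows "patch_at shape x b r = patch_at shape y b r"
proof -
  have *: "patch_at shape z b r = patch_at shape (patch_at shape z a R) b r" for z
    using assms(2) by (auto simp: patch_at_def)
  show ?thesis
    by (subst (1 2) *) (simp add: assms(1))
qed

lemma patch_at_shift_eq_iff:
  "patch_at shape (shift s x) a r = patch_at shape (shift t y) a r \<longleftrightarrow>
   patch_at shape (shift (s + u) x) (a + u) r = patch_at shape (shift (t + u) y) (a + u) r"
proof -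
  have *: "patch_at shape (shift (s + u) x) (a + u) r = shift u (patch_at shape (shift s x) a r)" for s x
    by (simp add: patch_at_shift algebra_simps)
  show ?thesis
    by (simp only: * shift_eq_iff)
qed

section \<open>The tiling metric\<close>

definition tmatch :: "('l \<Rightarrow> 'a::euclidean_space set) \<Rightarrow> real \<Rightarrow> ('a, 'l) tile set \<Rightarrow> ('a, 'l) tile set \<Rightarrow> bool" where
  "tmatch shape \<epsilon> x y \<longleftrightarrow> \<epsilon> > 0 \<and> (\<exists>s\<in>cball 0 \<epsilon>. \<exists>t\<in>cball 0 \<epsilon>.
     patch_at shape (shift (- s) x) 0 (1 / \<epsilon>) = patch_at shape (shift (- t) y) 0 (1 / \<epsilon>))"

lemma half_le_cut: "1 / 2 \<le> (2::real) powr (-1/2)"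
proof -
  have "(2::real) powr (-1) \<le> 2 powr (-1/2)" by (intro powr_mono) auto
  then show ?thesis by (simp add: powr_minus_divide)
qed

lemma tdist_alt: "tdist shape x y = Inf (insert (2 powr (-1/2)) {\<epsilon>. tmatch shape \<epsilon> x y})"
  by (simp add: tdist_def tmatch_def)

lemma tdist_bdd: "bdd_below (insert (2 powr (-1/2)) {\<epsilon>. tmatch shape \<epsilon> x y})"
  by (rule bdd_belowI[where m = 0]) (auto simp: tmatch_def)

lemma tdist_nonneg: "0 \<le> tdist shape x y"
  unfolding tdist_alt by (rule cInf_greatest) (auto simp: tmatch_def)

lemma tdist_le_cut: "tdist shape x y \<le> 2 powr (-1/2)"
  unfolding tdist_alt by (rule cInf_lower[OF _ tdist_bdd]) simp

lemma tdist_le_1: "tdist shape x y \<le> 1"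
proof -
  have "2 powr (-1/2) \<le> (2::real) powr 0"
    by (intro powr_mono) auto
  then show ?thesis using tdist_le_cut[of shape x y] by simp
qed

lemma tdist_le: "tmatch shape \<epsilon> x y \<Longrightarrow> tdist shape x y \<le> \<epsilon>"
  unfolding tdist_alt by (rule cInf_lower[OF _ tdist_bdd]) simp

lemma tdist_lessE:
  assumes "tdist shape x y < \<delta>" "\<delta> \<le> 2 powr (-1/2)"
  obtains \<epsilon> where "\<epsilon> < \<delta>" "tmatch shape \<epsilon> x y"
  using cInf_lessD[OF _ assms(1)[unfolded tdist_alt]] assms(2) by force

lemma tmatch_sym: "tmatch shape \<epsilon> x y \<longleftrightarrow> tmatch shape \<epsilon> y x"
  unfolding tmatch_def by metis

lemma tdist_commute: "tdist shape x y = tdist shape y x"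
  by (simp add: tdist_alt tmatch_sym)

lemma tmatch_shift:
  assumes "norm (s - t) \<le> \<epsilon>" "\<epsilon> > 0"
  shows "tmatch shape \<epsilon> (shift s x) (shift t x)"
  unfolding tmatch_def using assms
  by (intro conjI bexI[where x = "s - t"] bexI[where x = 0]) auto

lemma tdist_shift_le: "tdist shape (shift s x) (shift t x) \<le> norm (s - t)"
proof (rule field_le_epsilon)
  fix e :: real assume "e > 0"
  then show "tdist shape (shift s x) (shift t x) \<le> norm (s - t) + e"
    by (intro tdist_le tmatch_shift) (auto simp: add_nonneg_pos)
qed

lemma tdist_refl [simp]: "tdist shape x x = 0"
  using tdist_shift_le[of shape 0 x 0] tdist_nonneg[of shape x x] by simp

text \<open>Composing the two matches costs an extra shift by \<open>u\<close> or \<open>t\<close>,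
  so the agreement must survive in a smaller ball. The cut-off is made for this: below it,
  \<open>e * e\<close>, \<open>f * f\<close> and \<open>e * f\<close> are at most 1/2, hence
  \<open>1 / (e + f) + f \<le> 1 / e\<close> and \<open>1 / (e + f) + e \<le> 1 / f\<close>.\<close>

lemma tmatch_trans:
  assumes xy: "tmatch shape e x y" and yz: "tmatch shape f y z"
    and e: "e < 2 powr (-1/2)" and f: "f < 2 powr (-1/2)"
  shows "tmatch shape (e + f) x z"
proof -
  obtain s t where st: "norm s \<le> e" "norm t \<le> e" "e > 0"
      "patch_at shape (shift (- s) x) 0 (1 / e) = patch_at shape (shift (- t) y) 0 (1 / e)"
    using xy by (auto simp: tmatch_def)
  obtain u v where uv: "norm u \<le> f" "norm v \<le> f" "f > 0"
      "patch_at shape (shift (- u) y) 0 (1 / f) = patch_at shape (shift (- v) z) 0 (1 / f)"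
    using yz by (auto simp: tmatch_def)
  have half: "(2 powr (-1/2)) * (2 powr (-1/2)) = (1/2 :: real)"
    by (simp flip: powr_add add: powr_minus_divide)
  have ee: "e * e \<le> 1/2" "f * f \<le> 1/2" "e * f \<le> 1/2"
    unfolding half[symmetric] using e f st(3) uv(3) by (auto intro!: mult_mono)
  have r1: "1 / (e + f) + f \<le> 1 / e"
  proof -
    have "f * (e * (e + f)) \<le> f * 1"
      using ee uv(3) by (intro mult_left_mono) (auto simp: algebra_simps)
    then show ?thesis using st(3) uv(3) by (simp add: field_simps)
  qed
  have r2: "1 / (e + f) + e \<le> 1 / f"
  proof -
    have "e * (f * (e + f)) \<le> e * 1"
      using ee st(3) by (intro mult_left_mono) (auto simp: algebra_simps)
    then show ?thesis using st(3) uv(3) by (simp add: field_simps)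
  qed
  have 1: "patch_at shape (shift (- s - u) x) (0 - u) (1 / e) = patch_at shape (shift (- t - u) y) (0 - u) (1 / e)"
    using st(4) patch_at_shift_eq_iff[of shape "-s" x 0 "1/e" "-t" y "-u"] by simp
  have 2: "patch_at shape (shift (- u - t) y) (0 - t) (1 / f) = patch_at shape (shift (- v - t) z) (0 - t) (1 / f)"
    using uv(4) patch_at_shift_eq_iff[of shape "-u" y 0 "1/f" "-v" z "-t"] by simp
  have c1: "cball 0 (1 / (e + f)) \<subseteq> cball (0 - u) (1 / e)"
    using r1 uv(1) by (subst cball_subset_cball_iff) auto
  have c2: "cball 0 (1 / (e + f)) \<subseteq> cball (0 - t) (1 / f)"
    using r2 st(2) by (subst cball_subset_cball_iff) auto
  have "patch_at shape (shift (- s - u) x) 0 (1 / (e + f)) = patch_at shape (shift (- v - t) z) 0 (1 / (e + f))"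
    using patch_at_mono_eq[OF 1 c1] patch_at_mono_eq[OF 2 c2] by (simp only: minus_diff_commute)
  moreover have "norm (s + u) \<le> e + f" "norm (v + t) \<le> e + f"
    using st uv norm_triangle_ineq[of s u] norm_triangle_ineq[of v t] by linarith+
  moreover have "- (s + u) = - s - u" "- (v + t) = - v - t" by simp_all
  ultimately show ?thesis
    unfolding tmatch_def using st(3) uv(3)
    by (intro conjI bexI[where x = "s + u"] bexI[where x = "v + t"]) (simp_all only: mem_cball_0 add_pos_pos)
qed

lemma tdist_triangle: "tdist shape x z \<le> tdist shape x y + tdist shape y z"
proof -
  let ?c = "2 powr (-1/2) :: real"
  show ?thesis
  proof (cases "tdist shape x y < ?c \<and> tdist shape y z < ?c")
    case False
    then show ?thesis
      using tdist_le_cut[of shape x z] tdist_nonneg[of shape x y] tdist_nonneg[of shape y z] by linarith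
  next
    case True
    show ?thesis
    proof (rule field_le_epsilon)
      fix d :: real assume "d > 0"
      obtain e where e: "e < min (tdist shape x y + d / 2) ?c" "tmatch shape e x y"
        using True \<open>d > 0\<close> by (auto intro: tdist_lessE[of shape x y "min (tdist shape x y + d / 2) ?c"])
      obtain f where f: "f < min (tdist shape y z + d / 2) ?c" "tmatch shape f y z"
        using True \<open>d > 0\<close> by (auto intro: tdist_lessE[of shape y z "min (tdist shape y z + d / 2) ?c"])
      have "tdist shape x z \<le> e + f"
        using e f by (intro tdist_le tmatch_trans) auto
      with e f show "tdist shape x z \<le> tdist shape x y + tdist shape y z + d" by simp
    qed
  qed
qed

lemma tdist_shift_shift_le:
  "tdist shape (shift t x) (shift t y) \<le> tdist shape (shift s x) (shift s y) + 2 * norm (t - s)"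
  using tdist_triangle[of shape "shift t x" "shift t y" "shift s x"]
    tdist_triangle[of shape "shift s x" "shift t y" "shift s y"]
    tdist_shift_le[of shape t x s] tdist_shift_le[of shape s y t]
  by (simp add: norm_minus_commute)

lemma continuous_on_tdist: "continuous_on A (\<lambda>t. tdist shape (shift t x) (shift t y))"
proof (rule lipschitz_on_continuous_on)
  show "2-lipschitz_on A (\<lambda>t. tdist shape (shift t x) (shift t y))"
  proof (rule lipschitz_onI)
    fix s t
    show "dist (tdist shape (shift s x) (shift s y)) (tdist shape (shift t x) (shift t y)) \<le> 2 * dist s t"
      using tdist_shift_shift_le[of shape s x y t] tdist_shift_shift_le[of shape t x y s]
      by (auto simp: dist_norm norm_minus_commute abs_le_iff)
  qed simp
qed

lemma finite_separated:
  fixes A :: "'b::euclidean_space set"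
  assumes "bounded A" "d > 0" "\<And>p q. p \<in> A \<Longrightarrow> q \<in> A \<Longrightarrow> dist p q < d \<Longrightarrow> p = q"
  shows "finite A"
proof (rule ccontr)
  assume "infinite A"
  then obtain l where l: "l islimpt A"
    using assms(1) bounded_infinite_imp_islimpt by blast
  then obtain p where p: "p \<in> A" "p \<noteq> l" "dist p l < d / 2"
    using assms(2) by (metis half_gt_zero islimpt_approachable)
  then obtain q where q: "q \<in> A" "q \<noteq> l" "dist q l < min (d / 2) (dist p l)"
    using assms(2) l by (metis half_gt_zero islimpt_approachable min_less_iff_conj zero_less_dist_iff)
  have "dist p q < d"
    using p(3) q(3) dist_triangle2[of p q l] by simp
  with assms(3)[OF p(1) q(1)] have "p = q" by simp
  with q(3) show False by simp
qed

section \<open>Geometry of tiles and of nonoverlapping patches\<close>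

locale prototile_shapes =
  fixes shape :: "'l::finite \<Rightarrow> 'a::euclidean_space set"
    and r0 R0 :: real and cen :: "'l \<Rightarrow> 'a"
  assumes prototile_shapes: "prototiles shape"
    and r0: "r0 > 0" and R0: "R0 > 0"
    and cen: "cball (cen i) r0 \<subseteq> interior (shape i)"
    and R0_bound: "shape i \<subseteq> cball 0 R0"
begin

abbreviation "S \<equiv> supp shape"

text \<open>The position \<open>fst \<tau>\<close> need not lie in the tile; \<open>centre\<close>
  is a reference point that does, with a ball of radius \<open>r0\<close> around it in the
  interior.\<close>

definition centre :: "('a, 'l) tile \<Rightarrow> 'a" where
  "centre \<tau> = fst \<tau> + cen (snd \<tau>)"

lemma centre_shift [simp]: "centre (shift_tile t \<tau>) = centre \<tau> + t"
  by (simp add: centre_def algebra_simps)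

lemma compact_supp: "compact (S \<tau>)"
  using prototile_shapes by (auto simp: prototiles_def supp_def intro: compact_translation)

lemma closed_supp: "closed (S \<tau>)"
  by (rule compact_imp_closed[OF compact_supp])

lemma supp_subset: "S \<tau> \<subseteq> cball (fst \<tau>) R0"
  using R0_bound[of "snd \<tau>"] by (auto simp: supp_def dist_norm subset_iff)

lemma dist_fst_supp: "p \<in> S \<tau> \<Longrightarrow> dist (fst \<tau>) p \<le> R0"
  using supp_subset[of \<tau>] by (meson mem_cball subsetD)

lemma interior_supp: "interior (S \<tau>) = (+) (fst \<tau>) ` interior (shape (snd \<tau>))"
  by (simp add: supp_def interior_translation)

lemma closure_interior_supp: "closure (interior (S \<tau>)) = S \<tau>"
  unfolding interior_supp closure_translation using prototile_shapes by (simp add: prototiles_def supp_def)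

lemma cball_centre: "cball (centre \<tau>) r0 \<subseteq> interior (S \<tau>)"
proof -
  have "cball (centre \<tau>) r0 = (+) (fst \<tau>) ` cball (cen (snd \<tau>)) r0"
    unfolding centre_def by (rule cball_translation)
  then show ?thesis
    unfolding interior_supp by (simp only: image_mono[OF cen])
qed

lemma centre_in_interior: "centre \<tau> \<in> interior (S \<tau>)"
  using cball_centre r0 by (meson centre_in_cball less_imp_le subsetD)

lemma centre_in_supp: "centre \<tau> \<in> S \<tau>"
  using centre_in_interior interior_subset by blast

lemma supp_nonempty [simp]: "S \<tau> \<noteq> {}"
  using centre_in_supp by blast

lemma norm_centre_fst: "norm (centre \<tau> - fst \<tau>) \<le> R0"
  using dist_fst_supp[OF centre_in_supp[of \<tau>]] by (simp add: dist_norm norm_minus_commute)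

lemma negligible_frontier_supp: "negligible (frontier (S \<tau>))"
proof -
  have "frontier (S \<tau>) = (+) (fst \<tau>) ` frontier (shape (snd \<tau>))"
    by (simp add: supp_def frontier_translation)
  then show ?thesis
    using prototile_shapes by (simp add: prototiles_def negligible_translation)
qed

lemma lmeasurable_supp: "S \<tau> \<in> lmeasurable"
  by (rule lmeasurable_compact[OF compact_supp])

text \<open>Distinct tiles meet only in frontiers, so a point interior to one of them and merely
  contained in the other already identifies the two.\<close>

lemma nonoverlapping_eqI:
  assumes "nonoverlapping shape P" "\<sigma> \<in> P" "\<tau> \<in> P" "p \<in> interior (S \<sigma>)" "p \<in> S \<tau>"
  shows "\<sigma> = \<tau>"
proof (rule ccontr)
  assume "\<sigma> \<noteq> \<tau>"
  then have "p \<in> frontier (S \<sigma>)"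
    using assms interior_subset unfolding nonoverlapping_def by blast
  with assms(4) show False by (simp add: frontier_def)
qed

lemma nonoverlappingI:
  assumes "\<And>\<sigma> \<tau> p. \<sigma> \<in> P \<Longrightarrow> \<tau> \<in> P \<Longrightarrow> p \<in> interior (S \<sigma>) \<Longrightarrow> p \<in> S \<tau> \<Longrightarrow> \<sigma> = \<tau>"
  shows "nonoverlapping shape P"
  unfolding nonoverlapping_def
proof (intro ballI impI subsetI)
  fix \<sigma> \<tau> p assume *: "\<sigma> \<in> P" "\<tau> \<in> P" "\<sigma> \<noteq> \<tau>" "p \<in> S \<sigma> \<inter> S \<tau>"
  have "p \<notin> interior (S \<sigma>)" "p \<notin> interior (S \<tau>)"
    using assms[of \<sigma> \<tau> p] assms[of \<tau> \<sigma> p] * by auto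
  with * show "p \<in> frontier (S \<sigma>) \<inter> frontier (S \<tau>)"
    using closed_supp by (auto simp: frontier_def)
qed

lemma open_meets_interior:
  assumes "open U" "U \<inter> S \<tau> \<noteq> {}"
  shows "U \<inter> interior (S \<tau>) \<noteq> {}"
  using assms closure_interior_supp[of \<tau>] by (metis open_Int_closure_eq_empty)

text \<open>A tile is the closure of its interior, so if it meets the open set \<open>U\<close> then
  it has an interior point there, and that point lies in some tile of \<open>Z\<close>. This is the
  device by which a tiling is recognised on a region from a patch covering it.\<close>

lemma covered_mem:
  assumes "nonoverlapping shape x" "Z \<subseteq> x" "open U" "U \<subseteq> (\<Union>\<zeta>\<in>Z. S \<zeta>)" "\<eta> \<in> x" "S \<eta> \<inter> U \<noteq> {}"
  shows "\<eta> \<in> Z"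
proof -
  obtain p where p: "p \<in> U" "p \<in> interior (S \<eta>)"
    using open_meets_interior[OF assms(3)] assms(6) by blast
  then obtain \<zeta> where "\<zeta> \<in> Z" "p \<in> S \<zeta>" using assms(4) by blast
  with p assms nonoverlapping_eqI show ?thesis by (metis subsetD)
qed

lemma nonoverlapping_separated:
  assumes "nonoverlapping shape P" "\<sigma> \<in> P" "\<tau> \<in> P" "snd \<sigma> = snd \<tau>" "norm (fst \<sigma> - fst \<tau>) \<le> r0"
  shows "\<sigma> = \<tau>"
proof (rule nonoverlapping_eqI[OF assms(1-3) _ centre_in_supp])
  have "dist (centre \<sigma>) (centre \<tau>) \<le> r0"
    using assms(4,5) by (simp add: centre_def dist_norm)
  then show "centre \<tau> \<in> interior (S \<sigma>)"
    using cball_centre[of \<sigma>] by auto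
qed

lemma finite_local:
  assumes "nonoverlapping shape P"
  shows "finite {\<tau> \<in> P. fst \<tau> \<in> cball a r}"
proof -
  have "finite {p \<in> cball a r. (p, i) \<in> P}" for i
  proof (rule finite_separated[where d = r0])
    show "bounded {p \<in> cball a r. (p, i) \<in> P}"
      by (rule bounded_subset[OF bounded_cball]) auto
    show "p = q" if "p \<in> {p \<in> cball a r. (p, i) \<in> P}" "q \<in> {p \<in> cball a r. (p, i) \<in> P}" "dist p q < r0" for p q
      using nonoverlapping_separated[OF assms, of "(p, i)" "(q, i)"] that by (simp add: dist_norm)
  qed (rule r0)
  then have "finite (\<Union>i. (\<lambda>p. (p, i)) ` {p \<in> cball a r. (p, i) \<in> P})"
    by auto
  moreover have "{\<tau> \<in> P. fst \<tau> \<in> cball a r} \<subseteq> (\<Union>i. (\<lambda>p. (p, i)) ` {p \<in> cball a r. (p, i) \<in> P})"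
    by force
  ultimately show ?thesis by (rule finite_subset[rotated])
qed

lemma finite_patch_at:
  assumes "nonoverlapping shape P"
  shows "finite (patch_at shape P a r)"
proof (rule finite_subset[OF _ finite_local[OF assms, of a "r + R0"]])
  show "patch_at shape P a r \<subseteq> {\<tau> \<in> P. fst \<tau> \<in> cball a (r + R0)}"
  proof
    fix \<tau> assume "\<tau> \<in> patch_at shape P a r"
    then obtain p where p: "p \<in> S \<tau>" "dist a p \<le> r" "\<tau> \<in> P"
      by (auto simp: patch_at_def)
    then have "dist (fst \<tau>) p \<le> R0" using dist_fst_supp by blast
    with p show "\<tau> \<in> {\<tau> \<in> P. fst \<tau> \<in> cball a (r + R0)}"
      using dist_triangle2[of a "fst \<tau>" p] by simp
  qed
qed

lemma countable_nonoverlapping: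
  assumes "nonoverlapping shape P"
  shows "countable P"
proof -
  have "P = (\<Union>n::nat. {\<tau> \<in> P. fst \<tau> \<in> cball 0 (real n)})"
    by (auto simp: real_arch_simple)
  also have "countable \<dots>"
    by (intro countable_UN countableI_type countable_finite finite_local assms)
  finally show ?thesis .
qed

lemma dist_supp: "p \<in> S \<tau> \<Longrightarrow> q \<in> S \<tau> \<Longrightarrow> dist p q \<le> 2 * R0"
  using dist_fst_supp[of p \<tau>] dist_fst_supp[of q \<tau>] dist_triangle3[of p q "fst \<tau>"] by linarith

lemma tiling_covers: "tiling shape x \<Longrightarrow> \<exists>\<tau>\<in>x. p \<in> S \<tau>"
  unfolding tiling_def by blast

text \<open>Distance 0 only yields agreement up to arbitrarily small shifts. But the vectors that
  carry a fixed tile \<open>\<tau>\<close> to a tile of \<open>y\<close> are separated by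
  nonoverlapping, so all sufficiently short ones coincide and must be 0.\<close>

lemma tdist_tiling_eq:
  assumes x: "tiling shape x" and y: "tiling shape y" and 0: "tdist shape x y = 0"
  shows "x = y"
proof -
  have sub: "x \<subseteq> y" if x: "tiling shape x" and y: "tiling shape y" and 0: "tdist shape x y = 0" for x y
  proof
    fix \<tau> assume \<tau>: "\<tau> \<in> x"
    \<comment> \<open>With \<open>r0 / 4\<close>, two shifts of length at most \<open>2 * e\<close>
      differ by at most \<open>r0\<close>; with the other bound, the ball of radius
      \<open>1 / e\<close> still contains \<open>centre \<tau>\<close> after the shift.\<close>
    define e0 where "e0 = min (r0 / 4) (1 / (norm (fst \<tau>) + R0 + 1))"
    have e0: "e0 > 0" using r0 R0 unfolding e0_def by (simp add: add_nonneg_pos)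
    have ex: "\<exists>v. shift_tile v \<tau> \<in> y \<and> norm v \<le> 2 * e" if "0 < e" "e \<le> e0" "e \<le> 1/2" for e
    proof -
      from half_le_cut that 0 obtain \<epsilon> where \<epsilon>: "\<epsilon> < e" "tmatch shape \<epsilon> x y"
        by (auto intro: tdist_lessE[of shape x y e])
      then obtain s t where st: "\<epsilon> > 0" "norm s \<le> \<epsilon>" "norm t \<le> \<epsilon>"
        "patch_at shape (shift (- s) x) 0 (1 / \<epsilon>) = patch_at shape (shift (- t) y) 0 (1 / \<epsilon>)"
        by (auto simp: tmatch_def)
      have "norm (centre \<tau> - s) \<le> 1 / \<epsilon>"
      proof -
        have "norm (centre \<tau> - s) \<le> norm (fst \<tau>) + R0 + 1"
          using norm_centre_fst[of \<tau>] norm_triangle_ineq4[of "centre \<tau>" s] norm_triangle_ineq2[of "centre \<tau>" "fst \<tau>"] st \<epsilon> that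
          by linarith
        also have "... \<le> 1 / e0"
        proof -
          have K: "0 < norm (fst \<tau>) + R0 + 1" using R0 by (simp add: add_nonneg_pos)
          have "e0 \<le> 1 / (norm (fst \<tau>) + R0 + 1)" by (simp add: e0_def)
          then have "(norm (fst \<tau>) + R0 + 1) * e0 \<le> 1"
            by (simp only: pos_le_divide_eq[OF K] mult.commute)
          then show ?thesis by (simp only: pos_le_divide_eq[OF e0])
        qed
        also have "... \<le> 1 / \<epsilon>"
          using \<epsilon> that st by (intro divide_left_mono) auto
        finally show ?thesis .
      qed
      then have "centre \<tau> - s \<in> S (shift_tile (- s) \<tau>) \<inter> cball 0 (1 / \<epsilon>)"
        using centre_in_supp[of \<tau>] by simp
      then have "shift_tile (- s) \<tau> \<in> patch_at shape (shift (- s) x) 0 (1 / \<epsilon>)"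
        using \<tau> unfolding patch_at_def by (simp only: mem_Collect_eq shift_tile_mem_shift) blast
      then have "shift_tile (- s) \<tau> \<in> shift (- t) y"
        using st by (auto simp: patch_at_def)
      then have "shift_tile (t - s) \<tau> \<in> y" by (simp add: mem_shift)
      moreover have "norm (t - s) \<le> 2 * e"
        using st \<epsilon> norm_triangle_ineq4[of t s] by linarith
      ultimately show ?thesis by blast
    qed
    define e1 where "e1 = min e0 (1/2)"
    have e1: "e1 > 0" "e1 \<le> e0" "e1 \<le> 1/2" "e1 \<le> r0 / 4" using e0 unfolding e1_def e0_def by auto
    obtain v where v: "shift_tile v \<tau> \<in> y" "norm v \<le> 2 * e1" using ex[OF e1(1-3)] by blast
    have "v = 0"
    proof (rule ccontr)
      assume nz: "v \<noteq> 0"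
      define e2 where "e2 = min e1 (norm v / 4)"
      have e2: "e2 > 0" "e2 \<le> e1" "e2 \<le> norm v / 4" using nz e1 unfolding e2_def by auto
      obtain w where w: "shift_tile w \<tau> \<in> y" "norm w \<le> 2 * e2" using ex[of e2] e1 e2 by auto
      have "shift_tile v \<tau> = shift_tile w \<tau>"
        using y v w e1 e2 norm_triangle_ineq4[of v w]
        by (intro nonoverlapping_separated[of y]) (auto simp: tiling_def)
      then have "v = w" by (simp add: shift_tile_def)
      then have "norm v \<le> norm v / 2" using w e2 by simp
      with nz show False by simp
    qed
    with v show "\<tau> \<in> y" by simp
  qed
  from sub[OF x y 0] sub[OF y x] 0 show ?thesis by (simp add: tdist_commute subset_antisym)
qed

end

lemma prototiles_constants:
  fixes shape :: "'l::finite \<Rightarrow> 'a::euclidean_space set"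
  assumes "prototiles shape"
  obtains r0 R0 cen where "prototile_shapes shape r0 R0 cen"
proof -
  have "\<exists>r c. r > 0 \<and> cball c r \<subseteq> interior (shape i)" for i
  proof -
    have "interior (shape i) \<noteq> {}"
      using assms unfolding prototiles_def by (metis closure_empty)
    then obtain c where "c \<in> interior (shape i)" by blast
    then show ?thesis
      using open_contains_cball[of "interior (shape i)"] by (metis open_interior)
  qed
  then obtain r c where rc: "\<And>i. r i > 0" "\<And>i. cball (c i) (r i) \<subseteq> interior (shape i)" by metis
  have "\<exists>R. shape i \<subseteq> cball 0 R" for i
  proof -
    have "bounded (shape i)"
      using assms unfolding prototiles_def by (meson compact_imp_bounded)
    then show ?thesis by (auto simp: bounded_iff subset_iff)
  qed
  then obtain R where R: "\<And>i. shape i \<subseteq> cball 0 (R i)" by metis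
  define r0 where "r0 = Min (range r)"
  define R0 where "R0 = Max (insert 1 (range R))"
  have "r0 > 0" "\<And>i. r0 \<le> r i" unfolding r0_def using rc by (auto simp: Min_gr_iff)
  moreover have "R0 > 0" "\<And>i. R i \<le> R0"
    unfolding R0_def by (simp_all add: Max_gr_iff le_max_iff_disj)
  moreover have "cball (c i) r0 \<subseteq> interior (shape i)" if "r0 \<le> r i" for i
    using subset_cball[OF that, of "c i"] rc(2)[of i] by (rule subset_trans)
  moreover have "shape i \<subseteq> cball 0 R0" if "R i \<le> R0" for i
    using R[of i] subset_cball[OF that, of 0] by (rule subset_trans)
  ultimately have "prototile_shapes shape r0 R0 c"
    using assms by unfold_locales blast+
  then show ?thesis by (rule that)
qed

section \<open>Supertiles\<close>

lemma inflate_mono: "P \<subseteq> Q \<Longrightarrow> inflate lam rho P \<subseteq> inflate lam rho Q"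
  unfolding inflate_def by blast

lemma inflate_Union: "inflate lam rho P = (\<Union>\<tau>\<in>P. inflate lam rho {\<tau>})"
  unfolding inflate_def by blast

lemma inflate_shift: "inflate lam rho (shift t P) = shift (lam *\<^sub>R t) (inflate lam rho P)"
  unfolding inflate_def shift_def by (simp add: image_UN image_image scaleR_add_right algebra_simps)

locale stone_inflations = prototile_shapes shape r0 R0 cen
  for shape :: "'l::finite \<Rightarrow> 'a::euclidean_space set" and r0 R0 :: real and cen :: "'l \<Rightarrow> 'a" +
  fixes lam :: real and rho :: "'l \<Rightarrow> ('a, 'l) tile set"
  assumes stone: "stone_inflation shape lam rho"
begin

abbreviation "infl n P \<equiv> (inflate lam rho ^^ n) P"

lemma lam: "lam > 1"
  using stone by (simp add: stone_inflation_def)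

lemma lam_pow [simp]: "lam ^ n > 0" "lam ^ n \<noteq> 0" "lam ^ n \<ge> 0"
  using lam by auto

lemma lam_pow_ge_1: "lam ^ n \<ge> 1"
  using lam by (simp add: one_le_power)

lemma infl_add: "infl (m + n) P = infl m (infl n P)"
  by (simp add: funpow_add)

lemma infl_mono: "P \<subseteq> Q \<Longrightarrow> infl n P \<subseteq> infl n Q"
  by (induction n) (simp_all add: inflate_mono)

lemma infl_Union: "infl n P = (\<Union>\<tau>\<in>P. infl n {\<tau>})"
proof (induction n)
  case (Suc n)
  have "infl (Suc n) P = inflate lam rho (\<Union>\<tau>\<in>P. infl n {\<tau>})"
    by (simp add: Suc[symmetric])
  also have "\<dots> = (\<Union>\<tau>\<in>P. inflate lam rho (infl n {\<tau>}))"
    unfolding inflate_def by blast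
  finally show ?case by simp
qed simp

lemma infl_shift: "infl n (shift t P) = shift (lam ^ n *\<^sub>R t) (infl n P)"
  by (induction n) (simp_all add: inflate_shift)

lemma supp_inflate1: "(\<Union>\<zeta>\<in>inflate lam rho {\<tau>}. S \<zeta>) = (*\<^sub>R) lam ` S \<tau>"
proof -
  have "(\<Union>\<zeta>\<in>inflate lam rho {\<tau>}. S \<zeta>) = (+) (lam *\<^sub>R fst \<tau>) ` (\<Union>\<zeta>\<in>rho (snd \<tau>). S \<zeta>)"
    unfolding inflate_def by (simp add: shift_def image_UN supp_shift_tile)
  also have "(\<Union>\<zeta>\<in>rho (snd \<tau>). S \<zeta>) = (*\<^sub>R) lam ` shape (snd \<tau>)"
    using stone by (simp add: stone_inflation_def)
  finally show ?thesis
    by (simp add: supp_def image_image scaleR_add_right)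
qed

lemma supp_infl: "(\<Union>\<zeta>\<in>infl n P. S \<zeta>) = (*\<^sub>R) (lam ^ n) ` (\<Union>\<zeta>\<in>P. S \<zeta>)"
proof (induction n)
  case (Suc n)
  have "(\<Union>\<zeta>\<in>infl (Suc n) P. S \<zeta>) = (\<Union>\<tau>\<in>infl n P. \<Union>\<zeta>\<in>inflate lam rho {\<tau>}. S \<zeta>)"
    by (subst funpow.simps, subst comp_apply, subst inflate_Union) blast
  also have "\<dots> = (*\<^sub>R) lam ` (\<Union>\<tau>\<in>infl n P. S \<tau>)"
    by (simp add: supp_inflate1 image_UN)
  finally show ?case
    by (simp add: Suc image_image)
qed simp

lemma infl_supp_subset:
  assumes "\<zeta> \<in> infl n {\<tau>}"
  shows "S \<zeta> \<subseteq> (*\<^sub>R) (lam ^ n) ` S \<tau>"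
  using supp_infl[of n "{\<tau>}"] assms by auto

lemma scaled_supp_subset: "(*\<^sub>R) (lam ^ n) ` S \<tau> \<subseteq> cball (lam ^ n *\<^sub>R fst \<tau>) (lam ^ n * R0)"
proof -
  have "(*\<^sub>R) (lam ^ n) ` S \<tau> \<subseteq> (*\<^sub>R) (lam ^ n) ` cball (fst \<tau>) R0"
    by (intro image_mono supp_subset)
  also have "\<dots> \<subseteq> cball (lam ^ n *\<^sub>R fst \<tau>) (lam ^ n * R0)"
    using lam by (auto simp: dist_norm simp flip: scaleR_diff_right)
  finally show ?thesis .
qed

lemma finite_inflate: "finite P \<Longrightarrow> finite (inflate lam rho P)"
  unfolding inflate_def using stone by (simp add: stone_inflation_def)

lemma finite_infl: "finite P \<Longrightarrow> finite (infl n P)"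
  by (induction n) (simp_all add: finite_inflate)

lemma infl_nonempty: "P \<noteq> {} \<Longrightarrow> infl n P \<noteq> {}"
  using supp_infl[of n P] by force

lemma nonoverlapping_shift: "nonoverlapping shape P \<Longrightarrow> nonoverlapping shape (shift t P)"
proof (rule nonoverlappingI)
  fix \<sigma> \<tau> p assume P: "nonoverlapping shape P"
    and *: "\<sigma> \<in> shift t P" "\<tau> \<in> shift t P" "p \<in> interior (S \<sigma>)" "p \<in> S \<tau>"
  have "interior (S \<sigma>) = (+) t ` interior (S (shift_tile (- t) \<sigma>))"
    by (simp flip: interior_translation supp_shift_tile)
  then have "p - t \<in> interior (S (shift_tile (- t) \<sigma>))" using *(3) by auto
  then have "shift_tile (- t) \<sigma> = shift_tile (- t) \<tau>"
    using * by (intro nonoverlapping_eqI[OF P]) (auto simp: mem_shift)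
  then show "\<sigma> = \<tau>" by (rule injD[OF inj_shift_tile])
qed

text \<open>Tiles of the inflated patch that overlap have parents that overlap after scaling back,
  so the parents coincide; inside a single inflated tile the dissection is nonoverlapping by
  assumption.\<close>

lemma nonoverlapping_inflate:
  assumes P: "nonoverlapping shape P"
  shows "nonoverlapping shape (inflate lam rho P)"
proof (rule nonoverlappingI)
  fix \<sigma> \<tau> p assume *: "\<sigma> \<in> inflate lam rho P" "\<tau> \<in> inflate lam rho P" "p \<in> interior (S \<sigma>)" "p \<in> S \<tau>"
  obtain \<sigma>' where \<sigma>': "\<sigma>' \<in> P" "\<sigma> \<in> inflate lam rho {\<sigma>'}"
    using *(1) by (subst (asm) inflate_Union) blast
  obtain \<tau>' where \<tau>': "\<tau>' \<in> P" "\<tau> \<in> inflate lam rho {\<tau>'}"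
    using *(2) by (subst (asm) inflate_Union) blast
  have "S \<sigma> \<subseteq> (*\<^sub>R) lam ` S \<sigma>'" "S \<tau> \<subseteq> (*\<^sub>R) lam ` S \<tau>'"
    using supp_inflate1 \<sigma>' \<tau>' by blast+
  then have "p \<in> interior ((*\<^sub>R) lam ` S \<sigma>')" "p \<in> (*\<^sub>R) lam ` S \<tau>'"
    using * interior_mono by blast+
  moreover have "interior ((*\<^sub>R) lam ` S \<sigma>') = (*\<^sub>R) lam ` interior (S \<sigma>')"
    using lam by (intro interior_injective_linear_image) (auto intro: linear_scaleR injI)
  ultimately obtain q where "q \<in> interior (S \<sigma>')" "q \<in> S \<tau>'"
    using lam by auto
  then have eq: "\<sigma>' = \<tau>'" using nonoverlapping_eqI[OF P \<sigma>'(1) \<tau>'(1)] by blast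
  have "nonoverlapping shape (inflate lam rho {\<tau>'})"
    unfolding inflate_def using stone by (auto simp: stone_inflation_def intro: nonoverlapping_shift)
  from nonoverlapping_eqI[OF this] show "\<sigma> = \<tau>" using \<sigma>' \<tau>' eq * by blast
qed

lemma nonoverlapping_infl: "nonoverlapping shape P \<Longrightarrow> nonoverlapping shape (infl n P)"
  by (induction n) (simp_all add: nonoverlapping_inflate)

lemma nonoverlapping_singleton [simp]: "nonoverlapping shape {\<tau>}"
  by (simp add: nonoverlapping_def)

definition X :: "('a, 'l) tile set set" where "X = inflation_hull shape lam rho"

lemma X_tiling: "x \<in> X \<Longrightarrow> tiling shape x"
  by (simp add: X_def inflation_hull_def)

lemma X_nonoverlapping: "x \<in> X \<Longrightarrow> nonoverlapping shape x"
  using X_tiling by (simp add: tiling_def)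

lemma X_finite_patch: "x \<in> X \<Longrightarrow> finite P \<Longrightarrow> P \<subseteq> x \<Longrightarrow> \<exists>n \<tau>. P \<subseteq> infl n {\<tau>}"
  by (simp add: X_def inflation_hull_def)

lemma X_cover: "x \<in> X \<Longrightarrow> \<exists>\<tau>\<in>x. p \<in> S \<tau>"
  using X_tiling tiling_covers by blast

lemma X_shift: assumes "x \<in> X" shows "shift t x \<in> X"
proof -
  have "(\<Union>\<tau>\<in>shift t x. S \<tau>) = (+) t ` (\<Union>\<tau>\<in>x. S \<tau>)"
    by (simp add: shift_def image_UN supp_shift_tile)
  also have "\<dots> = UNIV"
    using X_tiling[OF assms] by (simp add: tiling_def surj_plus)
  finally have "tiling shape (shift t x)"
    using X_nonoverlapping[OF assms] by (simp add: tiling_def nonoverlapping_shift)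
  moreover have "\<exists>n \<tau>. P \<subseteq> infl n {\<tau>}" if P: "finite P" "P \<subseteq> shift t x" for P
  proof -
    have "shift (- t) P \<subseteq> x" using shift_mono[OF P(2), of "- t"] by simp
    then obtain n \<tau> where n: "shift (- t) P \<subseteq> infl n {\<tau>}"
      using X_finite_patch[OF assms, of "shift (- t) P"] P(1) by auto
    have "P \<subseteq> shift t (infl n {\<tau>})" using shift_mono[OF n, of t] by simp
    also have "\<dots> = infl n (shift ((1 / lam ^ n) *\<^sub>R t) {\<tau>})" 
      using lam by (simp add: infl_shift del: shift_singleton)
    finally show ?thesis unfolding shift_singleton by blast
  qed
  ultimately show ?thesis by (simp add: X_def inflation_hull_def)
qed

text \<open>The hull only provides some level \<open>N\<close> for a given finite patch. A patch
  covering a ball larger than a level-\<open>n\<close> supertile forces \<open>N\<close> above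
  \<open>n\<close>, and then \<open>infl N\<close> factors through \<open>infl n\<close>. Every
  later statement on level-\<open>n\<close> supertiles inside a tiling rests on this
  factorisation.\<close>

lemma X_local_structure:
  assumes x: "x \<in> X"
  obtains j \<tau> where "patch_at shape x a R = patch_at shape (infl n (infl j {\<tau>})) a R"
    "cball a R \<subseteq> (\<Union>\<zeta>\<in>infl n (infl j {\<tau>}). S \<zeta>)"
proof -
  \<comment> \<open>The term \<open>lam ^ n * R0\<close> bounds the radius of a
    level-\<open>n\<close> supertile and forces \<open>n \<le> N\<close>; the excess over
    \<open>R\<close> leaves an open ball around \<open>cball a R\<close> on which
    \<open>covered_mem\<close> applies.\<close>
  define R' where "R' = max 0 R + 2 * R0 + lam ^ n * R0 + 1"
  have R': "R' > 0" "R + 2 * R0 < R'" "R < R'" "lam ^ n * R0 < R'"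
    using R0 mult_pos_pos[OF lam_pow(1)[of n] R0] unfolding R'_def by linarith+
  define P where "P = patch_at shape x a R'"
  have P: "finite P" "P \<subseteq> x"
    unfolding P_def using finite_patch_at[OF X_nonoverlapping[OF x]] by (auto simp: patch_at_def)
  have cov: "cball a R' \<subseteq> (\<Union>\<zeta>\<in>P. S \<zeta>)"
  proof
    fix p assume p: "p \<in> cball a R'"
    obtain \<zeta> where "\<zeta> \<in> x" "p \<in> S \<zeta>" using X_cover[OF x] by blast
    with p show "p \<in> (\<Union>\<zeta>\<in>P. S \<zeta>)" unfolding P_def patch_at_def by blast
  qed
  obtain N \<tau> where N: "P \<subseteq> infl N {\<tau>}" using X_finite_patch[OF x P] by blast
  have "cball a R' \<subseteq> (\<Union>\<zeta>\<in>infl N {\<tau>}. S \<zeta>)" using cov N by blast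
  also have "\<dots> \<subseteq> cball (lam ^ N *\<^sub>R fst \<tau>) (lam ^ N * R0)"
    unfolding supp_infl using scaled_supp_subset by simp
  finally have "R' \<le> lam ^ N * R0"
    using R' by (auto simp: cball_subset_cball_iff intro: order_trans[rotated])
  then have "lam ^ n * R0 < lam ^ N * R0" using R' by simp
  then have "n \<le> N" using R0 lam by (simp add: power_strict_increasing_iff less_imp_le)
  then obtain j where j: "N = n + j" using le_Suc_ex by blast
  show thesis
  proof (rule that[of j \<tau>])
    show "cball a R \<subseteq> (\<Union>\<zeta>\<in>infl n (infl j {\<tau>}). S \<zeta>)"
      using subset_trans[OF subset_cball[of R R' a] cov] UN_mono[OF N, of S S] R' unfolding j infl_add
      by (meson order_refl less_imp_le subset_trans)
    show "patch_at shape x a R = patch_at shape (infl n (infl j {\<tau>})) a R"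
    proof (intro equalityI subsetI)
      fix \<zeta> assume "\<zeta> \<in> patch_at shape x a R"
      moreover have "cball a R \<subseteq> cball a R'" using R' by auto
      ultimately have "\<zeta> \<in> P" "S \<zeta> \<inter> cball a R \<noteq> {}"
        unfolding P_def patch_at_def by blast+
      then show "\<zeta> \<in> patch_at shape (infl n (infl j {\<tau>})) a R"
        using N unfolding j infl_add by (auto simp: patch_at_def)
    next
      fix \<zeta> assume "\<zeta> \<in> patch_at shape (infl n (infl j {\<tau>})) a R"
      then have \<zeta>: "\<zeta> \<in> infl N {\<tau>}" "S \<zeta> \<inter> cball a R \<noteq> {}"
        unfolding j infl_add by (auto simp: patch_at_def)
      have "cball a R \<subseteq> ball a R'" using R' by auto
      then have "S \<zeta> \<inter> ball a R' \<noteq> {}" using \<zeta>(2) by blast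
      then have "\<zeta> \<in> P"
        by (rule covered_mem[OF nonoverlapping_infl[OF nonoverlapping_singleton] N open_ball
              subset_trans[OF ball_subset_cball cov] \<zeta>(1)])
      then show "\<zeta> \<in> patch_at shape x a R" using P(2) \<zeta>(2) by (auto simp: patch_at_def)
    qed
  qed
qed

text \<open>A supertile containing \<open>a\<close> has diameter at most
  \<open>2 * (lam ^ n * R0)\<close>, so all its tiles belong to the patch of that radius around
  \<open>a\<close>, where the local structure is exact.\<close>

lemma X_supertile:
  assumes x: "x \<in> X"
  obtains \<sigma> where "a \<in> (*\<^sub>R) (lam ^ n) ` S \<sigma>" "infl n {\<sigma>} \<subseteq> x"
proof -
  define R where "R = 2 * (lam ^ n * R0)"
  have "R \<ge> 0" using R0 by (simp add: R_def)
  obtain j \<tau> where j: "patch_at shape x a R = patch_at shape (infl n (infl j {\<tau>})) a R"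
    "cball a R \<subseteq> (\<Union>\<zeta>\<in>infl n (infl j {\<tau>}). S \<zeta>)"
    using X_local_structure[OF x] by metis
  have "a \<in> (*\<^sub>R) (lam ^ n) ` (\<Union>\<zeta>\<in>infl j {\<tau>}. S \<zeta>)"
    using j(2) \<open>R \<ge> 0\<close> unfolding supp_infl by auto
  then obtain \<sigma> where \<sigma>: "\<sigma> \<in> infl j {\<tau>}" "a \<in> (*\<^sub>R) (lam ^ n) ` S \<sigma>" by blast
  have "infl n {\<sigma>} \<subseteq> x"
  proof
    fix \<zeta> assume \<zeta>: "\<zeta> \<in> infl n {\<sigma>}"
    have "centre \<zeta> \<in> cball (lam ^ n *\<^sub>R fst \<sigma>) (lam ^ n * R0)" "a \<in> cball (lam ^ n *\<^sub>R fst \<sigma>) (lam ^ n * R0)"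
      using infl_supp_subset[OF \<zeta>] centre_in_supp[of \<zeta>] \<sigma>(2) scaled_supp_subset[of n \<sigma>] by blast+
    then have "centre \<zeta> \<in> cball a R"
      using dist_triangle3[of a "centre \<zeta>" "lam ^ n *\<^sub>R fst \<sigma>"] by (simp add: R_def)
    moreover have "\<zeta> \<in> infl n (infl j {\<tau>})"
      using \<zeta> infl_mono[of "{\<sigma>}" "infl j {\<tau>}" n] \<sigma>(1) by blast
    ultimately have "\<zeta> \<in> patch_at shape x a R"
      unfolding j(1) using centre_in_supp[of \<zeta>] unfolding patch_at_def by blast
    then show "\<zeta> \<in> x" by (simp add: patch_at_def)
  qed
  with \<sigma>(2) that show thesis by blast
qed

end

locale primitive_stone_inflations = stone_inflations shape r0 R0 cen lam rho
  for shape :: "'l::finite \<Rightarrow> 'a::euclidean_space set" and r0 R0 :: real and cen :: "'l \<Rightarrow> 'a"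
    and lam rho +
  assumes prim: "primitive_inflation lam rho"
    and X_nonempty: "X \<noteq> {}"
begin

text \<open>By primitivity \<open>k\<close> inflations of any tile contain a translate of
  \<open>\<tau>0\<close>, so every level-\<open>(m + k)\<close> supertile contains a copy of
  \<open>P\<close>, and every level-\<open>(n + (m + k))\<close> supertile a copy of
  \<open>infl n P\<close>. Both the copy and the supertile scale with \<open>lam ^ n\<close>, which
  is why one constant \<open>C\<close> serves all \<open>n\<close>.\<close>

lemma patch_relatively_dense:
  assumes "P \<subseteq> infl m {\<tau>0}"
  shows "\<exists>C>0. \<forall>n a. \<forall>x\<in>X. \<exists>b. shift (lam ^ n *\<^sub>R b) (infl n P) \<subseteq> x \<and> norm (lam ^ n *\<^sub>R b - a) \<le> C * lam ^ n"
proof -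
  obtain k where k: "\<And>\<tau>. snd ` infl k {\<tau>} = UNIV"
    using prim unfolding primitive_inflation_def by blast
  \<comment> \<open>The first summand bounds the distance from the copy to the scaled position of
    the supertile, the second the distance from there to \<open>a\<close>, both divided by
    \<open>lam ^ n\<close>.\<close>
  define C where "C = lam ^ m * (lam ^ k * R0 + R0 + norm (fst \<tau>0)) + lam ^ (m + k) * R0"
  show ?thesis
  proof (intro exI[of _ C] conjI allI ballI)
    show "C > 0" unfolding C_def using R0 by (intro add_nonneg_pos mult_nonneg_nonneg mult_pos_pos add_nonneg_nonneg) simp_all
    fix n a x assume x: "x \<in> X"
    let ?M = "n + (m + k)"
    obtain \<sigma> where \<sigma>: "a \<in> (*\<^sub>R) (lam ^ ?M) ` S \<sigma>" "infl ?M {\<sigma>} \<subseteq> x"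
      using X_supertile[OF x] by metis
    obtain \<xi> where \<xi>: "\<xi> \<in> infl k {\<sigma>}" "snd \<xi> = snd \<tau>0"
      using k[of \<sigma>] by (metis UNIV_I imageE)
    define c where "c = fst \<xi> - fst \<tau>0"
    have \<xi>c: "\<xi> = shift_tile c \<tau>0" using \<xi>(2) by (simp add: c_def shift_tile_def prod_eq_iff)
    have "shift (lam ^ m *\<^sub>R c) P \<subseteq> infl m {\<xi>}"
      using shift_mono[OF assms, of "lam ^ m *\<^sub>R c"] infl_shift[of m c "{\<tau>0}"] by (simp add: \<xi>c)
    also have "\<dots> \<subseteq> infl m (infl k {\<sigma>})" using \<xi>(1) by (intro infl_mono) simp
    finally have "infl n (shift (lam ^ m *\<^sub>R c) P) \<subseteq> infl n (infl m (infl k {\<sigma>}))" by (rule infl_mono)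
    then have 1: "shift (lam ^ n *\<^sub>R (lam ^ m *\<^sub>R c)) (infl n P) \<subseteq> x"
      using \<sigma>(2) by (simp add: infl_shift infl_add)
    have "centre \<xi> \<in> cball (lam ^ k *\<^sub>R fst \<sigma>) (lam ^ k * R0)"
      using infl_supp_subset[OF \<xi>(1)] centre_in_supp[of \<xi>] scaled_supp_subset[of k \<sigma>] by blast
    then have "norm (fst \<xi> - lam ^ k *\<^sub>R fst \<sigma>) \<le> lam ^ k * R0 + R0"
      using norm_centre_fst[of \<xi>] norm_triangle_ineq4[of "centre \<xi> - lam ^ k *\<^sub>R fst \<sigma>" "centre \<xi> - fst \<xi>"]
      by (simp add: dist_norm norm_minus_commute)
    then have "norm (c - lam ^ k *\<^sub>R fst \<sigma>) \<le> lam ^ k * R0 + R0 + norm (fst \<tau>0)"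
      using norm_triangle_ineq4[of "fst \<xi> - lam ^ k *\<^sub>R fst \<sigma>" "fst \<tau>0"] by (simp add: c_def algebra_simps)
    then have "lam ^ (n + m) * norm (c - lam ^ k *\<^sub>R fst \<sigma>) \<le> lam ^ (n + m) * (lam ^ k * R0 + R0 + norm (fst \<tau>0))"
      by (rule mult_left_mono) simp
    moreover have "norm (lam ^ (n + m) *\<^sub>R (c - lam ^ k *\<^sub>R fst \<sigma>)) = lam ^ (n + m) * norm (c - lam ^ k *\<^sub>R fst \<sigma>)"
      by simp
    moreover have "lam ^ (n + m) *\<^sub>R (c - lam ^ k *\<^sub>R fst \<sigma>) = lam ^ n *\<^sub>R (lam ^ m *\<^sub>R c) - lam ^ ?M *\<^sub>R fst \<sigma>"
      by (simp add: scaleR_diff_right power_add algebra_simps)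
    ultimately have 2: "norm (lam ^ n *\<^sub>R (lam ^ m *\<^sub>R c) - lam ^ ?M *\<^sub>R fst \<sigma>) \<le> lam ^ (n + m) * (lam ^ k * R0 + R0 + norm (fst \<tau>0))"
      by simp
    have 3: "norm (lam ^ ?M *\<^sub>R fst \<sigma> - a) \<le> lam ^ ?M * R0"
      using \<sigma>(1) scaled_supp_subset[of ?M \<sigma>] unfolding dist_norm[symmetric] by (meson mem_cball subsetD)
    have "norm (lam ^ n *\<^sub>R (lam ^ m *\<^sub>R c) - a) \<le> lam ^ (n + m) * (lam ^ k * R0 + R0 + norm (fst \<tau>0)) + lam ^ ?M * R0"
      using 2 3 norm_triangle_ineq[of "lam ^ n *\<^sub>R (lam ^ m *\<^sub>R c) - lam ^ ?M *\<^sub>R fst \<sigma>" "lam ^ ?M *\<^sub>R fst \<sigma> - a"]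
      by simp
    also have "\<dots> = C * lam ^ n" by (simp add: C_def power_add algebra_simps)
    finally show "\<exists>b. shift (lam ^ n *\<^sub>R b) (infl n P) \<subseteq> x \<and> norm (lam ^ n *\<^sub>R b - a) \<le> C * lam ^ n"
      using 1 by blast
  qed
qed

lemma infl_legal: "\<exists>x\<in>X. infl n {\<tau>} \<subseteq> x"
proof -
  obtain x where x: "x \<in> X" using X_nonempty by blast
  obtain C where C: "\<forall>m a. \<forall>x\<in>X. \<exists>b. shift (lam ^ m *\<^sub>R b) (infl m (infl n {\<tau>})) \<subseteq> x \<and> norm (lam ^ m *\<^sub>R b - a) \<le> C * lam ^ m"
    using patch_relatively_dense[OF subset_refl, of n \<tau>] by (elim exE conjE)
  obtain b where b: "shift b (infl n {\<tau>}) \<subseteq> x" using bspec[OF spec[OF spec[OF C, of 0], of 0] x] by auto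
  have "infl n {\<tau>} \<subseteq> shift (- b) x" using shift_mono[OF b, of "- b"] by simp
  with X_shift[OF x] show ?thesis by blast
qed

text \<open>This replaces the statement that the inflation maps \<open>X\<close> to itself: two
  tiles of a tiling may be inflated together, and their descendants again lie in a common
  tiling.\<close>

lemma infl_patch_legal:
  assumes "x \<in> X" "finite P" "P \<subseteq> x"
  shows "\<exists>y\<in>X. infl n P \<subseteq> y"
proof -
  obtain m \<tau> where "P \<subseteq> infl m {\<tau>}" using X_finite_patch[OF assms] by blast
  then have "infl n P \<subseteq> infl (n + m) {\<tau>}" unfolding infl_add by (rule infl_mono)
  with infl_legal[of "n + m" \<tau>] show ?thesis by (meson order_trans)
qed

end

section \<open>Integer recurrences and phases modulo one\<close>

text \<open>Fraction-free Gaussian elimination, by induction on the number of equations: one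
  equation with a nonzero coefficient at \<open>j0\<close> is used to eliminate the unknown
  \<open>j0\<close> from the others.\<close>

lemma integer_relation:
  fixes a :: "'i \<Rightarrow> 'j \<Rightarrow> int"
  assumes "finite I" "finite J" "card I < card J"
  shows "\<exists>c. (\<exists>j\<in>J. c j \<noteq> 0) \<and> (\<forall>i\<in>I. (\<Sum>j\<in>J. c j * a i j) = 0)"
  using assms
proof (induction I arbitrary: a J rule: finite_induct)
  case empty
  then have "J \<noteq> {}" by force
  then show ?case by (intro exI[of _ "\<lambda>_. 1"]) auto
next
  case (insert i I)
  show ?case
  proof (cases "\<exists>j0\<in>J. a i j0 \<noteq> 0")
    case False
    with insert.IH[of J a] insert.prems insert.hyps show ?thesis by auto
  next
    case True
    then obtain j0 where j0: "j0 \<in> J" "a i j0 \<noteq> 0" by blast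
    let ?J = "J - {j0}"
    have "card I < card ?J" using insert j0 by (simp add: card_Diff_singleton)
    with insert.IH[of ?J "\<lambda>k j. a i j0 * a k j - a k j0 * a i j"] insert.prems
    obtain c where c: "\<exists>j\<in>?J. c j \<noteq> 0"
        "\<forall>k\<in>I. (\<Sum>j\<in>?J. c j * (a i j0 * a k j - a k j0 * a i j)) = 0"
      by auto
    \<comment> \<open>The solution of the reduced system is multiplied by the pivot
      \<open>a i j0\<close>; the value at \<open>j0\<close> is then the one that satisfies equation
      \<open>i\<close>.\<close>
    define c' where "c' j = (if j = j0 then - (\<Sum>j\<in>?J. a i j * c j) else a i j0 * c j)" for j
    have *: "(\<Sum>j\<in>J. c' j * a k j) = (\<Sum>j\<in>?J. c j * (a i j0 * a k j - a k j0 * a i j))" for k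
    proof -
      have "(\<Sum>j\<in>J. c' j * a k j) = c' j0 * a k j0 + (\<Sum>j\<in>?J. c' j * a k j)"
        using insert.prems j0 by (simp add: sum.remove)
      also have "(\<Sum>j\<in>?J. c' j * a k j) = (\<Sum>j\<in>?J. a i j0 * c j * a k j)"
        by (rule sum.cong) (auto simp: c'_def)
      finally show ?thesis
        by (simp add: c'_def sum_distrib_right sum_distrib_left sum_subtractf right_diff_distrib mult_ac)
    qed
    have "\<forall>k\<in>insert i I. (\<Sum>j\<in>J. c' j * a k j) = 0"
      using c(2) unfolding * by (auto simp: mult.commute)
    moreover have "\<exists>j\<in>J. c' j \<noteq> 0" using c(1) j0(2) by (auto simp: c'_def)
    ultimately show ?thesis by blast
  qed
qed

text \<open>The polynomial is evaluated at the shift operator on sequences;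
  \<open>poly_act p s n = 0\<close> for all \<open>n\<close> is the linear recurrence with
  characteristic polynomial \<open>p\<close>.\<close>

definition poly_act :: "complex poly \<Rightarrow> (nat \<Rightarrow> complex) \<Rightarrow> nat \<Rightarrow> complex" where
  "poly_act p s n = (\<Sum>i\<le>degree p. coeff p i * s (n + i))"

lemma poly_act_bound: "degree p \<le> N \<Longrightarrow> poly_act p s n = (\<Sum>i\<le>N. coeff p i * s (n + i))"
  unfolding poly_act_def by (rule sum.mono_neutral_left) (auto simp: coeff_eq_0)

lemma poly_act_linear_factor:
  "poly_act ([:- z, 1:] * q) s n = poly_act q (\<lambda>n. s (Suc n) - z * s n) n"
proof -
  let ?N = "degree q"
  have deg: "degree ([:- z, 1:] * q) \<le> Suc ?N"
    using degree_mult_le[of "[:- z, 1:]" q] by simp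
  have co: "coeff ([:- z, 1:] * q) i = (case i of 0 \<Rightarrow> 0 | Suc j \<Rightarrow> coeff q j) - z * coeff q i" for i
    by (simp add: coeff_pCons split: nat.split)
  have "poly_act ([:- z, 1:] * q) s n =
      (\<Sum>i\<le>Suc ?N. (case i of 0 \<Rightarrow> 0 | Suc j \<Rightarrow> coeff q j) * s (n + i)) - z * (\<Sum>i\<le>Suc ?N. coeff q i * s (n + i))"
    unfolding poly_act_bound[OF deg] co by (simp only: left_diff_distrib sum_subtractf sum_distrib_left mult.assoc)
  also have "(\<Sum>i\<le>Suc ?N. (case i of 0 \<Rightarrow> 0 | Suc j \<Rightarrow> coeff q j) * s (n + i)) = (\<Sum>i\<le>?N. coeff q i * s (Suc (n + i)))"
    by (subst sum.atMost_Suc_shift) simp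
  also have "(\<Sum>i\<le>Suc ?N. coeff q i * s (n + i)) = (\<Sum>i\<le>?N. coeff q i * s (n + i))"
    by (simp add: coeff_eq_0)
  finally show ?thesis
    unfolding poly_act_def by (simp add: right_diff_distrib sum_subtractf sum_distrib_left mult_ac)
qed

text \<open>
  If \<open>norm z < 1\<close>, the recurrence is estimated forwards. Otherwise it is solved backwards from infinity,
  where \<open>s\<close> vanishes.
\<close>

lemma exponential_decay_step:
  fixes s :: "nat \<Rightarrow> complex"
  assumes "s \<longlonglongrightarrow> 0" and t: "\<And>n. norm (s (Suc n) - z * s n) \<le> C * \<theta> ^ n" and \<theta>: "0 < \<theta>" "\<theta> < 1"
  shows "\<exists>C \<theta>. 0 < \<theta> \<and> \<theta> < 1 \<and> (\<forall>n. norm (s n) \<le> C * \<theta> ^ n)"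
proof (cases "norm z < 1")
  case True
  define \<eta> where "\<eta> = (1 + max \<theta> (norm z)) / 2"
  have \<eta>: "\<theta> \<le> \<eta>" "norm z < \<eta>" "\<eta> < 1" "0 < \<eta>" using True \<theta> by (auto simp: \<eta>_def)
  have C: "0 \<le> C" using order_trans[OF norm_ge_zero t[of 0]] by simp
  \<comment> \<open>The second summand makes \<open>norm z * K + C \<le> \<eta> * K\<close>, so the
    bound reproduces itself in the induction; the first one starts it.\<close>
  define K where "K = norm (s 0) + C / (\<eta> - norm z)"
  have "norm (s n) \<le> K * \<eta> ^ n" for n
  proof (induction n)
    case 0 then show ?case using C \<eta> by (simp add: K_def)
  next
    case (Suc n)
    have "norm (s (Suc n)) \<le> norm z * norm (s n) + C * \<theta> ^ n"
      using norm_triangle_ineq[of "s (Suc n) - z * s n" "z * s n"] t[of n] by (simp add: norm_mult)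
    also have "\<dots> \<le> norm z * (K * \<eta> ^ n) + C * \<eta> ^ n"
      using Suc C \<eta> \<theta> by (intro add_mono mult_left_mono power_mono) auto
    also have "\<dots> = (norm z * K + C) * \<eta> ^ n" by (simp add: algebra_simps)
    also have "\<dots> \<le> (\<eta> * K) * \<eta> ^ n"
    proof (rule mult_right_mono)
      have "C = (\<eta> - norm z) * (C / (\<eta> - norm z))" using \<eta> by simp
      also have "\<dots> \<le> (\<eta> - norm z) * K" using \<eta> by (intro mult_left_mono) (auto simp: K_def)
      finally show "norm z * K + C \<le> \<eta> * K" by (simp add: algebra_simps)
    qed (use \<eta> in simp)
    finally show ?case by (simp add: mult_ac)
  qed
  with \<eta> show ?thesis by blast
next
  case False
  have C: "0 \<le> C" using order_trans[OF norm_ge_zero t[of 0]] by simp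
  have step: "norm (s n) \<le> norm (s (Suc n)) + C * \<theta> ^ n" for n
  proof -
    have "norm (s n) \<le> norm (z * s n)"
      using False mult_right_mono[of 1 "norm z" "norm (s n)"] by (simp add: norm_mult)
    also have "\<dots> \<le> norm (s (Suc n)) + C * \<theta> ^ n"
      using t[of n] norm_triangle_ineq2[of "z * s n" "s (Suc n)"] by (simp add: norm_minus_commute)
    finally show ?thesis .
  qed
  have it: "norm (s n) \<le> norm (s (n + m)) + C * \<theta> ^ n * (\<Sum>j<m. \<theta> ^ j)" for n m
  proof (induction m)
    case (Suc m)
    then show ?case using step[of "n + m"] by (simp add: algebra_simps power_add)
  qed simp
  have "norm (s n) \<le> C / (1 - \<theta>) * \<theta> ^ n" for n
  proof -
    have "norm (s n) \<le> norm (s (n + m)) + C * \<theta> ^ n * (1 / (1 - \<theta>))" for m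
    proof -
      have "(\<Sum>j<m. \<theta> ^ j) \<le> (\<Sum>j. \<theta> ^ j)"
        using \<theta> by (intro sum_le_suminf summable_geometric) auto
      also have "\<dots> = 1 / (1 - \<theta>)" using \<theta> by (intro suminf_geometric) auto
      finally have "C * \<theta> ^ n * (\<Sum>j<m. \<theta> ^ j) \<le> C * \<theta> ^ n * (1 / (1 - \<theta>))"
        using C \<theta> by (intro mult_left_mono) auto
      with it[of n m] show ?thesis by simp
    qed
    moreover have "(\<lambda>m. norm (s (n + m)) + C * \<theta> ^ n * (1 / (1 - \<theta>))) \<longlonglongrightarrow> norm (0::complex) + C * \<theta> ^ n * (1 / (1 - \<theta>))"
      using LIMSEQ_ignore_initial_segment[OF assms(1), of n]
      by (intro tendsto_add tendsto_norm tendsto_const) (simp add: add.commute)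
    ultimately have "norm (s n) \<le> norm (0::complex) + C * \<theta> ^ n * (1 / (1 - \<theta>))"
      by (intro LIMSEQ_le_const) auto
    then show ?thesis by simp
  qed
  with \<theta> show ?thesis by blast
qed

text \<open>A complex root \<open>z\<close> of \<open>p\<close> is split off. The sequence
  \<open>s (Suc n) - z * s n\<close> tends to 0 and satisfies a recurrence of smaller degree, so it
  decays exponentially by induction, and the decay is carried back to \<open>s\<close>.\<close>

lemma linear_recurrence_exponential_decay:
  assumes "p \<noteq> 0" "\<And>n. poly_act p s n = 0" "s \<longlonglongrightarrow> 0"
  shows "\<exists>C \<theta>. 0 < \<theta> \<and> \<theta> < 1 \<and> (\<forall>n. norm (s n) \<le> C * \<theta> ^ n)"
  using assms
proof (induction "degree p" arbitrary: p s)
  case 0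
  then have "coeff p 0 \<noteq> 0" by (metis leading_coeff_0_iff)
  with 0 have "s n = 0" for n
    using 0(3)[of n] by (simp add: poly_act_def flip: 0(1))
  then show ?case by (intro exI[of _ 0] exI[of _ "1/2"]) simp
next
  case (Suc d)
  have "\<not> constant (poly p)" using Suc(2) by (simp add: constant_degree)
  then obtain z where "poly p z = 0" using fundamental_theorem_of_algebra by blast
  then obtain q where q: "p = [:- z, 1:] * q"
    by (auto simp: poly_eq_0_iff_dvd elim: dvdE)
  have "q \<noteq> 0" using Suc(3) q by auto
  then have "degree q = d" using Suc(2) degree_mult_eq[of "[:- z, 1:]" q] q by simp
  let ?t = "\<lambda>n. s (Suc n) - z * s n"
  have "?t \<longlonglongrightarrow> 0 - z * 0"
    using Suc(5) by (intro tendsto_diff tendsto_mult tendsto_const LIMSEQ_Suc)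
  then have t0: "?t \<longlonglongrightarrow> 0" by simp
  have "\<exists>C \<theta>. 0 < \<theta> \<and> \<theta> < 1 \<and> (\<forall>n. norm (?t n) \<le> C * \<theta> ^ n)"
    by (rule Suc(1)) (use \<open>degree q = d\<close> \<open>q \<noteq> 0\<close> t0 Suc(4) in \<open>simp_all add: q poly_act_linear_factor del: mult_pCons_left\<close>)
  with exponential_decay_step[OF Suc(5)] show ?case by blast
qed

text \<open>Distance of \<open>x\<close> from the integers, measured as a chord of the unit circle.
  In this form it is subadditive and is directly the factor by which an eigenfunction changes under
  translation.\<close>

definition phase_dist :: "real \<Rightarrow> real" where
  "phase_dist x = norm (cis (2 * pi * x) - 1)"

lemma phase_dist_nonneg [simp]: "0 \<le> phase_dist x" by (simp add: phase_dist_def)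

lemma phase_dist_0 [simp]: "phase_dist 0 = 0" by (simp add: phase_dist_def)

lemma phase_dist_sin: "phase_dist x = 2 * \<bar>sin (pi * x)\<bar>"
  using dist_exp_i_1[of "2 * pi * x"] by (simp add: phase_dist_def cis_conv_exp)

lemma phase_dist_le: "phase_dist x \<le> 2 * pi * \<bar>x\<bar>"
proof -
  have "\<bar>sin (pi * x)\<bar> \<le> \<bar>pi * x\<bar>" by (rule abs_sin_x_le_abs_x)
  then show ?thesis by (simp add: phase_dist_sin abs_mult)
qed

lemma phase_dist_add: "phase_dist (x + y) \<le> phase_dist x + phase_dist y"
proof -
  have "cis (2 * pi * (x + y)) - 1 = cis (2 * pi * x) * (cis (2 * pi * y) - 1) + (cis (2 * pi * x) - 1)"
    by (simp add: algebra_simps cis_mult)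
  then have "phase_dist (x + y) \<le> norm (cis (2 * pi * x) * (cis (2 * pi * y) - 1)) + phase_dist x"
    unfolding phase_dist_def by (simp only: norm_triangle_ineq)
  then show ?thesis by (simp add: norm_mult phase_dist_def)
qed

lemma phase_dist_minus [simp]: "phase_dist (- x) = phase_dist x"
  by (simp add: phase_dist_sin)

lemma phase_dist_diff: "phase_dist (x - y) \<le> phase_dist x + phase_dist y"
  using phase_dist_add[of x "- y"] by simp

lemma phase_dist_int [simp]: "phase_dist (of_int n) = 0"
  using cis_multiple_2pi[of "of_int n"] by (simp add: phase_dist_def)

lemma phase_dist_add_int: "phase_dist (x + of_int n) = phase_dist x"
  using phase_dist_add[of x "of_int n"] phase_dist_diff[of "x + of_int n" "of_int n"] by simp

lemma phase_dist_diff_int: "phase_dist (x - of_int n) = phase_dist x"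
  using phase_dist_add_int[of x "- n"] by simp

lemma phase_dist_sum: "phase_dist (\<Sum>i\<in>A. f i) \<le> (\<Sum>i\<in>A. phase_dist (f i))"
  by (induction A rule: infinite_finite_induct) (auto intro: order_trans[OF phase_dist_add])

lemma phase_dist_of_nat_mult: "phase_dist (of_nat n * x) \<le> of_nat n * phase_dist x"
  by (induction n) (auto simp: algebra_simps intro: order_trans[OF phase_dist_add])

lemma phase_dist_of_int_mult: "phase_dist (of_int n * x) \<le> \<bar>of_int n\<bar> * phase_dist x"
proof (cases "n \<ge> 0")
  case True
  then show ?thesis using phase_dist_of_nat_mult[of "nat n" x] by simp
next
  case False
  then show ?thesis using phase_dist_of_nat_mult[of "nat (- n)" x] phase_dist_minus[of "of_int n * x"] by simp
qed

lemma phase_dist_small: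
  assumes "0 < \<kappa>" "\<kappa> \<le> 1/2"
  shows "\<exists>\<eta>>0. \<forall>t. \<bar>t\<bar> \<le> 1/2 \<longrightarrow> phase_dist t < \<eta> \<longrightarrow> \<bar>t\<bar> < \<kappa>"
proof (intro exI[of _ "2 * sin (pi * \<kappa>)"] conjI allI impI)
  have pk: "0 < pi * \<kappa>" "pi * \<kappa> \<le> pi / 2" using assms by auto
  have "pi * \<kappa> < pi" using pk(2) pi_gt_zero by linarith
  then show "0 < 2 * sin (pi * \<kappa>)" using sin_gt_zero[OF pk(1)] by simp
  fix t :: real assume t: "\<bar>t\<bar> \<le> 1/2" "phase_dist t < 2 * sin (pi * \<kappa>)"
  show "\<bar>t\<bar> < \<kappa>"
  proof (rule ccontr)
    assume "\<not> \<bar>t\<bar> < \<kappa>"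
    then have "sin (pi * \<kappa>) \<le> sin (pi * \<bar>t\<bar>)"
    proof (intro sin_monotone_2pi_le)
      show "- (pi / 2) \<le> pi * \<kappa>" using pk(1) pi_gt_zero by linarith
    qed (use pk t in auto)
    also have "\<dots> \<le> \<bar>sin (pi * t)\<bar>" by (cases "t \<ge> 0") auto
    finally show False using t by (simp add: phase_dist_sin)
  qed
qed

text \<open>Pisot's argument. Write \<open>\<alpha> * lam ^ n\<close> as an integer plus an error
  \<open>\<epsilon> n\<close> tending to 0. Applying the integer relation of \<open>lam\<close> to
  the errors gives integers that tend to 0, hence vanish eventually. So the errors satisfy an exact
  linear recurrence from some index on, and convergence becomes geometric.\<close>

lemma algebraic_phase_dist_summable:
  fixes lam \<alpha> :: real and c :: "nat \<Rightarrow> int"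
  assumes rel: "(\<Sum>i\<le>q. of_int (c i) * lam ^ i) = 0" and c: "\<exists>i\<le>q. c i \<noteq> 0"
    and lim: "(\<lambda>n. phase_dist (\<alpha> * lam ^ n)) \<longlonglongrightarrow> 0"
  shows "summable (\<lambda>n. phase_dist (\<alpha> * lam ^ n))"
proof -
  define u where "u n = \<alpha> * lam ^ n" for n
  define \<epsilon> where "\<epsilon> n = u n - of_int (round (u n))" for n
  have e: "\<bar>\<epsilon> n\<bar> \<le> 1/2" "phase_dist (\<epsilon> n) = phase_dist (u n)" for n
    using of_int_round_abs_le[of "u n"] unfolding \<epsilon>_def by (auto simp: phase_dist_diff_int abs_minus_commute)
  have lim0: "\<epsilon> \<longlonglongrightarrow> 0"
  proof (rule LIMSEQ_I)
    fix r :: real assume "r > 0"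
    then have "\<exists>\<eta>>0. \<forall>t. \<bar>t\<bar> \<le> 1/2 \<longrightarrow> phase_dist t < \<eta> \<longrightarrow> \<bar>t\<bar> < min r (1/2)"
      by (intro phase_dist_small) auto
    then obtain \<eta> where \<eta>: "\<eta> > 0" "\<And>t. \<bar>t\<bar> \<le> 1/2 \<Longrightarrow> phase_dist t < \<eta> \<Longrightarrow> \<bar>t\<bar> < min r (1/2)"
      by blast
    obtain N where "\<forall>n\<ge>N. phase_dist (u n) < \<eta>"
      using LIMSEQ_D[OF lim \<eta>(1)] by (auto simp: u_def)
    then show "\<exists>no. \<forall>n\<ge>no. norm (\<epsilon> n - 0) < r"
      using \<eta>(2) e by (intro exI[of _ N]) (metis diff_zero min_less_iff_conj real_norm_def)
  qed
  define w where "w n = (\<Sum>i\<le>q. of_int (c i) * \<epsilon> (n + i))" for n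
  \<comment> \<open>The relation annihilates the sequence \<open>u\<close> itself, so only the
    rounded parts contribute.\<close>
  have wi: "w n = of_int (- (\<Sum>i\<le>q. c i * round (u (n + i))))" for n
  proof -
    have "(\<Sum>i\<le>q. of_int (c i) * u (n + i)) = \<alpha> * lam ^ n * (\<Sum>i\<le>q. of_int (c i) * lam ^ i)"
      by (simp add: u_def power_add sum_distrib_left mult_ac)
    then show ?thesis
      unfolding w_def \<epsilon>_def by (simp add: rel right_diff_distrib sum_subtractf)
  qed
  have "w \<longlonglongrightarrow> (\<Sum>i\<le>q. of_int (c i) * 0)"
    unfolding w_def by (intro tendsto_sum tendsto_mult tendsto_const LIMSEQ_ignore_initial_segment lim0)
  then have "w \<longlonglongrightarrow> 0" by simp
  from LIMSEQ_D[OF this, of 1] obtain N where N: "\<And>n. n \<ge> N \<Longrightarrow> \<bar>w n\<bar> < 1" by auto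
  have w0: "w n = 0" if "n \<ge> N" for n
    using N[OF that] unfolding wi by (simp only: of_int_abs[symmetric] of_int_less_1_iff of_int_eq_0_iff)
  define p where "p = Abs_poly (\<lambda>i. if i \<le> q then of_int (c i) else (0::complex))"
  have p: "coeff p i = (if i \<le> q then of_int (c i) else 0)" for i
    unfolding p_def by (subst coeff_Abs_poly[of q]) auto
  have "degree p \<le> q" by (rule degree_le) (simp add: p)
  have "p \<noteq> 0" using c p by (metis coeff_0 of_int_eq_0_iff)
  \<comment> \<open>The recurrence is only known from index \<open>N\<close> on; summability does
    not notice the shift.\<close>
  define s where "s n = complex_of_real (\<epsilon> (n + N))" for n
  have "poly_act p s n = complex_of_real (w (n + N))" for n
    unfolding poly_act_bound[OF \<open>degree p \<le> q\<close>] w_def by (simp add: p s_def add_ac)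
  then have "poly_act p s n = 0" for n using w0 by simp
  moreover have "s \<longlonglongrightarrow> of_real 0"
    unfolding s_def by (intro tendsto_of_real LIMSEQ_ignore_initial_segment lim0)
  ultimately obtain C \<theta> where C: "0 < \<theta>" "\<theta> < 1" "\<And>n. norm (s n) \<le> C * \<theta> ^ n"
    using linear_recurrence_exponential_decay[OF \<open>p \<noteq> 0\<close>, of s] by auto
  have "summable (\<lambda>n. phase_dist (u (n + N)))"
  proof (rule summable_comparison_test')
    show "summable (\<lambda>n. 2 * pi * C * \<theta> ^ n)"
      using C by (intro summable_mult summable_geometric) auto
    fix n
    have "phase_dist (u (n + N)) \<le> 2 * pi * \<bar>\<epsilon> (n + N)\<bar>"
      using phase_dist_le[of "\<epsilon> (n + N)"] e by simp
    also have "\<dots> \<le> 2 * pi * (C * \<theta> ^ n)"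
      using C(3)[of n] by (intro mult_left_mono) (auto simp: s_def)
    finally show "norm (phase_dist (u (n + N))) \<le> 2 * pi * C * \<theta> ^ n" by (simp add: mult_ac)
  qed
  then show ?thesis unfolding summable_iff_shift[of "\<lambda>n. phase_dist (u n)"] by (simp only: u_def)
qed

section \<open>Differences of control points\<close>

text \<open>Tiles are pairs; quantifiers over tiles are to stay unsplit.\<close>
declare split_paired_Ex [simp del] split_paired_All [simp del]

lemma patch_atI: "\<tau> \<in> x \<Longrightarrow> p \<in> supp shape \<tau> \<Longrightarrow> dist a p \<le> r \<Longrightarrow> \<tau> \<in> patch_at shape x a r"
  unfolding patch_at_def by auto

locale control_point_inflation = primitive_stone_inflations shape r0 R0 cen lam rho
  for shape :: "'l::finite \<Rightarrow> 'a::euclidean_space set" and r0 R0 :: real and cen :: "'l \<Rightarrow> 'a"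
    and lam rho +
  fixes cp :: "('a, 'l) tile \<Rightarrow> 'a"
  assumes FLC: "flc shape X"
    and cp: "control_points lam rho X cp"
begin

lemma cp_shift [simp]: "cp (shift_tile t \<tau>) = cp \<tau> + t"
  using cp unfolding control_points_def by blast

lemma cp_alt: "cp \<tau> = fst \<tau> + cp (0, snd \<tau>)"
  using cp_shift[of "fst \<tau>" "(0, snd \<tau>)"] by (simp add: shift_tile_def add.commute)

lemma cp_inflate: "\<exists>\<sigma>\<in>inflate lam rho {\<tau>}. cp \<sigma> = lam *\<^sub>R cp \<tau>"
  using cp unfolding control_points_def by blast

lemma cp_inj: "x \<in> X \<Longrightarrow> inj_on cp x"
  using cp unfolding control_points_def by blast

definition \<Delta> :: "'a set" where
  "\<Delta> = {cp \<sigma> - cp \<tau> | \<sigma> \<tau> x. x \<in> X \<and> \<sigma> \<in> x \<and> \<tau> \<in> x}"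

lemma \<Delta>I: "x \<in> X \<Longrightarrow> \<sigma> \<in> x \<Longrightarrow> \<tau> \<in> x \<Longrightarrow> cp \<sigma> - cp \<tau> \<in> \<Delta>"
  unfolding \<Delta>_def by blast

lemma \<Delta>_minus: "d \<in> \<Delta> \<Longrightarrow> - d \<in> \<Delta>"
  using minus_diff_eq unfolding \<Delta>_def by fastforce

lemma zero_in_\<Delta>: "0 \<in> \<Delta>"
proof -
  obtain x where x: "x \<in> X" using X_nonempty by blast
  then obtain \<tau> where "\<tau> \<in> x" using X_cover[of x 0] by blast
  with x \<Delta>I[of x \<tau> \<tau>] show ?thesis by simp
qed

lemma \<Delta>_R_ev: "\<Delta> \<subseteq> R_ev lam X"
  using cp unfolding \<Delta>_def control_points_def by blast

text \<open>The two tiles are inflated as one patch, which is again legal, and in each inflated tile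
  some tile has its control point at \<open>lam\<close> times the old one.\<close>

lemma \<Delta>_scale: "d \<in> \<Delta> \<Longrightarrow> lam *\<^sub>R d \<in> \<Delta>"
proof -
  assume "d \<in> \<Delta>"
  then obtain x \<sigma> \<tau> where x: "x \<in> X" "\<sigma> \<in> x" "\<tau> \<in> x" "d = cp \<sigma> - cp \<tau>"
    unfolding \<Delta>_def by blast
  obtain y where y: "y \<in> X" "infl 1 {\<sigma>, \<tau>} \<subseteq> y"
    using infl_patch_legal[of x "{\<sigma>, \<tau>}" 1] x by auto
  obtain \<sigma>' where \<sigma>': "\<sigma>' \<in> infl 1 {\<sigma>}" "cp \<sigma>' = lam *\<^sub>R cp \<sigma>" using cp_inflate[of \<sigma>] by auto
  obtain \<tau>' where \<tau>': "\<tau>' \<in> infl 1 {\<tau>}" "cp \<tau>' = lam *\<^sub>R cp \<tau>" using cp_inflate[of \<tau>] by auto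
  have "\<sigma>' \<in> y" "\<tau>' \<in> y"
    using \<sigma>'(1) \<tau>'(1) y(2) infl_mono[of "{\<sigma>}" "{\<sigma>, \<tau>}" 1] infl_mono[of "{\<tau>}" "{\<sigma>, \<tau>}" 1] by blast+
  then have "cp \<sigma>' - cp \<tau>' \<in> \<Delta>" using y(1) \<Delta>I by blast
  then show ?thesis by (simp add: \<sigma>' \<tau>' x scaleR_diff_right)
qed

lemma \<Delta>_scale_pow: "d \<in> \<Delta> \<Longrightarrow> lam ^ n *\<^sub>R d \<in> \<Delta>"
proof (induction n)
  case (Suc n)
  then show ?case using \<Delta>_scale[of "lam ^ n *\<^sub>R d"] by simp
qed simp

text \<open>Tiles at bounded distance lie in a common patch of bounded radius. FLC leaves finitely
  many such patches up to translation, and differences of control points are translation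
  invariant.\<close>

lemma finite_short_differences:
  "finite {cp \<sigma> - cp \<tau> | \<sigma> \<tau> x. x \<in> X \<and> \<sigma> \<in> x \<and> \<tau> \<in> x \<and> norm (fst \<sigma> - fst \<tau>) \<le> r}" (is "finite ?A")
proof -
  obtain \<P> where \<P>: "finite \<P>" "\<And>x a. x \<in> X \<Longrightarrow> \<exists>P\<in>\<P>. \<exists>t. patch_at shape x a (r + R0) = shift t P"
    using FLC unfolding flc_def by meson
  \<comment> \<open>The family provided by FLC may contain infinite sets; only its finite members
    can be translates of patches.\<close>
  have "?A \<subseteq> (\<Union>P\<in>{P \<in> \<P>. finite P}. (\<lambda>(\<sigma>, \<tau>). cp \<sigma> - cp \<tau>) ` (P \<times> P))"
  proof
    fix d assume "d \<in> ?A"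
    then obtain \<sigma> \<tau> x where d: "d = cp \<sigma> - cp \<tau>" "x \<in> X" "\<sigma> \<in> x" "\<tau> \<in> x" "norm (fst \<sigma> - fst \<tau>) \<le> r"
      by blast
    obtain P t where P: "P \<in> \<P>" "patch_at shape x (fst \<tau>) (r + R0) = shift t P" using \<P>(2)[OF d(2)] by blast
    have "finite P" using finite_patch_at[OF X_nonoverlapping[OF d(2)]] P(2) by (metis finite_shift)
    have "dist (fst \<tau>) (centre \<sigma>) \<le> r + R0" "dist (fst \<tau>) (centre \<tau>) \<le> r + R0"
      using d(5) norm_centre_fst[of \<sigma>] norm_centre_fst[of \<tau>] order_trans[OF norm_ge_zero d(5)]
        dist_triangle[of "fst \<tau>" "centre \<sigma>" "fst \<sigma>"]
      by (auto simp: dist_norm norm_minus_commute)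
    then have "\<sigma> \<in> patch_at shape x (fst \<tau>) (r + R0)" "\<tau> \<in> patch_at shape x (fst \<tau>) (r + R0)"
      using d(3,4) centre_in_supp by (blast intro: patch_atI)+
    then have "shift_tile (- t) \<sigma> \<in> P" "shift_tile (- t) \<tau> \<in> P" unfolding P(2) mem_shift .
    moreover have "d = cp (shift_tile (- t) \<sigma>) - cp (shift_tile (- t) \<tau>)" by (simp add: d)
    ultimately show "d \<in> (\<Union>P\<in>{P \<in> \<P>. finite P}. (\<lambda>(\<sigma>, \<tau>). cp \<sigma> - cp \<tau>) ` (P \<times> P))"
      using P(1) \<open>finite P\<close> by (intro UN_I[of P] image_eqI[of _ _ "(shift_tile (- t) \<sigma>, shift_tile (- t) \<tau>)"]) auto
  qed
  then show ?thesis by (rule finite_subset) (use \<P>(1) in auto)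
qed

text \<open>The bound is the largest distance between the positions of two tiles that contain points
  at distance at most 1.\<close>

definition gens :: "'a set" where
  "gens = {cp \<sigma> - cp \<tau> | \<sigma> \<tau> x. x \<in> X \<and> \<sigma> \<in> x \<and> \<tau> \<in> x \<and> norm (fst \<sigma> - fst \<tau>) \<le> 2 * R0 + 1}"

lemma finite_gens: "finite gens"
  unfolding gens_def by (rule finite_short_differences)

text \<open>Walk along the segment between the two tiles in steps of length at most 1 and choose a
  tile over each point passed. Consecutive tiles differ by an element of \<open>gens\<close>, so
  \<open>\<Delta>\<close> lies in a finitely generated group.\<close>

lemma \<Delta>_generated:
  assumes "d \<in> \<Delta>"
  shows "\<exists>c::'a \<Rightarrow> int. d = (\<Sum>g\<in>gens. of_int (c g) *\<^sub>R g)"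
proof -
  let ?M = "{d. \<exists>c::'a \<Rightarrow> int. d = (\<Sum>g\<in>gens. of_int (c g) *\<^sub>R g)}"
  have gen: "g \<in> ?M" if "g \<in> gens" for g
  proof -
    have "(\<Sum>h\<in>gens. of_int (if h = g then 1 else 0) *\<^sub>R h) = (\<Sum>h\<in>gens. if h = g then h else 0)"
      by (rule sum.cong) auto
    then have "g = (\<Sum>h\<in>gens. of_int (if h = g then 1 else 0) *\<^sub>R h)"
      using that finite_gens by simp
    then show ?thesis by (intro CollectI exI)
  qed
  have add: "a + b \<in> ?M" if ab: "a \<in> ?M" "b \<in> ?M" for a b
  proof -
    obtain c c' :: "'a \<Rightarrow> int" where "a = (\<Sum>g\<in>gens. of_int (c g) *\<^sub>R g)" "b = (\<Sum>g\<in>gens. of_int (c' g) *\<^sub>R g)"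
      using ab by blast
    then have "a + b = (\<Sum>g\<in>gens. of_int (c g + c' g) *\<^sub>R g)"
      by (simp add: sum.distrib scaleR_add_left)
    then show ?thesis by (intro CollectI exI)
  qed
  obtain x \<sigma> \<tau> where x: "x \<in> X" "\<sigma> \<in> x" "\<tau> \<in> x" "d = cp \<sigma> - cp \<tau>"
    using assms unfolding \<Delta>_def by blast
  have path: "norm (p - fst \<tau>) \<le> real m \<Longrightarrow> \<zeta> \<in> x \<Longrightarrow> norm (fst \<zeta> - p) \<le> R0 \<Longrightarrow> cp \<zeta> - cp \<tau> \<in> ?M" for p m \<zeta>
  proof (induction m arbitrary: p \<zeta>)
    case 0
    then have "norm (fst \<zeta> - fst \<tau>) \<le> 2 * R0 + 1" using R0 by simp
    with 0 x show ?case by (intro gen) (unfold gens_def, blast)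
  next
    case (Suc m)
    \<comment> \<open>The point of the segment whose distance from \<open>fst \<tau>\<close> is
      shortened by the factor \<open>m / (m + 1)\<close>; this moves \<open>p\<close> by at most
      1.\<close>
    define p' where "p' = fst \<tau> + (real m / real (Suc m)) *\<^sub>R (p - fst \<tau>)"
    have "norm (p' - fst \<tau>) = real m / real (Suc m) * norm (p - fst \<tau>)" by (simp add: p'_def)
    also have "\<dots> \<le> real m / real (Suc m) * real (Suc m)" using Suc(2) by (intro mult_left_mono) auto
    finally have n1: "norm (p' - fst \<tau>) \<le> real m" by simp
    have "p - p' = (1 - real m / real (Suc m)) *\<^sub>R (p - fst \<tau>)"
      by (simp add: p'_def algebra_simps)
    also have "1 - real m / real (Suc m) = 1 / real (Suc m)" by (simp add: field_simps)
    finally have "norm (p - p') = norm (p - fst \<tau>) / real (Suc m)" by simp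
    then have n2: "norm (p - p') \<le> 1" using Suc(2) by simp
    obtain \<zeta>' where \<zeta>': "\<zeta>' \<in> x" "p' \<in> S \<zeta>'" using X_cover[OF x(1)] by blast
    have n3: "norm (fst \<zeta>' - p') \<le> R0" using dist_fst_supp[OF \<zeta>'(2)] by (simp add: dist_norm)
    have "norm (fst \<zeta> - fst \<zeta>') \<le> 2 * R0 + 1"
    proof -
      have "fst \<zeta> - fst \<zeta>' = (fst \<zeta> - p) + ((p - p') - (fst \<zeta>' - p'))" by simp
      then have "norm (fst \<zeta> - fst \<zeta>') \<le> norm (fst \<zeta> - p) + norm ((p - p') - (fst \<zeta>' - p'))"
        by (simp only: norm_triangle_ineq)
      with norm_triangle_ineq4[of "p - p'" "fst \<zeta>' - p'"] n2 n3 Suc(4) show ?thesis by linarith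
    qed
    then have "cp \<zeta> - cp \<zeta>' \<in> ?M" using Suc(3) \<zeta>'(1) x(1) by (intro gen) (unfold gens_def, blast)
    from add[OF this Suc(1)[OF n1 \<zeta>'(1) n3]] show ?case by simp
  qed
  obtain m where m: "norm (fst \<sigma> - fst \<tau>) \<le> real m" using real_arch_simple by blast
  have "cp \<sigma> - cp \<tau> \<in> ?M" by (rule path[OF m x(2)]) (use R0 in simp)
  with x(4) show ?thesis by simp
qed

lemma X_infinite_tiles:
  assumes "x \<in> X" shows "\<exists>\<sigma>\<in>x. \<exists>\<tau>\<in>x. cp \<sigma> \<noteq> cp \<tau>"
proof -
  obtain b :: 'a where b: "b \<in> Basis" using nonempty_Basis by blast
  obtain \<sigma> where \<sigma>: "\<sigma> \<in> x" "0 \<in> S \<sigma>" using X_cover[OF assms] by blast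
  obtain \<tau> where \<tau>: "\<tau> \<in> x" "(2 * R0 + 1) *\<^sub>R b \<in> S \<tau>" using X_cover[OF assms] by blast
  have "\<sigma> \<noteq> \<tau>" using dist_supp[of 0 \<sigma> "(2 * R0 + 1) *\<^sub>R b"] \<sigma> \<tau> b R0 by auto
  then show ?thesis using \<sigma> \<tau> cp_inj[OF assms] by (meson inj_onD)
qed

text \<open>For a nonzero \<open>d\<close> in \<open>\<Delta>\<close> the vectors
  \<open>lam ^ j *\<^sub>R d\<close> with \<open>j \<le> card gens\<close> are one more than the
  generators that express them with integer coefficients, so they satisfy an integer relation;
  cancelling \<open>d\<close> shows that \<open>lam\<close> is algebraic.\<close>

lemma lam_integer_relation:
  "\<exists>q c. (\<Sum>i\<le>q. of_int (c i) * lam ^ i) = 0 \<and> (\<exists>i\<le>q. c i \<noteq> (0::int))"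
proof -
  obtain x where x: "x \<in> X" using X_nonempty by blast
  obtain \<sigma> \<tau> where "\<sigma> \<in> x" "\<tau> \<in> x" "cp \<sigma> \<noteq> cp \<tau>" using X_infinite_tiles[OF x] by blast
  then have d: "cp \<sigma> - cp \<tau> \<in> \<Delta>" "cp \<sigma> - cp \<tau> \<noteq> 0" using x \<Delta>I by auto
  define d where "d = cp \<sigma> - cp \<tau>"
  have "\<forall>j. \<exists>c::'a \<Rightarrow> int. lam ^ j *\<^sub>R d = (\<Sum>g\<in>gens. of_int (c g) *\<^sub>R g)"
    using d(1) \<Delta>_scale_pow \<Delta>_generated unfolding d_def by blast
  then obtain a :: "nat \<Rightarrow> 'a \<Rightarrow> int" where a: "\<And>j. lam ^ j *\<^sub>R d = (\<Sum>g\<in>gens. of_int (a j g) *\<^sub>R g)"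
    by metis
  obtain c :: "nat \<Rightarrow> int" where c: "\<exists>j\<in>{..card gens}. c j \<noteq> 0" "\<forall>g\<in>gens. (\<Sum>j\<le>card gens. c j * a j g) = 0"
    using integer_relation[OF finite_gens, of "{..card gens}" "\<lambda>g j. a j g"] by auto
  have "(\<Sum>j\<le>card gens. of_int (c j) * lam ^ j) *\<^sub>R d = (\<Sum>j\<le>card gens. of_int (c j) *\<^sub>R (lam ^ j *\<^sub>R d))"
    by (simp add: scaleR_sum_left)
  also have "\<dots> = (\<Sum>j\<le>card gens. \<Sum>g\<in>gens. of_int (c j * a j g) *\<^sub>R g)"
    by (simp add: a scaleR_sum_right)
  also have "\<dots> = (\<Sum>g\<in>gens. of_int (\<Sum>j\<le>card gens. c j * a j g) *\<^sub>R g)"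
    by (subst sum.swap) (simp add: scaleR_sum_left)
  also have "\<dots> = 0" using c(2) by simp
  finally have "(\<Sum>j\<le>card gens. of_int (c j) * lam ^ j) = 0" using d(2) by (simp add: d_def)
  with c(1) show ?thesis by (intro exI[of _ "card gens"] exI[of _ c]) auto
qed

section \<open>Expansions of control points in base \<open>lam\<close>, uniform phases and the Meyer
  property\<close>

definition digits :: "'a set" where
  "digits = {cp \<zeta> - lam *\<^sub>R cp \<tau> | \<zeta> \<tau>. \<zeta> \<in> inflate lam rho {\<tau>}}"

text \<open>By equivariance a digit depends on \<open>\<tau>\<close> only through its type, and
  there are finitely many types.\<close>

lemma finite_digits: "finite digits"
proof (rule finite_subset)
  show "digits \<subseteq> (\<Union>i. (\<lambda>\<zeta>. cp \<zeta> - lam *\<^sub>R cp (0, i)) ` inflate lam rho {(0, i)})"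
  proof
    fix d assume "d \<in> digits"
    then obtain \<zeta> \<tau> where d: "d = cp \<zeta> - lam *\<^sub>R cp \<tau>" "\<zeta> \<in> inflate lam rho {\<tau>}"
      by (auto simp: digits_def)
    have \<tau>: "\<tau> = shift_tile (fst \<tau>) (0, snd \<tau>)" by (simp add: shift_tile_def)
    have "inflate lam rho {\<tau>} = shift (lam *\<^sub>R fst \<tau>) (inflate lam rho {(0, snd \<tau>)})"
      by (subst \<tau>) (simp only: inflate_shift flip: shift_singleton)
    then have "shift_tile (- (lam *\<^sub>R fst \<tau>)) \<zeta> \<in> inflate lam rho {(0, snd \<tau>)}"
      using d(2) by (simp add: mem_shift)
    moreover have "d = cp (shift_tile (- (lam *\<^sub>R fst \<tau>)) \<zeta>) - lam *\<^sub>R cp (0, snd \<tau>)"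
      using cp_alt[of \<tau>] by (simp add: d(1) scaleR_add_right)
    ultimately show "d \<in> (\<Union>i. (\<lambda>\<zeta>. cp \<zeta> - lam *\<^sub>R cp (0, i)) ` inflate lam rho {(0, i)})" by blast
  qed
qed (auto intro!: finite_inflate)

text \<open>The vector \<open>lam *\<^sub>R cp \<tau>\<close> is itself a control point in the
  inflated tile, so a digit is a difference of two control points of one legal patch.\<close>

lemma digits_subset: "digits \<subseteq> \<Delta>"
proof
  fix d assume "d \<in> digits"
  then obtain \<zeta> \<tau> where d: "d = cp \<zeta> - lam *\<^sub>R cp \<tau>" "\<zeta> \<in> inflate lam rho {\<tau>}"
    by (auto simp: digits_def)
  obtain \<sigma> where \<sigma>: "\<sigma> \<in> inflate lam rho {\<tau>}" "cp \<sigma> = lam *\<^sub>R cp \<tau>" using cp_inflate by blast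
  obtain x where "x \<in> X" "infl 1 {\<tau>} \<subseteq> x" using infl_legal by blast
  with \<sigma> d \<Delta>I[of x \<zeta> \<sigma>] show "d \<in> \<Delta>" by auto
qed

text \<open>Each generation from \<open>\<tau>\<close> down to \<open>\<zeta>\<close> contributes
  one digit, and every later inflation multiplies it by \<open>lam\<close>.\<close>

lemma cp_address:
  assumes "\<zeta> \<in> infl n {\<tau>}"
  shows "\<exists>e. (\<forall>j. e j \<in> digits) \<and> cp \<zeta> - lam ^ n *\<^sub>R cp \<tau> = (\<Sum>j<n. lam ^ j *\<^sub>R e j)"
  using assms
proof (induction n arbitrary: \<zeta>)
  case 0
  \<comment> \<open>The sequence \<open>e\<close> takes digits as values also at the indices outside
    the sum, so some digit is needed as a default value.\<close>
  obtain d where "d \<in> digits" using cp_inflate[of \<tau>] unfolding digits_def by blast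
  with 0 show ?case by (intro exI[of _ "\<lambda>_. d"]) auto
next
  case (Suc n)
  then obtain \<zeta>' where \<zeta>': "\<zeta>' \<in> infl n {\<tau>}" "\<zeta> \<in> inflate lam rho {\<zeta>'}"
    using inflate_Union[of lam rho "infl n {\<tau>}"] by auto
  obtain e where e: "\<And>j. e j \<in> digits" "cp \<zeta>' - lam ^ n *\<^sub>R cp \<tau> = (\<Sum>j<n. lam ^ j *\<^sub>R e j)"
    using Suc.IH[OF \<zeta>'(1)] by blast
  define e' where "e' j = (case j of 0 \<Rightarrow> cp \<zeta> - lam *\<^sub>R cp \<zeta>' | Suc i \<Rightarrow> e i)" for j
  have "(\<Sum>j<Suc n. lam ^ j *\<^sub>R e' j) = e' 0 + lam *\<^sub>R (\<Sum>j<n. lam ^ j *\<^sub>R e j)"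
    by (subst sum.lessThan_Suc_shift) (simp add: e'_def scaleR_sum_right)
  also have "\<dots> = cp \<zeta> - lam ^ Suc n *\<^sub>R cp \<tau>"
    by (simp add: e'_def flip: e(2)) (simp add: scaleR_diff_right)
  finally have "cp \<zeta> - lam ^ Suc n *\<^sub>R cp \<tau> = (\<Sum>j<Suc n. lam ^ j *\<^sub>R e' j)" by simp
  moreover have "\<forall>j. e' j \<in> digits"
    using e(1) \<zeta>'(2) by (auto simp: e'_def digits_def split: nat.split)
  ultimately show ?case by blast
qed

text \<open>Phases of the finitely many digits are summable, so the tail of one convergent series
  bounds the phase of \<open>lam ^ n\<close> times an expansion of any length. Two tiles of a tiling
  descend from a common ancestor, hence their difference is a difference of two expansions, each
  accounting for half of \<open>\<epsilon>\<close>.\<close>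

lemma uniform_phase:
  assumes k: "\<And>d. d \<in> \<Delta> \<Longrightarrow> (\<lambda>n. phase_dist (k \<bullet> (lam ^ n *\<^sub>R d))) \<longlonglongrightarrow> 0" and "\<epsilon> > 0"
  shows "\<exists>N. \<forall>n\<ge>N. \<forall>d\<in>\<Delta>. phase_dist (k \<bullet> (lam ^ n *\<^sub>R d)) < \<epsilon>"
proof -
  define b where "b n = (\<Sum>d\<in>digits. phase_dist (k \<bullet> (lam ^ n *\<^sub>R d)))" for n
  obtain q c where rel: "(\<Sum>i\<le>q. of_int (c i) * lam ^ i) = 0" "\<exists>i\<le>q. c i \<noteq> (0::int)"
    using lam_integer_relation by blast
  have "summable (\<lambda>n. phase_dist (k \<bullet> (lam ^ n *\<^sub>R d)))" if "d \<in> digits" for d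
    using algebraic_phase_dist_summable[OF rel, of "k \<bullet> d"] k[of d] that digits_subset by (auto simp: mult.commute)
  then have sb: "summable b" unfolding b_def by (intro summable_sum)
  have b0: "b n \<ge> 0" for n by (simp add: b_def sum_nonneg)
  obtain N where N: "\<And>n. n \<ge> N \<Longrightarrow> norm (\<Sum>i. b (i + n)) < \<epsilon> / 2"
    using suminf_exist_split[OF _ sb, of "\<epsilon> / 2"] assms(2) by auto
  have "phase_dist (k \<bullet> (lam ^ n *\<^sub>R d)) < \<epsilon>" if n: "n \<ge> N" and d: "d \<in> \<Delta>" for n d
  proof -
    obtain x \<sigma> \<tau> where x: "x \<in> X" "\<sigma> \<in> x" "\<tau> \<in> x" "d = cp \<sigma> - cp \<tau>"
      using d unfolding \<Delta>_def by blast
    obtain m \<tau>0 where "{\<sigma>, \<tau>} \<subseteq> infl m {\<tau>0}" using X_finite_patch[OF x(1), of "{\<sigma>, \<tau>}"] x by auto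
    then obtain e f where ef: "\<And>j. e j \<in> digits" "\<And>j. f j \<in> digits"
      "cp \<sigma> - lam ^ m *\<^sub>R cp \<tau>0 = (\<Sum>j<m. lam ^ j *\<^sub>R e j)" "cp \<tau> - lam ^ m *\<^sub>R cp \<tau>0 = (\<Sum>j<m. lam ^ j *\<^sub>R f j)"
      using cp_address[of \<sigma> m \<tau>0] cp_address[of \<tau> m \<tau>0] by auto
    have bd: "phase_dist (k \<bullet> (lam ^ n *\<^sub>R (\<Sum>j<m. lam ^ j *\<^sub>R e j))) < \<epsilon> / 2" if e: "\<And>j. e j \<in> digits" for e :: "nat \<Rightarrow> 'a"
    proof -
      have "k \<bullet> (lam ^ n *\<^sub>R (\<Sum>j<m. lam ^ j *\<^sub>R e j)) = (\<Sum>j<m. k \<bullet> (lam ^ (j + n) *\<^sub>R e j))"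
        by (simp add: scaleR_sum_right inner_sum_right power_add mult_ac)
      also have "phase_dist \<dots> \<le> (\<Sum>j<m. phase_dist (k \<bullet> (lam ^ (j + n) *\<^sub>R e j)))" by (rule phase_dist_sum)
      also have "\<dots> \<le> (\<Sum>j<m. b (j + n))"
        unfolding b_def using e finite_digits
        by (intro sum_mono member_le_sum[where f = "\<lambda>d. phase_dist (k \<bullet> (lam ^ _ *\<^sub>R d))"]) auto
      also have "\<dots> \<le> (\<Sum>j. b (j + n))"
        using b0 sb by (intro sum_le_suminf) (auto simp: summable_iff_shift)
      also have "\<dots> < \<epsilon> / 2" using N[OF n] by simp
      finally show ?thesis .
    qed
    have "d = (\<Sum>j<m. lam ^ j *\<^sub>R e j) - (\<Sum>j<m. lam ^ j *\<^sub>R f j)"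
      by (simp add: x(4) flip: ef(3,4))
    then have "k \<bullet> (lam ^ n *\<^sub>R d) = k \<bullet> (lam ^ n *\<^sub>R (\<Sum>j<m. lam ^ j *\<^sub>R e j)) - k \<bullet> (lam ^ n *\<^sub>R (\<Sum>j<m. lam ^ j *\<^sub>R f j))"
      by (simp only: scaleR_diff_right inner_diff_right)
    then have "phase_dist (k \<bullet> (lam ^ n *\<^sub>R d)) = phase_dist (k \<bullet> (lam ^ n *\<^sub>R (\<Sum>j<m. lam ^ j *\<^sub>R e j)) - k \<bullet> (lam ^ n *\<^sub>R (\<Sum>j<m. lam ^ j *\<^sub>R f j)))"
      by (rule arg_cong)
    then show ?thesis
      using phase_dist_diff[of "k \<bullet> (lam ^ n *\<^sub>R (\<Sum>j<m. lam ^ j *\<^sub>R e j))" "k \<bullet> (lam ^ n *\<^sub>R (\<Sum>j<m. lam ^ j *\<^sub>R f j))"]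
        bd[of e, OF ef(1)] bd[of f, OF ef(2)] by linarith
  qed
  then show ?thesis by blast
qed

text \<open>If \<open>s\<close> is short, \<open>k \<bullet> (lam ^ N *\<^sub>R s)\<close> lies in
  [-1/2, 1/2]. There a small phase means a small number: the value is below
  \<open>1 / (2 * lam)\<close>, so after multiplication by \<open>lam\<close> it is still in the
  interval. Inductively \<open>lam ^ n * (k \<bullet> s)\<close> stays bounded for all
  \<open>n\<close>, which forces \<open>k \<bullet> s = 0\<close>; the set \<open>K\<close> then
  determines \<open>s\<close>.\<close>

lemma meyer:
  assumes K: "finite K" "\<And>s. (\<And>k. k \<in> K \<Longrightarrow> k \<bullet> s = 0) \<Longrightarrow> s = 0"
    and k: "\<And>k d. k \<in> K \<Longrightarrow> d \<in> \<Delta> \<Longrightarrow> (\<lambda>n. phase_dist (k \<bullet> (lam ^ n *\<^sub>R d))) \<longlonglongrightarrow> 0"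
  shows "\<exists>\<eta>>0. \<forall>a\<in>\<Delta>. \<forall>b\<in>\<Delta>. \<forall>c\<in>\<Delta>. \<forall>d\<in>\<Delta>. norm (a + b + c + d) < \<eta> \<longrightarrow> a + b + c + d = 0"
proof -
  have "\<exists>\<eta>>0. \<forall>t. \<bar>t\<bar> \<le> 1/2 \<longrightarrow> phase_dist t < \<eta> \<longrightarrow> \<bar>t\<bar> < 1 / (2 * lam)"
    using lam by (intro phase_dist_small) auto
  then obtain \<eta>0 where \<eta>0: "\<eta>0 > 0" "\<And>t. \<bar>t\<bar> \<le> 1/2 \<Longrightarrow> phase_dist t < \<eta>0 \<Longrightarrow> \<bar>t\<bar> < 1 / (2 * lam)" by blast
  have "\<forall>k\<in>K. \<exists>N. \<forall>n\<ge>N. \<forall>d\<in>\<Delta>. phase_dist (k \<bullet> (lam ^ n *\<^sub>R d)) < \<eta>0 / 4"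
  proof
    fix k0 assume "k0 \<in> K"
    then show "\<exists>N. \<forall>n\<ge>N. \<forall>d\<in>\<Delta>. phase_dist (k0 \<bullet> (lam ^ n *\<^sub>R d)) < \<eta>0 / 4"
      using \<eta>0(1) by (intro uniform_phase k) auto
  qed
  then obtain Nk where Nk: "\<And>k n d. k \<in> K \<Longrightarrow> n \<ge> Nk k \<Longrightarrow> d \<in> \<Delta> \<Longrightarrow> phase_dist (k \<bullet> (lam ^ n *\<^sub>R d)) < \<eta>0 / 4"
    by metis
  define N where "N = Max (insert 0 (Nk ` K))"
  have N: "Nk k \<le> N" if "k \<in> K" for k using K(1) that by (simp add: N_def)
  define Z where "Z = 1 + (\<Sum>k\<in>K. norm k)"
  \<comment> \<open>Chosen so that \<open>lam ^ N * norm k * norm s \<le> 1 / 2\<close> for all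
    \<open>k\<close> in \<open>K\<close>, which starts the induction at level
    \<open>N\<close>.\<close>
  define \<eta> where "\<eta> = 1 / (2 * lam ^ N * Z)"
  have pos: "0 < Z" by (simp add: Z_def add_pos_nonneg sum_nonneg)
  have "\<eta> > 0" unfolding \<eta>_def using pos by simp
  moreover have "s = 0" if abcd: "a \<in> \<Delta>" "b \<in> \<Delta>" "c \<in> \<Delta>" "d \<in> \<Delta>" and s: "s = a + b + c + d" "norm s < \<eta>" for a b c d s
  proof (rule K(2))
    fix k assume kK: "k \<in> K"
    have small: "phase_dist (k \<bullet> (lam ^ n *\<^sub>R s)) < \<eta>0" if "n \<ge> N" for n
    proof -
      have n: "n \<ge> Nk k" using N[OF kK] that by simp
      have "k \<bullet> (lam ^ n *\<^sub>R s) = k \<bullet> (lam ^ n *\<^sub>R a) + k \<bullet> (lam ^ n *\<^sub>R b) + k \<bullet> (lam ^ n *\<^sub>R c) + k \<bullet> (lam ^ n *\<^sub>R d)"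
        by (simp add: s(1) inner_add_right algebra_simps)
      then have "phase_dist (k \<bullet> (lam ^ n *\<^sub>R s)) = phase_dist (k \<bullet> (lam ^ n *\<^sub>R a) + k \<bullet> (lam ^ n *\<^sub>R b) + k \<bullet> (lam ^ n *\<^sub>R c) + k \<bullet> (lam ^ n *\<^sub>R d))"
        by (rule arg_cong)
      then show ?thesis
        using Nk[OF kK n abcd(1)] Nk[OF kK n abcd(2)] Nk[OF kK n abcd(3)] Nk[OF kK n abcd(4)]
          phase_dist_add[of "k \<bullet> (lam ^ n *\<^sub>R a) + k \<bullet> (lam ^ n *\<^sub>R b) + k \<bullet> (lam ^ n *\<^sub>R c)" "k \<bullet> (lam ^ n *\<^sub>R d)"]
          phase_dist_add[of "k \<bullet> (lam ^ n *\<^sub>R a) + k \<bullet> (lam ^ n *\<^sub>R b)" "k \<bullet> (lam ^ n *\<^sub>R c)"]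
          phase_dist_add[of "k \<bullet> (lam ^ n *\<^sub>R a)" "k \<bullet> (lam ^ n *\<^sub>R b)"]
        by linarith
    qed
    have bd: "\<bar>k \<bullet> (lam ^ (N + m) *\<^sub>R s)\<bar> \<le> 1/2" for m
    proof (induction m)
      case 0
      have "\<bar>k \<bullet> (lam ^ N *\<^sub>R s)\<bar> = lam ^ N * \<bar>k \<bullet> s\<bar>" using lam by (simp add: abs_mult)
      also have "\<dots> \<le> lam ^ N * (norm k * norm s)" by (intro mult_left_mono Cauchy_Schwarz_ineq2) simp
      also have "\<dots> \<le> lam ^ N * (Z * \<eta>)"
      proof (intro mult_left_mono mult_mono)
        show "norm k \<le> Z"
          using member_le_sum[of k K norm] kK K(1) by (simp add: Z_def)
      qed (use s pos in auto)
      also have "\<dots> = 1 / 2" using pos lam by (simp add: \<eta>_def field_simps)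
      finally show ?case by simp
    next
      case (Suc m)
      have "\<bar>k \<bullet> (lam ^ (N + m) *\<^sub>R s)\<bar> < 1 / (2 * lam)" using \<eta>0(2)[OF Suc small] by simp
      then have "lam * \<bar>k \<bullet> (lam ^ (N + m) *\<^sub>R s)\<bar> < lam * (1 / (2 * lam))"
        using lam by (intro mult_strict_left_mono) auto
      then show ?case using lam by (simp add: abs_mult mult.assoc)
    qed
    show "k \<bullet> s = 0"
    proof (rule ccontr)
      assume nz: "k \<bullet> s \<noteq> 0"
      obtain m where m: "1 / \<bar>k \<bullet> s\<bar> < lam ^ m" using real_arch_pow[OF lam] by blast
      have "1 < lam ^ m * \<bar>k \<bullet> s\<bar>" using m nz by (simp add: field_simps)
      also have "\<dots> \<le> lam ^ (N + m) * \<bar>k \<bullet> s\<bar>"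
        using lam by (intro mult_right_mono power_increasing) auto
      also have "\<dots> = \<bar>k \<bullet> (lam ^ (N + m) *\<^sub>R s)\<bar>" using lam by (simp add: abs_mult)
      finally show False using bd[of m] by simp
    qed
  qed
  ultimately show ?thesis by blast
qed

end

section \<open>The invariant measure\<close>

context stone_inflations
begin

text \<open>The common part \<open>Z\<close> covers an open ball beyond radius \<open>r\<close>, so
  in either tiling the patch of radius \<open>r\<close> consists of tiles of \<open>Z\<close>
  alone.\<close>

lemma patch_at_eq_of_common:
  assumes "x \<in> X" "y \<in> X" "Z \<subseteq> x" "Z \<subseteq> y" "ball a R \<subseteq> (\<Union>\<zeta>\<in>Z. S \<zeta>)" "r < R"
  shows "patch_at shape x a r = patch_at shape y a r"
proof -
  have "patch_at shape w a r = patch_at shape Z a r" if w: "w \<in> X" "Z \<subseteq> w" for w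
  proof -
    have "\<zeta> \<in> Z" if "\<zeta> \<in> w" "S \<zeta> \<inter> cball a r \<noteq> {}" for \<zeta>
    proof (rule covered_mem[OF X_nonoverlapping[OF w(1)] w(2) open_ball assms(5) that(1)])
      have "cball a r \<subseteq> ball a R" using assms(6) by auto
      then show "S \<zeta> \<inter> ball a R \<noteq> {}" using that(2) by blast
    qed
    then show ?thesis using w(2) unfolding patch_at_def by blast
  qed
  then show ?thesis using assms by simp
qed

lemma ball_in_supertile: "ball (lam ^ n *\<^sub>R centre \<tau>) (lam ^ n * r0) \<subseteq> (\<Union>\<zeta>\<in>infl n {\<tau>}. S \<zeta>)"
proof
  fix p assume "p \<in> ball (lam ^ n *\<^sub>R centre \<tau>) (lam ^ n * r0)"
  then have "norm (lam ^ n *\<^sub>R (centre \<tau> - (1 / lam ^ n) *\<^sub>R p)) < lam ^ n * r0"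
    using lam by (simp add: dist_norm scaleR_diff_right)
  then have "dist (centre \<tau>) ((1 / lam ^ n) *\<^sub>R p) < r0"
    using lam by (simp add: dist_norm)
  then have "(1 / lam ^ n) *\<^sub>R p \<in> S \<tau>"
    using cball_centre[of \<tau>] interior_subset[of "S \<tau>"] by (auto simp: subset_iff)
  then have "lam ^ n *\<^sub>R ((1 / lam ^ n) *\<^sub>R p) \<in> (*\<^sub>R) (lam ^ n) ` S \<tau>" by (rule imageI)
  then show "p \<in> (\<Union>\<zeta>\<in>infl n {\<tau>}. S \<zeta>)"
    using lam unfolding supp_infl by simp
qed

lemma tdist_shift_le_of_patch_eq:
  assumes "patch_at shape x p (1 / \<epsilon>) = patch_at shape y p (1 / \<epsilon>)" "\<epsilon> > 0"
  shows "tdist shape (shift (- p) x) (shift (- p) y) \<le> \<epsilon>"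
proof (rule tdist_le)
  show "tmatch shape \<epsilon> (shift (- p) x) (shift (- p) y)"
    unfolding tmatch_def using assms
    by (intro conjI bexI[of _ 0]) (simp_all add: patch_at_shift)
qed

lemma finite_scaled_net:
  assumes "r > 0"
  shows "\<exists>N::'a set. finite N \<and> (\<forall>n p. norm p \<le> C * lam ^ n \<longrightarrow> (\<exists>s\<in>N. norm (p - lam ^ n *\<^sub>R s) \<le> r * lam ^ n))"
proof -
  have "cball (0::'a) C \<subseteq> (\<Union>s\<in>cball 0 C. ball s r)" using assms by auto
  then obtain N where N: "finite N" "cball (0::'a) C \<subseteq> (\<Union>s\<in>N. ball s r)"
    using compactE_image[OF compact_cball, of "cball 0 C" "\<lambda>s. ball s r" 0 C] by (metis open_ball)
  have "\<exists>s\<in>N. norm (p - lam ^ n *\<^sub>R s) \<le> r * lam ^ n" if p: "norm p \<le> C * lam ^ n" for n and p :: 'a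
  proof -
    have "norm ((1 / lam ^ n) *\<^sub>R p) \<le> C" using p lam by (simp add: field_simps)
    then have "(1 / lam ^ n) *\<^sub>R p \<in> (\<Union>s\<in>N. ball s r)" using N(2) by (meson mem_cball_0 subsetD)
    then obtain s where s: "s \<in> N" "dist s ((1 / lam ^ n) *\<^sub>R p) < r" by auto
    have "p - lam ^ n *\<^sub>R s = lam ^ n *\<^sub>R ((1 / lam ^ n) *\<^sub>R p - s)" using lam by (simp add: scaleR_diff_right)
    then have "norm (p - lam ^ n *\<^sub>R s) = lam ^ n * dist s ((1 / lam ^ n) *\<^sub>R p)"
      using lam by (simp add: dist_norm norm_minus_commute)
    also have "\<dots> \<le> lam ^ n * r" using s(2) by (intro mult_left_mono) auto
    finally show ?thesis using s(1) by (auto simp: mult.commute)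
  qed
  with N(1) show ?thesis by blast
qed

lemma X_Metric_space: "Metric_space X (tdist shape)"
proof
  show "tdist shape x y = 0 \<longleftrightarrow> x = y" if "x \<in> X" "y \<in> X" for x y
    using tdist_tiling_eq[OF X_tiling[OF that(1)] X_tiling[OF that(2)]] by auto
qed (auto simp: tdist_nonneg tdist_commute intro: tdist_triangle)

end

locale pure_point_inflation = control_point_inflation shape r0 R0 cen lam rho cp
  for shape :: "'l::finite \<Rightarrow> 'a::euclidean_space set" and r0 R0 :: real and cen :: "'l \<Rightarrow> 'a"
    and lam rho and cp +
  fixes \<mu> :: "('a, 'l) tile set measure"
  assumes uniq: "unique_invariant_prob shape X \<mu>"
    and pp: "pure_point_spectrum \<mu>"
begin

sublocale TM: Metric_space X "tdist shape"
  by (rule X_Metric_space)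

lemma inv_mu: "invariant_prob shape X \<mu>"
  using uniq by (simp add: unique_invariant_prob_def)

sublocale prob_space \<mu>
  using inv_mu by (simp add: invariant_prob_def)

lemma sets_mu: "sets \<mu> = sigma_sets X {U. openin TM.mtopology U}"
  using inv_mu by (simp add: invariant_prob_def)

lemma opens_Pow: "{U. openin TM.mtopology U} \<subseteq> Pow X"
  using openin_subset[of TM.mtopology] by auto

lemma space_mu [simp]: "space \<mu> = X"
proof -
  have "space \<mu> \<in> sigma_sets X {U. openin TM.mtopology U}" using sets.top sets_mu by metis
  then have "space \<mu> \<subseteq> X" using sigma_sets_into_sp[OF opens_Pow] by blast
  moreover have "X \<in> sets \<mu>" unfolding sets_mu by (rule sigma_sets_top)
  ultimately show ?thesis using sets.sets_into_space by blast
qed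

lemma open_sets_mu:
  assumes "U \<subseteq> X" "\<And>x. x \<in> U \<Longrightarrow> \<exists>r>0. \<forall>y\<in>X. tdist shape x y < r \<longrightarrow> y \<in> U"
  shows "U \<in> sets \<mu>" "openin TM.mtopology U"
proof -
  show "openin TM.mtopology U"
    unfolding TM.openin_mtopology
  proof (intro conjI allI impI assms(1))
    fix x assume "x \<in> U"
    then obtain r where "r > 0" "\<forall>y\<in>X. tdist shape x y < r \<longrightarrow> y \<in> U" using assms(2) by blast
    then show "\<exists>r>0. TM.mball x r \<subseteq> U" by (auto intro!: exI[of _ r])
  qed
  then show "U \<in> sets \<mu>" unfolding sets_mu by (intro sigma_sets.Basic) simp
qed

lemma shift_measurable [measurable]: "shift t \<in> measurable \<mu> \<mu>"
  using inv_mu by (simp add: invariant_prob_def)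

lemma distr_shift: "distr \<mu> \<mu> (shift t) = \<mu>"
  using inv_mu by (simp add: invariant_prob_def)

lemma measure_shift_vimage:
  assumes "A \<in> sets \<mu>"
  shows "{x \<in> X. shift t x \<in> A} \<in> sets \<mu>" "emeasure \<mu> {x \<in> X. shift t x \<in> A} = emeasure \<mu> A"
    "measure \<mu> {x \<in> X. shift t x \<in> A} = measure \<mu> A"
proof -
  have eq: "{x \<in> X. shift t x \<in> A} = shift t -` A \<inter> space \<mu>" by auto
  show "{x \<in> X. shift t x \<in> A} \<in> sets \<mu>" unfolding eq using assms by measurable
  have "emeasure \<mu> A = emeasure (distr \<mu> \<mu> (shift t)) A" by (simp add: distr_shift)
  also have "\<dots> = emeasure \<mu> (shift t -` A \<inter> space \<mu>)" using assms by (intro emeasure_distr) auto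
  finally show "emeasure \<mu> {x \<in> X. shift t x \<in> A} = emeasure \<mu> A" by (simp add: eq)
  then show "measure \<mu> {x \<in> X. shift t x \<in> A} = measure \<mu> A" by (simp add: measure_def)
qed

text \<open>The bound \<open>m\<close> is independent of \<open>n\<close> because one net, scaled by \<open>lam ^ n\<close>, serves all \<open>n\<close>.\<close>

lemma measure_ge_of_net:
  assumes "r > 0"
  shows "\<exists>m>0. \<forall>n. \<forall>A\<in>sets \<mu>.
    (\<forall>x\<in>X. \<exists>z. norm z \<le> C * lam ^ n \<and> (\<forall>p. norm (p - z) \<le> r * lam ^ n \<longrightarrow> shift (- p) x \<in> A)) \<longrightarrow>
    m \<le> measure \<mu> A"
proof -
  obtain N :: "'a set" where N: "finite N" "\<And>n p. norm p \<le> C * lam ^ n \<Longrightarrow> \<exists>s\<in>N. norm (p - lam ^ n *\<^sub>R s) \<le> r * lam ^ n"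
    using finite_scaled_net[OF assms] by meson
  have "1 \<le> real (card N) * measure \<mu> A"
    if A: "A \<in> sets \<mu>" and *: "\<And>x. x \<in> X \<Longrightarrow> \<exists>z. norm z \<le> C * lam ^ n \<and> (\<forall>p. norm (p - z) \<le> r * lam ^ n \<longrightarrow> shift (- p) x \<in> A)" for n A
  proof -
    let ?B = "\<lambda>s. {x \<in> X. shift (- (lam ^ n *\<^sub>R s)) x \<in> A}"
    \<comment> \<open>The preimages \<open>?B s\<close> all have the measure of \<open>A\<close>,
      and there are as many as net points, whatever \<open>n\<close> is.\<close>
    have "X \<subseteq> (\<Union>s\<in>N. ?B s)"
    proof
      fix x assume x: "x \<in> X"
      then obtain z where z: "norm z \<le> C * lam ^ n" "\<And>p. norm (p - z) \<le> r * lam ^ n \<Longrightarrow> shift (- p) x \<in> A"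
        using * by blast
      obtain s where s: "s \<in> N" "norm (z - lam ^ n *\<^sub>R s) \<le> r * lam ^ n" using N(2)[OF z(1)] by blast
      then show "x \<in> (\<Union>s\<in>N. ?B s)" using x z(2)[of "lam ^ n *\<^sub>R s"] by (auto simp: norm_minus_commute)
    qed
    then have "measure \<mu> (space \<mu>) \<le> measure \<mu> (\<Union>s\<in>N. ?B s)"
      using measure_shift_vimage[OF A] N(1) by (intro finite_measure_mono) auto
    also have "\<dots> \<le> (\<Sum>s\<in>N. measure \<mu> (?B s))"
      using measure_shift_vimage[OF A] N(1) by (intro measure_UNION_le) auto
    also have "\<dots> = real (card N) * measure \<mu> A"
      using measure_shift_vimage[OF A] by simp
    finally show ?thesis by (simp only: prob_space)
  qed
  note bound = this
  show ?thesis
  proof (intro exI[of _ "1 / (real (card N) + 1)"] conjI allI ballI impI)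
    fix n A assume A: "A \<in> sets \<mu>"
      "\<forall>x\<in>X. \<exists>z. norm z \<le> C * lam ^ n \<and> (\<forall>p. norm (p - z) \<le> r * lam ^ n \<longrightarrow> shift (- p) x \<in> A)"
    have "1 \<le> real (card N) * measure \<mu> A" using bound[OF A(1)] A(2) by blast
    also have "\<dots> \<le> (real (card N) + 1) * measure \<mu> A" by (simp add: algebra_simps)
    finally show "1 / (real (card N) + 1) \<le> measure \<mu> A"
      by (simp add: field_simps)
  qed simp
qed

section \<open>Density of the bounded uniformly continuous functions in the integrable
  functions\<close>

definition unif_cont :: "(('a, 'l) tile set \<Rightarrow> complex) \<Rightarrow> bool" where
  "unif_cont g \<longleftrightarrow> (\<exists>B. \<forall>x\<in>X. norm (g x) \<le> B) \<and>
     (\<forall>e>0. \<exists>d>0. \<forall>x\<in>X. \<forall>y\<in>X. tdist shape x y < d \<longrightarrow> norm (g x - g y) < e)"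

lemma unif_contD:
  assumes "unif_cont g" "e > 0"
  obtains d where "d > 0" "\<And>x y. x \<in> X \<Longrightarrow> y \<in> X \<Longrightarrow> tdist shape x y < d \<Longrightarrow> norm (g x - g y) < e"
  using assms unfolding unif_cont_def by auto

lemma unif_cont_measurable: assumes "unif_cont g" shows "g \<in> borel_measurable \<mu>"
proof (rule borel_measurableI)
  fix V :: "complex set" assume "open V"
  show "g -` V \<inter> space \<mu> \<in> sets \<mu>"
  proof (rule open_sets_mu(1))
    fix x assume x: "x \<in> g -` V \<inter> space \<mu>"
    then obtain e where e: "e > 0" "\<And>z. dist z (g x) < e \<Longrightarrow> z \<in> V"
      using \<open>open V\<close> by (auto simp: open_dist)
    obtain d where "d > 0" "\<forall>x\<in>X. \<forall>y\<in>X. tdist shape x y < d \<longrightarrow> norm (g x - g y) < e"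
      using assms e(1) unfolding unif_cont_def by blast
    then show "\<exists>r>0. \<forall>y\<in>X. tdist shape x y < r \<longrightarrow> y \<in> g -` V \<inter> space \<mu>"
      using x e(2) by (intro exI[of _ d]) (auto simp: dist_norm norm_minus_commute)
  qed auto
qed

lemma unif_cont_integrable: assumes "unif_cont g" shows "integrable \<mu> g"
proof -
  obtain B where "\<forall>x\<in>X. norm (g x) \<le> B" using assms unfolding unif_cont_def by blast
  then show ?thesis using unif_cont_measurable[OF assms] by (intro integrable_const_bound[of _ B]) auto
qed

lemma unif_cont_const [simp]: "unif_cont (\<lambda>_. c)"
  unfolding unif_cont_def by (auto intro: exI[of _ 1])

lemma unif_cont_add: assumes "unif_cont f" "unif_cont g" shows "unif_cont (\<lambda>x. f x + g x)"
  unfolding unif_cont_def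
proof (intro conjI allI impI)
  obtain B B' where "\<forall>x\<in>X. norm (f x) \<le> B" "\<forall>x\<in>X. norm (g x) \<le> B'" using assms unfolding unif_cont_def by blast
  then show "\<exists>B. \<forall>x\<in>X. norm (f x + g x) \<le> B"
    by (intro exI[of _ "B + B'"]) (auto intro: norm_triangle_mono)
  fix e :: real assume "e > 0"
  then have "e / 2 > 0" by simp
  obtain d where d: "d > 0" "\<And>x y. x \<in> X \<Longrightarrow> y \<in> X \<Longrightarrow> tdist shape x y < d \<Longrightarrow> norm (f x - f y) < e / 2"
    using unif_contD[OF assms(1) \<open>e / 2 > 0\<close>] by blast
  obtain d' where d': "d' > 0" "\<And>x y. x \<in> X \<Longrightarrow> y \<in> X \<Longrightarrow> tdist shape x y < d' \<Longrightarrow> norm (g x - g y) < e / 2"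
    using unif_contD[OF assms(2) \<open>e / 2 > 0\<close>] by blast
  show "\<exists>d>0. \<forall>x\<in>X. \<forall>y\<in>X. tdist shape x y < d \<longrightarrow> norm (f x + g x - (f y + g y)) < e"
  proof (intro exI[of _ "min d d'"] conjI ballI impI)
    fix x y assume xy: "x \<in> X" "y \<in> X" "tdist shape x y < min d d'"
    have "norm (f x - f y) < e / 2" "norm (g x - g y) < e / 2" using xy d d' by auto
    then show "norm (f x + g x - (f y + g y)) < e"
      using norm_triangle_ineq[of "f x - f y" "g x - g y"] by (simp add: algebra_simps)
  qed (use d d' in auto)
qed

lemma unif_cont_cmult: assumes "unif_cont f" shows "unif_cont (\<lambda>x. c * f x)"
  unfolding unif_cont_def
proof (intro conjI allI impI)
  obtain B where "\<forall>x\<in>X. norm (f x) \<le> B" using assms unfolding unif_cont_def by blast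
  then show "\<exists>B. \<forall>x\<in>X. norm (c * f x) \<le> B"
    by (intro exI[of _ "norm c * B"]) (auto simp: norm_mult intro: mult_left_mono)
  fix e :: real assume "e > 0"
  then have "e / (norm c + 1) > 0" by (simp add: add_nonneg_pos)
  from unif_contD[OF assms this] obtain d where d: "d > 0"
    "\<And>x y. x \<in> X \<Longrightarrow> y \<in> X \<Longrightarrow> tdist shape x y < d \<Longrightarrow> norm (f x - f y) < e / (norm c + 1)" by blast
  show "\<exists>d>0. \<forall>x\<in>X. \<forall>y\<in>X. tdist shape x y < d \<longrightarrow> norm (c * f x - c * f y) < e"
  proof (intro exI[of _ d] conjI ballI impI d(1))
    fix x y assume xy: "x \<in> X" "y \<in> X" "tdist shape x y < d"
    have "norm (c * f x - c * f y) = norm c * norm (f x - f y)" by (simp add: norm_mult flip: right_diff_distrib)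
    also have "\<dots> \<le> (norm c + 1) * norm (f x - f y)" by (intro mult_right_mono) auto
    also have "\<dots> < e"
      using d(2)[OF xy] by (simp add: pos_less_divide_eq add_nonneg_pos mult.commute)
    finally show "norm (c * f x - c * f y) < e" .
  qed
qed

text \<open>This is the closure of \<open>unif_cont\<close> in the mean. It is closed under linear
  combinations and limits in the mean, so it only has to be shown to contain the indicators of open
  sets and to pass from these to all measurable sets.\<close>

definition approximable :: "(('a, 'l) tile set \<Rightarrow> complex) \<Rightarrow> bool" where
  "approximable f \<longleftrightarrow> integrable \<mu> f \<and> (\<forall>e>0. \<exists>g. unif_cont g \<and> (\<integral>x. norm (f x - g x) \<partial>\<mu>) < e)"

lemma approximableD:
  assumes "approximable f" "e > 0"
  obtains g where "unif_cont g" "(\<integral>x. norm (f x - g x) \<partial>\<mu>) < e"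
  using assms unfolding approximable_def by blast

lemma approximable_cong:
  assumes "approximable f" "\<And>x. x \<in> X \<Longrightarrow> h x = f x"
  shows "approximable h"
proof -
  have "integrable \<mu> h \<longleftrightarrow> integrable \<mu> f"
    using assms(2) by (intro Bochner_Integration.integrable_cong) auto
  moreover have "(\<integral>x. norm (h x - g x) \<partial>\<mu>) = (\<integral>x. norm (f x - g x) \<partial>\<mu>)" for g
    using assms(2) by (intro Bochner_Integration.integral_cong) auto
  ultimately show ?thesis using assms(1) by (simp add: approximable_def)
qed

lemma approximable_add: assumes "approximable f" "approximable h" shows "approximable (\<lambda>x. f x + h x)"
  unfolding approximable_def
proof (intro conjI allI impI)
  have int: "integrable \<mu> f" "integrable \<mu> h" using assms by (auto simp: approximable_def)
  then show "integrable \<mu> (\<lambda>x. f x + h x)" by simp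
  fix e :: real assume "e > 0"
  then have "e / 2 > 0" by simp
  obtain g where "unif_cont g" "(\<integral>x. norm (f x - g x) \<partial>\<mu>) < e / 2"
    by (rule approximableD[OF assms(1) \<open>e / 2 > 0\<close>])
  moreover obtain g' where "unif_cont g'" "(\<integral>x. norm (h x - g' x) \<partial>\<mu>) < e / 2"
    by (rule approximableD[OF assms(2) \<open>e / 2 > 0\<close>])
  ultimately have g: "unif_cont g" "(\<integral>x. norm (f x - g x) \<partial>\<mu>) < e / 2" "unif_cont g'" "(\<integral>x. norm (h x - g' x) \<partial>\<mu>) < e / 2"
    by simp_all
  have "(\<integral>x. norm (f x + h x - (g x + g' x)) \<partial>\<mu>) \<le> (\<integral>x. norm (f x - g x) + norm (h x - g' x) \<partial>\<mu>)"
    using int unif_cont_integrable[OF g(1)] unif_cont_integrable[OF g(3)]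
    by (intro integral_mono integrable_norm Bochner_Integration.integrable_add Bochner_Integration.integrable_diff)
       (auto simp: add_diff_add norm_triangle_ineq)
  also have "\<dots> = (\<integral>x. norm (f x - g x) \<partial>\<mu>) + (\<integral>x. norm (h x - g' x) \<partial>\<mu>)"
    using int unif_cont_integrable[OF g(1)] unif_cont_integrable[OF g(3)] by (intro Bochner_Integration.integral_add) auto
  finally show "\<exists>g. unif_cont g \<and> (\<integral>x. norm (f x + h x - g x) \<partial>\<mu>) < e"
    using g by (intro exI[of _ "\<lambda>x. g x + g' x"]) (simp add: unif_cont_add)
qed

lemma approximable_cmult: assumes "approximable f" shows "approximable (\<lambda>x. c * f x)"
  unfolding approximable_def
proof (intro conjI allI impI)
  show "integrable \<mu> (\<lambda>x. c * f x)" using assms by (simp add: approximable_def)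
  fix e :: real assume "e > 0"
  then have "e / (norm c + 1) > 0" by (simp add: add_nonneg_pos)
  from approximableD[OF assms this] obtain g where g: "unif_cont g" "(\<integral>x. norm (f x - g x) \<partial>\<mu>) < e / (norm c + 1)"
    by blast
  have "(\<integral>x. norm (c * f x - c * g x) \<partial>\<mu>) = norm c * (\<integral>x. norm (f x - g x) \<partial>\<mu>)"
    by (simp add: norm_mult flip: right_diff_distrib)
  also have "\<dots> \<le> (norm c + 1) * (\<integral>x. norm (f x - g x) \<partial>\<mu>)" by (intro mult_right_mono) auto
  also have "\<dots> < e" using g(2) by (simp add: pos_less_divide_eq add_nonneg_pos mult.commute)
  finally show "\<exists>g. unif_cont g \<and> (\<integral>x. norm (c * f x - g x) \<partial>\<mu>) < e"
    using g(1) by (intro exI[of _ "\<lambda>x. c * g x"]) (simp add: unif_cont_cmult)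
qed

lemma approximable_unif_cont: "unif_cont g \<Longrightarrow> approximable g"
  unfolding approximable_def by (auto intro!: unif_cont_integrable exI[of _ g])

lemma approximable_limit:
  assumes "integrable \<mu> f" "\<And>n. approximable (h n)" "(\<lambda>n. \<integral>x. norm (f x - h n x) \<partial>\<mu>) \<longlonglongrightarrow> 0"
  shows "approximable f"
  unfolding approximable_def
proof (intro conjI allI impI assms(1))
  fix e :: real assume "e > 0"
  then obtain n where n: "(\<integral>x. norm (f x - h n x) \<partial>\<mu>) < e / 2"
    using LIMSEQ_D[OF assms(3), of "e / 2"] by force
  have "e / 2 > 0" using \<open>e > 0\<close> by simp
  from approximableD[OF assms(2) this] obtain g where g: "unif_cont g" "(\<integral>x. norm (h n x - g x) \<partial>\<mu>) < e / 2"
    by blast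
  have int: "integrable \<mu> f" "integrable \<mu> (h n)" "integrable \<mu> g"
    using assms g(1) unif_cont_integrable by (auto simp: approximable_def)
  have tri: "norm (f x - g x) \<le> norm (f x - h n x) + norm (h n x - g x)" for x
    using norm_triangle_ineq[of "f x - h n x" "h n x - g x"] by simp
  have "(\<integral>x. norm (f x - g x) \<partial>\<mu>) \<le> (\<integral>x. norm (f x - h n x) + norm (h n x - g x) \<partial>\<mu>)"
    using int tri by (intro integral_mono) auto
  also have "\<dots> = (\<integral>x. norm (f x - h n x) \<partial>\<mu>) + (\<integral>x. norm (h n x - g x) \<partial>\<mu>)"
    using int by (intro Bochner_Integration.integral_add) auto
  finally show "\<exists>g. unif_cont g \<and> (\<integral>x. norm (f x - g x) \<partial>\<mu>) < e"
    using g(1) n g(2) by (intro exI[of _ g]) simp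
qed

lemma integrable_complex_indicator:
  assumes [measurable]: "A \<in> sets \<mu>"
  shows "integrable \<mu> (\<lambda>x. complex_of_real (indicator A x))"
proof (rule integrable_const_bound[of _ 1])
  show "AE x in \<mu>. norm (complex_of_real (indicator A x)) \<le> 1" by (simp add: indicator_def)
qed measurable

text \<open>With \<open>d\<close> the distance to the complement of \<open>U\<close>, the functions
  \<open>min 1 (real n * d x)\<close> are uniformly continuous and converge to the indicator of
  \<open>U\<close>. The case \<open>U = X\<close> is separate because the infimum over an empty
  complement is not a distance.\<close>

lemma approximable_open:
  assumes U: "openin TM.mtopology U"
  shows "approximable (\<lambda>x. complex_of_real (indicator U x))"
proof (cases "U = X")
  case True
  have "approximable (\<lambda>_. 1)" by (rule approximable_unif_cont) simp
  then show ?thesis by (rule approximable_cong) (simp add: True)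
next
  case False
  have UX: "U \<subseteq> X" using U openin_subset[of TM.mtopology U] by simp
  then have ne: "X - U \<noteq> {}" using False by blast
  define d where "d x = (INF y\<in>X - U. tdist shape x y)" for x
  have bdd: "bdd_below (tdist shape x ` (X - U))" for x
    by (rule bdd_belowI[of _ 0]) (auto simp: tdist_nonneg)
  have d0: "0 \<le> d x" for x unfolding d_def using ne by (intro cINF_greatest) (auto simp: tdist_nonneg)
  have dlip: "d x \<le> d y + tdist shape x y" for x y
  proof -
    have "d x - tdist shape x y \<le> d y"
      unfolding d_def[of y] using ne
    proof (rule cINF_greatest)
      fix z assume "z \<in> X - U"
      then have "d x \<le> tdist shape x z" unfolding d_def using bdd by (intro cINF_lower) auto
      also have "\<dots> \<le> tdist shape x y + tdist shape y z" by (rule tdist_triangle)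
      finally show "d x - tdist shape x y \<le> tdist shape y z" by simp
    qed
    then show ?thesis by simp
  qed
  have dU: "d x > 0" if xU: "x \<in> U" for x
  proof -
    obtain r where r: "r > 0" "TM.mball x r \<subseteq> U" using U xU unfolding TM.openin_mtopology by blast
    have "r \<le> d x" unfolding d_def using ne
    proof (rule cINF_greatest)
      fix y assume "y \<in> X - U"
      then show "r \<le> tdist shape x y" using r(2) xU UX by (auto simp: subset_iff not_less)
    qed
    with r show ?thesis by simp
  qed
  have dnU: "d x = 0" if "x \<in> X - U" for x
    using cINF_lower[OF bdd that, of x] d0[of x] by (simp add: d_def)
  define g where "g n x = complex_of_real (min 1 (real n * d x))" for n x
  have UCg: "unif_cont (g n)" for n
    unfolding unif_cont_def
  proof (intro conjI allI impI)
    show "\<exists>B. \<forall>x\<in>X. norm (g n x) \<le> B"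
      using d0 by (intro exI[of _ 1]) (auto simp: g_def abs_le_iff min_le_iff_disj intro: order_trans[of _ 0])
    fix e :: real assume "e > 0"
    have "norm (g n x - g n y) < e" if "tdist shape x y < e / (real n + 1)" for x y
    proof -
      have "\<bar>min 1 (real n * d x) - min 1 (real n * d y)\<bar> \<le> \<bar>real n * d x - real n * d y\<bar>" by linarith
      also have "\<dots> = real n * \<bar>d x - d y\<bar>" by (simp add: abs_mult flip: right_diff_distrib)
      also have "\<dots> \<le> (real n + 1) * tdist shape x y"
        using dlip[of x y] dlip[of y x] tdist_nonneg[of shape x y]
        by (intro mult_mono) (auto simp: tdist_commute)
      also have "\<dots> < e" using that by (simp add: field_simps add_pos_nonneg)
      finally show ?thesis by (simp add: g_def flip: of_real_diff)
    qed
    then show "\<exists>d>0. \<forall>x\<in>X. \<forall>y\<in>X. tdist shape x y < d \<longrightarrow> norm (g n x - g n y) < e"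
      using \<open>e > 0\<close> by (intro exI[of _ "e / (real n + 1)"]) (auto simp: add_nonneg_pos)
  qed
  have Um: "U \<in> sets \<mu>" using U unfolding sets_mu by (intro sigma_sets.Basic) simp
  show ?thesis
  proof (rule approximable_limit)
    show "integrable \<mu> (\<lambda>x. complex_of_real (indicator U x))" by (rule integrable_complex_indicator[OF Um])
    show "approximable (g n)" for n by (rule approximable_unif_cont[OF UCg])
    have "(\<lambda>n. \<integral>x. norm (complex_of_real (indicator U x) - g n x) \<partial>\<mu>) \<longlonglongrightarrow> (\<integral>x. 0 \<partial>\<mu>)"
    proof (rule integral_dominated_convergence[where w = "\<lambda>_. 2"])
      show "(\<lambda>x. norm (complex_of_real (indicator U x) - g n x)) \<in> borel_measurable \<mu>" for n
        using Um unif_cont_measurable[OF UCg] by measurable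
      show "AE x in \<mu>. (\<lambda>n. norm (complex_of_real (indicator U x) - g n x)) \<longlonglongrightarrow> 0"
      proof (rule AE_I2)
        fix x assume "x \<in> space \<mu>"
        show "(\<lambda>n. norm (complex_of_real (indicator U x) - g n x)) \<longlonglongrightarrow> 0"
        proof (cases "x \<in> U")
          case True
          obtain N where N: "1 / d x < real N" using reals_Archimedean2 by blast
          have "g n x = 1" if "n \<ge> N" for n
          proof -
            have "1 / d x \<le> real n" using N that by simp
            then show ?thesis using dU[OF True] by (simp add: g_def field_simps min_def)
          qed
          then show ?thesis
            using True by (intro tendsto_eventually eventually_sequentiallyI[of N]) simp
        next
          case False
          then show ?thesis using dnU[of x] \<open>x \<in> space \<mu>\<close> by (simp add: g_def)
        qed
      qed
      show "AE x in \<mu>. norm (norm (complex_of_real (indicator U x) - g n x)) \<le> 2" for n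
      proof (rule AE_I2)
        fix x
        have "norm (g n x) \<le> 1" using d0[of x] by (auto simp: g_def abs_le_iff min_le_iff_disj intro: order_trans[of _ 0])
        moreover have "norm (complex_of_real (indicator U x)) \<le> 1" by (simp add: indicator_def)
        ultimately show "norm (norm (complex_of_real (indicator U x) - g n x)) \<le> 2"
          using norm_triangle_ineq4[of "complex_of_real (indicator U x)" "g n x"] by (simp split: split_indicator_asm)
      qed
    qed auto
    then show "(\<lambda>n. \<integral>x. norm (complex_of_real (indicator U x) - g n x) \<partial>\<mu>) \<longlonglongrightarrow> 0" by simp
  qed
qed

lemma approximable_sum: "finite I \<Longrightarrow> (\<And>i. i \<in> I \<Longrightarrow> approximable (f i)) \<Longrightarrow> approximable (\<lambda>x. \<Sum>i\<in>I. f i x)"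
proof (induction I rule: finite_induct)
  case empty show ?case by (simp add: approximable_unif_cont)
next
  case (insert i I) then show ?case by (simp add: approximable_add)
qed

text \<open>The open sets generate the sigma-algebra and are stable under intersections, so only
  complements and countable disjoint unions have to be treated; a union is the limit in the mean of
  its finite partial sums.\<close>

lemma approximable_indicator:
  assumes "A \<in> sets \<mu>"
  shows "approximable (\<lambda>x. complex_of_real (indicator A x))"
proof -
  have "Int_stable {U. openin TM.mtopology U}" by (auto simp: Int_stable_def)
  then show ?thesis
    using opens_Pow assms[unfolded sets_mu]
  proof (induction rule: sigma_sets_induct_disjoint)
    case (basic A) then show ?case by (simp add: approximable_open)
  next
    case empty show ?case by (simp add: approximable_unif_cont)
  next
    case (compl A)
    have "approximable (\<lambda>x. 1 + (- 1) * complex_of_real (indicator A x))"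
      by (intro approximable_add approximable_cmult compl approximable_unif_cont) simp
    moreover have "complex_of_real (indicator (X - A) x) = 1 + (- 1) * complex_of_real (indicator A x)" if "x \<in> X" for x
      using that by (simp add: indicator_def)
    ultimately show ?case by (rule approximable_cong)
  next
    case (union A)
    have m: "A i \<in> sets \<mu>" for i using union(2) unfolding sets_mu by blast
    show ?case
    proof (rule approximable_limit)
      have "\<Union>(range A) \<in> sets \<mu>" using m by (intro sets.countable_UN) auto
      then show "integrable \<mu> (\<lambda>x. complex_of_real (indicator (\<Union>(range A)) x))" by (rule integrable_complex_indicator)
      show "approximable (\<lambda>x. \<Sum>i<n. complex_of_real (indicator (A i) x))" for n by (intro approximable_sum union) auto
      have eq: "(\<Sum>i<n. complex_of_real (indicator (A i) x)) = complex_of_real (indicator (\<Union>i<n. A i) x)" for n x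
        using union(1) by (subst indicator_UN_disjoint) (auto simp: disjoint_family_on_def)
      have "(\<lambda>n. \<integral>x. norm (complex_of_real (indicator (\<Union>(range A)) x) - complex_of_real (indicator (\<Union>i<n. A i) x)) \<partial>\<mu>) \<longlonglongrightarrow> (\<integral>x. 0 \<partial>\<mu>)"
      proof (rule integral_dominated_convergence[where w = "\<lambda>_. 1"])
        show "AE x in \<mu>. (\<lambda>n. norm (complex_of_real (indicator (\<Union>(range A)) x) - complex_of_real (indicator (\<Union>i<n. A i) x))) \<longlonglongrightarrow> 0"
        proof (rule AE_I2)
          fix x
          show "(\<lambda>n. norm (complex_of_real (indicator (\<Union>(range A)) x) - complex_of_real (indicator (\<Union>i<n. A i) x))) \<longlonglongrightarrow> 0"
          proof (cases "\<exists>i. x \<in> A i")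
            case True
            then obtain i where "x \<in> A i" by blast
            then show ?thesis
              by (intro tendsto_eventually eventually_sequentiallyI[of "Suc i"]) (auto simp: indicator_def)
          qed (auto simp: indicator_def)
        qed
      qed (use m in \<open>auto simp: indicator_def\<close>)
      then show "(\<lambda>n. \<integral>x. norm (complex_of_real (indicator (\<Union>(range A)) x) - (\<Sum>i<n. complex_of_real (indicator (A i) x))) \<partial>\<mu>) \<longlonglongrightarrow> 0"
        by (simp add: eq)
    qed
  qed
qed

lemma approximable_integrable: "integrable \<mu> f \<Longrightarrow> approximable f"
proof (induction rule: integrable_induct)
  case (base A c)
  have "approximable (\<lambda>x. c * complex_of_real (indicator A x))" by (intro approximable_cmult approximable_indicator base)
  then show ?case by (simp add: scaleR_conv_of_real mult.commute)
next
  case (add f g) then show ?case by (simp add: approximable_add)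
next
  case (lim f s)
  show ?case
  proof (rule approximable_limit[OF lim(4) lim(5)])
    have "(\<lambda>n. \<integral>x. norm (f x - s n x) \<partial>\<mu>) \<longlonglongrightarrow> (\<integral>x. 0 \<partial>\<mu>)"
    \<comment> \<open>The approximating functions satisfy
      \<open>norm (s n x) \<le> 2 * norm (f x)\<close>, whence the factor 3.\<close>
    proof (rule integral_dominated_convergence[where w = "\<lambda>x. 3 * norm (f x)"])
      show "AE x in \<mu>. (\<lambda>n. norm (f x - s n x)) \<longlonglongrightarrow> 0"
        using lim(2) by (intro AE_I2) (auto intro!: tendsto_eq_intros)
      show "AE x in \<mu>. norm (norm (f x - s n x)) \<le> 3 * norm (f x)" for n
      proof (rule AE_I2)
        fix x assume "x \<in> space \<mu>"
        then show "norm (norm (f x - s n x)) \<le> 3 * norm (f x)"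
          using lim(3)[of x n] norm_triangle_ineq4[of "f x" "s n x"] by simp
      qed
    qed (use lim in \<open>auto intro: borel_measurable_integrable\<close>)
    then show "(\<lambda>n. \<integral>x. norm (f x - s n x) \<partial>\<mu>) \<longlonglongrightarrow> 0" by simp
  qed
qed

end

section \<open>Eigenvalues\<close>

text \<open>Translating by \<open>t\<close> moves the centre of the ball of agreement by
  \<open>norm t\<close>. Agreement up to radius \<open>1 / e1 + norm t\<close> therefore leaves
  agreement up to radius \<open>1 / e1\<close> around the origin, and \<open>d\<close> is the
  reciprocal of that radius, kept below the cut-off.\<close>

lemma tdist_shift_continuous:
  assumes "e > 0"
  shows "\<exists>d>0. \<forall>x y. tdist shape x y < d \<longrightarrow> tdist shape (shift t x) (shift t y) < e"
proof -
  define e1 where "e1 = e / 2"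
  define d where "d = min (1/2) (1 / (1 / e1 + norm t))"
  have e1: "e1 > 0" "e1 < e" using assms by (auto simp: e1_def)
  have K: "1 / e1 + norm t > 0" using e1 by (simp add: add_pos_nonneg)
  have "d > 0" unfolding d_def using K by simp
  have dc: "d \<le> 2 powr (-1/2)" unfolding d_def using half_le_cut by (simp add: min_le_iff_disj)
  have "tdist shape (shift t x) (shift t y) < e" if xy: "tdist shape x y < d" for x y
  proof -
    obtain \<epsilon> where \<epsilon>: "\<epsilon> < d" "tmatch shape \<epsilon> x y" using tdist_lessE[OF xy dc] by blast
    then obtain u v where uv: "\<epsilon> > 0" "norm u \<le> \<epsilon>" "norm v \<le> \<epsilon>"
      "patch_at shape (shift (- u) x) 0 (1 / \<epsilon>) = patch_at shape (shift (- v) y) 0 (1 / \<epsilon>)"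
      by (auto simp: tmatch_def)
    have "\<epsilon> \<le> 1 / (1 / e1 + norm t)" using \<epsilon>(1) by (simp add: d_def)
    then have "(1 / e1 + norm t) * \<epsilon> \<le> 1" by (simp only: pos_le_divide_eq[OF K] mult.commute)
    then have rad: "1 / e1 + norm t \<le> 1 / \<epsilon>" by (simp only: pos_le_divide_eq[OF uv(1)])
    then have "1 / e1 \<le> 1 / \<epsilon>" using norm_ge_zero[of t] by linarith
    then have le: "\<epsilon> \<le> e1" using uv(1) e1 by (simp add: field_simps)
    have "patch_at shape (shift (- u + t) x) (0 + t) (1 / \<epsilon>) = patch_at shape (shift (- v + t) y) (0 + t) (1 / \<epsilon>)"
      using uv(4) patch_at_shift_eq_iff[of shape "- u" x 0 "1 / \<epsilon>" "- v" y t] by simp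
    moreover have "cball 0 (1 / e1) \<subseteq> cball (0 + t) (1 / \<epsilon>)"
      using rad by (simp add: cball_subset_cball_iff)
    ultimately have "patch_at shape (shift (- u + t) x) 0 (1 / e1) = patch_at shape (shift (- v + t) y) 0 (1 / e1)"
      by (rule patch_at_mono_eq)
    then have "tmatch shape e1 (shift t x) (shift t y)"
      unfolding tmatch_def using uv le e1 by (intro conjI bexI[of _ u] bexI[of _ v]) (auto simp: shift_shift)
    then show ?thesis using tdist_le e1(2) by (metis order.strict_trans1)
  qed
  with \<open>d > 0\<close> show ?thesis by blast
qed

context pure_point_inflation
begin

definition eigenvalue :: "'a \<Rightarrow> bool" where
  "eigenvalue k \<longleftrightarrow> (\<exists>f. square_integrable \<mu> f \<and> \<not> (AE x in \<mu>. f x = 0) \<and>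
     (\<forall>t. AE x in \<mu>. f (shift t x) = cis (2 * pi * (k \<bullet> t)) * f x))"

lemma prob_X: "measure \<mu> X = 1"
  using prob_space by simp

text \<open>Ergodicity from uniqueness: conditioning \<open>\<mu>\<close> on an almost invariant set
  \<open>B\<close> gives another invariant probability, which must be \<open>\<mu>\<close> itself
  and does not charge the complement of \<open>B\<close>.\<close>

lemma invariant_set_trivial:
  assumes B: "B \<in> sets \<mu>" "emeasure \<mu> B \<noteq> 0"
    and inv: "\<And>t. AE x in \<mu>. shift t x \<in> B \<longleftrightarrow> x \<in> B"
  shows "AE x in \<mu>. x \<in> B"
proof -
  let ?\<nu> = "uniform_measure \<mu> B"
  have Binf: "emeasure \<mu> B \<noteq> \<infinity>" by simp
  have eq: "emeasure ?\<nu> (shift t -` C \<inter> X) = emeasure ?\<nu> C" if C: "C \<in> sets \<mu>" for t C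
  proof -
    have C': "shift t -` C \<inter> X \<in> sets \<mu>" "{x \<in> X. shift t x \<in> B \<inter> C} \<in> sets \<mu>"
      using measurable_sets[OF shift_measurable C] measure_shift_vimage[of "B \<inter> C"] B C by auto
    have "emeasure \<mu> (B \<inter> (shift t -` C \<inter> X)) = emeasure \<mu> {x \<in> X. shift t x \<in> B \<inter> C}"
    proof (rule emeasure_eq_AE)
      show "AE x in \<mu>. x \<in> B \<inter> (shift t -` C \<inter> X) \<longleftrightarrow> x \<in> {x \<in> X. shift t x \<in> B \<inter> C}"
        using inv[of t] AE_space by eventually_elim auto
    qed (use B C' in auto)
    also have "\<dots> = emeasure \<mu> (B \<inter> C)" using B C by (intro measure_shift_vimage) auto
    finally show ?thesis using B C C' by (simp add: emeasure_uniform_measure)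
  qed
  have "invariant_prob shape X ?\<nu>"
    unfolding invariant_prob_def
  proof (intro conjI allI)
    show "prob_space ?\<nu>" using B Binf by (intro prob_space_uniform_measure) auto
    show "sets ?\<nu> = sigma_sets X {U. openin TM.mtopology U}" by (simp add: sets_mu)
    fix t
    show "shift t \<in> measurable ?\<nu> ?\<nu>" by simp
    show "distr ?\<nu> ?\<nu> (shift t) = ?\<nu>"
    proof (rule measure_eqI)
      fix C assume "C \<in> sets (distr ?\<nu> ?\<nu> (shift t))"
      then have C: "C \<in> sets \<mu>" by simp
      have "emeasure (distr ?\<nu> ?\<nu> (shift t)) C = emeasure ?\<nu> (shift t -` C \<inter> X)"
        using C by (subst emeasure_distr) auto
      then show "emeasure (distr ?\<nu> ?\<nu> (shift t)) C = emeasure ?\<nu> C" using eq[OF C] by simp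
    qed simp
  qed
  then have "?\<nu> = \<mu>" using uniq unfolding unique_invariant_prob_def by blast
  moreover have XB: "X - B \<in> sets \<mu>" using B(1) by (metis sets.compl_sets space_mu)
  ultimately have "emeasure \<mu> (X - B) = emeasure \<mu> (B \<inter> (X - B)) / emeasure \<mu> B"
    using emeasure_uniform_measure[of B \<mu> "X - B"] B(1) by simp
  also have "B \<inter> (X - B) = {}" by blast
  finally have "emeasure \<mu> (X - B) = 0" by simp
  then show ?thesis using XB by (intro AE_I[of _ _ "X - B"]) auto
qed

text \<open>The modulus of \<open>f\<close> is invariant, so the sets on which it exceeds
  \<open>1 / real (Suc n)\<close> are almost invariant. As \<open>f\<close> is not null, one of them
  has positive measure, and that one is full by ergodicity.\<close>

lemma eigenfunction_bounded_below:
  assumes f: "f \<in> borel_measurable \<mu>" "\<not> (AE x in \<mu>. f x = 0)"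
    and eig: "\<And>t. AE x in \<mu>. f (shift t x) = cis (2 * pi * (k \<bullet> t)) * (f x :: complex)"
  shows "\<exists>q>0. AE x in \<mu>. q < norm (f x)"
proof -
  let ?B = "\<lambda>n::nat. {x \<in> space \<mu>. 1 / real (Suc n) < norm (f x)}"
  have m: "?B n \<in> sets \<mu>" for n using f(1) by measurable
  have "\<exists>n. emeasure \<mu> (?B n) \<noteq> 0"
  proof (rule ccontr)
    assume "\<not> ?thesis"
    then have "AE x in \<mu>. x \<notin> ?B n" for n
      using m by (intro AE_not_in) (auto simp: null_sets_def)
    then have "AE x in \<mu>. \<forall>n. x \<notin> ?B n" by (subst AE_all_countable) blast
    then have "AE x in \<mu>. f x = 0"
      using AE_space
    proof eventually_elim
      fix x assume x: "\<forall>n. x \<notin> ?B n" "x \<in> space \<mu>"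
      show "f x = 0"
      proof (rule ccontr)
        assume "f x \<noteq> 0"
        then obtain n where "inverse (real (Suc n)) < norm (f x)"
          using reals_Archimedean[of "norm (f x)"] by auto
        with x show False by (auto simp: inverse_eq_divide)
      qed
    qed
    with f(2) show False by simp
  qed
  then obtain n where n: "emeasure \<mu> (?B n) \<noteq> 0" by blast
  have "AE x in \<mu>. x \<in> ?B n"
  proof (rule invariant_set_trivial[OF m n])
    fix t
    show "AE x in \<mu>. shift t x \<in> ?B n \<longleftrightarrow> x \<in> ?B n"
      using eig[of t] AE_space by eventually_elim (auto simp: norm_mult X_shift)
  qed
  then show ?thesis by (intro exI[of _ "1 / real (Suc n)"]) auto
qed

lemma square_integrable_integrable:
  assumes "square_integrable \<mu> f"
  shows "integrable \<mu> f"
proof (rule Bochner_Integration.integrable_bound)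
  show "integrable \<mu> (\<lambda>x. 1 + (norm (f x))\<^sup>2)"
    using assms by (simp add: square_integrable_def)
  show "f \<in> borel_measurable \<mu>" using assms by (simp add: square_integrable_def)
  show "AE x in \<mu>. norm (f x) \<le> norm (1 + (norm (f x))\<^sup>2)"
  proof (rule AE_I2)
    fix x
    have "norm (f x) \<le> 1 + (norm (f x))\<^sup>2"
      using sum_power2_ge_zero[of "norm (f x) - 1" 0] zero_le_power2[of "norm (f x)"]
      by (simp add: power2_eq_square algebra_simps) (smt (verit) mult_nonneg_nonneg norm_ge_zero)
    then show "norm (f x) \<le> norm (1 + (norm (f x))\<^sup>2)" by simp
  qed
qed

lemma integral_shift:
  fixes h :: "('a, 'l) tile set \<Rightarrow> real"
  assumes "h \<in> borel_measurable \<mu>"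
  shows "(\<integral>x. h (shift t x) \<partial>\<mu>) = (\<integral>x. h x \<partial>\<mu>)"
  using integral_distr[OF shift_measurable assms, of t] distr_shift by simp

lemma integrable_shift:
  fixes h :: "('a, 'l) tile set \<Rightarrow> 'b::{banach, second_countable_topology}"
  assumes "integrable \<mu> h"
  shows "integrable \<mu> (\<lambda>x. h (shift t x))"
  using integrable_distr[OF shift_measurable, of t h] assms distr_shift by simp

text \<open>
  If \<open>0\<close> lies deep inside one of the two level-\<open>n\<close> supertiles of \<open>\<tau>\<close> and \<open>\<tau> + v\<close>, translation by
  \<open>lam ^ n *\<^sub>R v\<close> does not change the tiling near \<open>0\<close>; such positions have a frequency bounded below.
\<close>

lemma shifted_tiling_close:
  assumes "x1 \<in> X" "\<tau> \<in> x1" "shift_tile v \<tau> \<in> x1"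
  shows "\<exists>m>0. \<forall>\<delta>>0. \<exists>N. \<forall>n\<ge>N. m \<le> measure \<mu> {y \<in> X. tdist shape y (shift (- (lam ^ n *\<^sub>R v)) y) < \<delta>}"
proof -
  let ?P = "{\<tau>, shift_tile v \<tau>}"
  obtain j \<tau>0 where "?P \<subseteq> infl j {\<tau>0}" using X_finite_patch[OF assms(1), of ?P] assms by auto
  then obtain C where C: "C > 0" "\<forall>n a. \<forall>x\<in>X. \<exists>b. shift (lam ^ n *\<^sub>R b) (infl n ?P) \<subseteq> x \<and> norm (lam ^ n *\<^sub>R b - a) \<le> C * lam ^ n"
    using patch_relatively_dense[of ?P j \<tau>0] by blast
  define C' where "C' = C + norm (centre \<tau>)"
  have "r0 / 2 > 0" using r0 by simp
  then obtain m where m: "m > 0" "\<forall>n. \<forall>A\<in>sets \<mu>.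
    (\<forall>x\<in>X. \<exists>z. norm z \<le> C' * lam ^ n \<and> (\<forall>p. norm (p - z) \<le> r0 / 2 * lam ^ n \<longrightarrow> shift (- p) x \<in> A)) \<longrightarrow>
    m \<le> measure \<mu> A"
    using measure_ge_of_net[of "r0 / 2" C'] by blast
  have "\<exists>N. \<forall>n\<ge>N. m \<le> measure \<mu> {y \<in> X. tdist shape y (shift (- (lam ^ n *\<^sub>R v)) y) < \<delta>}" if \<delta>: "\<delta> > 0" for \<delta>
  proof -
    \<comment> \<open>From this level on, half the inradius of the supertile exceeds
      \<open>2 / \<delta>\<close>, the radius of agreement that gives distance at most
      \<open>\<delta> / 2\<close>.\<close>
    obtain N where N: "4 / (\<delta> * r0) < lam ^ N" using real_arch_pow[OF lam] by blast
    have "m \<le> measure \<mu> {y \<in> X. tdist shape y (shift (- (lam ^ n *\<^sub>R v)) y) < \<delta>}" (is "_ \<le> measure \<mu> ?A") if n: "n \<ge> N" for n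
    proof (rule m(2)[rule_format])
      show "?A \<in> sets \<mu>"
      proof (rule open_sets_mu(1))
        fix x assume x: "x \<in> ?A"
        let ?T = "shift (- (lam ^ n *\<^sub>R v))"
        define e where "e = (\<delta> - tdist shape x (?T x)) / 2"
        have e: "e > 0" using x by (simp add: e_def)
        obtain d where d: "d > 0" "\<And>x y. tdist shape x y < d \<Longrightarrow> tdist shape (?T x) (?T y) < e"
          using tdist_shift_continuous[OF e] by blast
        have "y \<in> ?A" if y: "y \<in> X" "tdist shape x y < min d e" for y
        proof -
          have "tdist shape y (?T y) \<le> tdist shape y x + (tdist shape x (?T x) + tdist shape (?T x) (?T y))"
            by (meson add_left_mono order_trans tdist_triangle)
          also have "\<dots> < e + (tdist shape x (?T x) + e)"
            using y(2) d(2)[of x y] by (simp add: tdist_commute)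
          also have "\<dots> = \<delta>" by (simp add: e_def field_simps)
          finally show ?thesis using y(1) by simp
        qed
        then show "\<exists>r>0. \<forall>y\<in>X. tdist shape x y < r \<longrightarrow> y \<in> ?A"
          using d(1) e by (intro exI[of _ "min d e"]) auto
      qed auto
      fix x assume x: "x \<in> X"
      obtain b where b: "shift (lam ^ n *\<^sub>R b) (infl n ?P) \<subseteq> x" "norm (lam ^ n *\<^sub>R b - 0) \<le> C * lam ^ n"
        using C(2) x by blast
      let ?w = "lam ^ n *\<^sub>R v"
      define z where "z = lam ^ n *\<^sub>R (b + centre \<tau>)"
      define Z where "Z = infl n {shift_tile b \<tau>}"
      have Z: "Z = shift (lam ^ n *\<^sub>R b) (infl n {\<tau>})" unfolding Z_def by (simp flip: infl_shift)
      have "infl n {\<tau>} \<subseteq> infl n ?P" "infl n {shift_tile v \<tau>} \<subseteq> infl n ?P" by (rule infl_mono, blast)+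
      then have Zx: "Z \<subseteq> x" and "shift (lam ^ n *\<^sub>R b) (infl n {shift_tile v \<tau>}) \<subseteq> x"
        unfolding Z using b(1) by (meson order_trans shift_mono)+
      moreover have "shift (lam ^ n *\<^sub>R b) (infl n {shift_tile v \<tau>}) = shift ?w Z"
        unfolding Z using infl_shift[of n v "{\<tau>}"] by (simp add: add.commute)
      ultimately have "shift ?w Z \<subseteq> x" by simp
      from shift_mono[OF this, of "- ?w"] have Zx': "Z \<subseteq> shift (- ?w) x" by simp
      have bz: "ball z (lam ^ n * r0) \<subseteq> (\<Union>\<zeta>\<in>Z. S \<zeta>)"
        using ball_in_supertile[of n "shift_tile b \<tau>"] unfolding Z_def z_def by (simp add: add.commute)
      show "\<exists>z. norm z \<le> C' * lam ^ n \<and> (\<forall>p. norm (p - z) \<le> r0 / 2 * lam ^ n \<longrightarrow> shift (- p) x \<in> ?A)"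
      proof (intro exI[of _ z] conjI allI impI)
        have "norm z \<le> norm (lam ^ n *\<^sub>R b) + norm (lam ^ n *\<^sub>R centre \<tau>)"
          unfolding z_def scaleR_add_right by (rule norm_triangle_ineq)
        also have "\<dots> \<le> C' * lam ^ n" using b(2) lam by (simp add: C'_def algebra_simps)
        finally show "norm z \<le> C' * lam ^ n" .
        fix p assume p: "norm (p - z) \<le> r0 / 2 * lam ^ n"
        have "4 / (\<delta> * r0) < lam ^ n" using N n lam power_increasing[of N n lam] by linarith
        then have rad: "2 / \<delta> < r0 / 2 * lam ^ n" using \<delta> r0 by (simp add: field_simps)
        have "ball p (r0 / 2 * lam ^ n) \<subseteq> ball z (lam ^ n * r0)"
          using p by (intro ball_subset_ball_iff[THEN iffD2]) (auto simp: dist_norm mult.commute[of r0])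
        then have "ball p (r0 / 2 * lam ^ n) \<subseteq> (\<Union>\<zeta>\<in>Z. S \<zeta>)" using bz by (rule subset_trans)
        then have "patch_at shape x p (1 / (\<delta> / 2)) = patch_at shape (shift (- ?w) x) p (1 / (\<delta> / 2))"
          using rad by (intro patch_at_eq_of_common[OF x X_shift[OF x] Zx Zx']) auto
        then have "tdist shape (shift (- p) x) (shift (- p) (shift (- ?w) x)) \<le> \<delta> / 2"
          using \<delta> by (intro tdist_shift_le_of_patch_eq) auto
        then show "shift (- p) x \<in> ?A" using X_shift[OF x] \<delta> by (simp add: add.commute)
      qed
    qed
    then show ?thesis by blast
  qed
  with m(1) show ?thesis by blast
qed

text \<open>On the set where a tiling is close to its translate, the uniformly continuous
  \<open>g\<close> hardly changes, whereas \<open>f\<close> changes by at least \<open>q\<close>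
  times the phase. Integrating, with \<open>g\<close> close to \<open>f\<close> in the mean and the
  measure invariant, bounds phase times \<open>q * m\<close> by \<open>3 * \<eta>\<close>.\<close>

lemma eigenvalue_return:
  assumes k: "eigenvalue k" and v: "v \<in> return_vectors X"
  shows "(\<lambda>n. phase_dist (k \<bullet> (lam ^ n *\<^sub>R v))) \<longlonglongrightarrow> 0"
proof (rule LIMSEQ_I)
  fix e :: real assume e: "e > 0"
  obtain f where f: "square_integrable \<mu> f" "\<not> (AE x in \<mu>. f x = 0)"
    "\<And>t. AE x in \<mu>. f (shift t x) = cis (2 * pi * (k \<bullet> t)) * f x"
    using k unfolding eigenvalue_def by blast
  have fm [measurable]: "f \<in> borel_measurable \<mu>" using f(1) by (simp add: square_integrable_def)
  have fi: "integrable \<mu> f" using f(1) by (rule square_integrable_integrable)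
  obtain q where q: "q > 0" "AE x in \<mu>. q < norm (f x)"
    using eigenfunction_bounded_below[OF fm f(2,3)] by blast
  obtain x1 \<tau> where x1: "x1 \<in> X" "\<tau> \<in> x1" "shift_tile v \<tau> \<in> x1"
    using v unfolding return_vectors_def by blast
  obtain m where m: "m > 0" "\<And>\<delta>. \<delta> > 0 \<Longrightarrow> \<exists>N. \<forall>n\<ge>N. m \<le> measure \<mu> {y \<in> X. tdist shape y (shift (- (lam ^ n *\<^sub>R v)) y) < \<delta>}"
    using shifted_tiling_close[OF x1] by blast
  \<comment> \<open>This makes the final bound
    \<open>3 * \<eta> / (q * m) = 3 * e / 4\<close>.\<close>
  define \<eta> where "\<eta> = q * m * e / 4"
  have \<eta>: "\<eta> > 0" using q m e by (simp add: \<eta>_def)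
  obtain g where g: "unif_cont g" "(\<integral>x. norm (f x - g x) \<partial>\<mu>) < \<eta>"
    using approximableD[OF approximable_integrable[OF fi] \<eta>] by blast
  have gm [measurable]: "g \<in> borel_measurable \<mu>" by (rule unif_cont_measurable[OF g(1)])
  obtain \<delta> where \<delta>: "\<delta> > 0" "\<And>x y. x \<in> X \<Longrightarrow> y \<in> X \<Longrightarrow> tdist shape x y < \<delta> \<Longrightarrow> norm (g x - g y) < \<eta>"
    using unif_contD[OF g(1) \<eta>] by blast
  obtain N where N: "\<And>n. n \<ge> N \<Longrightarrow> m \<le> measure \<mu> {y \<in> X. tdist shape y (shift (- (lam ^ n *\<^sub>R v)) y) < \<delta>}"
    using m(2)[OF \<delta>(1)] by blast
  have "phase_dist (k \<bullet> (lam ^ n *\<^sub>R v)) < e" if n: "n \<ge> N" for n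
  proof -
    let ?A = "{y \<in> X. tdist shape y (shift (- (lam ^ n *\<^sub>R v)) y) < \<delta>}"
    let ?T = "shift (- (lam ^ n *\<^sub>R v))"
    let ?c = "phase_dist (k \<bullet> (lam ^ n *\<^sub>R v))"
    \<comment> \<open>A non-measurable set would have \<open>measure\<close> 0 by convention,
      contrary to the lower bound \<open>m\<close>.\<close>
    have Am: "?A \<in> sets \<mu>" using N[OF n] m(1) measure_notin_sets[of ?A \<mu>] by force
    have c: "?c = norm (cis (2 * pi * (k \<bullet> - (lam ^ n *\<^sub>R v))) - 1)"
      using phase_dist_minus[of "k \<bullet> (lam ^ n *\<^sub>R v)"] by (simp add: phase_dist_def)
    have iA: "integrable \<mu> (indicator ?A :: _ \<Rightarrow> real)"
      by (rule integrable_real_indicator[OF Am]) (simp add: emeasure_eq_measure)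
    have int: "integrable \<mu> (\<lambda>x. norm (f x - g x))"
      using fi unif_cont_integrable[OF g(1)] by simp
    have "AE x in \<mu>. indicator ?A x * (?c * q) \<le> norm (f (?T x) - g (?T x)) + \<eta> + norm (f x - g x)"
      using q(2) f(3)[of "- (lam ^ n *\<^sub>R v)"] AE_space
    proof eventually_elim
      fix x assume x: "q < norm (f x)" "f (?T x) = cis (2 * pi * (k \<bullet> - (lam ^ n *\<^sub>R v))) * f x" "x \<in> space \<mu>"
      show "indicator ?A x * (?c * q) \<le> norm (f (?T x) - g (?T x)) + \<eta> + norm (f x - g x)"
      proof (cases "x \<in> ?A")
        case True
        have "?c * q \<le> ?c * norm (f x)" using x(1) by (intro mult_left_mono) auto
        also have "\<dots> = norm (f (?T x) - f x)"
          unfolding c x(2) by (simp add: left_diff_distrib flip: norm_mult)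
        also have "f (?T x) - f x = (f (?T x) - g (?T x)) + ((g (?T x) - g x) - (f x - g x))" by simp
        also have "norm \<dots> \<le> norm (f (?T x) - g (?T x)) + (norm (g (?T x) - g x) + norm (f x - g x))"
          by (intro order_trans[OF norm_triangle_ineq] add_left_mono norm_triangle_ineq4)
        also have "norm (g (?T x) - g x) \<le> \<eta>"
          using \<delta>(2)[of x "?T x"] True X_shift by (auto simp: norm_minus_commute)
        finally show ?thesis using True by simp
      next
        case False
        then show ?thesis using \<eta> by simp
      qed
    qed
    then have "(\<integral>x. indicator ?A x * (?c * q) \<partial>\<mu>) \<le> (\<integral>x. norm (f (?T x) - g (?T x)) + \<eta> + norm (f x - g x) \<partial>\<mu>)"
      using int integrable_shift[OF int] iA
      by (intro integral_mono_AE) auto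
    also have "\<dots> = (\<integral>x. norm (f (?T x) - g (?T x)) \<partial>\<mu>) + \<eta> + (\<integral>x. norm (f x - g x) \<partial>\<mu>)"
      using int integrable_shift[OF int] by (simp add: prob_X)
    also have "(\<integral>x. norm (f (?T x) - g (?T x)) \<partial>\<mu>) = (\<integral>x. norm (f x - g x) \<partial>\<mu>)"
      by (rule integral_shift) measurable
    also have "(\<integral>x. norm (f x - g x) \<partial>\<mu>) + \<eta> + (\<integral>x. norm (f x - g x) \<partial>\<mu>) < 3 * \<eta>"
      using g(2) by simp
    also have "(\<integral>x. indicator ?A x * (?c * q) \<partial>\<mu>) = measure \<mu> ?A * (?c * q)"
      using Am sets.sets_into_space[OF Am] by (simp add: Int_absorb2)
    finally have "measure \<mu> ?A * (?c * q) < 3 * \<eta>" .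
    moreover have "m * (?c * q) \<le> measure \<mu> ?A * (?c * q)" using N[OF n] q(1) by (intro mult_right_mono) auto
    ultimately have "m * (?c * q) < 3 * (q * m * e / 4)" by (simp add: \<eta>_def)
    then have "m * q * ?c < m * q * (3 * e / 4)" by (simp add: algebra_simps)
    then have "?c < 3 * e / 4" using m q by (subst (asm) mult_less_cancel_left_pos) auto
    then show ?thesis using e by simp
  qed
  then show "\<exists>no. \<forall>n\<ge>no. norm (phase_dist (k \<bullet> (lam ^ n *\<^sub>R v)) - 0) < e" by auto
qed

text \<open>An element of \<open>R_ev\<close> becomes an integer combination of return vectors after
  multiplication by some \<open>lam ^ m\<close>, and this only shifts the index of the
  sequence.\<close>

lemma eigenvalue_\<Delta>:
  assumes k: "eigenvalue k" and d: "d \<in> \<Delta>"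
  shows "(\<lambda>n. phase_dist (k \<bullet> (lam ^ n *\<^sub>R d))) \<longlonglongrightarrow> 0"
proof -
  obtain m w where mw: "w \<in> int_span (return_vectors X)" "d = (1 / lam ^ m) *\<^sub>R w"
    using \<Delta>_R_ev d unfolding R_ev_def by blast
  obtain B c where B: "finite B" "B \<subseteq> return_vectors X" "w = (\<Sum>r\<in>B. real_of_int (c r) *\<^sub>R r)"
    using mw(1) unfolding int_span_def by blast
  have "(\<lambda>n. \<Sum>r\<in>B. \<bar>of_int (c r)\<bar> * phase_dist (k \<bullet> (lam ^ n *\<^sub>R r))) \<longlonglongrightarrow> (\<Sum>r\<in>B. \<bar>of_int (c r)\<bar> * 0)"
    using B(2) by (intro tendsto_sum tendsto_mult tendsto_const eigenvalue_return[OF k]) blast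
  then have lim: "(\<lambda>n. \<Sum>r\<in>B. \<bar>of_int (c r)\<bar> * phase_dist (k \<bullet> (lam ^ n *\<^sub>R r))) \<longlonglongrightarrow> 0" by simp
  have "(\<lambda>n. phase_dist (k \<bullet> (lam ^ n *\<^sub>R w))) \<longlonglongrightarrow> 0"
  proof (rule tendsto_sandwich[OF _ _ tendsto_const lim])
    show "\<forall>\<^sub>F n in sequentially. phase_dist (k \<bullet> (lam ^ n *\<^sub>R w)) \<le> (\<Sum>r\<in>B. \<bar>of_int (c r)\<bar> * phase_dist (k \<bullet> (lam ^ n *\<^sub>R r)))"
    proof (rule always_eventually, rule allI)
      fix n
      have "k \<bullet> (lam ^ n *\<^sub>R w) = (\<Sum>r\<in>B. of_int (c r) * (k \<bullet> (lam ^ n *\<^sub>R r)))"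
        by (simp add: B(3) scaleR_sum_right inner_sum_right mult_ac)
      then have "phase_dist (k \<bullet> (lam ^ n *\<^sub>R w)) \<le> (\<Sum>r\<in>B. phase_dist (of_int (c r) * (k \<bullet> (lam ^ n *\<^sub>R r))))"
        by (simp only: phase_dist_sum)
      also have "\<dots> \<le> (\<Sum>r\<in>B. \<bar>of_int (c r)\<bar> * phase_dist (k \<bullet> (lam ^ n *\<^sub>R r)))"
        by (intro sum_mono phase_dist_of_int_mult)
      finally show "phase_dist (k \<bullet> (lam ^ n *\<^sub>R w)) \<le> (\<Sum>r\<in>B. \<bar>of_int (c r)\<bar> * phase_dist (k \<bullet> (lam ^ n *\<^sub>R r)))" .
    qed
  qed (simp add: always_eventually)
  moreover have "lam ^ (n + m) *\<^sub>R d = lam ^ n *\<^sub>R w" for n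
    using lam by (simp add: mw(2) power_add)
  ultimately have "(\<lambda>n. phase_dist (k \<bullet> (lam ^ (n + m) *\<^sub>R d))) \<longlonglongrightarrow> 0" by simp
  then show ?thesis by (rule LIMSEQ_offset)
qed

end

section \<open>Translations in the square-integrable functions\<close>

lemma norm_add3_square:
  fixes a b c :: complex
  shows "(norm (a + b + c))\<^sup>2 \<le> 3 * ((norm a)\<^sup>2 + (norm b)\<^sup>2 + (norm c)\<^sup>2)"
proof -
  have "norm (a + b + c) \<le> norm a + norm b + norm c"
    by (meson add_right_mono norm_triangle_ineq order_trans)
  then have "(norm (a + b + c))\<^sup>2 \<le> (norm a + norm b + norm c)\<^sup>2" by (rule power_mono) simp
  also have "\<dots> \<le> 3 * ((norm a)\<^sup>2 + (norm b)\<^sup>2 + (norm c)\<^sup>2)"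
    using zero_le_power2[of "norm a - norm b"] zero_le_power2[of "norm b - norm c"] zero_le_power2[of "norm a - norm c"]
    by (simp add: power2_eq_square algebra_simps)
  finally show ?thesis .
qed

context pure_point_inflation
begin

lemma square_integrable_add:
  assumes "square_integrable \<mu> f" "square_integrable \<mu> g"
  shows "square_integrable \<mu> (\<lambda>x. f x + g x)"
  unfolding square_integrable_def
proof
  have [measurable]: "f \<in> borel_measurable \<mu>" "g \<in> borel_measurable \<mu>" using assms by (auto simp: square_integrable_def)
  show "(\<lambda>x. f x + g x) \<in> borel_measurable \<mu>" by measurable
  show "integrable \<mu> (\<lambda>x. (norm (f x + g x))\<^sup>2)"
  proof (rule Bochner_Integration.integrable_bound)
    show "integrable \<mu> (\<lambda>x. 3 * ((norm (f x))\<^sup>2 + (norm (g x))\<^sup>2 + (norm (0::complex))\<^sup>2))"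
      using assms by (simp add: square_integrable_def)
    show "AE x in \<mu>. norm ((norm (f x + g x))\<^sup>2) \<le> norm (3 * ((norm (f x))\<^sup>2 + (norm (g x))\<^sup>2 + (norm (0::complex))\<^sup>2))"
    proof (rule AE_I2)
      fix x
      show "norm ((norm (f x + g x))\<^sup>2) \<le> norm (3 * ((norm (f x))\<^sup>2 + (norm (g x))\<^sup>2 + (norm (0::complex))\<^sup>2))"
        using norm_add3_square[of "f x" "g x" 0] by simp
    qed
  qed measurable
qed

lemma square_integrable_cmult:
  assumes "square_integrable \<mu> f"
  shows "square_integrable \<mu> (\<lambda>x. c * f x)"
  using assms unfolding square_integrable_def by (auto simp: norm_mult power_mult_distrib)

lemma square_integrable_sum:
  "finite I \<Longrightarrow> (\<And>i. i \<in> I \<Longrightarrow> square_integrable \<mu> (f i)) \<Longrightarrow> square_integrable \<mu> (\<lambda>x. \<Sum>i\<in>I. f i x)"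
proof (induction I rule: finite_induct)
  case empty show ?case by (simp add: square_integrable_def)
next
  case (insert i I) then show ?case by (simp add: square_integrable_add)
qed

lemma square_integrable_diff:
  assumes "square_integrable \<mu> f" "square_integrable \<mu> g"
  shows "square_integrable \<mu> (\<lambda>x. f x - g x)"
  using square_integrable_add[OF assms(1) square_integrable_cmult[OF assms(2), of "- 1"]] by simp

lemma square_integrable_shift:
  assumes "square_integrable \<mu> f"
  shows "square_integrable \<mu> (\<lambda>x. f (shift t x))"
  using assms integrable_shift[of "\<lambda>x. (norm (f x))\<^sup>2" t] measurable_compose[OF shift_measurable, of f borel t]
  unfolding square_integrable_def by auto

text \<open>This is the square of the norm, which turns the triangle inequality into estimates with
  a factor 3.\<close>

definition L2 :: "(('a, 'l) tile set \<Rightarrow> complex) \<Rightarrow> real" where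
  "L2 f = (\<integral>x. (norm (f x))\<^sup>2 \<partial>\<mu>)"

lemma L2_nonneg: "0 \<le> L2 f" unfolding L2_def by simp

lemma L2_add3:
  assumes "square_integrable \<mu> f" "square_integrable \<mu> g" "square_integrable \<mu> h"
  shows "L2 (\<lambda>x. f x + g x + h x) \<le> 3 * (L2 f + L2 g + L2 h)"
proof -
  have i: "integrable \<mu> (\<lambda>x. (norm (f x))\<^sup>2)" "integrable \<mu> (\<lambda>x. (norm (g x))\<^sup>2)" "integrable \<mu> (\<lambda>x. (norm (h x))\<^sup>2)"
    using assms by (auto simp: square_integrable_def)
  have "L2 (\<lambda>x. f x + g x + h x) \<le> (\<integral>x. 3 * ((norm (f x))\<^sup>2 + (norm (g x))\<^sup>2 + (norm (h x))\<^sup>2) \<partial>\<mu>)"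
    unfolding L2_def
  proof (rule integral_mono)
    show "integrable \<mu> (\<lambda>x. (norm (f x + g x + h x))\<^sup>2)"
      using square_integrable_add[OF square_integrable_add[OF assms(1,2)] assms(3)] by (simp add: square_integrable_def)
    show "integrable \<mu> (\<lambda>x. 3 * ((norm (f x))\<^sup>2 + (norm (g x))\<^sup>2 + (norm (h x))\<^sup>2))" using i by simp
  qed (rule norm_add3_square)
  also have "\<dots> = 3 * (L2 f + L2 g + L2 h)" using i by (simp add: L2_def)
  finally show ?thesis .
qed

lemma L2_shift:
  assumes "square_integrable \<mu> f"
  shows "L2 (\<lambda>x. f (shift t x)) = L2 f"
proof -
  have [measurable]: "f \<in> borel_measurable \<mu>" using assms by (simp add: square_integrable_def)
  show ?thesis unfolding L2_def by (rule integral_shift) measurable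
qed

text \<open>The constant is crude, but it depends on the number of summands only, and this number is
  fixed before \<open>n\<close> tends to infinity.\<close>

lemma L2_sum_le:
  assumes "finite I" "\<And>i. i \<in> I \<Longrightarrow> square_integrable \<mu> (f i)"
  shows "L2 (\<lambda>x. \<Sum>i\<in>I. f i x) \<le> 3 ^ card I * (\<Sum>i\<in>I. L2 (f i))"
  using assms
proof (induction I rule: finite_induct)
  case empty show ?case by (simp add: L2_def)
next
  case (insert i I)
  have 0: "square_integrable \<mu> (\<lambda>_. 0)" "L2 (\<lambda>_. 0) = 0" by (simp_all add: square_integrable_def L2_def)
  have "L2 (\<lambda>x. f i x + (\<Sum>i\<in>I. f i x) + 0) \<le> 3 * (L2 (f i) + L2 (\<lambda>x. \<Sum>i\<in>I. f i x) + L2 (\<lambda>_. 0))"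
    using insert 0 by (intro L2_add3 square_integrable_sum) auto
  also have "\<dots> \<le> 3 * (L2 (f i) + 3 ^ card I * (\<Sum>i\<in>I. L2 (f i)))"
    using insert 0 by simp
  also have "\<dots> \<le> 3 * (3 ^ card I * L2 (f i) + 3 ^ card I * (\<Sum>i\<in>I. L2 (f i)))"
    using mult_right_mono[of 1 "3 ^ card I" "L2 (f i)"] L2_nonneg[of "f i"] by simp
  finally show ?case using insert by (simp add: algebra_simps)
qed

text \<open>Translating an eigenfunction multiplies it by a phase factor, so its squared distance
  from the translate is \<open>(phase_dist _)\<^sup>2\<close> times its squared norm. By pure-point
  spectrum a finite combination of eigenfunctions is close to \<open>g\<close>, and translation
  preserves the error.\<close>

lemma L2_translation_tendsto:
  assumes g: "square_integrable \<mu> g"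
    and t: "\<And>k. eigenvalue k \<Longrightarrow> (\<lambda>n. phase_dist (k \<bullet> t n)) \<longlonglongrightarrow> 0"
  shows "(\<lambda>n. L2 (\<lambda>x. g (shift (t n) x) - g x)) \<longlonglongrightarrow> 0"
proof (rule LIMSEQ_I)
  fix e :: real assume e: "e > 0"
  \<comment> \<open>The three parts contribute \<open>3 * (e / 18 + e / 6 + e / 18)\<close>, which
    is less than \<open>e\<close>.\<close>
  then have "e / 18 > 0" by simp
  with pp[unfolded pure_point_spectrum_def, rule_format, of g "e / 18"] g
  have "\<exists>E c. finite E \<and> (\<forall>f\<in>E. eigenfunction \<mu> f) \<and> L2 (\<lambda>x. g x - (\<Sum>f\<in>E. c f * f x)) < e / 18"
    unfolding L2_def by simp
  then obtain E c where E': "finite E" "\<forall>f\<in>E. eigenfunction \<mu> f"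
      "L2 (\<lambda>x. g x - (\<Sum>f\<in>E. c f * f x)) < e / 18"
    by (elim exE conjE)
  then have E: "finite E" "\<And>f. f \<in> E \<Longrightarrow> eigenfunction \<mu> f"
      "L2 (\<lambda>x. g x - (\<Sum>f\<in>E. c f * f x)) < e / 18"
    by simp_all
  define h where "h x = (\<Sum>f\<in>E. c f * f x)" for x
  have sqf: "square_integrable \<mu> f" if "f \<in> E" for f using E(2)[OF that] by (simp add: eigenfunction_def)
  have sqh: "square_integrable \<mu> h"
    unfolding h_def by (intro square_integrable_sum square_integrable_cmult sqf E(1))
  have "\<forall>f\<in>E. \<exists>k. \<forall>t. AE x in \<mu>. f (shift t x) = cis (2 * pi * (k \<bullet> t)) * f x"
    using E(2) unfolding eigenfunction_def by blast
  then obtain K where K: "\<And>f t. f \<in> E \<Longrightarrow> AE x in \<mu>. f (shift t x) = cis (2 * pi * (K f \<bullet> t)) * f x"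
    by metis
  have Ke: "eigenvalue (K f)" if "f \<in> E" for f
    unfolding eigenvalue_def using K[OF that] E(2)[OF that] unfolding eigenfunction_def by blast
  have L2f: "L2 (\<lambda>x. c f * f (shift (t n) x) - c f * f x) = (phase_dist (K f \<bullet> t n))\<^sup>2 * ((norm (c f))\<^sup>2 * L2 f)" if f: "f \<in> E" for f n
  proof -
    have [measurable]: "f \<in> borel_measurable \<mu>" using sqf[OF f] by (simp add: square_integrable_def)
    have "L2 (\<lambda>x. c f * f (shift (t n) x) - c f * f x) = (\<integral>x. ((phase_dist (K f \<bullet> t n))\<^sup>2 * (norm (c f))\<^sup>2) * (norm (f x))\<^sup>2 \<partial>\<mu>)"
      unfolding L2_def
    proof (rule integral_cong_AE)
      show "AE x in \<mu>. (norm (c f * f (shift (t n) x) - c f * f x))\<^sup>2 = ((phase_dist (K f \<bullet> t n))\<^sup>2 * (norm (c f))\<^sup>2) * (norm (f x))\<^sup>2"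
        using K[OF f, of "t n"]
      proof eventually_elim
        fix x assume x: "f (shift (t n) x) = cis (2 * pi * (K f \<bullet> t n)) * f x"
        have "c f * f (shift (t n) x) - c f * f x = c f * ((cis (2 * pi * (K f \<bullet> t n)) - 1) * f x)"
          by (simp add: x algebra_simps)
        then show "(norm (c f * f (shift (t n) x) - c f * f x))\<^sup>2 = ((phase_dist (K f \<bullet> t n))\<^sup>2 * (norm (c f))\<^sup>2) * (norm (f x))\<^sup>2"
          by (simp add: norm_mult power_mult_distrib phase_dist_def)
      qed
    qed measurable
    then show ?thesis by (simp add: L2_def mult.assoc)
  qed
  have "(\<lambda>n. 3 ^ card E * (\<Sum>f\<in>E. (phase_dist (K f \<bullet> t n))\<^sup>2 * ((norm (c f))\<^sup>2 * L2 f))) \<longlonglongrightarrow> 3 ^ card E * (\<Sum>f\<in>E. 0\<^sup>2 * ((norm (c f))\<^sup>2 * L2 f))"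
    by (intro tendsto_mult tendsto_sum tendsto_const tendsto_power t Ke)
  then have "(\<lambda>n. 3 ^ card E * (\<Sum>f\<in>E. (phase_dist (K f \<bullet> t n))\<^sup>2 * ((norm (c f))\<^sup>2 * L2 f))) \<longlonglongrightarrow> 0" by simp
  from LIMSEQ_D[OF this, of "e / 6"] e obtain N where
    N: "\<And>n. n \<ge> N \<Longrightarrow> 3 ^ card E * (\<Sum>f\<in>E. (phase_dist (K f \<bullet> t n))\<^sup>2 * ((norm (c f))\<^sup>2 * L2 f)) < e / 6"
    unfolding real_norm_def diff_zero by (meson abs_less_iff zero_less_divide_iff zero_less_numeral)
  have "L2 (\<lambda>x. g (shift (t n) x) - g x) < e" if n: "n \<ge> N" for n
  proof -
    have "L2 (\<lambda>x. h (shift (t n) x) - h x) = L2 (\<lambda>x. \<Sum>f\<in>E. c f * f (shift (t n) x) - c f * f x)"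
      by (simp add: h_def sum_subtractf)
    also have "\<dots> \<le> 3 ^ card E * (\<Sum>f\<in>E. L2 (\<lambda>x. c f * f (shift (t n) x) - c f * f x))"
      by (intro L2_sum_le E(1) square_integrable_diff square_integrable_cmult square_integrable_shift sqf)
    also have "\<dots> < e / 6" using N[OF n] by (simp add: L2f)
    finally have hh: "L2 (\<lambda>x. h (shift (t n) x) - h x) < e / 6" .
    have gh: "square_integrable \<mu> (\<lambda>x. g x - h x)" by (intro square_integrable_diff g sqh)
    have ghL: "L2 (\<lambda>x. g x - h x) < e / 18" using E(3) by (simp add: h_def)
    have "L2 (\<lambda>x. (g (shift (t n) x) - h (shift (t n) x)) + (h (shift (t n) x) - h x) + (- 1) * (g x - h x))
        \<le> 3 * (L2 (\<lambda>x. g (shift (t n) x) - h (shift (t n) x)) + L2 (\<lambda>x. h (shift (t n) x) - h x) + L2 (\<lambda>x. (- 1) * (g x - h x)))"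
      by (intro L2_add3 square_integrable_shift[OF gh] square_integrable_diff square_integrable_cmult gh square_integrable_shift[OF sqh] sqh)
    also have "L2 (\<lambda>x. g (shift (t n) x) - h (shift (t n) x)) = L2 (\<lambda>x. g x - h x)"
      by (rule L2_shift[OF gh])
    also have "L2 (\<lambda>x. (- 1) * (g x - h x)) = L2 (\<lambda>x. g x - h x)" by (simp add: L2_def norm_minus_commute)
    also have "3 * (L2 (\<lambda>x. g x - h x) + L2 (\<lambda>x. h (shift (t n) x) - h x) + L2 (\<lambda>x. g x - h x)) < e"
      using hh ghL e by simp
    finally show ?thesis by simp
  qed
  then show "\<exists>no. \<forall>n\<ge>no. norm (L2 (\<lambda>x. g (shift (t n) x) - g x) - 0) < e"
    using L2_nonneg by (intro exI[of _ N]) (auto simp: abs_less_iff intro: order.strict_trans2[of _ 0])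
qed

text \<open>The squared modulus of the difference of the indicator and its translate is the
  indicator of the set where membership changes.\<close>

lemma measure_translation_tendsto:
  assumes A: "A \<in> sets \<mu>"
    and t: "\<And>k. eigenvalue k \<Longrightarrow> (\<lambda>n. phase_dist (k \<bullet> t n)) \<longlonglongrightarrow> 0"
  shows "{x \<in> X. (shift s x \<in> A) \<noteq> (x \<in> A)} \<in> sets \<mu>"
    "(\<lambda>n. measure \<mu> {x \<in> X. (shift (t n) x \<in> A) \<noteq> (x \<in> A)}) \<longlonglongrightarrow> 0"
proof -
  let ?g = "\<lambda>x. complex_of_real (indicator A x)"
  have "{x \<in> X. (shift s x \<in> A) \<noteq> (x \<in> A)} = ({x \<in> X. shift s x \<in> A} - A) \<union> (A - {x \<in> X. shift s x \<in> A})" for s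
    using A sets.sets_into_space[OF A] by auto
  then show m: "{x \<in> X. (shift s x \<in> A) \<noteq> (x \<in> A)} \<in> sets \<mu>" for s
    using A measure_shift_vimage(1)[OF A] by simp
  have g: "square_integrable \<mu> ?g"
    using A integrable_complex_indicator[OF A]
    unfolding square_integrable_def by (auto intro!: integrable_const_bound[of _ 1] simp: indicator_def)
  have "L2 (\<lambda>x. ?g (shift s x) - ?g x) = measure \<mu> {x \<in> X. (shift s x \<in> A) \<noteq> (x \<in> A)}" for s
  proof -
    have "L2 (\<lambda>x. ?g (shift s x) - ?g x) = (\<integral>x. indicator {x \<in> X. (shift s x \<in> A) \<noteq> (x \<in> A)} x \<partial>\<mu>)"
      unfolding L2_def by (rule Bochner_Integration.integral_cong) (auto simp: indicator_def)
    also have "\<dots> = measure \<mu> {x \<in> X. (shift s x \<in> A) \<noteq> (x \<in> A)}"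
      using m[of s] sets.sets_into_space[OF m[of s]] by (simp add: Int_absorb2 del: not_iff)
    finally show ?thesis .
  qed
  with L2_translation_tendsto[OF g t]
  show "(\<lambda>n. measure \<mu> {x \<in> X. (shift (t n) x \<in> A) \<noteq> (x \<in> A)}) \<longlonglongrightarrow> 0" by simp
qed

section \<open>Cylinder sets and the span of the eigenvalues\<close>

definition cylinder :: "'a \<Rightarrow> real \<Rightarrow> 'l \<Rightarrow> ('a, 'l) tile set set" where
  "cylinder c r i = {x \<in> X. \<exists>\<tau>\<in>x. snd \<tau> = i \<and> dist c (fst \<tau>) < r}"

lemma cylinder_sets: "cylinder c r i \<in> sets \<mu>"
proof (rule open_sets_mu(1))
  show "cylinder c r i \<subseteq> X" by (auto simp: cylinder_def)
  fix x assume "x \<in> cylinder c r i"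
  then obtain \<tau> where \<tau>: "x \<in> X" "\<tau> \<in> x" "snd \<tau> = i" "dist c (fst \<tau>) < r" by (auto simp: cylinder_def)
  \<comment> \<open>The three bounds keep \<open>d\<close> below the cut-off, keep the displacement
    of the tile below the slack in the strict inequality, and make the ball of agreement reach the
    centre of \<open>\<tau>\<close>.\<close>
  define d where "d = min (1/2) (min ((r - dist c (fst \<tau>)) / 2) (1 / (norm (centre \<tau>) + 1)))"
  have d: "d > 0" unfolding d_def using \<tau>(4) by (simp add: add_nonneg_pos)
  have dc: "d \<le> 2 powr (-1/2)" unfolding d_def using half_le_cut by (simp add: min_le_iff_disj)
  have "y \<in> cylinder c r i" if y: "y \<in> X" "tdist shape x y < d" for y
  proof -
    obtain \<epsilon> where \<epsilon>: "\<epsilon> < d" "tmatch shape \<epsilon> x y" using tdist_lessE[OF y(2) dc] by blast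
    then obtain u v where uv: "\<epsilon> > 0" "norm u \<le> \<epsilon>" "norm v \<le> \<epsilon>"
      "patch_at shape (shift (- u) x) 0 (1 / \<epsilon>) = patch_at shape (shift (- v) y) 0 (1 / \<epsilon>)"
      by (auto simp: tmatch_def)
    have K: "norm (centre \<tau>) + 1 > 0" by (simp add: add_nonneg_pos)
    have "\<epsilon> \<le> 1 / (norm (centre \<tau>) + 1)" using \<epsilon>(1) by (simp add: d_def)
    then have "(norm (centre \<tau>) + 1) * \<epsilon> \<le> 1" by (simp only: pos_le_divide_eq[OF K] mult.commute)
    then have "norm (centre \<tau>) + 1 \<le> 1 / \<epsilon>" by (simp only: pos_le_divide_eq[OF uv(1)])
    moreover have "norm u \<le> 1" using uv(2) \<epsilon>(1) by (simp add: d_def)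
    ultimately have "norm (centre \<tau> - u) \<le> 1 / \<epsilon>" using norm_triangle_ineq4[of "centre \<tau>" u] by linarith
    then have "shift_tile (- u) \<tau> \<in> patch_at shape (shift (- u) x) 0 (1 / \<epsilon>)"
      using \<tau>(2) centre_in_supp[of \<tau>] by (intro patch_atI[of _ _ "centre \<tau> - u"]) auto
    then have "shift_tile (- u) \<tau> \<in> shift (- v) y" unfolding uv(4) by (simp add: patch_at_def)
    then have "shift_tile (v - u) \<tau> \<in> y" by (simp add: mem_shift)
    moreover have "dist c (fst (shift_tile (v - u) \<tau>)) < r"
    proof -
      have "norm (v - u) < r - dist c (fst \<tau>)"
        using norm_triangle_ineq4[of v u] uv \<epsilon>(1) by (simp add: d_def)
      then show ?thesis
        using dist_triangle[of c "fst \<tau> + (v - u)" "fst \<tau>"] by (simp add: dist_norm norm_minus_commute[of u v])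
    qed
    ultimately show ?thesis using y(1) \<tau>(3) unfolding cylinder_def by (intro CollectI conjI bexI[of _ "shift_tile (v - u) \<tau>"]) auto
  qed
  with d show "\<exists>r'>0. \<forall>y\<in>X. tdist shape x y < r' \<longrightarrow> y \<in> cylinder c r i" by blast
qed

text \<open>A vector orthogonal to all eigenvalues has vanishing phases, so translation by it
  changes membership in any measurable set on a null set only. But a short translation moves every
  tile out of a still smaller cylinder, and no second tile of the same type is near. So small
  cylinders would be null, while finitely many of them cover \<open>X\<close>.\<close>

lemma eigenvalues_separate:
  "\<exists>K. finite K \<and> (\<forall>k\<in>K. eigenvalue k) \<and> (\<forall>s. (\<forall>k\<in>K. k \<bullet> s = 0) \<longrightarrow> s = 0)"
proof -
  have span: "span {k. eigenvalue k} = UNIV"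
  proof (rule ccontr)
    assume "span {k. eigenvalue k} \<noteq> UNIV"
    then obtain w where w: "w \<noteq> 0" "\<And>y. y \<in> span {k. eigenvalue k} \<Longrightarrow> orthogonal w y"
      using span_not_UNIV_orthogonal[of "{k. eigenvalue k}"] unfolding orthogonal_def by blast
    \<comment> \<open>Two positions in a cylinder of radius \<open>r0 / 8\<close> differ by less
      than \<open>r0 / 4\<close>. Adding the length \<open>r0 / 2\<close> of \<open>s\<close> stays
      within \<open>r0\<close>, so the two tiles are identified, and then \<open>s\<close> would be
      shorter than \<open>r0 / 4\<close>.\<close>
    define s where "s = (r0 / (2 * norm w)) *\<^sub>R w"
    have s: "norm s = r0 / 2" using w(1) r0 by (simp add: s_def)
    have ks: "k \<bullet> s = 0" if "eigenvalue k" for k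
      using w(2)[OF span_base, of k] that by (simp add: s_def orthogonal_def inner_commute)
    have null: "measure \<mu> (cylinder c (r0 / 8) i) = 0" for c i
    proof -
      let ?A = "cylinder c (r0 / 8) i"
      have "?A \<subseteq> {x \<in> X. (shift s x \<in> ?A) \<noteq> (x \<in> ?A)}"
      proof
        fix x assume x: "x \<in> ?A"
        then obtain \<tau> where \<tau>: "x \<in> X" "\<tau> \<in> x" "snd \<tau> = i" "dist c (fst \<tau>) < r0 / 8" by (auto simp: cylinder_def)
        have "shift s x \<notin> ?A"
        proof
          assume "shift s x \<in> ?A"
          then obtain \<sigma> where \<sigma>: "shift_tile (- s) \<sigma> \<in> x" "snd \<sigma> = i" "dist c (fst \<sigma>) < r0 / 8"
            by (auto simp: cylinder_def mem_shift)
          have d: "norm (fst \<sigma> - fst \<tau>) < r0 / 4"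
            using \<tau>(4) \<sigma>(3) dist_triangle3[of "fst \<sigma>" "fst \<tau>" c] by (simp add: dist_norm)
          have "norm (fst (shift_tile (- s) \<sigma>) - fst \<tau>) \<le> r0"
            using d s r0 norm_triangle_ineq4[of "fst \<sigma> - fst \<tau>" s] by (simp add: algebra_simps)
          then have "shift_tile (- s) \<sigma> = \<tau>"
            using \<tau> \<sigma> by (intro nonoverlapping_separated[OF X_nonoverlapping[OF \<tau>(1)]]) auto
          then have "fst \<sigma> - fst \<tau> = s" by (auto simp: shift_tile_def)
          with d s r0 show False by simp
        qed
        then show "x \<in> {x \<in> X. (shift s x \<in> ?A) \<noteq> (x \<in> ?A)}" using x \<tau>(1) by simp
      qed
      then have "measure \<mu> ?A \<le> measure \<mu> {x \<in> X. (shift s x \<in> ?A) \<noteq> (x \<in> ?A)}"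
        \<comment> \<open>The convergence lemma is applied to a constant sequence of translations,
          whose phases are all 0.\<close>
        using measure_translation_tendsto(1)[OF cylinder_sets, of "\<lambda>_. s"] ks
        by (intro finite_measure_mono) auto
      moreover have "(\<lambda>n::nat. measure \<mu> {x \<in> X. (shift s x \<in> ?A) \<noteq> (x \<in> ?A)}) \<longlonglongrightarrow> 0"
        using measure_translation_tendsto(2)[OF cylinder_sets, of "\<lambda>_. s"] ks by simp
      then have "measure \<mu> {x \<in> X. (shift s x \<in> ?A) \<noteq> (x \<in> ?A)} = 0"
        by (simp add: LIMSEQ_const_iff)
      ultimately show ?thesis using measure_nonneg[of \<mu> ?A] by linarith
    qed
    have "cball (0::'a) R0 \<subseteq> (\<Union>c\<in>cball 0 R0. ball c (r0 / 8))" using r0 by auto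
    then obtain N where N: "finite N" "cball (0::'a) R0 \<subseteq> (\<Union>c\<in>N. ball c (r0 / 8))"
      using compactE_image[OF compact_cball, of "cball 0 R0" "\<lambda>c. ball c (r0 / 8)" 0 R0] by (metis open_ball)
    have "X \<subseteq> (\<Union>(c, i)\<in>N \<times> UNIV. cylinder c (r0 / 8) i)"
    proof
      fix x assume x: "x \<in> X"
      obtain \<tau> where \<tau>: "\<tau> \<in> x" "0 \<in> S \<tau>" using X_cover[OF x] by blast
      have "fst \<tau> \<in> cball 0 R0" using dist_fst_supp[OF \<tau>(2)] by simp
      then obtain c where "c \<in> N" "dist c (fst \<tau>) < r0 / 8" using N(2) by (auto simp: subset_iff)
      with x \<tau>(1) show "x \<in> (\<Union>(c, i)\<in>N \<times> UNIV. cylinder c (r0 / 8) i)"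
        by (intro UN_I[of "(c, snd \<tau>)"]) (auto simp: cylinder_def)
    qed
    then have "measure \<mu> (space \<mu>) \<le> measure \<mu> (\<Union>(c, i)\<in>N \<times> UNIV. cylinder c (r0 / 8) i)"
      using N(1) cylinder_sets by (intro finite_measure_mono) auto
    also have "\<dots> \<le> (\<Sum>p\<in>N \<times> UNIV. measure \<mu> (case p of (c, i) \<Rightarrow> cylinder c (r0 / 8) i))"
      using N(1) cylinder_sets by (intro measure_UNION_le) auto
    also have "\<dots> = 0" by (intro sum.neutral) (auto simp: null)
    finally show False by (simp add: prob_X)
  qed
  obtain K where K: "K \<subseteq> {k. eigenvalue k}" "independent K" "{k. eigenvalue k} \<subseteq> span K"
    using maximal_independent_subset[of "{k. eigenvalue k}"] by blast
  have "s = 0" if s: "\<forall>k\<in>K. k \<bullet> s = 0" for s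
  proof -
    have "span K = UNIV" using K(3) span span_mono[OF K(3)] by (simp add: span_span top.extremum_uniqueI)
    then have "s \<in> span K" by simp
    then have "orthogonal s s"
      by (rule orthogonal_to_span) (use s in \<open>simp add: orthogonal_def inner_commute\<close>)
    then show ?thesis by (simp add: orthogonal_def)
  qed
  moreover have "finite K" using K(2) by (rule independent_imp_finite)
  ultimately show ?thesis using K(1) by blast
qed

lemma \<Delta>_meyer:
  "\<exists>\<eta>>0. \<forall>a\<in>\<Delta>. \<forall>b\<in>\<Delta>. \<forall>c\<in>\<Delta>. \<forall>d\<in>\<Delta>. norm (a + b + c + d) < \<eta> \<longrightarrow> a + b + c + d = 0"
proof -
  obtain K where K: "finite K" "\<forall>k\<in>K. eigenvalue k" "\<forall>s. (\<forall>k\<in>K. k \<bullet> s = 0) \<longrightarrow> s = 0"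
    using eigenvalues_separate by blast
  show ?thesis by (rule meyer[of K]) (use K eigenvalue_\<Delta> in blast)+
qed

definition meyer_radius :: real where
  "meyer_radius = (SOME \<epsilon>. \<epsilon> > 0 \<and> (\<forall>a\<in>\<Delta>. \<forall>b\<in>\<Delta>. \<forall>c\<in>\<Delta>. \<forall>d\<in>\<Delta>. norm (a + b + c + d) < \<epsilon> \<longrightarrow> a + b + c + d = 0))"

lemma meyer_radius: "meyer_radius > 0" "a \<in> \<Delta> \<Longrightarrow> b \<in> \<Delta> \<Longrightarrow> c \<in> \<Delta> \<Longrightarrow> d \<in> \<Delta> \<Longrightarrow> norm (a + b + c + d) < meyer_radius \<Longrightarrow> a + b + c + d = 0"
  using someI_ex[OF \<Delta>_meyer, folded meyer_radius_def] by blast+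

lemma meyer_radius2: "a \<in> \<Delta> \<Longrightarrow> b \<in> \<Delta> \<Longrightarrow> norm (a + b) < meyer_radius \<Longrightarrow> a + b = 0"
  using meyer_radius(2)[of a b 0 0] zero_in_\<Delta> by simp

end

section \<open>Coincidences\<close>

abbreviation vol :: "'a::euclidean_space set \<Rightarrow> real" where
  "vol A \<equiv> measure lebesgue A"

lemma vol_scale: "vol ((*\<^sub>R) c ` A) = \<bar>c\<bar> ^ DIM('a) * vol (A :: 'a::euclidean_space set)"
  using measure_lebesgue_affine[of c 0 A] by simp

lemma vol_cball: "r \<ge> 0 \<Longrightarrow> vol (cball (c::'a::euclidean_space) r) = r ^ DIM('a) * vol (cball (0::'a) 1)"
  using content_ball_conv_unit_ball[of r c] by (simp add: content_cball_conv_ball)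

lemma lmeasurable_scale:
  fixes A :: "'a::euclidean_space set"
  assumes "compact A" shows "(*\<^sub>R) c ` A \<in> lmeasurable"
  by (rule lmeasurable_compact[OF compact_scaling[OF assms]])

context stone_inflations
begin

lemma scaled_ball_subset:
  assumes "ball q r \<subseteq> S \<tau>"
  shows "ball (lam ^ n *\<^sub>R (b + q)) (lam ^ n * r) \<subseteq> (\<Union>\<zeta>\<in>shift (lam ^ n *\<^sub>R b) (infl n {\<tau>}). S \<zeta>)"
proof
  fix p assume "p \<in> ball (lam ^ n *\<^sub>R (b + q)) (lam ^ n * r)"
  then have "norm (lam ^ n *\<^sub>R (b + q) - p) < lam ^ n * r" by (simp add: dist_norm)
  moreover have "lam ^ n *\<^sub>R (b + q) - p = lam ^ n *\<^sub>R (q - ((1 / lam ^ n) *\<^sub>R p - b))"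
    using lam by (simp add: algebra_simps)
  ultimately have "lam ^ n * norm (q - ((1 / lam ^ n) *\<^sub>R p - b)) < lam ^ n * r"
    using lam by (simp only: norm_scaleR abs_of_pos lam_pow)
  then have "dist q ((1 / lam ^ n) *\<^sub>R p - b) < r"
    using lam by (simp add: dist_norm)
  then have "(1 / lam ^ n) *\<^sub>R p - b \<in> S \<tau>" using assms by (auto simp: subset_iff)
  then have "(1 / lam ^ n) *\<^sub>R p \<in> S (shift_tile b \<tau>)" by simp
  then have "lam ^ n *\<^sub>R ((1 / lam ^ n) *\<^sub>R p) \<in> (*\<^sub>R) (lam ^ n) ` S (shift_tile b \<tau>)" by (rule imageI)
  then have "p \<in> (\<Union>\<zeta>\<in>infl n {shift_tile b \<tau>}. S \<zeta>)"
    using lam unfolding supp_infl by simp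
  then show "p \<in> (\<Union>\<zeta>\<in>shift (lam ^ n *\<^sub>R b) (infl n {\<tau>}). S \<zeta>)"
    by (simp flip: infl_shift)
qed

text \<open>In each factor distinct tiles meet in null sets, so the intersections belonging to
  distinct pairs are almost disjoint and their volumes add up inside \<open>E\<close>.\<close>

lemma sum_vol_Int_le:
  assumes "nonoverlapping shape P" "nonoverlapping shape Q" "finite I" "I \<subseteq> P \<times> Q" "E \<in> lmeasurable"
    and "\<And>\<tau> \<sigma>. (\<tau>, \<sigma>) \<in> I \<Longrightarrow> S \<tau> \<inter> S \<sigma> \<subseteq> E"
  shows "(\<Sum>(\<tau>, \<sigma>)\<in>I. vol (S \<tau> \<inter> S \<sigma>)) \<le> vol E"
proof -
  let ?f = "\<lambda>(\<tau>, \<sigma>). S \<tau> \<inter> S \<sigma>"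
  have neg: "negligible (S \<sigma> \<inter> S \<tau>)" if "nonoverlapping shape P" "\<sigma> \<in> P" "\<tau> \<in> P" "\<sigma> \<noteq> \<tau>" for P \<sigma> \<tau>
    using that unfolding nonoverlapping_def
    by (meson inf_le1 negligible_frontier_supp negligible_subset order_trans)
  have m: "?f p \<in> lmeasurable" for p
    by (cases p) (auto intro!: fmeasurable.Int lmeasurable_supp)
  have "pairwise (\<lambda>p q. negligible (?f p \<inter> ?f q)) I"
  proof (rule pairwiseI)
    fix p q assume pq: "p \<in> I" "q \<in> I" "p \<noteq> q"
    obtain \<tau> \<sigma> \<tau>' \<sigma>' where e: "p = (\<tau>, \<sigma>)" "q = (\<tau>', \<sigma>')" by (metis surj_pair)
    have mem: "\<tau> \<in> P" "\<tau>' \<in> P" "\<sigma> \<in> Q" "\<sigma>' \<in> Q" using pq e assms(4) by auto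
    have "\<tau> \<noteq> \<tau>' \<or> \<sigma> \<noteq> \<sigma>'" using pq(3) e by auto
    then have "negligible (S \<tau> \<inter> S \<tau>') \<or> negligible (S \<sigma> \<inter> S \<sigma>')"
      using neg[OF assms(1) mem(1,2)] neg[OF assms(2) mem(3,4)] by blast
    moreover have "?f p \<inter> ?f q \<subseteq> S \<tau> \<inter> S \<tau>'" "?f p \<inter> ?f q \<subseteq> S \<sigma> \<inter> S \<sigma>'" unfolding e by auto
    ultimately show "negligible (?f p \<inter> ?f q)" by (meson negligible_subset)
  qed
  then have "(\<Sum>p\<in>I. vol (?f p)) = vol (\<Union>(?f ` I))"
    using measure_negligible_finite_Union_image[OF assms(3), of ?f] m by simp
  also have "\<dots> \<le> vol E"
  proof (rule measure_mono_fmeasurable)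
    show "\<Union>(?f ` I) \<subseteq> E"
    proof (rule UN_least)
      fix p assume "p \<in> I"
      then show "?f p \<subseteq> E" using assms(6)[of "fst p" "snd p"] by (simp add: case_prod_unfold)
    qed
    show "\<Union>(?f ` I) \<in> sets lebesgue" using m assms(3) by (intro sets.finite_Union) auto
  qed (rule assms(5))
  finally show ?thesis by (simp add: case_prod_unfold)
qed

definition noncoincident :: "nat \<Rightarrow> ('a, 'l) tile \<Rightarrow> ('a, 'l) tile \<Rightarrow> 'a set" where
  "noncoincident n \<tau> \<sigma> = ((*\<^sub>R) (lam ^ n) ` S \<tau> \<inter> (*\<^sub>R) (lam ^ n) ` S \<sigma>) - (\<Union>\<zeta>\<in>infl n {\<tau>} \<inter> infl n {\<sigma>}. S \<zeta>)"

lemma lmeasurable_noncoincident: "noncoincident n \<tau> \<sigma> \<in> lmeasurable"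
  unfolding noncoincident_def
proof (rule fmeasurable.Diff)
  show "(*\<^sub>R) (lam ^ n) ` S \<tau> \<inter> (*\<^sub>R) (lam ^ n) ` S \<sigma> \<in> lmeasurable"
    by (intro fmeasurable.Int lmeasurable_scale compact_supp)
  show "(\<Union>\<zeta>\<in>infl n {\<tau>} \<inter> infl n {\<sigma>}. S \<zeta>) \<in> lmeasurable"
    using finite_infl[of "{\<tau>}" n] by (intro fmeasurable.finite_UN lmeasurable_supp) auto
qed

lemma negligible_Int_supp:
  assumes "interior (S \<tau>) \<inter> interior (S \<sigma>) = {}"
  shows "negligible (S \<tau> \<inter> S \<sigma>)"
proof -
  have "S \<tau> \<inter> S \<sigma> \<subseteq> frontier (S \<tau>) \<union> frontier (S \<sigma>)"
    using assms closed_supp by (auto simp: frontier_def)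
  then show ?thesis using negligible_frontier_supp by (meson negligible_Un negligible_subset)
qed

end

context pure_point_inflation
begin

text \<open>The set \<open>B n\<close> collects the tilings whose membership in one of finitely many
  small cylinders changes under the translation. Off \<open>B n\<close>, a tile at the origin has a
  tile of its type nearby in the translate; their displacement is a short sum of two elements of
  \<open>\<Delta>\<close>, hence 0.\<close>

lemma translation_coincidence_set:
  assumes v: "v \<in> \<Delta>"
  shows "\<exists>B. (\<forall>n. B n \<in> sets \<mu>) \<and> (\<lambda>n. measure \<mu> (B n)) \<longlonglongrightarrow> 0 \<and>
    (\<forall>n. \<forall>x\<in>X - B n. \<forall>\<tau>\<in>x. 0 \<in> S \<tau> \<longrightarrow> \<tau> \<in> shift (lam ^ n *\<^sub>R v) x)"
proof -
  let ?r = "meyer_radius / 2"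
  have "cball (0::'a) R0 \<subseteq> (\<Union>c\<in>cball 0 R0. ball c ?r)" using meyer_radius(1) by auto
  then obtain N where N: "finite N" "cball (0::'a) R0 \<subseteq> (\<Union>c\<in>N. ball c ?r)"
    using compactE_image[OF compact_cball, of "cball 0 R0" "\<lambda>c. ball c ?r" 0 R0] by (metis open_ball)
  define D where "D n p = {x \<in> X. (shift (lam ^ n *\<^sub>R v) x \<in> cylinder (fst p) ?r (snd p)) \<noteq> (x \<in> cylinder (fst p) ?r (snd p))}" for n and p :: "'a \<times> 'l"
  have phase: "(\<lambda>n. phase_dist (k \<bullet> (lam ^ n *\<^sub>R v))) \<longlonglongrightarrow> 0" if "eigenvalue k" for k
    by (rule eigenvalue_\<Delta>[OF that v])
  have D: "D n p \<in> sets \<mu>" "(\<lambda>n. measure \<mu> (D n p)) \<longlonglongrightarrow> 0" for n p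
    unfolding D_def
    using measure_translation_tendsto(1)[OF cylinder_sets, of "\<lambda>n. lam ^ n *\<^sub>R v"]
      measure_translation_tendsto(2)[OF cylinder_sets, of "\<lambda>n. lam ^ n *\<^sub>R v"] phase by auto
  define B where "B n = (\<Union>p\<in>N \<times> UNIV. D n p)" for n
  have fin: "finite (N \<times> (UNIV :: 'l set))" using N(1) by simp
  have "B n \<in> sets \<mu>" for n unfolding B_def using D fin by (intro sets.finite_UN) auto
  moreover have "(\<lambda>n. measure \<mu> (B n)) \<longlonglongrightarrow> 0"
  proof (rule tendsto_sandwich[OF _ _ tendsto_const])
    show "\<forall>\<^sub>F n in sequentially. measure \<mu> (B n) \<le> (\<Sum>p\<in>N \<times> UNIV. measure \<mu> (D n p))"
      unfolding B_def using D fin by (intro always_eventually allI measure_UNION_le) auto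
    have "(\<lambda>n. \<Sum>p\<in>N \<times> UNIV. measure \<mu> (D n p)) \<longlonglongrightarrow> (\<Sum>p\<in>N \<times> (UNIV :: 'l set). 0)"
      by (intro tendsto_sum D)
    then show "(\<lambda>n. \<Sum>p\<in>N \<times> UNIV. measure \<mu> (D n p)) \<longlonglongrightarrow> 0" by simp
  qed simp
  moreover have "\<tau> \<in> shift (lam ^ n *\<^sub>R v) x" if x: "x \<in> X - B n" "\<tau> \<in> x" "0 \<in> S \<tau>" for n x \<tau>
  proof -
    let ?w = "lam ^ n *\<^sub>R v"
    have "fst \<tau> \<in> cball 0 R0" using dist_fst_supp[OF x(3)] by simp
    then obtain c where c: "c \<in> N" "dist c (fst \<tau>) < ?r" using N(2) by (auto simp: subset_iff)
    have "x \<in> cylinder c ?r (snd \<tau>)" using x c by (auto simp: cylinder_def)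
    moreover have "x \<notin> D n (c, snd \<tau>)" using x(1) c(1) unfolding B_def by auto
    ultimately have "shift ?w x \<in> cylinder c ?r (snd \<tau>)" using x(1) by (auto simp: D_def)
    then obtain \<sigma> where \<sigma>: "\<sigma> \<in> shift ?w x" "snd \<sigma> = snd \<tau>" "dist c (fst \<sigma>) < ?r" by (auto simp: cylinder_def)
    have d: "norm (fst \<sigma> - fst \<tau>) < meyer_radius"
      using c(2) \<sigma>(3) dist_triangle3[of "fst \<sigma>" "fst \<tau>" c] by (simp add: dist_norm)
    have "shift_tile (- ?w) \<sigma> \<in> x" using \<sigma>(1) by (simp add: mem_shift)
    then have 1: "cp (shift_tile (- ?w) \<sigma>) - cp \<tau> \<in> \<Delta>" using x by (intro \<Delta>I) auto
    \<comment> \<open>As the types agree, the displacement of positions is also the displacement of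
      control points.\<close>
    have 2: "fst \<sigma> - fst \<tau> = (cp (shift_tile (- ?w) \<sigma>) - cp \<tau>) + ?w"
      using cp_alt[of \<sigma>] cp_alt[of \<tau>] \<sigma>(2) by simp
    have "fst \<sigma> - fst \<tau> = 0"
      using meyer_radius2[OF 1 \<Delta>_scale_pow[OF v, of n]] d unfolding 2[symmetric] by simp
    then have "\<sigma> = \<tau>" using \<sigma>(2) by (simp add: prod_eq_iff)
    with \<sigma>(1) show ?thesis by simp
  qed
  ultimately show ?thesis by blast
qed

text \<open>
  An overlap that never produces a coincidence would keep \<open>x\<close> and its translate by \<open>lam ^ n *\<^sub>R v\<close> different
  on a set of positions whose frequency is bounded below, contrary to the previous lemma.
\<close>

lemma overlap_coincidence_aux:
  assumes x1: "x1 \<in> X" "\<tau> \<in> x1" "\<sigma>' \<in> x1" and v: "v \<in> \<Delta>"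
    and ov: "interior (S \<tau>) \<inter> interior (S (shift_tile v \<sigma>')) \<noteq> {}"
  shows "\<exists>n. infl n {\<tau>} \<inter> infl n {shift_tile v \<sigma>'} \<noteq> {}"
proof (rule ccontr)
  assume none: "\<not> ?thesis"
  let ?\<sigma> = "shift_tile v \<sigma>'"
  obtain q where "q \<in> interior (S \<tau>) \<inter> interior (S ?\<sigma>)" using ov by blast
  then obtain r where r: "r > 0" "ball q r \<subseteq> interior (S \<tau>) \<inter> interior (S ?\<sigma>)"
    by (metis open_Int open_contains_ball open_interior)
  then have rS: "ball q r \<subseteq> S \<tau>" "ball q r \<subseteq> S ?\<sigma>" using interior_subset by blast+
  let ?P = "{\<tau>, \<sigma>'}"
  obtain j \<tau>0 where "?P \<subseteq> infl j {\<tau>0}" using X_finite_patch[OF x1(1), of ?P] x1 by auto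
  then obtain C where C: "\<forall>n a. \<forall>x\<in>X. \<exists>b. shift (lam ^ n *\<^sub>R b) (infl n ?P) \<subseteq> x \<and> norm (lam ^ n *\<^sub>R b - a) \<le> C * lam ^ n"
    using patch_relatively_dense[of ?P j \<tau>0] by blast
  define C' where "C' = C + norm q"
  have "r / 2 > 0" using r by simp
  then obtain m where m: "m > 0" "\<forall>n. \<forall>A\<in>sets \<mu>.
    (\<forall>x\<in>X. \<exists>z. norm z \<le> C' * lam ^ n \<and> (\<forall>p. norm (p - z) \<le> r / 2 * lam ^ n \<longrightarrow> shift (- p) x \<in> A)) \<longrightarrow>
    m \<le> measure \<mu> A"
    using measure_ge_of_net[of "r / 2" C'] by blast
  obtain B where B: "\<And>n. B n \<in> sets \<mu>" "(\<lambda>n. measure \<mu> (B n)) \<longlonglongrightarrow> 0"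
    "\<And>n x \<tau>. x \<in> X - B n \<Longrightarrow> \<tau> \<in> x \<Longrightarrow> 0 \<in> S \<tau> \<Longrightarrow> \<tau> \<in> shift (lam ^ n *\<^sub>R v) x"
    using translation_coincidence_set[OF v] by blast
  have "m \<le> measure \<mu> (B n)" for n
  proof (rule m(2)[rule_format, OF B(1)])
    fix x assume x: "x \<in> X"
    obtain b where b: "shift (lam ^ n *\<^sub>R b) (infl n ?P) \<subseteq> x" "norm (lam ^ n *\<^sub>R b - 0) \<le> C * lam ^ n"
      using C x by blast
    define z where "z = lam ^ n *\<^sub>R (b + q)"
    let ?w = "lam ^ n *\<^sub>R v"
    define Z1 where "Z1 = shift (lam ^ n *\<^sub>R b) (infl n {\<tau>})"
    define Z2 where "Z2 = shift (lam ^ n *\<^sub>R b) (infl n {?\<sigma>})"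
    have "infl n {\<tau>} \<subseteq> infl n ?P" "infl n {\<sigma>'} \<subseteq> infl n ?P" by (rule infl_mono, blast)+
    then have Z1x: "Z1 \<subseteq> x" and *: "shift (lam ^ n *\<^sub>R b) (infl n {\<sigma>'}) \<subseteq> x"
      unfolding Z1_def using b(1) by (meson order_trans shift_mono)+
    have "Z2 = shift ?w (shift (lam ^ n *\<^sub>R b) (infl n {\<sigma>'}))"
      unfolding Z2_def using infl_shift[of n v "{\<sigma>'}"] by (simp add: add.commute)
    then have Z2x: "Z2 \<subseteq> shift ?w x" using shift_mono[OF *, of ?w] by simp
    have disj: "Z1 \<inter> Z2 = {}"
    proof -
      have "\<zeta> \<notin> Z2" if "\<zeta> \<in> Z1" for \<zeta>
        using none that unfolding Z1_def Z2_def mem_shift by blast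
      then show ?thesis by blast
    qed
    have b1: "ball z (lam ^ n * r) \<subseteq> (\<Union>\<zeta>\<in>Z1. S \<zeta>)" and b2: "ball z (lam ^ n * r) \<subseteq> (\<Union>\<zeta>\<in>Z2. S \<zeta>)"
      unfolding z_def Z1_def Z2_def by (intro scaled_ball_subset rS)+
    show "\<exists>z. norm z \<le> C' * lam ^ n \<and> (\<forall>p. norm (p - z) \<le> r / 2 * lam ^ n \<longrightarrow> shift (- p) x \<in> B n)"
    proof (intro exI[of _ z] conjI allI impI)
      have "norm z \<le> norm (lam ^ n *\<^sub>R b) + norm (lam ^ n *\<^sub>R q)"
        unfolding z_def scaleR_add_right by (rule norm_triangle_ineq)
      also have "\<dots> \<le> C' * lam ^ n" using b(2) lam by (simp add: C'_def algebra_simps)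
      finally show "norm z \<le> C' * lam ^ n" .
      fix p assume p: "norm (p - z) \<le> r / 2 * lam ^ n"
      have "r / 2 * lam ^ n < r * lam ^ n" using r lam by simp
      then have pb: "p \<in> ball z (lam ^ n * r)" using p by (simp add: dist_norm norm_minus_commute mult.commute)
      \<comment> \<open>Otherwise a tile over \<open>p\<close> would occur in both \<open>x\<close>
        and its translate, and by covering it would belong to both supertiles, which share no
        tile.\<close>
      show "shift (- p) x \<in> B n"
      proof (rule ccontr)
        assume nB: "shift (- p) x \<notin> B n"
        obtain \<zeta> where \<zeta>: "\<zeta> \<in> x" "p \<in> S \<zeta>" using X_cover[OF x] by blast
        have "shift_tile (- p) \<zeta> \<in> shift ?w (shift (- p) x)"
          using nB X_shift[OF x] \<zeta> by (intro B(3)) auto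
        then have "\<zeta> \<in> shift ?w x" by (simp add: mem_shift algebra_simps)
        moreover have "S \<zeta> \<inter> ball z (lam ^ n * r) \<noteq> {}" using \<zeta>(2) pb by blast
        ultimately have "\<zeta> \<in> Z1" "\<zeta> \<in> Z2"
          using covered_mem[OF X_nonoverlapping[OF x] Z1x open_ball b1 \<zeta>(1)]
            covered_mem[OF X_nonoverlapping[OF X_shift[OF x]] Z2x open_ball b2] by blast+
        with disj show False by blast
      qed
    qed
  qed
  then have "m \<le> 0" using B(2) by (intro LIMSEQ_le_const[OF B(2)]) auto
  with m(1) show False by simp
qed

section \<open>Overlaps and uniform coincidence\<close>

definition overlap :: "('a, 'l) tile \<Rightarrow> ('a, 'l) tile \<Rightarrow> bool" where
  "overlap \<tau> \<sigma> \<longleftrightarrow> (\<exists>x\<in>X. \<exists>v\<in>\<Delta>. \<tau> \<in> x \<and> shift_tile (- v) \<sigma> \<in> x) \<and> interior (S \<tau>) \<inter> interior (S \<sigma>) \<noteq> {}"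

lemma interior_shift_tile: "interior (S (shift_tile t \<tau>)) = (+) t ` interior (S \<tau>)"
  by (simp add: supp_shift_tile interior_translation)

lemma overlap_shift:
  assumes "overlap \<tau> \<sigma>" shows "overlap (shift_tile t \<tau>) (shift_tile t \<sigma>)"
proof -
  obtain x v where x: "x \<in> X" "v \<in> \<Delta>" "\<tau> \<in> x" "shift_tile (- v) \<sigma> \<in> x" "interior (S \<tau>) \<inter> interior (S \<sigma>) \<noteq> {}"
    using assms unfolding overlap_def by blast
  have "shift t x \<in> X" "shift_tile t \<tau> \<in> shift t x" "shift_tile (- v) (shift_tile t \<sigma>) \<in> shift t x"
    using x X_shift by (simp_all add: mem_shift)
  moreover have "interior (S (shift_tile t \<tau>)) \<inter> interior (S (shift_tile t \<sigma>)) \<noteq> {}"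
    using x(5) unfolding interior_shift_tile by blast
  ultimately show ?thesis using x(2) unfolding overlap_def by blast
qed

text \<open>Under \<open>n\<close> inflations the displacement \<open>v\<close> becomes
  \<open>lam ^ n *\<^sub>R v\<close>, which is again in \<open>\<Delta>\<close>.\<close>

lemma overlap_infl:
  assumes o: "overlap \<tau> \<sigma>" and "\<tau>' \<in> infl n {\<tau>}" "\<sigma>' \<in> infl n {\<sigma>}" "interior (S \<tau>') \<inter> interior (S \<sigma>') \<noteq> {}"
  shows "overlap \<tau>' \<sigma>'"
proof -
  obtain x v where x: "x \<in> X" "v \<in> \<Delta>" "\<tau> \<in> x" "shift_tile (- v) \<sigma> \<in> x"
    using o unfolding overlap_def by blast
  let ?P = "{\<tau>, shift_tile (- v) \<sigma>}"
  obtain y where y: "y \<in> X" "infl n ?P \<subseteq> y" using infl_patch_legal[of x ?P n] x by auto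
  have "infl n {\<tau>} \<subseteq> infl n ?P" "infl n {shift_tile (- v) \<sigma>} \<subseteq> infl n ?P" by (rule infl_mono, blast)+
  moreover have "infl n {shift_tile (- v) \<sigma>} = shift (lam ^ n *\<^sub>R (- v)) (infl n {\<sigma>})"
    by (simp flip: infl_shift del: scaleR_minus_right)
  then have "shift_tile (- (lam ^ n *\<^sub>R v)) \<sigma>' \<in> infl n {shift_tile (- v) \<sigma>}"
    using assms(3) by (simp add: mem_shift)
  ultimately have "\<tau>' \<in> y" "shift_tile (- (lam ^ n *\<^sub>R v)) \<sigma>' \<in> y" using y(2) assms(2) by blast+
  then show ?thesis using y(1) \<Delta>_scale_pow[OF x(2)] assms(4) unfolding overlap_def by blast
qed

lemma overlap_coincidence:
  assumes "overlap \<tau> \<sigma>" shows "\<exists>n. infl n {\<tau>} \<inter> infl n {\<sigma>} \<noteq> {}"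
proof -
  obtain x v where x: "x \<in> X" "v \<in> \<Delta>" "\<tau> \<in> x" "shift_tile (- v) \<sigma> \<in> x" "interior (S \<tau>) \<inter> interior (S \<sigma>) \<noteq> {}"
    using assms unfolding overlap_def by blast
  show ?thesis using overlap_coincidence_aux[OF x(1,3,4,2)] x(5) by simp
qed

lemma coincidence_mono:
  assumes "infl n {\<tau>} \<inter> infl n {\<sigma>} \<noteq> {}" "n \<le> m"
  shows "infl m {\<tau>} \<inter> infl m {\<sigma>} \<noteq> {}"
proof -
  obtain k where k: "m = k + n" using assms(2) by (metis add.commute le_Suc_ex)
  obtain \<zeta> where \<zeta>: "\<zeta> \<in> infl n {\<tau>}" "\<zeta> \<in> infl n {\<sigma>}" using assms(1) by blast
  have "infl k {\<zeta>} \<subseteq> infl m {\<tau>}" "infl k {\<zeta>} \<subseteq> infl m {\<sigma>}"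
    unfolding k infl_add by (rule infl_mono, use \<zeta> in blast)+
  moreover have "infl k {\<zeta>} \<noteq> {}" by (rule infl_nonempty) simp
  ultimately show ?thesis by blast
qed

text \<open>Up to translation an overlap is determined by two types and the difference of control
  points, a vector of bounded length in \<open>\<Delta> + \<Delta>\<close>. The four-term Meyer
  property separates such vectors, so there are finitely many overlaps; since a coincidence persists
  under further inflation, the largest level serves all of them.\<close>

lemma uniform_coincidence: "\<exists>N. \<forall>\<tau> \<sigma>. overlap \<tau> \<sigma> \<longrightarrow> infl N {\<tau>} \<inter> infl N {\<sigma>} \<noteq> {}"
proof -
  \<comment> \<open>Overlapping tiles have positions at distance at most \<open>2 * R0\<close>; the
    sum pays for passing from positions to control points at both tiles.\<close>
  define M where "M = 2 * R0 + 2 * (\<Sum>i\<in>UNIV. norm (cp (0, i)))"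
  define W where "W = {d. (\<exists>a\<in>\<Delta>. \<exists>b\<in>\<Delta>. d = a + b) \<and> norm d \<le> M}"
  have "finite W"
  proof (rule finite_separated[where d = meyer_radius])
    show "bounded W" unfolding W_def bounded_iff by auto
    fix p q assume pq: "p \<in> W" "q \<in> W" "dist p q < meyer_radius"
    then obtain a b c d where abcd: "a \<in> \<Delta>" "b \<in> \<Delta>" "c \<in> \<Delta>" "d \<in> \<Delta>" "p = a + b" "q = c + d"
      unfolding W_def by blast
    have "a + b + - c + - d = 0"
      using pq(3) abcd by (intro meyer_radius(2) \<Delta>_minus) (auto simp: dist_norm algebra_simps)
    then show "p = q" using abcd by (simp add: algebra_simps)
  qed (rule meyer_radius(1))
  define \<Omega> where "\<Omega> = {(\<tau>, \<sigma>). overlap \<tau> \<sigma> \<and> fst \<tau> = 0}"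
  have "\<Omega> \<subseteq> (\<lambda>(i, j, d). ((0, i), (d + cp (0, i) - cp (0, j), j))) ` (UNIV \<times> UNIV \<times> W)"
  proof
    fix p assume "p \<in> \<Omega>"
    then obtain \<tau> \<sigma> where p: "p = (\<tau>, \<sigma>)" "overlap \<tau> \<sigma>" "fst \<tau> = 0" unfolding \<Omega>_def by blast
    obtain x v where x: "x \<in> X" "v \<in> \<Delta>" "\<tau> \<in> x" "shift_tile (- v) \<sigma> \<in> x" "interior (S \<tau>) \<inter> interior (S \<sigma>) \<noteq> {}"
      using p(2) unfolding overlap_def by blast
    define d where "d = cp \<sigma> - cp \<tau>"
    have d: "d = (cp (shift_tile (- v) \<sigma>) - cp \<tau>) + v" by (simp add: d_def)
    have d2: "d = fst \<sigma> + cp (0, snd \<sigma>) - cp (0, snd \<tau>)"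
      unfolding d_def using cp_alt[of \<sigma>] cp_alt[of \<tau>] p(3) by simp
    obtain a where "a \<in> S \<tau>" "a \<in> S \<sigma>" using x(5) interior_subset by blast
    then have "norm (fst \<sigma>) \<le> 2 * R0"
      using dist_fst_supp[of a \<tau>] dist_fst_supp[of a \<sigma>] p(3) dist_triangle2[of "fst \<sigma>" "fst \<tau>" a]
      by (simp add: dist_norm)
    moreover have "norm (cp (0, i)) \<le> (\<Sum>i\<in>UNIV. norm (cp (0, i)))" for i
      by (rule member_le_sum) auto
    from this[of "snd \<sigma>"] this[of "snd \<tau>"]
    have "norm (cp (0, snd \<sigma>)) + norm (cp (0, snd \<tau>)) \<le> 2 * (\<Sum>i\<in>UNIV. norm (cp (0, i)))" by simp
    ultimately have "norm d \<le> M"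
      unfolding d2 M_def
      using norm_triangle_ineq4[of "fst \<sigma> + cp (0, snd \<sigma>)" "cp (0, snd \<tau>)"] norm_triangle_ineq[of "fst \<sigma>" "cp (0, snd \<sigma>)"]
      by linarith
    moreover have "cp (shift_tile (- v) \<sigma>) - cp \<tau> \<in> \<Delta>" using x by (intro \<Delta>I)
    ultimately have "d \<in> W" using d x(2) unfolding W_def by blast
    moreover have "p = (\<lambda>(i, j, d). ((0, i), (d + cp (0, i) - cp (0, j), j))) (snd \<tau>, snd \<sigma>, d)"
      using p(1,3) d2 by (simp add: prod_eq_iff)
    ultimately show "p \<in> (\<lambda>(i, j, d). ((0, i), (d + cp (0, i) - cp (0, j), j))) ` (UNIV \<times> UNIV \<times> W)"
      by (intro image_eqI) auto
  qed
  then have fin: "finite \<Omega>" by (rule finite_subset) (use \<open>finite W\<close> in auto)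
  have "\<forall>p\<in>\<Omega>. \<exists>n. infl n {fst p} \<inter> infl n {snd p} \<noteq> {}"
    using overlap_coincidence unfolding \<Omega>_def by auto
  then obtain f where f: "\<And>p. p \<in> \<Omega> \<Longrightarrow> infl (f p) {fst p} \<inter> infl (f p) {snd p} \<noteq> {}" by metis
  define N where "N = Max (insert 0 (f ` \<Omega>))"
  have "infl N {\<tau>} \<inter> infl N {\<sigma>} \<noteq> {}" if o: "overlap \<tau> \<sigma>" for \<tau> \<sigma>
  proof -
    let ?t = "- fst \<tau>"
    let ?p = "(shift_tile ?t \<tau>, shift_tile ?t \<sigma>)"
    have "?p \<in> \<Omega>" using overlap_shift[OF o, of ?t] unfolding \<Omega>_def by simp
    then have "infl (f ?p) {shift_tile ?t \<tau>} \<inter> infl (f ?p) {shift_tile ?t \<sigma>} \<noteq> {}" "f ?p \<le> N"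
      using f[of ?p] fin by (auto simp: N_def)
    then have "infl N {shift_tile ?t \<tau>} \<inter> infl N {shift_tile ?t \<sigma>} \<noteq> {}" by (rule coincidence_mono)
    moreover have "infl N {shift_tile ?t \<tau>} = shift (lam ^ N *\<^sub>R ?t) (infl N {\<tau>})" for \<tau>
      by (simp flip: infl_shift del: scaleR_minus_right)
    ultimately show ?thesis by (auto simp: mem_shift)
  qed
  then show ?thesis by blast
qed

end

section \<open>Geometric decay of the noncoincident part\<close>

context pure_point_inflation
begin

text \<open>Equal ancestors at level \<open>m\<close> would share all their later descendants and
  hence a common tile over \<open>p\<close>; so the two ancestors over \<open>p\<close> are distinct
  and inherit the failure to coincide.\<close>

lemma noncoincident_cover:
  assumes o: "overlap \<tau> \<sigma>" and p: "p \<in> noncoincident (n + m) \<tau> \<sigma>"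
  obtains \<tau>' \<sigma>' where "\<tau>' \<in> infl m {\<tau>}" "\<sigma>' \<in> infl m {\<sigma>}" "\<tau>' \<noteq> \<sigma>'"
    "p \<in> (*\<^sub>R) (lam ^ n) ` (S \<tau>' \<inter> S \<sigma>')" "p \<in> noncoincident n \<tau>' \<sigma>'"
proof -
  have "p \<in> (\<Union>\<zeta>\<in>infl (n + m) {\<tau>}. S \<zeta>)" "p \<in> (\<Union>\<zeta>\<in>infl (n + m) {\<sigma>}. S \<zeta>)"
    using p by (simp_all add: noncoincident_def supp_infl)
  then have "p \<in> (*\<^sub>R) (lam ^ n) ` (\<Union>\<zeta>\<in>infl m {\<tau>}. S \<zeta>)" "p \<in> (*\<^sub>R) (lam ^ n) ` (\<Union>\<zeta>\<in>infl m {\<sigma>}. S \<zeta>)"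
    unfolding infl_add supp_infl[of n] .
  then obtain \<tau>' \<sigma>' where \<tau>': "\<tau>' \<in> infl m {\<tau>}" "p \<in> (*\<^sub>R) (lam ^ n) ` S \<tau>'"
    and \<sigma>': "\<sigma>' \<in> infl m {\<sigma>}" "p \<in> (*\<^sub>R) (lam ^ n) ` S \<sigma>'" by blast
  have sub: "infl n {\<tau>'} \<subseteq> infl (n + m) {\<tau>}" "infl n {\<sigma>'} \<subseteq> infl (n + m) {\<sigma>}"
    unfolding infl_add by (rule infl_mono, use \<tau>' \<sigma>' in blast)+
  have none: "p \<notin> S \<zeta>" if "\<zeta> \<in> infl n {\<tau>'}" "\<zeta> \<in> infl n {\<sigma>'}" for \<zeta>
    using p sub that unfolding noncoincident_def by blast
  have "\<tau>' \<noteq> \<sigma>'"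
  proof
    assume eq: "\<tau>' = \<sigma>'"
    have "p \<in> (\<Union>\<zeta>\<in>infl n {\<tau>'}. S \<zeta>)" using \<tau>'(2) by (simp add: supp_infl)
    with none eq show False by blast
  qed
  moreover have "p \<in> noncoincident n \<tau>' \<sigma>'" using \<tau>'(2) \<sigma>'(2) none unfolding noncoincident_def by blast
  moreover have "p \<in> (*\<^sub>R) (lam ^ n) ` (S \<tau>' \<inter> S \<sigma>')" using \<tau>'(2) \<sigma>'(2) lam by auto
  ultimately show thesis using that \<tau>'(1) \<sigma>'(1) by blast
qed

lemma vol_le_sum_noncoincident:
  assumes "finite P" "finite Q" and E: "A \<in> lmeasurable"
    and cov: "A \<subseteq> M \<union> (\<Union>(\<tau>, \<sigma>)\<in>P \<times> Q. noncoincident n \<tau> \<sigma> \<inter> A)" "negligible M"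
    and I: "I = {(\<tau>, \<sigma>) \<in> P \<times> Q. interior (S \<tau>) \<inter> interior (S \<sigma>) \<noteq> {} \<and> noncoincident n \<tau> \<sigma> \<inter> A \<noteq> {}}"
  shows "vol A \<le> (\<Sum>(\<tau>, \<sigma>)\<in>I. vol (noncoincident n \<tau> \<sigma>))"
proof -
  let ?f = "\<lambda>(\<tau>, \<sigma>). noncoincident n \<tau> \<sigma>"
  have fin: "finite I" unfolding I using assms(1,2) by (auto intro: finite_subset[of _ "P \<times> Q"])
  define M' where "M' = M \<union> (\<Union>p\<in>{p \<in> P \<times> Q. interior (S (fst p)) \<inter> interior (S (snd p)) = {}}. (*\<^sub>R) (lam ^ n) ` (S (fst p) \<inter> S (snd p)))"
  have M': "negligible M'"
    unfolding M'_def
  proof (intro negligible_Un cov(2) negligible_Union)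
    show "finite ((\<lambda>p. (*\<^sub>R) (lam ^ n) ` (S (fst p) \<inter> S (snd p))) ` {p \<in> P \<times> Q. interior (S (fst p)) \<inter> interior (S (snd p)) = {}})"
      using assms(1,2) by simp
    fix T assume "T \<in> (\<lambda>p. (*\<^sub>R) (lam ^ n) ` (S (fst p) \<inter> S (snd p))) ` {p \<in> P \<times> Q. interior (S (fst p)) \<inter> interior (S (snd p)) = {}}"
    then show "negligible T"
      using negligible_Int_supp
      by (auto simp: negligible_iff_measure vol_scale intro!: lmeasurable_scale compact_Int compact_supp)
  qed
  have sub: "A \<subseteq> M' \<union> (\<Union>p\<in>I. ?f p)"
  proof
    fix a assume a: "a \<in> A"
    show "a \<in> M' \<union> (\<Union>p\<in>I. ?f p)"
    proof (cases "a \<in> M")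
      case False
      then obtain \<tau> \<sigma> where ts: "\<tau> \<in> P" "\<sigma> \<in> Q" "a \<in> noncoincident n \<tau> \<sigma>" using cov(1) a by blast
      show ?thesis
      proof (cases "interior (S \<tau>) \<inter> interior (S \<sigma>) = {}")
        case True
        have "a \<in> (*\<^sub>R) (lam ^ n) ` (S \<tau> \<inter> S \<sigma>)" using ts(3) lam by (auto simp: noncoincident_def)
        with True ts show ?thesis unfolding M'_def by (intro UnI1 UnI2 UN_I[of "(\<tau>, \<sigma>)"]) auto
      next
        case False
        with ts a show ?thesis unfolding I by blast
      qed
    qed (simp add: M'_def)
  qed
  have U: "(\<Union>p\<in>I. ?f p) \<in> lmeasurable"
    using fin lmeasurable_noncoincident by (intro fmeasurable.finite_UN) (auto split: prod.split)
  have nM': "M' \<in> lmeasurable" using M' by (simp add: negligible_imp_measurable)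
  have "vol A \<le> vol (M' \<union> (\<Union>p\<in>I. ?f p))"
    using E nM' U by (intro measure_mono_fmeasurable[OF sub]) auto
  also have "\<dots> \<le> vol M' + vol (\<Union>p\<in>I. ?f p)"
    using nM' U by (intro measure_Un_le) auto
  also have "vol M' = 0" using M' by (rule negligible_imp_measure0)
  also have "vol (\<Union>p\<in>I. ?f p) \<le> (\<Sum>p\<in>I. vol (?f p))"
    using fin lmeasurable_noncoincident by (intro measure_UNION_le) (auto split: prod.split)
  finally show ?thesis by (simp add: case_prod_unfold)
qed

text \<open>After \<open>N\<close> inflations every overlap contains a shared tile
  \<open>\<zeta>0\<close>. Pairs of distinct descendants avoid its interior, so they fill at most
  the fraction \<open>\<theta>\<close> of the inflated overlap, and they are overlaps again. The
  estimate is iterated in blocks of \<open>N\<close> inflations.\<close>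

lemma noncoincident_volume_decay:
  "\<exists>N \<theta>. 0 \<le> \<theta> \<and> \<theta> < 1 \<and> (\<forall>j \<tau> \<sigma>. overlap \<tau> \<sigma> \<longrightarrow>
     vol (noncoincident (j * N) \<tau> \<sigma>) \<le> \<theta> ^ j * (lam ^ (j * N)) ^ DIM('a) * vol (S \<tau> \<inter> S \<sigma>))"
proof -
  obtain N where N: "\<And>\<tau> \<sigma>. overlap \<tau> \<sigma> \<Longrightarrow> infl N {\<tau>} \<inter> infl N {\<sigma>} \<noteq> {}"
    using uniform_coincidence by blast
  let ?L = "(lam ^ N) ^ DIM('a)"
  define \<beta> where "\<beta> = vol (cball (0::'a) r0)"
  define V where "V = vol (cball (0::'a) R0)"
  have V: "V > 0" "\<beta> > 0" using r0 R0 unfolding V_def \<beta>_def by simp_all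
  have L: "?L \<ge> 1" using lam_pow_ge_1 by (simp add: one_le_power)
  have vS: "vol (S \<tau>) \<le> V" for \<tau>
  proof -
    have "vol (S \<tau>) \<le> vol (cball (fst \<tau>) R0)"
      by (intro measure_mono_fmeasurable supp_subset) (auto simp: fmeasurableD lmeasurable_supp)
    also have "\<dots> = V" unfolding V_def by (simp only: vol_cball[OF less_imp_le[OF R0]])
    finally show ?thesis .
  qed
  have vI: "\<beta> \<le> vol (interior (S \<tau>))" for \<tau>
  proof -
    have "\<beta> = vol (cball (centre \<tau>) r0)"
      unfolding \<beta>_def by (simp only: vol_cball[OF less_imp_le[OF r0]])
    also have "\<dots> \<le> vol (interior (S \<tau>))"
      by (intro measure_mono_fmeasurable cball_centre)
        (auto intro: lmeasurable_interior bounded_interior compact_imp_bounded compact_supp lmeasurable_compact fmeasurableD)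
    finally show ?thesis .
  qed
  have vIS: "vol (interior (S \<tau>)) \<le> vol (S \<tau>)" for \<tau>
    by (intro measure_mono_fmeasurable interior_subset) (auto simp: lmeasurable_supp)
  \<comment> \<open>Any tile will do: the volumes of its interior and of its support give
    \<open>\<beta> \<le> V\<close>, which is needed for \<open>0 \<le> \<theta>\<close>.\<close>
  obtain \<tau>1 :: "('a, 'l) tile" where True by blast
  have "\<beta> \<le> V" using vI[of \<tau>1] vIS[of \<tau>1] vS[of \<tau>1] by linarith
  \<comment> \<open>An inflated overlap has volume at most \<open>?L * V\<close>, of which the
    shared tile takes away at least \<open>\<beta>\<close>.\<close>
  define \<theta> where "\<theta> = 1 - \<beta> / (?L * V)"
  have \<theta>: "0 \<le> \<theta>" "\<theta> < 1"
  proof -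
    have "\<beta> \<le> ?L * V" using \<open>\<beta> \<le> V\<close> mult_right_mono[OF L, of V] V by linarith
    then show "0 \<le> \<theta>" unfolding \<theta>_def using V L by (simp add: field_simps)
    show "\<theta> < 1" unfolding \<theta>_def using V L lam by simp
  qed
  have "vol (noncoincident (j * N) \<tau> \<sigma>) \<le> \<theta> ^ j * (lam ^ (j * N)) ^ DIM('a) * vol (S \<tau> \<inter> S \<sigma>)" if "overlap \<tau> \<sigma>" for j \<tau> \<sigma>
    using that
  proof (induction j arbitrary: \<tau> \<sigma>)
    case 0
    have "vol (noncoincident 0 \<tau> \<sigma>) \<le> vol (S \<tau> \<inter> S \<sigma>)"
      by (intro measure_mono_fmeasurable fmeasurable.Int lmeasurable_supp fmeasurableD[OF lmeasurable_noncoincident]) (auto simp: noncoincident_def)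
    then show ?case by simp
  next
    case (Suc j)
    define n where "n = j * N"
    have SN: "Suc j * N = n + N" by (simp add: n_def add.commute)
    let ?P = "infl N {\<tau>}" and ?Q = "infl N {\<sigma>}"
    let ?A = "noncoincident (n + N) \<tau> \<sigma>"
    define I where "I = {(\<tau>', \<sigma>') \<in> ?P \<times> ?Q. interior (S \<tau>') \<inter> interior (S \<sigma>') \<noteq> {} \<and> noncoincident n \<tau>' \<sigma>' \<inter> ?A \<noteq> {}}"
    have finP: "finite ?P" "finite ?Q" by (simp_all add: finite_infl)
    have finI: "finite I" unfolding I_def using finP by (auto intro: finite_subset[of _ "?P \<times> ?Q"])
    obtain \<zeta>0 where \<zeta>0: "\<zeta>0 \<in> ?P" "\<zeta>0 \<in> ?Q" using N[OF Suc.prems] by blast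
    let ?E0 = "(*\<^sub>R) (lam ^ N) ` (S \<tau> \<inter> S \<sigma>)"
    have cS: "compact (S \<tau> \<inter> S \<sigma>)" by (intro compact_Int compact_supp)
    have E0: "?E0 \<in> lmeasurable" by (intro lmeasurable_scale cS)
    have E0_eq: "?E0 = (*\<^sub>R) (lam ^ N) ` S \<tau> \<inter> (*\<^sub>R) (lam ^ N) ` S \<sigma>"
      using lam by (intro image_Int injI) simp
    have sub0: "interior (S \<zeta>0) \<subseteq> ?E0"
      unfolding E0_eq
      using infl_supp_subset[OF \<zeta>0(1)] infl_supp_subset[OF \<zeta>0(2)] interior_subset[of "S \<zeta>0"] by blast
    have I0: "interior (S \<zeta>0) \<in> lmeasurable"
      by (intro lmeasurable_interior compact_imp_bounded compact_supp)
    have disj: "S \<tau>' \<inter> S \<sigma>' \<subseteq> ?E0 - interior (S \<zeta>0)" if ts: "\<tau>' \<in> ?P" "\<sigma>' \<in> ?Q" "\<tau>' \<noteq> \<sigma>'" for \<tau>' \<sigma>'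
    proof
      fix p assume p: "p \<in> S \<tau>' \<inter> S \<sigma>'"
      have "p \<in> ?E0" unfolding E0_eq using p infl_supp_subset[OF ts(1)] infl_supp_subset[OF ts(2)] by blast
      moreover have "p \<notin> interior (S \<zeta>0)"
      proof
        assume "p \<in> interior (S \<zeta>0)"
        then have "\<zeta>0 = \<tau>'" "\<zeta>0 = \<sigma>'"
          using p ts \<zeta>0 nonoverlapping_eqI[OF nonoverlapping_infl[OF nonoverlapping_singleton]] by blast+
        with ts(3) show False by simp
      qed
      ultimately show "p \<in> ?E0 - interior (S \<zeta>0)" by blast
    qed
    \<comment> \<open>For equal tiles the noncoincident part is empty, so the diagonal does not
      enter \<open>I\<close>.\<close>
    have "\<tau>' \<noteq> \<sigma>'" if "(\<tau>', \<sigma>') \<in> I" for \<tau>' \<sigma>'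
    proof
      assume eq: "\<tau>' = \<sigma>'"
      obtain p where "p \<in> noncoincident n \<tau>' \<sigma>'" using \<open>(\<tau>', \<sigma>') \<in> I\<close> unfolding I_def by blast
      then have "p \<in> (*\<^sub>R) (lam ^ n) ` S \<tau>'" "\<And>\<zeta>. \<zeta> \<in> infl n {\<tau>'} \<Longrightarrow> p \<notin> S \<zeta>"
        unfolding noncoincident_def eq by blast+
      moreover have "(*\<^sub>R) (lam ^ n) ` S \<tau>' = (\<Union>\<zeta>\<in>infl n {\<tau>'}. S \<zeta>)" by (simp add: supp_infl)
      ultimately show False by blast
    qed
    note Ine = this
    have "vol ?A \<le> (\<Sum>(\<tau>', \<sigma>')\<in>I. vol (noncoincident n \<tau>' \<sigma>'))"
    proof (rule vol_le_sum_noncoincident[OF finP lmeasurable_noncoincident _ _ I_def])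
      show "?A \<subseteq> {} \<union> (\<Union>(\<tau>', \<sigma>')\<in>?P \<times> ?Q. noncoincident n \<tau>' \<sigma>' \<inter> ?A)"
      proof
        fix p assume p: "p \<in> ?A"
        obtain \<tau>' \<sigma>' where "\<tau>' \<in> ?P" "\<sigma>' \<in> ?Q" "p \<in> noncoincident n \<tau>' \<sigma>'" by (rule noncoincident_cover[OF Suc.prems p])
        with p show "p \<in> {} \<union> (\<Union>(\<tau>', \<sigma>')\<in>?P \<times> ?Q. noncoincident n \<tau>' \<sigma>' \<inter> ?A)" by (intro UnI2 UN_I[of "(\<tau>', \<sigma>')"]) auto
      qed
    qed simp
    also have "\<dots> \<le> (\<Sum>(\<tau>', \<sigma>')\<in>I. \<theta> ^ j * (lam ^ n) ^ DIM('a) * vol (S \<tau>' \<inter> S \<sigma>'))"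
    proof (rule sum_mono, clarify)
      fix a b a' b' assume i: "((a, b), (a', b')) \<in> I"
      have "overlap (a, b) (a', b')"
        using i unfolding I_def by (intro overlap_infl[OF Suc.prems, of _ N]) auto
      then show "vol (noncoincident n (a, b) (a', b')) \<le> \<theta> ^ j * (lam ^ n) ^ DIM('a) * vol (S (a, b) \<inter> S (a', b'))"
        using Suc.IH unfolding n_def by blast
    qed
    also have "\<dots> = \<theta> ^ j * (lam ^ n) ^ DIM('a) * (\<Sum>(\<tau>', \<sigma>')\<in>I. vol (S \<tau>' \<inter> S \<sigma>'))"
      by (simp add: sum_distrib_left case_prod_unfold)
    also have "\<dots> \<le> \<theta> ^ j * (lam ^ n) ^ DIM('a) * (\<theta> * ?L * vol (S \<tau> \<inter> S \<sigma>))"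
    proof (rule mult_left_mono)
      have "(\<Sum>(\<tau>', \<sigma>')\<in>I. vol (S \<tau>' \<inter> S \<sigma>')) \<le> vol (?E0 - interior (S \<zeta>0))"
      proof (rule sum_vol_Int_le[OF _ _ finI])
        show "I \<subseteq> ?P \<times> ?Q" unfolding I_def by blast
        show "?E0 - interior (S \<zeta>0) \<in> lmeasurable" using E0 I0 by (intro fmeasurable.Diff)
        show "S \<tau>' \<inter> S \<sigma>' \<subseteq> ?E0 - interior (S \<zeta>0)" if "(\<tau>', \<sigma>') \<in> I" for \<tau>' \<sigma>'
          using Ine[OF that] that unfolding I_def by (intro disj) auto
      qed (auto intro: nonoverlapping_infl)
      also have "\<dots> = vol ?E0 - vol (interior (S \<zeta>0))"
        using E0 I0 sub0 by (intro measurable_measure_Diff fmeasurableD) auto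
      also have "\<dots> \<le> ?L * vol (S \<tau> \<inter> S \<sigma>) - \<beta>"
        using vI[of \<zeta>0] lam by (simp add: vol_scale)
      also have "\<dots> \<le> \<theta> * ?L * vol (S \<tau> \<inter> S \<sigma>)"
      proof -
        have "vol (S \<tau> \<inter> S \<sigma>) \<le> vol (S \<tau>)"
          by (intro measure_mono_fmeasurable lmeasurable_supp) (auto intro!: fmeasurableD lmeasurable_compact cS)
        then have "vol (S \<tau> \<inter> S \<sigma>) / V \<le> 1" using vS[of \<tau>] V by simp
        then have "\<beta> * (vol (S \<tau> \<inter> S \<sigma>) / V) \<le> \<beta> * 1" using V by (intro mult_left_mono) auto
        moreover have "\<theta> * ?L * vol (S \<tau> \<inter> S \<sigma>) = ?L * vol (S \<tau> \<inter> S \<sigma>) - \<beta> * (vol (S \<tau> \<inter> S \<sigma>) / V)"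
          unfolding \<theta>_def using V L lam by (simp add: field_simps)
        ultimately show ?thesis by simp
      qed
      finally show "(\<Sum>(\<tau>', \<sigma>')\<in>I. vol (S \<tau>' \<inter> S \<sigma>')) \<le> \<theta> * ?L * vol (S \<tau> \<inter> S \<sigma>)" .
    qed (use \<theta> lam in simp)
    also have "\<dots> = \<theta> ^ Suc j * (lam ^ (n + N)) ^ DIM('a) * vol (S \<tau> \<inter> S \<sigma>)"
      by (simp add: power_add power_mult_distrib)
    finally show ?case unfolding SN .
  qed
  with \<theta> show ?thesis by blast
qed

lemma disc_measurable:
  assumes "x \<in> X" "y \<in> X" shows "disc shape x y \<in> sets borel"
proof -
  have "countable (sym_diff x y)"
    using countable_nonoverlapping[OF X_nonoverlapping] assms by (auto intro: countable_subset[OF _ countable_Un[of x y]])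
  then show ?thesis unfolding disc_def
    by (intro sets.countable_UN') (auto intro: borel_closed closed_supp)
qed

text \<open>Near the ball \<open>x\<close> is the \<open>n\<close>-fold inflation of a finite legal
  patch \<open>?Q\<close>, and its translate by \<open>lam ^ n *\<^sub>R v\<close> is that of
  \<open>?Q\<close> shifted by \<open>v\<close>. Off tile boundaries, a point of \<open>disc\<close>
  lies in the noncoincident part of an overlap between these two patches, where the decay applies;
  the overlaps themselves are almost disjoint.\<close>

lemma disc_translate_volume:
  "\<exists>N \<theta>. 0 \<le> \<theta> \<and> \<theta> < 1 \<and> (\<forall>j. \<forall>x\<in>X. \<forall>v\<in>\<Delta>. \<forall>a. \<forall>L\<ge>0.
     vol (disc shape x (shift (lam ^ (j * N) *\<^sub>R v) x) \<inter> cball a L) \<le> \<theta> ^ j * vol (cball a (L + 2 * R0 * lam ^ (j * N))))"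
proof -
  obtain N \<theta> where \<theta>: "0 \<le> \<theta>" "\<theta> < 1" and decay: "\<And>j \<tau> \<sigma>. overlap \<tau> \<sigma> \<Longrightarrow>
     vol (noncoincident (j * N) \<tau> \<sigma>) \<le> \<theta> ^ j * (lam ^ (j * N)) ^ DIM('a) * vol (S \<tau> \<inter> S \<sigma>)"
    using noncoincident_volume_decay by blast
  have "vol (disc shape x (shift (lam ^ (j * N) *\<^sub>R v) x) \<inter> cball a L) \<le> \<theta> ^ j * vol (cball a (L + 2 * R0 * lam ^ (j * N)))"
    if x: "x \<in> X" and v: "v \<in> \<Delta>" and L0: "L \<ge> 0" for j x v a L
  proof -
    define n where "n = j * N"
    define w where "w = lam ^ n *\<^sub>R v"
    \<comment> \<open>The translate is inspected around \<open>a\<close>, that is, \<open>x\<close>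
      around \<open>a - w\<close>; one patch of \<open>x\<close> has to contain both balls.\<close>
    define R where "R = L + norm w"
    let ?y = "shift w x"
    have y: "?y \<in> X" by (rule X_shift[OF x])
    obtain i \<tau>0 where Y: "patch_at shape x a R = patch_at shape (infl n (infl i {\<tau>0})) a R"
      using X_local_structure[OF x] by metis
    let ?Q = "infl i {\<tau>0}"
    define Y1 where "Y1 = infl n ?Q"
    define Y2 where "Y2 = infl n (shift v ?Q)"
    have Y2: "Y2 = shift w Y1" by (simp add: Y1_def Y2_def infl_shift w_def)
    have P1: "patch_at shape x a L = patch_at shape Y1 a L"
      by (rule patch_at_mono_eq[OF Y[folded Y1_def]]) (simp add: R_def cball_subset_cball_iff)
    have "patch_at shape x (a - w) L = patch_at shape Y1 (a - w) L"
      by (rule patch_at_mono_eq[OF Y[folded Y1_def]]) (simp add: R_def cball_subset_cball_iff dist_norm)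
    then have P2: "patch_at shape ?y a L = patch_at shape Y2 a L"
      unfolding Y2 by (simp add: patch_at_shift)
    obtain x' where x': "x' \<in> X" "?Q \<subseteq> x'" using infl_legal by blast
    have noQ: "nonoverlapping shape ?Q" "nonoverlapping shape (shift v ?Q)"
      by (simp_all add: nonoverlapping_infl nonoverlapping_shift)
    have fin: "finite ?Q" "finite (shift v ?Q)" by (simp_all add: finite_infl)
    let ?A = "disc shape x ?y \<inter> cball a L"
    have A: "?A \<in> lmeasurable"
      using disc_measurable[OF x y] by (intro bounded_set_imp_lmeasurable) auto
    \<comment> \<open>Off this null set every point is interior to exactly one tile of each tiling,
      so the covering tiles of both can be compared.\<close>
    define M where "M = (\<Union>\<zeta>\<in>x \<union> ?y. frontier (S \<zeta>))"
    have M: "negligible M"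
      unfolding M_def
      using countable_nonoverlapping[OF X_nonoverlapping[OF x]] countable_nonoverlapping[OF X_nonoverlapping[OF y]]
      by (intro negligible_countable_Union) (auto simp: negligible_frontier_supp)
    define I where "I = {(\<tau>, \<sigma>) \<in> ?Q \<times> shift v ?Q. interior (S \<tau>) \<inter> interior (S \<sigma>) \<noteq> {} \<and> noncoincident n \<tau> \<sigma> \<inter> ?A \<noteq> {}}"
    have finI: "finite I" unfolding I_def using fin by (auto intro: finite_subset[of _ "?Q \<times> shift v ?Q"])
    have "vol ?A \<le> (\<Sum>(\<tau>, \<sigma>)\<in>I. vol (noncoincident n \<tau> \<sigma>))"
    proof (rule vol_le_sum_noncoincident[OF fin A _ M I_def])
      show "?A \<subseteq> M \<union> (\<Union>(\<tau>, \<sigma>)\<in>?Q \<times> shift v ?Q. noncoincident n \<tau> \<sigma> \<inter> ?A)"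
      proof
        fix p assume p: "p \<in> ?A"
        show "p \<in> M \<union> (\<Union>(\<tau>, \<sigma>)\<in>?Q \<times> shift v ?Q. noncoincident n \<tau> \<sigma> \<inter> ?A)"
        proof (cases "p \<in> M")
          case False
          obtain \<zeta>1 where \<zeta>1: "\<zeta>1 \<in> x" "p \<in> S \<zeta>1" using X_cover[OF x] by blast
          obtain \<zeta>2 where \<zeta>2: "\<zeta>2 \<in> ?y" "p \<in> S \<zeta>2" using X_cover[OF y] by blast
          have int: "p \<in> interior (S \<zeta>)" if "\<zeta> \<in> x \<union> ?y" "p \<in> S \<zeta>" for \<zeta>
          proof -
            have "p \<notin> frontier (S \<zeta>)" using False that(1) unfolding M_def by blast
            then show ?thesis using that(2) closed_supp[of \<zeta>] by (simp add: frontier_def)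
          qed
          obtain \<zeta> where \<zeta>: "\<zeta> \<in> sym_diff x ?y" "p \<in> S \<zeta>" using p unfolding disc_def by blast
          have ne: "\<zeta>1 \<noteq> \<zeta>2"
          proof
            assume eq: "\<zeta>1 = \<zeta>2"
            have "\<zeta> = \<zeta>1" if "\<zeta> \<in> x"
              using nonoverlapping_eqI[OF X_nonoverlapping[OF x] \<zeta>1(1) that int] \<zeta>1 \<zeta>(2) by auto
            moreover have "\<zeta> = \<zeta>2" if "\<zeta> \<in> ?y"
              using nonoverlapping_eqI[OF X_nonoverlapping[OF y] \<zeta>2(1) that int] \<zeta>2 \<zeta>(2) by auto
            ultimately show False using \<zeta>(1) \<zeta>1 \<zeta>2 eq by blast
          qed
          have pa: "p \<in> cball a L" using p by blast
          have "\<zeta>1 \<in> patch_at shape x a L" "\<zeta>2 \<in> patch_at shape ?y a L"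
            using \<zeta>1 \<zeta>2 pa by (auto intro: patch_atI)
          then have "\<zeta>1 \<in> Y1" "\<zeta>2 \<in> Y2" unfolding P1 P2 by (auto simp: patch_at_def)
          then obtain \<tau> \<sigma> where ts: "\<tau> \<in> ?Q" "\<zeta>1 \<in> infl n {\<tau>}" "\<sigma> \<in> shift v ?Q" "\<zeta>2 \<in> infl n {\<sigma>}"
            unfolding Y1_def Y2_def using infl_Union[of n ?Q] infl_Union[of n "shift v ?Q"] by blast
          have sub: "infl n {\<tau>} \<subseteq> Y1" "infl n {\<sigma>} \<subseteq> Y2"
            unfolding Y1_def Y2_def by (rule infl_mono, use ts in blast)+
          have "p \<notin> S \<xi>" if \<xi>: "\<xi> \<in> infl n {\<tau>} \<inter> infl n {\<sigma>}" for \<xi>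
          proof
            assume p\<xi>: "p \<in> S \<xi>"
            have "\<xi> \<in> patch_at shape Y1 a L" "\<xi> \<in> patch_at shape Y2 a L"
              using sub \<xi> p\<xi> pa by (auto intro: patch_atI)
            then have "\<xi> \<in> x" "\<xi> \<in> ?y" unfolding P1[symmetric] P2[symmetric] by (auto simp: patch_at_def)
            then have "\<zeta>1 = \<xi>" "\<zeta>2 = \<xi>"
              using nonoverlapping_eqI[OF X_nonoverlapping[OF x] \<zeta>1(1) _ int p\<xi>]
                nonoverlapping_eqI[OF X_nonoverlapping[OF y] \<zeta>2(1) _ int p\<xi>] \<zeta>1 \<zeta>2 by blast+
            with ne show False by simp
          qed
          moreover have "p \<in> (*\<^sub>R) (lam ^ n) ` S \<tau>" "p \<in> (*\<^sub>R) (lam ^ n) ` S \<sigma>"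
            using infl_supp_subset[OF ts(2)] infl_supp_subset[OF ts(4)] \<zeta>1 \<zeta>2 by blast+
          ultimately have "p \<in> noncoincident n \<tau> \<sigma>" unfolding noncoincident_def by blast
          with ts p show ?thesis by (intro UnI2 UN_I[of "(\<tau>, \<sigma>)"]) auto
        qed simp
      qed
    qed
    also have "\<dots> \<le> (\<Sum>(\<tau>, \<sigma>)\<in>I. \<theta> ^ j * (lam ^ n) ^ DIM('a) * vol (S \<tau> \<inter> S \<sigma>))"
    proof (rule sum_mono)
      fix q assume i: "q \<in> I"
      have "overlap (fst q) (snd q)"
        unfolding overlap_def
      proof (intro conjI bexI[of _ x'] bexI[of _ v])
        show "shift_tile (- v) (snd q) \<in> x'" using i x'(2) unfolding I_def by (auto simp: mem_shift)
      qed (use i x' v in \<open>auto simp: I_def\<close>)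
      then show "(case q of (\<tau>, \<sigma>) \<Rightarrow> vol (noncoincident n \<tau> \<sigma>)) \<le> (case q of (\<tau>, \<sigma>) \<Rightarrow> \<theta> ^ j * (lam ^ n) ^ DIM('a) * vol (S \<tau> \<inter> S \<sigma>))"
        using decay unfolding n_def by (simp add: case_prod_unfold)
    qed
    also have "\<dots> = \<theta> ^ j * (lam ^ n) ^ DIM('a) * (\<Sum>(\<tau>, \<sigma>)\<in>I. vol (S \<tau> \<inter> S \<sigma>))"
      by (simp add: sum_distrib_left case_prod_unfold)
    \<comment> \<open>The overlaps are measured before inflation, where the ball has radius
      \<open>L / lam ^ n\<close> and a tile meeting it protrudes by at most
      \<open>2 * R0\<close>.\<close>
    also have "\<dots> \<le> \<theta> ^ j * (lam ^ n) ^ DIM('a) * vol (cball ((1 / lam ^ n) *\<^sub>R a) (L / lam ^ n + 2 * R0))"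
    proof (intro mult_left_mono sum_vol_Int_le[OF noQ finI])
      show "I \<subseteq> ?Q \<times> shift v ?Q" unfolding I_def by blast
      fix \<tau> \<sigma> assume "(\<tau>, \<sigma>) \<in> I"
      then obtain p where p: "p \<in> noncoincident n \<tau> \<sigma>" "p \<in> cball a L" unfolding I_def by blast
      then obtain p' where p': "p' \<in> S \<tau>" "p = lam ^ n *\<^sub>R p'" unfolding noncoincident_def by blast
      have "dist ((1 / lam ^ n) *\<^sub>R a) p' = dist a p / lam ^ n"
      proof -
        have "a - p = lam ^ n *\<^sub>R ((1 / lam ^ n) *\<^sub>R a - p')" using lam by (simp add: p'(2) scaleR_diff_right)
        then show ?thesis using lam by (simp add: dist_norm)
      qed
      then have d: "dist ((1 / lam ^ n) *\<^sub>R a) p' \<le> L / lam ^ n" using p(2) by (simp add: divide_right_mono)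
      show "S \<tau> \<inter> S \<sigma> \<subseteq> cball ((1 / lam ^ n) *\<^sub>R a) (L / lam ^ n + 2 * R0)"
      proof
        fix s assume "s \<in> S \<tau> \<inter> S \<sigma>"
        then have "dist p' s \<le> 2 * R0" using p'(1) dist_supp by blast
        with d show "s \<in> cball ((1 / lam ^ n) *\<^sub>R a) (L / lam ^ n + 2 * R0)"
          using dist_triangle[of "(1 / lam ^ n) *\<^sub>R a" s p'] by simp
      qed
    qed (use \<theta> lam in auto)
    also have "\<dots> = \<theta> ^ j * vol (cball a (L + 2 * R0 * lam ^ n))"
    proof -
      have "L + 2 * R0 * lam ^ n = lam ^ n * (L / lam ^ n + 2 * R0)" using lam by (simp add: algebra_simps)
      moreover have "L / lam ^ n + 2 * R0 \<ge> 0" using L0 R0 by simp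
      moreover have "lam ^ n * (L / lam ^ n + 2 * R0) \<ge> 0" using L0 R0 lam by simp
      ultimately show ?thesis
        by (simp only: vol_cball[of "lam ^ n * (L / lam ^ n + 2 * R0)" a]
            vol_cball[of "L / lam ^ n + 2 * R0" "(1 / lam ^ n) *\<^sub>R a"] power_mult_distrib mult.assoc)
    qed
    finally show ?thesis unfolding w_def n_def .
  qed
  with \<theta> show ?thesis by blast
qed

end

section \<open>Densities along Folner sequences\<close>

definition dens :: "(nat \<Rightarrow> 'a::euclidean_space set) \<Rightarrow> 'a set \<Rightarrow> nat \<Rightarrow> real" where
  "dens F A n = vol (A \<inter> F n) / vol (F n)"

lemma upper_density_alt: "upper_density F A = limsup (\<lambda>n. ereal (dens F A n))"
  by (simp add: upper_density_def dens_def)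

lemma folnerD:
  assumes "folner F"
  shows "F n \<in> lmeasurable" "vol (F n) > 0"
    "(\<lambda>n. vol (sym_diff (F n) ((+) t ` F n)) / vol (F n)) \<longlonglongrightarrow> 0"
  using assms by (auto simp: folner_def)

lemma translation_emeasure:
  fixes C :: "'a::euclidean_space set"
  assumes "C \<in> sets borel"
  shows "(+) s ` C \<in> sets borel" "emeasure lborel ((+) s ` C) = emeasure lborel C"
proof -
  have eq: "(+) s ` C = (\<lambda>q. q - s) -` C \<inter> space borel"
    by (auto intro: image_eqI[where x = "_ - s"])
  show *: "(+) s ` C \<in> sets borel" unfolding eq using assms by measurable
  have "emeasure lborel ((+) s ` C) = emeasure lebesgue ((+) s ` C)" using * by simp
  also have "\<dots> = emeasure lebesgue C" using emeasure_lebesgue_affine[of 1 s C] by (simp add: add.commute cong: image_cong_simp)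
  finally show "emeasure lborel ((+) s ` C) = emeasure lborel C" using assms by simp
qed

text \<open>
  Fubini for the pairs \<open>(s, p)\<close> with \<open>s\<close> in the ball, \<open>p \<in> C\<close> and \<open>s + p \<in> A\<close>.
\<close>

lemma ball_average_le:
  fixes A C :: "'a::euclidean_space set"
  assumes A: "A \<in> sets borel" and C: "C \<in> sets borel" "emeasure lborel C < \<infinity>"
    and c: "0 \<le> c" "\<And>a. c \<le> vol (A \<inter> cball a L)"
  shows "c * measure lborel C \<le> measure lborel (cball (0::'a) L) * measure lborel (A \<inter> C) +
    (\<integral>s. indicator (cball 0 L) s * measure lborel ((+) s ` C - C) \<partial>lborel)"
    and "(\<lambda>s. measure lborel ((+) s ` C - C)) \<in> borel_measurable lborel"
proof -
  note [measurable] = A C(1)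
  let ?B = "cball (0::'a) L"
  let ?Q = "{z \<in> space (lborel \<Otimes>\<^sub>M lborel). fst z \<in> ?B \<and> snd z \<in> C \<and> fst z + snd z \<in> A}"
  have Q: "?Q \<in> sets (lborel \<Otimes>\<^sub>M lborel)"
  proof -
    have "(\<lambda>z. fst z + snd z) \<in> borel_measurable (lborel \<Otimes>\<^sub>M (lborel :: 'a measure))" by simp
    from measurable_sets[OF this A] have "(?B \<times> C) \<inter> ((\<lambda>z. fst z + snd z) -` A \<inter> space (lborel \<Otimes>\<^sub>M lborel)) \<in> sets (lborel \<Otimes>\<^sub>M lborel)"
      by (rule sets.Int[rotated]) (intro pair_measureI, use C(1) in auto)
    also have "(?B \<times> C) \<inter> ((\<lambda>z. fst z + snd z) -` A \<inter> space (lborel \<Otimes>\<^sub>M lborel)) = ?Q" by auto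
    finally show ?thesis .
  qed
  let ?R = "{z \<in> space (lborel \<Otimes>\<^sub>M lborel). snd z - fst z \<in> C \<and> snd z \<notin> C}"
  have R: "?R \<in> sets (lborel \<Otimes>\<^sub>M lborel)"
  proof -
    have "(\<lambda>z. snd z - fst z) \<in> borel_measurable (lborel \<Otimes>\<^sub>M (lborel :: 'a measure))" by simp
    from measurable_sets[OF this C(1)] have "((\<lambda>z. snd z - fst z) -` C \<inter> space (lborel \<Otimes>\<^sub>M lborel)) - UNIV \<times> C \<in> sets (lborel \<Otimes>\<^sub>M lborel)"
      by (rule sets.Diff) (intro pair_measureI, use C(1) in auto)
    also have "((\<lambda>z. snd z - fst z) -` C \<inter> space (lborel \<Otimes>\<^sub>M lborel)) - UNIV \<times> C = ?R" by auto
    finally show ?thesis .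
  qed
  have secR: "Pair s -` ?R = (+) s ` C - C" for s
    by (auto simp: space_pair_measure intro: image_eqI[where x = "_ - s"])
  have mE: "(\<lambda>s. emeasure lborel ((+) s ` C - C)) \<in> borel_measurable lborel"
    using lborel.measurable_emeasure_Pair[OF R] unfolding secR .
  then show mm: "(\<lambda>s. measure lborel ((+) s ` C - C)) \<in> borel_measurable lborel"
    unfolding measure_def by measurable
  have tr: "(+) s ` C \<in> sets borel" "emeasure lborel ((+) s ` C) = emeasure lborel C" for s
    using translation_emeasure[OF C(1)] by blast+
  have finE: "emeasure lborel ((+) s ` C - C) \<le> emeasure lborel C" for s
    using tr[of s] C(1) by (metis Diff_subset emeasure_mono sets_lborel)
  have E_eq: "emeasure lborel ((+) s ` C - C) = ennreal (measure lborel ((+) s ` C - C))" for s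
    using finE[of s] C(2) by (intro emeasure_eq_ennreal_measure) (auto simp: top_unique)
  have C_eq: "emeasure lborel C = ennreal (measure lborel C)"
    using C(2) by (intro emeasure_eq_ennreal_measure) auto
  have AC: "emeasure lborel (A \<inter> C) = ennreal (measure lborel (A \<inter> C))"
    using C emeasure_mono[of "A \<inter> C" C lborel] by (intro emeasure_eq_ennreal_measure) (auto simp: top_unique)
  have iB: "(indicator ?B :: 'a \<Rightarrow> ennreal) \<in> borel_measurable lborel"
    by (rule borel_measurable_indicator) simp
  have "ennreal c * emeasure lborel C = (\<integral>\<^sup>+p. ennreal c * indicator C p \<partial>lborel)"
    using C(1) by (simp add: nn_integral_cmult_indicator)
  also have "\<dots> \<le> (\<integral>\<^sup>+p. emeasure lborel ((\<lambda>s. (s, p)) -` ?Q) \<partial>lborel)"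
  proof (rule nn_integral_mono)
    \<comment> \<open>For fixed \<open>p\<close> in \<open>C\<close> the section is a translate of
      \<open>A \<inter> cball p L\<close>, so its volume is at least \<open>c\<close>.\<close>
    fix p
    show "ennreal c * indicator C p \<le> emeasure lborel ((\<lambda>s. (s, p)) -` ?Q)"
    proof (cases "p \<in> C")
      case True
      have eq: "(+) p ` ((\<lambda>s. (s, p)) -` ?Q) = A \<inter> cball p L"
      proof (intro equalityI subsetI)
        fix q assume "q \<in> A \<inter> cball p L"
        then have "q - p \<in> (\<lambda>s. (s, p)) -` ?Q"
          using True by (simp add: space_pair_measure dist_norm norm_minus_commute)
        then show "q \<in> (+) p ` ((\<lambda>s. (s, p)) -` ?Q)" by (rule image_eqI[rotated]) simp
      qed (use True in \<open>auto simp: space_pair_measure dist_norm add.commute\<close>)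
      have sec: "(\<lambda>s. (s, p)) -` ?Q \<in> sets borel" using sets_Pair2[OF Q] by simp
      have "ennreal c \<le> emeasure lebesgue (A \<inter> cball p L)"
        using c(2)[of p] A bounded_set_imp_lmeasurable[of "A \<inter> cball p L"]
        by (subst emeasure_eq_measure2) (auto intro: ennreal_leI)
      also have "\<dots> = emeasure lborel ((\<lambda>s. (s, p)) -` ?Q)"
        using translation_emeasure[OF sec, of p] unfolding eq by simp
      finally show ?thesis using True by simp
    qed simp
  qed
  also have "\<dots> = emeasure (lborel \<Otimes>\<^sub>M lborel) ?Q"
    using lborel_pair.emeasure_pair_measure_alt2[OF Q] by simp
  also have "\<dots> = (\<integral>\<^sup>+s. emeasure lborel (Pair s -` ?Q) \<partial>lborel)"
    by (rule lborel.emeasure_pair_measure_alt[OF Q])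
  also have "\<dots> \<le> (\<integral>\<^sup>+s. indicator ?B s * emeasure lborel (A \<inter> C) + indicator ?B s * emeasure lborel ((+) s ` C - C) \<partial>lborel)"
  proof (rule nn_integral_mono)
    \<comment> \<open>For fixed \<open>s\<close> in the ball, \<open>s + p\<close> either stays in
      \<open>C\<close>, hence lies in \<open>A \<inter> C\<close>, or has left
      \<open>C\<close>.\<close>
    fix s
    show "emeasure lborel (Pair s -` ?Q) \<le> indicator ?B s * emeasure lborel (A \<inter> C) + indicator ?B s * emeasure lborel ((+) s ` C - C)"
    proof (cases "s \<in> ?B")
      case True
      have sec: "Pair s -` ?Q \<in> sets borel" using sets_Pair1[OF Q] by simp
      have "(+) s ` (Pair s -` ?Q) \<subseteq> (A \<inter> C) \<union> ((+) s ` C - C)" by auto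
      then have "emeasure lborel ((+) s ` (Pair s -` ?Q)) \<le> emeasure lborel ((A \<inter> C) \<union> ((+) s ` C - C))"
        using tr[of s] by (intro emeasure_mono) auto
      also have "\<dots> \<le> emeasure lborel (A \<inter> C) + emeasure lborel ((+) s ` C - C)"
        using tr[of s] by (intro emeasure_subadditive) auto
      finally show ?thesis using True translation_emeasure(2)[OF sec, of s] by simp
    next
      case False
      then have e: "Pair s -` ?Q = {}" by auto
      show ?thesis unfolding e by simp
    qed
  qed
  also have "\<dots> = (\<integral>\<^sup>+s. indicator ?B s * emeasure lborel (A \<inter> C) \<partial>lborel) + (\<integral>\<^sup>+s. indicator ?B s * emeasure lborel ((+) s ` C - C) \<partial>lborel)"
    by (intro nn_integral_add borel_measurable_times_ennreal borel_measurable_const mE iB)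
  also have "(\<integral>\<^sup>+s. indicator ?B s * emeasure lborel (A \<inter> C) \<partial>lborel) = emeasure lborel ?B * emeasure lborel (A \<inter> C)"
    by (subst nn_integral_multc[OF iB]) simp
  also have "emeasure lborel ?B = ennreal (measure lborel ?B)"
    by (rule emeasure_eq_ennreal_measure) (use emeasure_lborel_cball_finite[of "0::'a" L] in force)
  also have "(\<integral>\<^sup>+s. indicator ?B s * emeasure lborel ((+) s ` C - C) \<partial>lborel) =
     ennreal (\<integral>s. indicator ?B s * measure lborel ((+) s ` C - C) \<partial>lborel)"
  proof -
    have "(\<integral>\<^sup>+s. indicator ?B s * emeasure lborel ((+) s ` C - C) \<partial>lborel) =
        (\<integral>\<^sup>+s. ennreal (indicator ?B s * measure lborel ((+) s ` C - C)) \<partial>lborel)"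
      by (rule nn_integral_cong) (simp add: E_eq ennreal_mult' flip: ennreal_indicator)
    also have "\<dots> = ennreal (\<integral>s. indicator ?B s * measure lborel ((+) s ` C - C) \<partial>lborel)"
    proof (rule nn_integral_eq_integral)
      have "integrable lborel (\<lambda>s. indicator ?B s * measure lborel C)"
        using emeasure_lborel_cball_finite[of "0::'a" L] by (intro integrable_mult_left integrable_real_indicator) auto
      then show "integrable lborel (\<lambda>s. indicator ?B s * measure lborel ((+) s ` C - C))"
      proof (rule Bochner_Integration.integrable_bound)
        show "(\<lambda>s. indicator ?B s * measure lborel ((+) s ` C - C)) \<in> borel_measurable lborel"
          by (intro borel_measurable_times borel_measurable_indicator mm) auto
        show "AE s in lborel. norm (indicator ?B s * measure lborel ((+) s ` C - C)) \<le> norm (indicator ?B s * measure lborel C)"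
        proof (rule AE_I2)
          fix s
          have "measure lborel ((+) s ` C - C) \<le> measure lborel C"
            using finE[of s] unfolding E_eq C_eq by simp
          then show "norm (indicator ?B s * measure lborel ((+) s ` C - C)) \<le> norm (indicator ?B s * measure lborel C)"
            by (auto simp: indicator_def)
        qed
      qed
    qed auto
    finally show ?thesis .
  qed
  finally have "ennreal c * ennreal (measure lborel C) \<le> ennreal (measure lborel ?B) * ennreal (measure lborel (A \<inter> C)) +
      ennreal (\<integral>s. indicator ?B s * measure lborel ((+) s ` C - C) \<partial>lborel)"
    unfolding C_eq AC .
  then show "c * measure lborel C \<le> measure lborel ?B * measure lborel (A \<inter> C) +
    (\<integral>s. indicator ?B s * measure lborel ((+) s ` C - C) \<partial>lborel)"
    using c(1) by (simp flip: ennreal_mult ennreal_plus)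
qed

text \<open>The Fubini argument works with Borel sets, so each \<open>F n\<close> is replaced by a
  Borel subset that differs from it by a null set.\<close>

lemma folner_borel:
  fixes F :: "nat \<Rightarrow> 'a::euclidean_space set"
  assumes "folner F"
  shows "\<exists>G. \<forall>n. G n \<in> sets borel \<and> G n \<subseteq> F n \<and> negligible (F n - G n)"
proof -
  have "\<exists>G. G \<in> sets borel \<and> G \<subseteq> F n \<and> negligible (F n - G)" for n
  proof -
    have "F n \<in> sets lebesgue" using folnerD(1)[OF assms] by blast
    then obtain C T where CT: "fsigma C" "T \<in> null_sets lebesgue" "C \<union> T = F n" "disjnt C T"
      by (rule lebesgue_set_almost_fsigma)
    then have "fsigma C" "negligible T" "C \<union> T = F n" by (simp_all add: negligible_iff_null_sets)
    moreover from this have "F n - C \<subseteq> T" by blast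
    ultimately show ?thesis
      by (intro exI[of _ C]) (auto intro: negligible_subset elim!: fsigma.cases)
  qed
  then show ?thesis by metis
qed

text \<open>The ball bound is averaged over all translates of \<open>F n\<close> by vectors of the
  ball. The error is the mean of the boundary ratios \<open>\<phi> n s\<close> over
  \<open>s\<close>; they are bounded by 1 and tend to 0 for each \<open>s\<close> separately, so
  dominated convergence suffices.\<close>

lemma dens_lower:
  fixes A :: "'a::euclidean_space set"
  assumes F: "folner F" and A: "A \<in> sets borel" and L: "L > 0"
    and c: "\<And>a. c * vol (cball (0::'a) L) \<le> vol (A \<inter> cball a L)" and "e > 0"
  shows "\<forall>\<^sub>F n in sequentially. c - e \<le> dens F A n"
proof (cases "c \<ge> 0")
  case False
  have "0 \<le> dens F A n" for n by (simp add: dens_def)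
  with False \<open>e > 0\<close> show ?thesis by (intro always_eventually allI) (smt (verit))
next
  case True
  let ?B = "cball (0::'a) L"
  have VB: "measure lborel ?B > 0" using L by simp
  obtain G where G: "\<And>n. G n \<in> sets borel" "\<And>n. G n \<subseteq> F n" "\<And>n. negligible (F n - G n)"
    using folner_borel[OF F] by blast
  have Fm: "F n \<in> lmeasurable" "vol (F n) > 0" for n using folnerD[OF F] by auto
  have GF: "vol (D \<inter> G n) = vol (D \<inter> F n)" if "D \<in> sets lebesgue" for D n
  proof (rule measure_negligible_symdiff)
    show "D \<inter> F n \<in> lmeasurable" using that Fm(1) by (metis fmeasurable_Int_fmeasurable inf_commute)
    show "negligible ((D \<inter> F n - D \<inter> G n) \<union> (D \<inter> G n - D \<inter> F n))"
      by (rule negligible_subset[OF G(3)[of n]]) (use G(2) in blast)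
  qed
  have GF1: "measure lborel (G n) = vol (F n)" for n using GF[of UNIV n] G(1)[of n] by simp
  have Gfin: "emeasure lborel (G n) < \<infinity>" for n
  proof -
    have "emeasure lborel (G n) = emeasure lebesgue (G n)" using G(1)[of n] by simp
    also have "\<dots> \<le> emeasure lebesgue (F n)" using G(2) Fm(1) by (intro emeasure_mono) auto
    also have "\<dots> < \<infinity>" using Fm(1)[of n] by (simp only: fmeasurable_def mem_Collect_eq)
    finally show ?thesis .
  qed
  \<comment> \<open>The proportion of the translated set that leaves \<open>F n\<close>, computed
    with the Borel part.\<close>
  define \<phi> where "\<phi> n s = measure lborel ((+) s ` G n - G n) / vol (F n)" for n s
  have trF: "(+) s ` F n \<in> lmeasurable" for s n by (rule measurable_translation[OF Fm(1)])
  have sd: "sym_diff (F n) ((+) s ` F n) \<in> lmeasurable" for n s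
    by (intro fmeasurable.Un fmeasurable.Diff fmeasurableD Fm(1) trF)
  have FG: "F n - G n \<in> lmeasurable" for n using G(3) by (rule negligible_imp_measurable)
  have \<phi>le: "\<phi> n s \<le> vol (sym_diff (F n) ((+) s ` F n)) / vol (F n)" for n s
  proof -
    have "measure lborel ((+) s ` G n - G n) = vol ((+) s ` G n - G n)"
      using G(1) translation_emeasure(1)[OF G(1)] by simp
    also have "\<dots> \<le> vol (sym_diff (F n) ((+) s ` F n) \<union> (F n - G n))"
    proof (rule measure_mono_fmeasurable)
      show "(+) s ` G n - G n \<subseteq> sym_diff (F n) ((+) s ` F n) \<union> (F n - G n)" using G(2)[of n] by blast
      show "(+) s ` G n - G n \<in> sets lebesgue" using G(1) translation_emeasure(1)[OF G(1)] by simp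
      show "sym_diff (F n) ((+) s ` F n) \<union> (F n - G n) \<in> lmeasurable"
        by (rule fmeasurable.Un[OF sd FG])
    qed
    also have "\<dots> \<le> vol (sym_diff (F n) ((+) s ` F n)) + vol (F n - G n)"
      by (intro measure_Un_le fmeasurableD sd FG)
    also have "vol (F n - G n) = 0" using G(3) by (rule negligible_imp_measure0)
    finally show ?thesis unfolding \<phi>_def using Fm(2)[of n] by (simp add: divide_right_mono)
  qed
  have \<phi>0: "0 \<le> \<phi> n s" for n s by (simp add: \<phi>_def)
  have \<phi>lim: "(\<lambda>n. \<phi> n s) \<longlonglongrightarrow> 0" for s
    by (rule tendsto_sandwich[OF _ _ tendsto_const folnerD(3)[OF F, of s]]) (auto simp: \<phi>0 \<phi>le)
  have \<phi>1: "\<phi> n s \<le> 1" for n s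
  proof -
    have "emeasure lborel ((+) s ` G n - G n) \<le> emeasure lborel ((+) s ` G n)"
      using translation_emeasure(1)[OF G(1)] by (intro emeasure_mono) auto
    then have "measure lborel ((+) s ` G n - G n) \<le> measure lborel ((+) s ` G n)"
      using translation_emeasure(2)[OF G(1), of s n] Gfin[of n] unfolding measure_def by (intro enn2real_mono) auto
    also have "\<dots> = measure lborel (G n)" unfolding measure_def translation_emeasure(2)[OF G(1)] by (rule refl)
    also have "\<dots> = vol (F n)" by (rule GF1)
    finally show ?thesis unfolding \<phi>_def using Fm(2)[of n] by simp
  qed
  have mes: "(\<lambda>s. \<phi> n s) \<in> borel_measurable lborel" for n
    unfolding \<phi>_def using ball_average_le(2)[OF A G(1) Gfin, of "0" L n] by simp
  have "(\<lambda>n. \<integral>s. indicator ?B s * \<phi> n s \<partial>lborel) \<longlonglongrightarrow> (\<integral>s. 0 \<partial>(lborel :: 'a measure))"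
  proof (rule integral_dominated_convergence[where w = "indicator ?B"])
    show "integrable lborel (indicator ?B :: 'a \<Rightarrow> real)"
      using emeasure_lborel_cball_finite[of "0::'a" L] by (intro integrable_real_indicator) auto
    show "(\<lambda>s. indicator ?B s * \<phi> n s) \<in> borel_measurable lborel" for n
      by (intro borel_measurable_times borel_measurable_indicator mes) auto
    show "AE s in lborel. (\<lambda>n. indicator ?B s * \<phi> n s) \<longlonglongrightarrow> 0"
      by (intro AE_I2 tendsto_mult_right_zero \<phi>lim)
    show "AE s in lborel. norm (indicator ?B s * \<phi> n s) \<le> indicator ?B s" for n
      using \<phi>0 \<phi>1 by (intro AE_I2) (auto simp: indicator_def)
  qed auto
  then have lim: "(\<lambda>n. (\<integral>s. indicator ?B s * \<phi> n s \<partial>lborel) / measure lborel ?B) \<longlonglongrightarrow> 0"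
    using tendsto_divide_zero by fastforce
  have ev: "\<forall>\<^sub>F n in sequentially. (\<integral>s. indicator ?B s * \<phi> n s \<partial>lborel) / measure lborel ?B < e"
    by (rule order_tendstoD(2)[OF lim \<open>e > 0\<close>])
  have ineq: "c \<le> dens F A n + (\<integral>s. indicator ?B s * \<phi> n s \<partial>lborel) / measure lborel ?B" for n
  proof -
    have "c * measure lborel ?B * measure lborel (G n) \<le> measure lborel ?B * measure lborel (A \<inter> G n) +
        (\<integral>s. indicator ?B s * measure lborel ((+) s ` G n - G n) \<partial>lborel)"
      using c True by (intro ball_average_le(1)[OF A G(1) Gfin]) auto
    also have "measure lborel (A \<inter> G n) = vol (A \<inter> F n)" using GF[of A n] A G(1)[of n] by simp
    also have "(\<integral>s. indicator ?B s * measure lborel ((+) s ` G n - G n) \<partial>lborel) = vol (F n) * (\<integral>s. indicator ?B s * \<phi> n s \<partial>lborel)"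
      unfolding \<phi>_def using Fm(2)[of n] by simp
    finally have "c * measure lborel ?B * vol (F n) \<le> measure lborel ?B * vol (A \<inter> F n) + vol (F n) * (\<integral>s. indicator ?B s * \<phi> n s \<partial>lborel)"
      by (simp only: GF1)
    then have "(c * measure lborel ?B * vol (F n)) / (measure lborel ?B * vol (F n)) \<le>
        (measure lborel ?B * vol (A \<inter> F n) + vol (F n) * (\<integral>s. indicator ?B s * \<phi> n s \<partial>lborel)) / (measure lborel ?B * vol (F n))"
      using VB Fm(2)[of n] by (intro divide_right_mono) auto
    then show ?thesis
      using VB Fm(2)[of n] by (simp add: dens_def add_divide_distrib)
  qed
  show ?thesis
    using ev
  proof eventually_elim
    fix n assume "(\<integral>s. indicator ?B s * \<phi> n s \<partial>lborel) / measure lborel ?B < e"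
    with ineq[of n] show "c - e \<le> dens F A n" by linarith
  qed
qed

lemma dens_compl:
  assumes "folner F" "A \<in> sets borel"
  shows "dens F (- A) n = 1 - dens F A n"
proof -
  have m: "F n \<in> lmeasurable" "vol (F n) > 0" using folnerD[OF assms(1)] by auto
  have AF: "A \<inter> F n \<in> lmeasurable" using m(1) assms(2) by (metis fmeasurable_Int_fmeasurable inf_commute sets_completionI_sets sets_lborel)
  have "vol (F n - A \<inter> F n) = vol (F n) - vol (A \<inter> F n)"
    using m AF by (intro measurable_measure_Diff) auto
  moreover have "F n - A \<inter> F n = - A \<inter> F n" by blast
  ultimately show ?thesis using m(2) by (simp add: dens_def field_simps)
qed

text \<open>One radius has to serve all centres, while the approximate density \<open>c\<close> may
  change with \<open>e\<close>. This gives the same density along every Folner sequence.\<close>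

definition mean_uniform :: "'a::euclidean_space set \<Rightarrow> bool" where
  "mean_uniform A \<longleftrightarrow> (\<forall>e>0. \<exists>L>0. \<exists>c. \<forall>a. \<bar>vol (A \<inter> cball a L) - c * vol (cball a L)\<bar> \<le> e * vol (cball a L))"

lemma vol_cball_center: "vol (cball (a::'a::euclidean_space) L) = vol (cball (0::'a) L)"
  using measure_translation[of a "cball 0 L"] by simp

text \<open>The lower estimate is used twice: for \<open>A\<close> along \<open>G\<close>, and for
  the complement of \<open>A\<close> along \<open>F\<close>, where it bounds the density of
  \<open>A\<close> from above. Both densities end up within \<open>e / 2\<close> of
  \<open>c\<close>.\<close>

lemma upper_density_le:
  fixes A :: "'a::euclidean_space set"
  assumes A: "A \<in> sets borel" "mean_uniform A" and F: "folner F" "folner G"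
  shows "upper_density F A \<le> upper_density G A"
proof -
  have "upper_density F A \<le> upper_density G A + ereal e" if e: "e > 0" for e
  proof -
    obtain L c where L: "L > 0" "\<And>a. \<bar>vol (A \<inter> cball a L) - c * vol (cball a L)\<bar> \<le> e / 4 * vol (cball a L)"
      using A(2) e unfolding mean_uniform_def by (metis zero_less_divide_iff zero_less_numeral)
    let ?V = "vol (cball (0::'a) L)"
    have b: "(c - e / 4) * ?V \<le> vol (A \<inter> cball a L)" "vol (A \<inter> cball a L) \<le> (c + e / 4) * ?V" for a
      using L(2)[of a] unfolding vol_cball_center[of a] left_diff_distrib distrib_right by linarith+
    have 1: "\<forall>\<^sub>F n in sequentially. c - e / 4 - e / 4 \<le> dens G A n"
      using e by (intro dens_lower[OF F(2) A(1) L(1) b(1)]) auto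
    have "(1 - (c + e / 4)) * ?V \<le> vol (- A \<inter> cball a L)" for a
    proof -
      have "vol (cball a L - A \<inter> cball a L) = vol (cball a L) - vol (A \<inter> cball a L)"
        using A(1) by (intro measurable_measure_Diff) auto
      moreover have "cball a L - A \<inter> cball a L = - A \<inter> cball a L" by blast
      ultimately show ?thesis using b(2)[of a] unfolding vol_cball_center[of a] by (simp add: algebra_simps)
    qed
    then have "\<forall>\<^sub>F n in sequentially. 1 - (c + e / 4) - e / 4 \<le> dens F (- A) n"
      using e A(1) by (intro dens_lower[OF F(1) _ L(1)]) auto
    then have 2: "\<forall>\<^sub>F n in sequentially. dens F A n \<le> c + e / 2"
      by eventually_elim (simp add: dens_compl[OF F(1) A(1)])
    have "upper_density F A \<le> ereal (c + e / 2)"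
      unfolding upper_density_alt by (rule Limsup_bounded) (use 2 in \<open>simp add: eventually_mono\<close>)
    also have "\<dots> = ereal (c - e / 4 - e / 4) + ereal e" by simp
    also have "\<dots> \<le> upper_density G A + ereal e"
    proof (rule add_right_mono)
      have "ereal (c - e / 4 - e / 4) \<le> liminf (\<lambda>n. ereal (dens G A n))"
        by (rule Liminf_bounded) (use 1 in \<open>simp add: eventually_mono\<close>)
      also have "\<dots> \<le> upper_density G A" unfolding upper_density_alt by (rule Liminf_le_Limsup) simp
      finally show "ereal (c - e / 4 - e / 4) \<le> upper_density G A" .
    qed
    finally show ?thesis .
  qed
  then show ?thesis by (rule ereal_le_epsilon2)
qed

lemma upper_density_folner_eq:
  assumes "A \<in> sets borel" "mean_uniform A" "folner F" "folner G"
  shows "upper_density F A = upper_density G A"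
  using upper_density_le[OF assms] upper_density_le[OF assms(1,2,4,3)] by (rule antisym)

lemma upper_density_leI:
  assumes "\<And>e. e > 0 \<Longrightarrow> \<forall>\<^sub>F n in sequentially. dens F A n \<le> d + e"
  shows "upper_density F A \<le> ereal d"
proof (rule ereal_le_epsilon2)
  fix e :: real assume "e > 0"
  have "limsup (\<lambda>n. ereal (dens F A n)) \<le> ereal (d + e)"
    by (rule Limsup_bounded) (use assms[OF \<open>e > 0\<close>] in \<open>simp add: eventually_mono\<close>)
  then show "upper_density F A \<le> ereal d + ereal e" by (simp add: upper_density_alt)
qed

lemma upper_density_leD:
  assumes "upper_density F A \<le> ereal d" "e > 0"
  shows "\<forall>\<^sub>F n in sequentially. dens F A n \<le> d + e"
proof -
  have "limsup (\<lambda>n. ereal (dens F A n)) < ereal (d + e)"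
  proof -
    have "limsup (\<lambda>n. ereal (dens F A n)) \<le> ereal d" using assms(1) by (simp add: upper_density_alt)
    also have "ereal d < ereal (d + e)" using assms(2) by simp
    finally show ?thesis .
  qed
  then have "\<forall>\<^sub>F n in sequentially. ereal (dens F A n) < ereal (d + e)" by (rule Limsup_lessD)
  then show ?thesis by eventually_elim simp
qed

lemma upper_density_nonneg: "0 \<le> upper_density F A"
proof -
  have "0 \<le> liminf (\<lambda>n. ereal (dens F A n))"
    by (rule Liminf_bounded) (simp add: dens_def)
  also have "\<dots> \<le> upper_density F A" unfolding upper_density_alt by (rule Liminf_le_Limsup) simp
  finally show ?thesis .
qed

lemma Int_folner_lmeasurable:
  assumes "folner F" "A \<in> sets lebesgue" shows "A \<inter> F n \<in> lmeasurable"
  using folnerD(1)[OF assms(1), of n] assms(2) by (metis fmeasurable_Int_fmeasurable inf_commute)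

lemma dens_mono:
  assumes "folner F" "A \<in> sets lebesgue" "B \<in> sets lebesgue" "A \<subseteq> B"
  shows "dens F A n \<le> dens F B n"
  unfolding dens_def using folnerD[OF assms(1)] assms(4)
  by (intro divide_right_mono measure_mono_fmeasurable fmeasurableD Int_folner_lmeasurable[OF assms(1)] assms(2,3)) auto

lemma dens_le_1:
  assumes "folner F" "A \<in> sets lebesgue" shows "dens F A n \<le> 1"
  using dens_mono[OF assms(1,2), of UNIV n] folnerD(2)[OF assms(1), of n] by (simp add: dens_def)

lemma upper_density_real:
  assumes "folner F" "A \<in> sets lebesgue"
  obtains d where "d \<ge> 0" "upper_density F A = ereal d"
proof -
  have "upper_density F A \<le> ereal 1"
  proof (rule upper_density_leI)
    fix e :: real assume "e > 0"
    then show "\<forall>\<^sub>F n in sequentially. dens F A n \<le> 1 + e"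
      using dens_le_1[OF assms] by (intro always_eventually allI) (meson add_increasing2 less_imp_le)
  qed
  then show thesis using upper_density_nonneg[of F A] that by (cases "upper_density F A") auto
qed

lemma upper_density_mono:
  assumes "folner F" "A \<in> sets lebesgue" "B \<in> sets lebesgue" "A \<subseteq> B"
  shows "upper_density F A \<le> upper_density F B"
  unfolding upper_density_alt by (intro Limsup_mono always_eventually allI) (simp add: dens_mono[OF assms])

lemma upper_density_Un:
  assumes "folner F" "A \<in> sets lebesgue" "B \<in> sets lebesgue"
  shows "upper_density F (A \<union> B) \<le> upper_density F A + upper_density F B"
proof -
  obtain a where a: "upper_density F A = ereal a" by (rule upper_density_real[OF assms(1,2)])
  obtain b where b: "upper_density F B = ereal b" by (rule upper_density_real[OF assms(1,3)])
  have "upper_density F (A \<union> B) \<le> ereal (a + b)"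
  proof (rule upper_density_leI)
    fix e :: real assume "e > 0"
    have "\<forall>\<^sub>F n in sequentially. dens F A n \<le> a + e / 2" "\<forall>\<^sub>F n in sequentially. dens F B n \<le> b + e / 2"
      using a b \<open>e > 0\<close> by (auto intro: upper_density_leD)
    then show "\<forall>\<^sub>F n in sequentially. dens F (A \<union> B) n \<le> a + b + e"
    proof eventually_elim
      fix n assume n: "dens F A n \<le> a + e / 2" "dens F B n \<le> b + e / 2"
      have "vol ((A \<union> B) \<inter> F n) \<le> vol (A \<inter> F n) + vol (B \<inter> F n)"
        unfolding Int_Un_distrib2 by (intro measure_Un_le fmeasurableD Int_folner_lmeasurable assms)
      then have "dens F (A \<union> B) n \<le> dens F A n + dens F B n"
        using folnerD(2)[OF assms(1), of n] by (simp add: dens_def divide_right_mono flip: add_divide_distrib)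
      with n show "dens F (A \<union> B) n \<le> a + b + e" by simp
    qed
  qed
  with a b show ?thesis by simp
qed

lemma upper_density_UN:
  assumes "folner F" "finite I" "\<And>i. i \<in> I \<Longrightarrow> A i \<in> sets lebesgue" "\<And>i. i \<in> I \<Longrightarrow> upper_density F (A i) \<le> ereal d" "d \<ge> 0"
  shows "upper_density F (\<Union>i\<in>I. A i) \<le> ereal (real (card I) * d)"
  using assms(2-)
proof (induction I rule: finite_induct)
  case empty
  have "upper_density F {} \<le> ereal 0" by (rule upper_density_leI) (simp add: dens_def)
  then show ?case by (simp add: zero_ereal_def)
next
  case (insert i I)
  have "upper_density F (\<Union>i\<in>insert i I. A i) \<le> upper_density F (A i) + upper_density F (\<Union>i\<in>I. A i)"
    using insert by (simp add: upper_density_Un[OF assms(1)] sets.finite_UN)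
  also have "\<dots> \<le> ereal d + ereal (real (card I) * d)"
    using insert by (intro add_mono) auto
  finally show ?case using insert by (simp add: algebra_simps)
qed

text \<open>The translation is moved from \<open>A\<close> to \<open>F n\<close>, at the cost of a
  symmetric difference that is negligible relative to \<open>F n\<close>.\<close>

lemma upper_density_translate:
  fixes A :: "'a::euclidean_space set"
  assumes F: "folner F" and A: "A \<in> sets borel"
  shows "upper_density F ((+) s ` A) \<le> upper_density F A"
proof -
  have AL: "A \<in> sets lebesgue" using A by simp
  obtain a where a: "upper_density F A = ereal a" by (rule upper_density_real[OF F AL])
  have "upper_density F ((+) s ` A) \<le> ereal a"
  proof (rule upper_density_leI)
    fix e :: real assume "e > 0"
    then have "\<forall>\<^sub>F n in sequentially. dens F A n \<le> a + e / 2"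
      by (intro upper_density_leD) (simp_all add: a)
    moreover have "\<forall>\<^sub>F n in sequentially. vol (sym_diff (F n) ((+) (- s) ` F n)) / vol (F n) < e / 2"
      by (rule order_tendstoD(2)[OF folnerD(3)[OF F]]) (use \<open>e > 0\<close> in simp)
    ultimately show "\<forall>\<^sub>F n in sequentially. dens F ((+) s ` A) n \<le> a + e"
    proof eventually_elim
      fix n assume n: "dens F A n \<le> a + e / 2" "vol (sym_diff (F n) ((+) (- s) ` F n)) / vol (F n) < e / 2"
      have Fm: "F n \<in> lmeasurable" by (rule folnerD(1)[OF F])
      have Ft: "(+) (- s) ` F n \<in> lmeasurable" by (rule measurable_translation[OF Fm])
      have eq: "(+) (- s) ` ((+) s ` A \<inter> F n) = A \<inter> (+) (- s) ` F n"
        by (subst image_Int) (auto simp: image_image)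
      have "vol ((+) s ` A \<inter> F n) = vol (A \<inter> (+) (- s) ` F n)"
        unfolding eq[symmetric] by (rule measure_translation[symmetric])
      also have "\<dots> \<le> vol ((A \<inter> F n) \<union> sym_diff (F n) ((+) (- s) ` F n))"
      proof (rule measure_mono_fmeasurable)
        show "A \<inter> (+) (- s) ` F n \<in> sets lebesgue" by (intro sets.Int AL fmeasurableD Ft)
        show "(A \<inter> F n) \<union> sym_diff (F n) ((+) (- s) ` F n) \<in> lmeasurable"
          by (intro fmeasurable.Un[OF Int_folner_lmeasurable[OF F AL]] fmeasurable.Un[OF fmeasurable.Diff fmeasurable.Diff] fmeasurableD Fm Ft)
      qed blast
      also have "\<dots> \<le> vol (A \<inter> F n) + vol (sym_diff (F n) ((+) (- s) ` F n))"
        by (intro measure_Un_le fmeasurableD fmeasurable.Un fmeasurable.Diff Fm Ft Int_folner_lmeasurable[OF F AL])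
      finally have "dens F ((+) s ` A) n \<le> dens F A n + vol (sym_diff (F n) ((+) (- s) ` F n)) / vol (F n)"
        using folnerD(2)[OF F, of n] by (simp add: dens_def divide_right_mono flip: add_divide_distrib)
      with n show "dens F ((+) s ` A) n \<le> a + e" by linarith
    qed
  qed
  with a show ?thesis by simp
qed

section \<open>Reflection at the origin\<close>

lemma uminus_image_borel: "A \<in> sets borel \<Longrightarrow> uminus ` A \<in> sets (borel :: 'a::euclidean_space measure)"
proof -
  assume [measurable]: "A \<in> sets borel"
  have "uminus ` A = uminus -` A \<inter> space borel" by (auto intro: image_eqI[where x = "- _"])
  also have "\<dots> \<in> sets borel" by measurable
  finally show ?thesis .
qed

lemma vol_uminus: "vol (uminus ` A) = vol (A :: 'a::euclidean_space set)"
  using vol_scale[of "- 1" A] by (simp add: scaleR_minus1_left[abs_def] cong: image_cong_simp)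

lemma folner_uminus:
  fixes F :: "nat \<Rightarrow> 'a::euclidean_space set"
  assumes "folner F" shows "folner (\<lambda>n. uminus ` F n)"
  unfolding folner_def
proof (intro conjI allI)
  fix n
  have eq: "uminus ` F n = (*\<^sub>R) (- 1) -` F n \<inter> space lebesgue" by (auto intro: image_eqI[where x = "- _"])
  have "F n \<in> sets lebesgue" using folnerD(1)[OF assms] by blast
  then have m: "uminus ` F n \<in> sets lebesgue"
    unfolding eq by (rule measurable_sets[OF lebesgue_measurable_scaling])
  have em: "emeasure lebesgue (uminus ` F n) = emeasure lebesgue (F n)"
    using emeasure_lebesgue_affine[of "- 1" 0 "F n"] by simp
  have "emeasure lebesgue (F n) < \<infinity>"
    using folnerD(1)[OF assms, of n] by (simp only: fmeasurable_def mem_Collect_eq)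
  then show "uminus ` F n \<in> lmeasurable"
    using m by (intro fmeasurableI) (simp_all only: em)
  show "0 < vol (uminus ` F n)" using folnerD(2)[OF assms] by (simp add: vol_uminus)
next
  fix t
  have eq: "sym_diff (uminus ` F n) ((+) t ` uminus ` F n) = uminus ` sym_diff (F n) ((+) (- t) ` F n)" for n
  proof -
    have i: "inj (uminus :: 'a \<Rightarrow> 'a)" by (rule injI) simp
    have "(+) t ` uminus ` F n = uminus ` (+) (- t) ` F n" by (simp add: image_image)
    then show ?thesis by (simp only: image_Un image_set_diff[OF i])
  qed
  show "(\<lambda>n. vol (sym_diff (uminus ` F n) ((+) t ` uminus ` F n)) / vol (uminus ` F n)) \<longlonglongrightarrow> 0"
    unfolding eq vol_uminus by (rule folnerD(3)[OF assms])
qed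

text \<open>Reflecting the set amounts to reflecting the Folner sequence, and the density of a
  mean-uniform set does not depend on that sequence.\<close>

lemma upper_density_uminus:
  fixes A :: "'a::euclidean_space set"
  assumes "A \<in> sets borel" "mean_uniform A" "folner F"
  shows "upper_density F (uminus ` A) = upper_density F A"
proof -
  have "dens F (uminus ` A) n = dens (\<lambda>n. uminus ` F n) A n" for n
  proof -
    have "uminus ` (uminus ` A \<inter> F n) = A \<inter> uminus ` F n"
      by (subst image_Int) (auto simp: image_image)
    then have "vol (uminus ` A \<inter> F n) = vol (A \<inter> uminus ` F n)" by (metis vol_uminus)
    then show ?thesis by (simp add: dens_def vol_uminus)
  qed
  then have "upper_density F (uminus ` A) = upper_density (\<lambda>n. uminus ` F n) A"
    by (simp add: upper_density_alt)
  also have "\<dots> = upper_density F A"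
    by (rule upper_density_folner_eq[OF assms(1,2) folner_uminus[OF assms(3)] assms(3)])
  finally show ?thesis .
qed

text \<open>The factor \<open>M\<close> adds \<open>ln M\<close> to the logarithm and the rescaling
  by \<open>C\<close> adds \<open>ln C\<close> to \<open>- ln \<nu>\<close>; both are negligible as
  \<open>- ln \<nu>\<close> tends to infinity.\<close>

lemma log_enat_mult_le:
  fixes f g :: "real \<Rightarrow> enat"
  assumes fg: "\<And>\<nu>. \<nu> > 0 \<Longrightarrow> f \<nu> \<le> of_nat M * g (\<nu> / C)" and M: "M \<ge> 1" and C: "C \<ge> 1"
  shows "Limsup (at_right 0) (\<lambda>\<nu>. log_enat (f \<nu>) / ereal (- ln \<nu>)) \<le> Limsup (at_right 0) (\<lambda>\<nu>. log_enat (g \<nu>) / ereal (- ln \<nu>))"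
    (is "?A \<le> ?B")
proof (rule dense_ge)
  fix z assume z: "?B < z"
  show "?A \<le> z"
  proof (cases z)
    case (real q)
    have "\<forall>\<^sub>F \<nu> in at_right 0. log_enat (g \<nu>) / ereal (- ln \<nu>) < ereal q"
      using Limsup_lessD[OF z] by (simp add: real)
    then obtain b where b: "b > 0" "\<And>\<nu>. 0 < \<nu> \<Longrightarrow> \<nu> < b \<Longrightarrow> log_enat (g \<nu>) / ereal (- ln \<nu>) < ereal q"
      unfolding eventually_at_right_field by auto
    \<comment> \<open>The quotient \<open>(ln M + q * (- ln \<nu> + ln C)) / (- ln \<nu>)\<close>,
      rearranged so that its limit \<open>q\<close> is visible.\<close>
    let ?h = "\<lambda>\<nu>. q + (ln (real M) + q * ln C) / (- ln \<nu>)"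
    have "\<forall>\<^sub>F \<nu> in at_right 0. log_enat (f \<nu>) / ereal (- ln \<nu>) \<le> ereal (?h \<nu>)"
      unfolding eventually_at_right_field
    proof (intro exI[of _ "min b 1"] conjI allI impI)
      fix \<nu> :: real assume \<nu>: "0 < \<nu>" "\<nu> < min b 1"
      have ln: "- ln \<nu> > 0" using \<nu> by simp
      have "\<nu> / C \<le> \<nu>" using C \<nu> by (simp add: field_simps)
      then have \<nu>C: "0 < \<nu> / C" "\<nu> / C < b" "\<nu> / C < 1" using \<nu> C by auto
      have lnC: "- ln (\<nu> / C) = - ln \<nu> + ln C" "- ln (\<nu> / C) > 0" using \<nu> C \<nu>C by (simp_all add: ln_div)
      have gq: "log_enat (g (\<nu> / C)) / ereal (- ln (\<nu> / C)) < ereal q" using b(2) \<nu>C by simp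
      have "g (\<nu> / C) \<noteq> \<infinity>"
      proof
        assume "g (\<nu> / C) = \<infinity>"
        then have "log_enat (g (\<nu> / C)) / ereal (- ln (\<nu> / C)) = \<infinity>"
          using lnC(2) by (simp add: log_enat_def)
        with gq show False by simp
      qed
      then obtain k where k: "g (\<nu> / C) = enat k" by auto
      obtain m where m: "f \<nu> = enat m" "m \<le> M * k"
        using fg[OF \<nu>(1)] unfolding k by (cases "f \<nu>") (auto simp: of_nat_eq_enat)
      show "log_enat (f \<nu>) / ereal (- ln \<nu>) \<le> ereal (?h \<nu>)"
      proof (cases "m = 0")
        case True
        then show ?thesis using ln m by (simp add: log_enat_def)
      next
        case False
        then have k0: "k > 0" using m(2) by (cases k) auto
        have "ln (real m) \<le> ln (real M) + ln (real k)"
        proof -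
          have "real m \<le> real M * real k" using m(2) by (metis of_nat_le_iff of_nat_mult)
          then have "ln (real m) \<le> ln (real M * real k)" using False by (subst ln_le_cancel_iff) (use k0 M in auto)
          then show ?thesis using k0 M by (simp add: ln_mult)
        qed
        moreover have "ln (real k) \<le> q * (- ln \<nu> + ln C)"
        proof -
          have "ln (real k) / (- ln (\<nu> / C)) < q" using gq k k0 lnC(2) by (simp add: log_enat_def)
          then have "ln (real k) < q * (- ln (\<nu> / C))" using lnC(2) by (simp only: pos_divide_less_eq)
          then show ?thesis unfolding lnC(1) by simp
        qed
        ultimately have "ln (real m) \<le> ln (real M) + q * (- ln \<nu> + ln C)" by simp
        then have "ln (real m) / (- ln \<nu>) \<le> (ln (real M) + q * (- ln \<nu> + ln C)) / (- ln \<nu>)"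
          using ln by (intro divide_right_mono) auto
        also have "\<dots> = ?h \<nu>" using ln by (simp add: field_simps)
        finally show ?thesis using False ln m(1) by (simp add: log_enat_def)
      qed
    qed (use b in auto)
    then have "?A \<le> Limsup (at_right 0) (\<lambda>\<nu>. ereal (?h \<nu>))" by (rule Limsup_mono)
    also have "((\<lambda>\<nu>. ?h \<nu>) \<longlongrightarrow> q + 0) (at_right 0)"
    proof (intro tendsto_add tendsto_const)
      have "filterlim (\<lambda>\<nu>::real. - ln \<nu>) at_top (at_right 0)"
        using ln_at_0 by (simp add: filterlim_uminus_at_top)
      then show "((\<lambda>\<nu>. (ln (real M) + q * ln C) / (- ln \<nu>)) \<longlongrightarrow> 0) (at_right 0)"
        by (intro tendsto_divide_0[OF tendsto_const] filterlim_at_top_imp_at_infinity)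
    qed
    then have "Limsup (at_right 0) (\<lambda>\<nu>. ereal (?h \<nu>)) = ereal (q + 0)"
      by (intro lim_imp_Limsup) auto
    finally show ?thesis by (simp add: real)
  qed (use z in auto)
qed

section \<open>Separation numbers\<close>

context control_point_inflation
begin

lemma norm_cp_bound: "norm (cp \<tau> - fst \<tau>) \<le> (\<Sum>i\<in>UNIV. norm (cp (0, i)))"
proof -
  have "cp \<tau> - fst \<tau> = cp (0, snd \<tau>)" using cp_alt[of \<tau>] by simp
  then show ?thesis using member_le_sum[of "snd \<tau>" UNIV "\<lambda>i. norm (cp (0, i))"] by simp
qed

definition cp_radius :: real where "cp_radius = R0 + (\<Sum>i\<in>UNIV. norm (cp (0, i)))"

lemma cp_radius_pos: "cp_radius > 0"
  unfolding cp_radius_def using R0 by (simp add: add_pos_nonneg sum_nonneg)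

lemma control_point_near:
  assumes "x \<in> X"
  obtains \<tau> where "\<tau> \<in> x" "norm (cp \<tau> - p) \<le> cp_radius"
proof -
  obtain \<tau> where \<tau>: "\<tau> \<in> x" "p \<in> S \<tau>" using X_cover[OF assms] by blast
  have "norm (fst \<tau> - p) \<le> R0" using dist_fst_supp[OF \<tau>(2)] by (simp add: dist_norm)
  then have "norm (cp \<tau> - p) \<le> cp_radius"
    unfolding cp_radius_def using norm_cp_bound[of \<tau>] norm_triangle_ineq[of "cp \<tau> - fst \<tau>" "fst \<tau> - p"] by simp
  with \<tau>(1) that show thesis by blast
qed

lemma \<Delta>_relatively_dense: "\<exists>v\<in>\<Delta>. norm (v - p) \<le> cp_radius"
proof -
  obtain x where x: "x \<in> X" using X_nonempty by blast
  obtain \<tau> where \<tau>: "\<tau> \<in> x" using X_cover[OF x, of 0] by blast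
  obtain \<sigma> where \<sigma>: "\<sigma> \<in> x" "norm (cp \<sigma> - (cp \<tau> + p)) \<le> cp_radius" using control_point_near[OF x] by blast
  show ?thesis by (rule bexI[OF _ \<Delta>I[OF x \<sigma>(1) \<tau>]]) (use \<sigma>(2) in \<open>simp add: algebra_simps\<close>)
qed

lemma \<Delta>_scaled_relatively_dense: "\<exists>v\<in>\<Delta>. norm (lam ^ n *\<^sub>R v - p) \<le> cp_radius * lam ^ n"
proof -
  obtain v where v: "v \<in> \<Delta>" "norm (v - (1 / lam ^ n) *\<^sub>R p) \<le> cp_radius" using \<Delta>_relatively_dense by blast
  have "lam ^ n *\<^sub>R v - p = lam ^ n *\<^sub>R (v - (1 / lam ^ n) *\<^sub>R p)" using lam by (simp add: scaleR_diff_right)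
  then have "norm (lam ^ n *\<^sub>R v - p) = lam ^ n * norm (v - (1 / lam ^ n) *\<^sub>R p)" using lam by simp
  also have "\<dots> \<le> lam ^ n * cp_radius" using v(2) by (intro mult_left_mono) auto
  finally show ?thesis using v(1) by (auto simp: mult.commute)
qed

lemma disc_shift: "disc shape (shift w x) (shift w y) = (+) w ` disc shape x y"
proof -
  have "sym_diff (shift w x) (shift w y) = shift_tile w ` sym_diff x y"
    unfolding shift_def by (simp add: image_Un image_set_diff[OF inj_shift_tile])
  moreover define D where "D = sym_diff x y"
  ultimately have "disc shape (shift w x) (shift w y) = (\<Union>\<tau>\<in>shift_tile w ` D. S \<tau>)"
    unfolding disc_def by simp
  also have "\<dots> = (+) w ` (\<Union>\<tau>\<in>D. S \<tau>)" by (simp add: supp_shift_tile image_UN)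
  finally show ?thesis unfolding disc_def D_def .
qed

lemma disc_triangle: "disc shape x z \<subseteq> disc shape x y \<union> disc shape y z"
  unfolding disc_def by blast

lemma disc_commute: "disc shape x y = disc shape y x"
  unfolding disc_def by (simp add: Un_commute)

end

context pure_point_inflation
begin

text \<open>For some \<open>v\<close> in \<open>\<Delta>\<close> the vector
  \<open>w = lam ^ (j * N) *\<^sub>R v\<close> is close to \<open>a - b\<close>. By the triangle
  inclusion, \<open>disc\<close> of \<open>x\<close> and \<open>y\<close> near \<open>a\<close> lies
  in the discrepancies of \<open>x\<close> and of \<open>y\<close> with their translates by
  \<open>w\<close>, which are small, and in the translate by \<open>w\<close> of \<open>disc\<close>
  of \<open>x\<close> and \<open>y\<close>, seen in a slightly larger ball around
  \<open>b\<close>.\<close>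

lemma disc_ball_compare:
  "\<exists>N \<theta>. 0 \<le> \<theta> \<and> \<theta> < 1 \<and> (\<forall>j. \<forall>x\<in>X. \<forall>y\<in>X. \<forall>a b. \<forall>L\<ge>0.
     vol (disc shape x y \<inter> cball a L) \<le> vol (disc shape x y \<inter> cball b L)
       + (vol (cball (0::'a) (L + cp_radius * lam ^ (j * N))) - vol (cball (0::'a) L))
       + 2 * (\<theta> ^ j * vol (cball (0::'a) (L + 2 * R0 * lam ^ (j * N)))))"
proof -
  obtain N \<theta> where \<theta>: "0 \<le> \<theta>" "\<theta> < 1" and
    tr: "\<And>j x v a L. x \<in> X \<Longrightarrow> v \<in> \<Delta> \<Longrightarrow> L \<ge> 0 \<Longrightarrow>
       vol (disc shape x (shift (lam ^ (j * N) *\<^sub>R v) x) \<inter> cball a L) \<le> \<theta> ^ j * vol (cball a (L + 2 * R0 * lam ^ (j * N)))"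
    using disc_translate_volume by blast
  have "vol (disc shape x y \<inter> cball a L) \<le> vol (disc shape x y \<inter> cball b L)
       + (vol (cball (0::'a) (L + cp_radius * lam ^ (j * N))) - vol (cball (0::'a) L))
       + 2 * (\<theta> ^ j * vol (cball (0::'a) (L + 2 * R0 * lam ^ (j * N))))"
    if x: "x \<in> X" and y: "y \<in> X" and L: "L \<ge> 0" for j x y a b L
  proof -
    let ?l = "lam ^ (j * N)"
    obtain v where v: "v \<in> \<Delta>" "norm (?l *\<^sub>R v - (a - b)) \<le> cp_radius * ?l"
      using \<Delta>_scaled_relatively_dense by blast
    define w where "w = ?l *\<^sub>R v"
    define s where "s = cp_radius * ?l"
    let ?A = "disc shape x y"
    have lm: "disc shape u u' \<inter> cball c r \<in> lmeasurable" if "u \<in> X" "u' \<in> X" for u u' c r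
      using disc_measurable[OF that] by (intro bounded_set_imp_lmeasurable) auto
    have wX: "shift w x \<in> X" "shift w y \<in> X" using X_shift x y by auto
    have "?A \<inter> cball a L \<subseteq> (disc shape x (shift w x) \<inter> cball a L) \<union>
        ((disc shape (shift w x) (shift w y) \<inter> cball a L) \<union> (disc shape y (shift w y) \<inter> cball a L))"
      using disc_triangle[of x y "shift w x"] disc_triangle[of "shift w x" y "shift w y"] disc_commute[of y "shift w y"] by blast
    then have "vol (?A \<inter> cball a L) \<le> vol ((disc shape x (shift w x) \<inter> cball a L) \<union>
        ((disc shape (shift w x) (shift w y) \<inter> cball a L) \<union> (disc shape y (shift w y) \<inter> cball a L)))"
      by (intro measure_mono_fmeasurable fmeasurable.Un fmeasurableD lm x y wX) auto
    also have "\<dots> \<le> vol (disc shape x (shift w x) \<inter> cball a L) +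
        (vol (disc shape (shift w x) (shift w y) \<inter> cball a L) + vol (disc shape y (shift w y) \<inter> cball a L))"
      by (intro order_trans[OF measure_Un_le] add_left_mono measure_Un_le fmeasurable.Un fmeasurableD lm x y wX)
    also have "vol (disc shape (shift w x) (shift w y) \<inter> cball a L) \<le> vol (?A \<inter> cball b L) + (vol (cball (0::'a) (L + s)) - vol (cball (0::'a) L))"
    proof -
      have sub: "disc shape (shift w x) (shift w y) \<inter> cball a L \<subseteq> (+) w ` (?A \<inter> cball b (L + s))"
      proof
        fix p assume p: "p \<in> disc shape (shift w x) (shift w y) \<inter> cball a L"
        then obtain q where q: "q \<in> ?A" "p = w + q" unfolding disc_shift by blast
        have "b - q = (a - p) + (w - (a - b))" by (simp add: q(2))
        then have "norm (b - q) \<le> norm (a - p) + norm (w - (a - b))" by (simp only: norm_triangle_ineq)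
        then have "q \<in> cball b (L + s)" using p v(2) by (simp add: dist_norm w_def s_def)
        with q show "p \<in> (+) w ` (?A \<inter> cball b (L + s))" by blast
      qed
      have "vol (disc shape (shift w x) (shift w y) \<inter> cball a L) \<le> vol ((+) w ` (?A \<inter> cball b (L + s)))"
        by (intro measure_mono_fmeasurable sub fmeasurableD lm wX measurable_translation x y)
      also have "\<dots> = vol (?A \<inter> cball b (L + s))" by (rule measure_translation)
      also have "\<dots> \<le> vol ((?A \<inter> cball b L) \<union> (cball b (L + s) - cball b L))"
        by (intro measure_mono_fmeasurable fmeasurable.Un fmeasurableD lm x y) auto
      also have "\<dots> \<le> vol (?A \<inter> cball b L) + vol (cball b (L + s) - cball b L)"
        by (intro measure_Un_le fmeasurableD lm x y) auto
      also have "vol (cball b (L + s) - cball b L) = vol (cball b (L + s)) - vol (cball b L)"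
        using cp_radius_pos lam by (intro measurable_measure_Diff) (auto simp: s_def intro!: subset_cball)
      finally show ?thesis unfolding vol_cball_center[of b] .
    qed
    also have "vol (disc shape x (shift w x) \<inter> cball a L) \<le> \<theta> ^ j * vol (cball (0::'a) (L + 2 * R0 * ?l))"
      using tr[OF x v(1) L, of j a] unfolding w_def vol_cball_center[of a] .
    also have "vol (disc shape y (shift w y) \<inter> cball a L) \<le> \<theta> ^ j * vol (cball (0::'a) (L + 2 * R0 * ?l))"
      using tr[OF y v(1) L, of j a] unfolding w_def vol_cball_center[of a] .
    finally show ?thesis unfolding s_def by simp
  qed
  with \<theta> show ?thesis by blast
qed

lemma mean_uniform_disc:
  assumes x: "x \<in> X" and y: "y \<in> X"
  shows "mean_uniform (disc shape x y)"
  unfolding mean_uniform_def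
proof (intro allI impI)
  fix e :: real assume e: "e > 0"
  obtain N \<theta> where \<theta>: "0 \<le> \<theta>" "\<theta> < 1" and cmp: "\<And>j a b L. L \<ge> 0 \<Longrightarrow>
     vol (disc shape x y \<inter> cball a L) \<le> vol (disc shape x y \<inter> cball b L)
       + (vol (cball (0::'a) (L + cp_radius * lam ^ (j * N))) - vol (cball (0::'a) L))
       + 2 * (\<theta> ^ j * vol (cball (0::'a) (L + 2 * R0 * lam ^ (j * N))))"
    using disc_ball_compare x y by blast
  have "(\<lambda>j. \<theta> ^ j) \<longlonglongrightarrow> 0" using \<theta> by (intro LIMSEQ_realpow_zero) auto
  \<comment> \<open>The two translate terms then cost at most \<open>2 * (e / 8) * 2\<close> volumes
    of the ball, that is, half of \<open>e\<close>.\<close>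
  then obtain j where j: "\<theta> ^ j < e / 8"
    using order_tendstoD(2)[of "\<lambda>j. \<theta> ^ j" 0 sequentially "e / 8"] e by (auto simp: eventually_sequentially)
  define s where "s = max (cp_radius * lam ^ (j * N)) (2 * R0 * lam ^ (j * N))"
  have s0: "s \<ge> 0" unfolding s_def using R0 lam by (simp add: le_max_iff_disj)
  \<comment> \<open>The bound 1 keeps the enlarged ball below twice the volume; the bound
    \<open>e / 2\<close> makes the shell cost the other half of \<open>e\<close>.\<close>
  define \<epsilon> where "\<epsilon> = min 1 (e / 2)"
  have "(\<lambda>n. (1 + s / real n) ^ DIM('a)) \<longlonglongrightarrow> (1 + 0) ^ DIM('a)"
    by (intro tendsto_intros lim_const_over_n)
  then have "\<forall>\<^sub>F n in sequentially. (1 + s / real n) ^ DIM('a) < 1 + \<epsilon>"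
    using e by (intro order_tendstoD(2)) (auto simp: \<epsilon>_def)
  then obtain m where m: "\<And>n. n \<ge> m \<Longrightarrow> (1 + s / real n) ^ DIM('a) < 1 + \<epsilon>" by (auto simp: eventually_sequentially)
  define L where "L = real (Suc m)"
  have L: "L > 0" by (simp add: L_def)
  let ?V = "vol (cball (0::'a) L)"
  have V: "?V > 0" using L by simp
  have grow: "vol (cball (0::'a) (L + t)) \<le> (1 + \<epsilon>) * ?V" if t: "0 \<le> t" "t \<le> s" for t
  proof -
    have "vol (cball (0::'a) (L + t)) \<le> vol (cball (0::'a) (L + s))"
      using t by (intro measure_mono_fmeasurable subset_cball) auto
    also have "\<dots> = (1 + s / L) ^ DIM('a) * ?V"
    proof -
      have "L + s = (1 + s / L) * L" using L by (simp add: field_simps)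
      then have "(L + s) ^ DIM('a) = (1 + s / L) ^ DIM('a) * L ^ DIM('a)" by (simp only: power_mult_distrib)
      moreover have "L + s \<ge> 0" "L \<ge> 0" using L s0 by auto
      ultimately show ?thesis by (simp only: vol_cball[of "L + s" "0::'a"] vol_cball[of L "0::'a"] mult.assoc)
    qed
    also have "\<dots> \<le> (1 + \<epsilon>) * ?V"
      using m[of "Suc m"] V unfolding L_def[symmetric] by (intro mult_right_mono) auto
    finally show ?thesis .
  qed
  have bd: "vol (disc shape x y \<inter> cball a L) \<le> vol (disc shape x y \<inter> cball b L) + e * ?V" for a b
  proof -
    have g1: "vol (cball (0::'a) (L + cp_radius * lam ^ (j * N))) \<le> (1 + \<epsilon>) * ?V"
      using cp_radius_pos lam by (intro grow) (auto simp: s_def)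
    have g2: "vol (cball (0::'a) (L + 2 * R0 * lam ^ (j * N))) \<le> (1 + \<epsilon>) * ?V"
      using R0 lam by (intro grow) (auto simp: s_def)
    have "\<theta> ^ j * vol (cball (0::'a) (L + 2 * R0 * lam ^ (j * N))) \<le> e / 8 * (2 * ?V)"
    proof (intro mult_mono)
      have "(1 + \<epsilon>) * ?V \<le> 2 * ?V" using V by (intro mult_right_mono) (auto simp: \<epsilon>_def)
      with g2 show "vol (cball (0::'a) (L + 2 * R0 * lam ^ (j * N))) \<le> 2 * ?V" by linarith
    qed (use j e in auto)
    moreover have "\<epsilon> * ?V \<le> e / 2 * ?V" using V by (intro mult_right_mono) (auto simp: \<epsilon>_def)
    ultimately show ?thesis using cmp[of L a b j] g1 L unfolding distrib_right by linarith
  qed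
  show "\<exists>L>0. \<exists>c. \<forall>a. \<bar>vol (disc shape x y \<inter> cball a L) - c * vol (cball a L)\<bar> \<le> e * vol (cball a L)"
  proof (rule exI[of _ L], rule conjI[OF L], rule exI[of _ "vol (disc shape x y \<inter> cball 0 L) / ?V"], rule allI)
    fix a
    have "vol (disc shape x y \<inter> cball 0 L) / ?V * ?V = vol (disc shape x y \<inter> cball 0 L)" using V by simp
    then show "\<bar>vol (disc shape x y \<inter> cball a L) - vol (disc shape x y \<inter> cball 0 L) / ?V * vol (cball a L)\<bar> \<le> e * vol (cball a L)"
      unfolding vol_cball_center[of a] using bd[of a 0] bd[of 0 a] by linarith
  qed
qed

end

section \<open>Comparison of orbit separation with the discrepancy metric\<close>

locale pure_point_inflation_folner = pure_point_inflation shape r0 R0 cen lam rho cp \<mu>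
  for shape :: "'l::finite \<Rightarrow> 'a::euclidean_space set" and r0 R0 :: real and cen :: "'l \<Rightarrow> 'a"
    and lam rho and cp and \<mu> +
  fixes F :: "nat \<Rightarrow> 'a set"
  assumes F: "folner F"
begin

abbreviation "X0 \<equiv> transversal X cp"
abbreviation "Dd \<equiv> D_disc shape F"

lemma X0D: "x \<in> X0 \<Longrightarrow> x \<in> X" by (simp add: transversal_def)

lemma disc_sets: "x \<in> X \<Longrightarrow> y \<in> X \<Longrightarrow> disc shape x y \<in> sets lebesgue"
  using disc_measurable by simp

lemma Dd_triangle:
  assumes "x \<in> X" "y \<in> X" "z \<in> X" shows "Dd x z \<le> Dd x y + Dd y z"
proof -
  have "Dd x z \<le> upper_density F (disc shape x y \<union> disc shape y z)"
    unfolding D_disc_def by (intro upper_density_mono[OF F] disc_sets assms sets.Un disc_triangle)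
  also have "\<dots> \<le> Dd x y + Dd y z"
    unfolding D_disc_def by (intro upper_density_Un[OF F] disc_sets assms)
  finally show ?thesis .
qed

lemma Dd_commute: "Dd x y = Dd y x"
  unfolding D_disc_def by (simp add: disc_commute)

lemma Dd_refl: "Dd x x = 0"
proof -
  have "Dd x x \<le> ereal 0" unfolding D_disc_def by (rule upper_density_leI) (simp add: disc_def dens_def)
  then show ?thesis using upper_density_nonneg[of F "disc shape x x"] by (simp add: D_disc_def zero_ereal_def)
qed

lemma Dd_uminus:
  assumes "x \<in> X" "y \<in> X" shows "upper_density F (uminus ` disc shape x y) = Dd x y"
  unfolding D_disc_def by (rule upper_density_uminus[OF disc_measurable[OF assms] mean_uniform_disc[OF assms] F])

text \<open>The bound 1/2 is below the cut-off and gives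
  \<open>\<epsilon> \<le> 1 / \<epsilon>\<close>; with \<open>meyer_radius / 2\<close>, two shifts
  shorter than \<open>\<delta>0\<close> differ by less than \<open>meyer_radius\<close>.\<close>

definition \<delta>0 :: real where "\<delta>0 = min (1 / 2) (meyer_radius / 2)"

lemma \<delta>0: "\<delta>0 > 0" "\<delta>0 \<le> 2 powr (-1/2)" "\<delta>0 \<le> meyer_radius / 2"
proof -
  show "\<delta>0 \<le> 2 powr (-1/2)" unfolding \<delta>0_def using half_le_cut by (simp add: min_le_iff_disj)
qed (use meyer_radius(1) in \<open>auto simp: \<delta>0_def\<close>)

text \<open>Closeness at \<open>p\<close> means agreement near \<open>p\<close> after small shifts
  \<open>u\<close> and \<open>v\<close>. Since both tilings have a control point at 0, a matched
  tile shows that \<open>v - u\<close> is a sum of two elements of \<open>\<Delta>\<close>, so it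
  vanishes. The tilings then agree exactly at \<open>p\<close>, which cannot lie in
  \<open>disc\<close>.\<close>

lemma tdist_ge_on_disc:
  assumes x: "x \<in> X0" and y: "y \<in> X0" and p: "p \<in> disc shape x y"
  shows "\<delta>0 \<le> tdist shape (shift (- p) x) (shift (- p) y)"
proof (rule ccontr)
  assume "\<not> ?thesis"
  then have "tdist shape (shift (- p) x) (shift (- p) y) < \<delta>0" by simp
  from tdist_lessE[OF this \<delta>0(2)] obtain \<epsilon> where \<epsilon>: "\<epsilon> < \<delta>0" "tmatch shape \<epsilon> (shift (- p) x) (shift (- p) y)" by blast
  then obtain u v where uv: "\<epsilon> > 0" "norm u \<le> \<epsilon>" "norm v \<le> \<epsilon>"
    "patch_at shape (shift (- u) (shift (- p) x)) 0 (1 / \<epsilon>) = patch_at shape (shift (- v) (shift (- p) y)) 0 (1 / \<epsilon>)"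
    unfolding tmatch_def by auto
  have xX: "x \<in> X" "y \<in> X" using x y X0D by auto
  let ?x = "shift (- u) (shift (- p) x)"
  let ?y = "shift (- v) (shift (- p) y)"
  obtain \<zeta> where \<zeta>: "\<zeta> \<in> ?x" "0 \<in> S \<zeta>" using X_cover[of ?x 0] xX X_shift by blast
  then have "\<zeta> \<in> patch_at shape ?x 0 (1 / \<epsilon>)" using uv(1) by (intro patch_atI) auto
  then have "\<zeta> \<in> ?y" unfolding uv(4) by (simp add: patch_at_def)
  then have 1: "shift_tile (p + v) \<zeta> \<in> y" by (simp add: mem_shift add.commute)
  have 2: "shift_tile (p + u) \<zeta> \<in> x" using \<zeta>(1) by (simp add: mem_shift add.commute)
  obtain \<sigma> \<tau> where st: "\<sigma> \<in> x" "cp \<sigma> = 0" "\<tau> \<in> y" "cp \<tau> = 0"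
    using x y unfolding transversal_def by auto
  have "cp (shift_tile (p + v) \<zeta>) - cp \<tau> \<in> \<Delta>" "cp \<sigma> - cp (shift_tile (p + u) \<zeta>) \<in> \<Delta>"
    by (rule \<Delta>I[OF xX(2) 1 st(3)], rule \<Delta>I[OF xX(1) st(1) 2])
  then have d: "cp \<zeta> + (p + v) \<in> \<Delta>" "- (cp \<zeta> + (p + u)) \<in> \<Delta>" using st by simp_all
  have "(cp \<zeta> + (p + v)) + - (cp \<zeta> + (p + u)) = 0"
  proof (rule meyer_radius2[OF d])
    have "norm (v - u) < meyer_radius" using norm_triangle_ineq4[of v u] uv \<epsilon>(1) \<delta>0(3) by simp
    then show "norm ((cp \<zeta> + (p + v)) + - (cp \<zeta> + (p + u))) < meyer_radius" by simp
  qed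
  then have vu: "v = u" by simp
  have "\<epsilon> < 1 / 2" using \<epsilon>(1) by (simp add: \<delta>0_def)
  then have "\<epsilon> * \<epsilon> \<le> 1" using uv(1) by (simp add: mult_le_one)
  then have "\<epsilon> \<le> 1 / \<epsilon>" using uv(1) by (simp add: field_simps)
  \<comment> \<open>After the common shift the point \<open>p\<close> sits at \<open>- u\<close>,
    within the ball of agreement because
    \<open>norm u \<le> \<epsilon> \<le> 1 / \<epsilon>\<close>.\<close>
  then have "cball (- u) 0 \<subseteq> cball 0 (1 / \<epsilon>)" using uv by auto
  from patch_at_mono_eq[OF uv(4)[unfolded vu] this]
  have "patch_at shape x p 0 = patch_at shape y p 0"
    using patch_at_shift_eq_iff[of shape "- u - p" x "- u" 0 "- u - p" y "u + p"] by simp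
  moreover obtain \<xi> where "\<xi> \<in> sym_diff x y" "p \<in> S \<xi>" using p unfolding disc_def by blast
  ultimately show False using patch_atI[of \<xi> x p shape p 0] patch_atI[of \<xi> y p shape p 0] by (auto simp: patch_at_def)
qed

lemma tdist_ge_sets: "{t. \<delta> \<le> tdist shape (shift t x) (shift t y)} \<in> sets borel"
  by (intro borel_closed closed_Collect_le continuous_on_const continuous_on_tdist)

lemma D_sep_ge:
  assumes x: "x \<in> X0" and y: "y \<in> X0" shows "Dd x y \<le> D_sep shape F \<delta>0 x y"
proof -
  have xX: "x \<in> X" "y \<in> X" using x y X0D by auto
  have "Dd x y = upper_density F (uminus ` disc shape x y)" by (simp add: Dd_uminus xX)
  also have "\<dots> \<le> D_sep shape F \<delta>0 x y"
    unfolding D_sep_def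
  proof (rule upper_density_mono[OF F])
    show "uminus ` disc shape x y \<in> sets lebesgue" using uminus_image_borel[OF disc_measurable[OF xX]] by simp
    show "{t. \<delta>0 \<le> tdist shape (shift t x) (shift t y)} \<in> sets lebesgue" using tdist_ge_sets by simp
  qed (use tdist_ge_on_disc[OF x y] in auto)
  finally show ?thesis .
qed

lemma D_W_refl: "D_W shape x x = 0"
proof -
  have "D_W shape x x = (SUP F\<in>Collect (folner :: (nat \<Rightarrow> 'a set) \<Rightarrow> bool). 0)"
    unfolding D_W_def by (rule SUP_cong) (simp_all add: set_lebesgue_integral_def zero_ereal_def[symmetric] Limsup_const)
  also have "\<dots> = 0" using F by (intro SUP_eq_const) auto
  finally show ?thesis .
qed

text \<open>Markov's inequality: \<open>tdist\<close> is at least \<open>\<delta>0\<close> on the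
  reflected \<open>disc\<close>, so the average along \<open>F\<close> dominates
  \<open>\<delta>0\<close> times its density.\<close>

lemma D_W_imp_Dd:
  assumes x: "x \<in> X0" and y: "y \<in> X0" and 0: "D_W shape x y = 0"
  shows "Dd x y = 0"
proof -
  have xX: "x \<in> X" "y \<in> X" using x y X0D by auto
  let ?g = "\<lambda>t. tdist shape (shift t x) (shift t y)"
  let ?A = "uminus ` disc shape x y"
  have A: "?A \<in> sets borel" by (rule uminus_image_borel[OF disc_measurable[OF xX]])
  have "limsup (\<lambda>n. ereal ((LINT t:F n|lebesgue. ?g t) / vol (F n))) \<le> D_W shape x y"
    unfolding D_W_def by (rule SUP_upper) (use F in simp)
  then have lim: "limsup (\<lambda>n. ereal ((LINT t:F n|lebesgue. ?g t) / vol (F n))) \<le> 0" using 0 by simp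
  have avg: "\<delta>0 * dens F ?A n \<le> (LINT t:F n|lebesgue. ?g t) / vol (F n)" for n
  proof -
    have Fm: "F n \<in> lmeasurable" by (rule folnerD(1)[OF F])
    have AF: "?A \<inter> F n \<in> lmeasurable" using A by (intro Int_folner_lmeasurable[OF F]) simp
    have gm: "?g \<in> borel_measurable lebesgue"
      using borel_measurable_continuous_onI[OF continuous_on_tdist] by (intro measurable_completion) simp
    have "\<delta>0 * vol (?A \<inter> F n) = (\<integral>t. \<delta>0 * indicator (?A \<inter> F n) t \<partial>lebesgue)"
      using AF by simp
    also have "\<dots> \<le> (\<integral>t. indicator (F n) t *\<^sub>R ?g t \<partial>lebesgue)"
    proof (rule integral_mono)
      show "integrable lebesgue (\<lambda>t. \<delta>0 * indicator (?A \<inter> F n) t)"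
        using AF by (intro integrable_mult_right integrable_real_indicator) (auto simp: fmeasurable_def)
      have "integrable lebesgue (indicator (F n) :: 'a \<Rightarrow> real)"
        using Fm by (intro integrable_real_indicator) (auto simp only: fmeasurable_def)
      then show "integrable lebesgue (\<lambda>t. indicator (F n) t *\<^sub>R ?g t)"
      proof (rule Bochner_Integration.integrable_bound)
        show "(\<lambda>t. indicator (F n) t *\<^sub>R ?g t) \<in> borel_measurable lebesgue"
          using gm Fm by (intro borel_measurable_scaleR borel_measurable_indicator) auto
        show "AE t in lebesgue. norm (indicator (F n) t *\<^sub>R ?g t) \<le> norm (indicator (F n) t :: real)"
          using tdist_nonneg[of shape] tdist_le_1[of shape] by (intro AE_I2) (auto simp: indicator_def)
      qed
      fix t
      show "\<delta>0 * indicator (?A \<inter> F n) t \<le> indicator (F n) t *\<^sub>R ?g t"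
        using tdist_ge_on_disc[OF x y, of "- t"] tdist_nonneg[of shape] by (auto simp: indicator_def)
    qed
    also have "\<dots> = (LINT t:F n|lebesgue. ?g t)" by (simp add: set_lebesgue_integral_def)
    finally have "\<delta>0 * vol (?A \<inter> F n) / vol (F n) \<le> (LINT t:F n|lebesgue. ?g t) / vol (F n)"
      using folnerD(2)[OF F, of n] by (intro divide_right_mono) auto
    then show ?thesis by (simp add: dens_def)
  qed
  have "upper_density F ?A \<le> ereal 0"
  proof (rule upper_density_leI)
    fix e :: real assume "e > 0"
    then have "limsup (\<lambda>n. ereal ((LINT t:F n|lebesgue. ?g t) / vol (F n))) < ereal (\<delta>0 * e)"
      using \<delta>0(1) by (intro order.strict_trans1[OF lim]) simp
    then have "\<forall>\<^sub>F n in sequentially. ereal ((LINT t:F n|lebesgue. ?g t) / vol (F n)) < ereal (\<delta>0 * e)"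
      by (rule Limsup_lessD)
    then show "\<forall>\<^sub>F n in sequentially. dens F ?A n \<le> 0 + e"
    proof eventually_elim
      fix n assume "ereal ((LINT t:F n|lebesgue. ?g t) / vol (F n)) < ereal (\<delta>0 * e)"
      with avg[of n] have "\<delta>0 * dens F ?A n < \<delta>0 * e" by simp
      then show "dens F ?A n \<le> 0 + e" using \<delta>0(1) by simp
    qed
  qed
  then have "Dd x y \<le> 0" using Dd_uminus[OF xX] by (simp add: zero_ereal_def)
  then show ?thesis using upper_density_nonneg[of F "disc shape x y"] by (simp add: D_disc_def)
qed

text \<open>The definite description is meaningful because representatives of one class have
  \<open>Dd\<close> distance 0 and \<open>Dd\<close> satisfies the triangle inequality.\<close>

lemma class_dist_eq:
  assumes x: "x \<in> X0" and y: "y \<in> X0"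
  shows "class_dist shape F X0 (W_class shape X x) (W_class shape X y) = Dd x y"
proof -
  have mem: "u \<in> W_class shape X u \<inter> X0" if "u \<in> X0" for u
    using that X0D by (simp add: W_class_def D_W_refl)
  have eq: "Dd x' y' = Dd x y" if "x' \<in> W_class shape X x \<inter> X0" "y' \<in> W_class shape X y \<inter> X0" for x' y'
  proof -
    have z: "Dd x x' = 0" "Dd y y' = 0" using that x y by (auto simp: W_class_def intro: D_W_imp_Dd)
    have X: "x \<in> X" "x' \<in> X" "y \<in> X" "y' \<in> X" using that x y X0D by auto
    have "Dd x' y' \<le> Dd x' x + (Dd x y + Dd y y')"
      using Dd_triangle[OF X(2,1,4)] Dd_triangle[OF X(1,3,4)] by (meson add_left_mono order_trans)
    moreover have "Dd x y \<le> Dd x x' + (Dd x' y' + Dd y' y)"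
      using Dd_triangle[OF X(1,2,3)] Dd_triangle[OF X(2,4,3)] by (meson add_left_mono order_trans)
    ultimately show ?thesis using z by (simp add: Dd_commute[of x' x] Dd_commute[of y' y])
  qed
  show ?thesis
    unfolding class_dist_def
  proof (rule the_equality)
    fix r assume r: "\<forall>x'\<in>W_class shape X x \<inter> X0. \<forall>y'\<in>W_class shape X y \<inter> X0. Dd x' y' = r"
    show "r = Dd x y" by (rule bspec[OF bspec[OF r mem[OF x]] mem[OF y], symmetric])
  qed (use eq in blast)
qed

text \<open>One representative in the transversal is chosen for each class. The separation
  \<open>\<nu>\<close> is kept without loss, since \<open>D_sep\<close> at \<open>\<delta>0\<close>
  dominates \<open>Dd\<close> there.\<close>

lemma sep_number_lower:
  assumes "\<nu> > 0"
  shows "sep_number (W_class shape X ` X0) (class_dist shape F X0) \<nu> \<le> sep_number X (D_sep shape F \<delta>0) \<nu>"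
  unfolding sep_number_def[of "W_class shape X ` X0"]
proof (rule SUP_least)
  fix T assume "T \<in> {S. S \<subseteq> W_class shape X ` X0 \<and> finite S \<and> (\<forall>x\<in>S. \<forall>y\<in>S. x \<noteq> y \<longrightarrow> ereal \<nu> \<le> class_dist shape F X0 x y)}"
  then have T: "T \<subseteq> W_class shape X ` X0" "finite T" "\<And>A B. A \<in> T \<Longrightarrow> B \<in> T \<Longrightarrow> A \<noteq> B \<Longrightarrow> ereal \<nu> \<le> class_dist shape F X0 A B"
    by auto
  have "\<forall>A\<in>T. \<exists>x. x \<in> X0 \<and> A = W_class shape X x" using T(1) by blast
  then obtain r where r: "\<And>A. A \<in> T \<Longrightarrow> r A \<in> X0" "\<And>A. A \<in> T \<Longrightarrow> A = W_class shape X (r A)" by metis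
  have inj: "inj_on r T" using r(2) by (metis inj_onI)
  have "ereal \<nu> \<le> D_sep shape F \<delta>0 (r A) (r B)" if AB: "A \<in> T" "B \<in> T" "r A \<noteq> r B" for A B
  proof -
    have "A \<noteq> B" using AB(3) by blast
    then have "ereal \<nu> \<le> class_dist shape F X0 (W_class shape X (r A)) (W_class shape X (r B))"
      using T(3)[OF AB(1,2)] r(2)[OF AB(1)] r(2)[OF AB(2)] by simp
    also have "\<dots> = Dd (r A) (r B)" by (rule class_dist_eq[OF r(1)[OF AB(1)] r(1)[OF AB(2)]])
    also have "\<dots> \<le> D_sep shape F \<delta>0 (r A) (r B)" by (rule D_sep_ge[OF r(1)[OF AB(1)] r(1)[OF AB(2)]])
    finally show ?thesis .
  qed
  then have "r ` T \<in> {S. S \<subseteq> X \<and> finite S \<and> (\<forall>x\<in>S. \<forall>y\<in>S. x \<noteq> y \<longrightarrow> ereal \<nu> \<le> D_sep shape F \<delta>0 x y)}"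
    using T(2) r(1) X0D by auto
  then have "enat (card (r ` T)) \<le> sep_number X (D_sep shape F \<delta>0) \<nu>"
    unfolding sep_number_def by (rule SUP_upper)
  then show "enat (card T) \<le> sep_number X (D_sep shape F \<delta>0) \<nu>" by (simp add: card_image[OF inj])
qed

text \<open>If the shifted tilings are \<open>\<delta>\<close>-apart at \<open>t\<close>, then
  \<open>x\<close> and \<open>y\<close> moved by the same \<open>t + a\<close> are still
  \<open>\<delta> / 2\<close>-apart and differ in a tile near the origin. Such a tile contains a
  point of a fixed net of mesh \<open>r0\<close>, so \<open>t\<close> lies in one of
  \<open>card N\<close> translates of the reflected \<open>disc\<close>.\<close>

lemma D_sep_le:
  assumes "\<delta> > 0"
  shows "\<exists>C\<ge>1. \<forall>x\<in>X. \<forall>y\<in>X. \<forall>a b. norm (a - b) \<le> \<delta> / 2 \<longrightarrow>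
     (\<forall>d. Dd x y \<le> ereal d \<longrightarrow> D_sep shape F \<delta> (shift a x) (shift b y) \<le> ereal (C * d))"
proof -
  \<comment> \<open>Agreement up to radius \<open>4 / \<delta>\<close> would give distance at most
    \<open>\<delta> / 4\<close>; a tile meeting that ball has its centre at most
    \<open>2 * R0\<close> further out.\<close>
  define \<rho> where "\<rho> = 4 / \<delta> + 2 * R0"
  have "cball (0::'a) \<rho> \<subseteq> (\<Union>s\<in>cball 0 \<rho>. ball s r0)" using r0 by auto
  then obtain N where N: "finite N" "cball (0::'a) \<rho> \<subseteq> (\<Union>s\<in>N. ball s r0)"
    using compactE_image[OF compact_cball, of "cball 0 \<rho>" "\<lambda>s. ball s r0" 0 \<rho>] by (metis open_ball)
  have "D_sep shape F \<delta> (shift a x) (shift b y) \<le> ereal ((real (card N) + 1) * d)"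
    if x: "x \<in> X" and y: "y \<in> X" and ab: "norm (a - b) \<le> \<delta> / 2" and d: "Dd x y \<le> ereal d" for x y a b d
  proof -
    let ?A = "uminus ` disc shape x y"
    have A: "?A \<in> sets borel" by (rule uminus_image_borel[OF disc_measurable[OF x y]])
    have Ad: "upper_density F ((+) (s - a) ` ?A) \<le> ereal d" for s
      using upper_density_translate[OF F A, of "s - a"] Dd_uminus[OF x y] d by (metis order_trans)
    have Am: "(+) s ` ?A \<in> sets lebesgue" for s using translation_emeasure(1)[OF A] by simp
    have d0: "d \<ge> 0" using d upper_density_nonneg[of F "disc shape x y"] by (metis D_disc_def ereal_less_eq(5) order_trans)
    have sub: "{t. \<delta> \<le> tdist shape (shift t (shift a x)) (shift t (shift b y))} \<subseteq> (\<Union>s\<in>N. (+) (s - a) ` ?A)"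
    proof
      fix t assume "t \<in> {t. \<delta> \<le> tdist shape (shift t (shift a x)) (shift t (shift b y))}"
      then have t: "\<delta> \<le> tdist shape (shift (t + a) x) (shift (t + b) y)" by simp
      let ?u = "shift (t + a) x" and ?v = "shift (t + a) y"
      have "tdist shape ?v (shift (t + b) y) \<le> \<delta> / 2"
        using tdist_shift_le[of shape "t + a" y "t + b"] ab by simp
      then have uv: "\<delta> / 2 \<le> tdist shape ?u ?v"
        using t tdist_triangle[of shape ?u "shift (t + b) y" ?v] by linarith
      have "patch_at shape ?u 0 (1 / (\<delta> / 4)) \<noteq> patch_at shape ?v 0 (1 / (\<delta> / 4))"
      proof
        assume "patch_at shape ?u 0 (1 / (\<delta> / 4)) = patch_at shape ?v 0 (1 / (\<delta> / 4))"
        then have "tdist shape (shift (- 0) ?u) (shift (- 0) ?v) \<le> \<delta> / 4"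
          by (rule tdist_shift_le_of_patch_eq) (use assms in simp)
        then show False using uv assms by simp
      qed
      then obtain \<zeta> where \<zeta>: "\<zeta> \<in> sym_diff ?u ?v" "S \<zeta> \<inter> cball 0 (4 / \<delta>) \<noteq> {}"
        unfolding patch_at_def by auto
      obtain q where q: "q \<in> S \<zeta>" "norm q \<le> 4 / \<delta>" using \<zeta>(2) by auto
      have "norm (centre \<zeta>) \<le> \<rho>"
        using dist_supp[OF q(1) centre_in_supp] q(2) norm_triangle_ineq2[of "centre \<zeta>" q]
        by (simp add: \<rho>_def dist_norm norm_minus_commute)
      then have "centre \<zeta> \<in> (\<Union>s\<in>N. ball s r0)" using N(2) by (meson mem_cball_0 subsetD)
      then obtain s where s: "s \<in> N" "dist s (centre \<zeta>) < r0" by auto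
      have "s \<in> S \<zeta>" using s(2) cball_centre[of \<zeta>] interior_subset[of "S \<zeta>"] by (auto simp: subset_iff dist_commute)
      then have "s \<in> disc shape ?u ?v" using \<zeta>(1) unfolding disc_def by blast
      then obtain p where p: "p \<in> disc shape x y" "s = (t + a) + p" unfolding disc_shift by blast
      have "t = (s - a) + - p" by (simp add: p(2))
      with p(1) s(1) show "t \<in> (\<Union>s\<in>N. (+) (s - a) ` ?A)" by blast
    qed
    have "D_sep shape F \<delta> (shift a x) (shift b y) \<le> upper_density F (\<Union>s\<in>N. (+) (s - a) ` ?A)"
      unfolding D_sep_def
    proof (rule upper_density_mono[OF F _ _ sub])
      show "{t. \<delta> \<le> tdist shape (shift t (shift a x)) (shift t (shift b y))} \<in> sets lebesgue"
        by (rule sets_completionI_sets) (simp only: sets_lborel tdist_ge_sets)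
      show "(\<Union>s\<in>N. (+) (s - a) ` ?A) \<in> sets lebesgue" using Am N(1) by (intro sets.finite_UN) auto
    qed
    also have "\<dots> \<le> ereal (real (card N) * d)"
      by (rule upper_density_UN[OF F N(1) Am Ad d0])
    also have "\<dots> \<le> ereal ((real (card N) + 1) * d)" using d0 by (simp add: mult_right_mono)
    finally show ?thesis .
  qed
  then show ?thesis by (intro exI[of _ "real (card N) + 1"]) auto
qed

text \<open>Each tiling is moved into the transversal by a control point near 0, and a separated set
  is split according to the net point next to that vector. Within one part the vectors differ by at
  most \<open>\<delta> / 2\<close>, so \<open>D_sep_le\<close> turns separation of tilings into
  separation of classes, and there are at most \<open>card N\<close> parts.\<close>

lemma sep_number_upper:
  assumes \<delta>: "\<delta> > 0"
  shows "\<exists>M\<ge>1. \<exists>C\<ge>1. \<forall>\<nu>>0. sep_number X (D_sep shape F \<delta>) \<nu> \<le>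
     of_nat M * sep_number (W_class shape X ` X0) (class_dist shape F X0) (\<nu> / C)"
proof -
  obtain C where C: "C \<ge> 1" "\<And>x y a b d. x \<in> X \<Longrightarrow> y \<in> X \<Longrightarrow> norm (a - b) \<le> \<delta> / 2 \<Longrightarrow> Dd x y \<le> ereal d \<Longrightarrow>
      D_sep shape F \<delta> (shift a x) (shift b y) \<le> ereal (C * d)"
    using D_sep_le[OF \<delta>] by blast
  have "cball (0::'a) cp_radius \<subseteq> (\<Union>s\<in>cball 0 cp_radius. ball s (\<delta> / 4))" using \<delta> by auto
  then obtain N where N: "finite N" "cball (0::'a) cp_radius \<subseteq> (\<Union>s\<in>N. ball s (\<delta> / 4))"
    using compactE_image[OF compact_cball, of "cball 0 cp_radius" "\<lambda>s. ball s (\<delta> / 4)" 0 cp_radius] by (metis open_ball)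
  have "\<exists>a s. shift (- a) x \<in> X0 \<and> s \<in> N \<and> dist s a < \<delta> / 4" if x: "x \<in> X" for x
  proof -
    obtain \<tau> where \<tau>: "\<tau> \<in> x" "norm (cp \<tau> - 0) \<le> cp_radius" using control_point_near[OF x] by blast
    have "shift_tile (- cp \<tau>) \<tau> \<in> shift (- cp \<tau>) x" "cp (shift_tile (- cp \<tau>) \<tau>) = 0" using \<tau>(1) by simp_all
    then have "shift (- cp \<tau>) x \<in> X0" unfolding transversal_def using X_shift[OF x] by (metis (mono_tags, lifting) image_eqI mem_Collect_eq)
    moreover have "cp \<tau> \<in> (\<Union>s\<in>N. ball s (\<delta> / 4))" by (rule subsetD[OF N(2)]) (use \<tau>(2) in simp)
    ultimately show ?thesis by auto
  qed
  then obtain a s where as: "\<And>x. x \<in> X \<Longrightarrow> shift (- a x) x \<in> X0" "\<And>x. x \<in> X \<Longrightarrow> s x \<in> N" "\<And>x. x \<in> X \<Longrightarrow> dist (s x) (a x) < \<delta> / 4"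
    by metis
  let ?sep = "\<lambda>\<nu>. sep_number (W_class shape X ` X0) (class_dist shape F X0) (\<nu> / C)"
  have main: "sep_number X (D_sep shape F \<delta>) \<nu> \<le> of_nat (card N + 1) * ?sep \<nu>" if \<nu>: "\<nu> > 0" for \<nu>
    unfolding sep_number_def[of X]
  proof (rule SUP_least)
    fix T assume "T \<in> {S. S \<subseteq> X \<and> finite S \<and> (\<forall>x\<in>S. \<forall>y\<in>S. x \<noteq> y \<longrightarrow> ereal \<nu> \<le> D_sep shape F \<delta> x y)}"
    then have T: "T \<subseteq> X" "finite T" "\<And>x y. x \<in> T \<Longrightarrow> y \<in> T \<Longrightarrow> x \<noteq> y \<Longrightarrow> ereal \<nu> \<le> D_sep shape F \<delta> x y" by auto
    define f where "f x = W_class shape X (shift (- a x) x)" for x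
    define P where "P c = {x \<in> T. s x = c}" for c
    have part: "enat (card (P c)) \<le> ?sep \<nu>" for c
    proof -
      have sepd: "ereal (\<nu> / C) \<le> Dd (shift (- a x) x) (shift (- a y) y)" if xy: "x \<in> P c" "y \<in> P c" "x \<noteq> y" for x y
      proof (rule ccontr)
        assume "\<not> ?thesis"
        then have "Dd (shift (- a x) x) (shift (- a y) y) < ereal (\<nu> / C)" by simp
        \<comment> \<open>A real number strictly in between is taken because \<open>Dd\<close> is
          extended real while \<open>D_sep_le\<close> works with real bounds.\<close>
        then obtain d where d: "Dd (shift (- a x) x) (shift (- a y) y) < ereal d" "ereal d < ereal (\<nu> / C)"
          using ereal_dense2 by blast
        have X: "x \<in> X" "y \<in> X" using xy T(1) by (auto simp: P_def)
        have "dist c (a x) < \<delta> / 4" "dist c (a y) < \<delta> / 4" using as(3)[OF X(1)] as(3)[OF X(2)] xy by (auto simp: P_def)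
        then have "norm (a x - a y) \<le> \<delta> / 2" using dist_triangle3[of "a x" "a y" c] by (simp add: dist_norm)
        then have "D_sep shape F \<delta> (shift (a x) (shift (- a x) x)) (shift (a y) (shift (- a y) y)) \<le> ereal (C * d)"
          using d(1) X X_shift by (intro C(2)) auto
        then have "D_sep shape F \<delta> x y \<le> ereal (C * d)" by simp
        also have "\<dots> < ereal \<nu>" using d(2) C(1) by (simp add: field_simps)
        finally show False using T(3)[of x y] xy by (auto simp: P_def)
      qed
      have inX0: "shift (- a x) x \<in> X0" if "x \<in> P c" for x using that T(1) as(1) by (auto simp: P_def)
      have cd: "ereal (\<nu> / C) \<le> class_dist shape F X0 (f x) (f y)" if "x \<in> P c" "y \<in> P c" "x \<noteq> y" for x y
        unfolding f_def class_dist_eq[OF inX0[OF that(1)] inX0[OF that(2)]] by (rule sepd[OF that])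
      have inj: "inj_on f (P c)"
      proof (rule inj_onI, rule ccontr)
        fix x y assume xy: "x \<in> P c" "y \<in> P c" "f x = f y" "x \<noteq> y"
        have "class_dist shape F X0 (f x) (f x) = Dd (shift (- a x) x) (shift (- a x) x)"
          unfolding f_def by (rule class_dist_eq[OF inX0[OF xy(1)] inX0[OF xy(1)]])
        then have "class_dist shape F X0 (f x) (f y) = 0" using xy(3) by (simp add: Dd_refl)
        moreover have "\<nu> / C > 0" using \<nu> C(1) by simp
        ultimately show False using cd[OF xy(1,2,4)] by (simp add: zero_ereal_def)
      qed
      have "f ` P c \<in> {S. S \<subseteq> W_class shape X ` X0 \<and> finite S \<and> (\<forall>x\<in>S. \<forall>y\<in>S. x \<noteq> y \<longrightarrow> ereal (\<nu> / C) \<le> class_dist shape F X0 x y)}"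
        using T(2) inX0 cd by (auto simp: P_def f_def)
      then have "enat (card (f ` P c)) \<le> ?sep \<nu>" unfolding sep_number_def by (rule SUP_upper)
      then show ?thesis by (simp add: card_image[OF inj])
    qed
    show "enat (card T) \<le> of_nat (card N + 1) * ?sep \<nu>"
    proof (cases "?sep \<nu>")
      case (enat k)
      have "T = (\<Union>c\<in>N. P c)" using T(1) as(2) by (auto simp: P_def)
      then have "card T \<le> (\<Sum>c\<in>N. card (P c))" using card_UN_le[OF N(1), of P] by simp
      also have "\<dots> \<le> (\<Sum>c\<in>N. k)" using part enat by (intro sum_mono) simp
      also have "\<dots> \<le> (card N + 1) * k" by simp
      finally show ?thesis unfolding enat by (simp only: of_nat_eq_enat times_enat_simps enat_ord_simps)
    next
      case infinity
      \<comment> \<open>The summand 1 keeps the factor nonzero, so its product with infinity is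
        infinity.\<close>
      have "of_nat (card N + 1) * (\<infinity> :: enat) = \<infinity>" unfolding of_nat_eq_enat by simp
      then show ?thesis unfolding infinity by simp
    qed
  qed
  show ?thesis
    by (rule exI[of _ "card N + 1"], rule conjI, simp, rule exI[of _ C]) (use C(1) main in blast)
qed

lemma OSD_eq: "OSD shape F X = upper_box_dim (W_class shape X ` X0) (class_dist shape F X0)"
proof (rule antisym)
  show "OSD shape F X \<le> upper_box_dim (W_class shape X ` X0) (class_dist shape F X0)"
    unfolding OSD_def
  proof (rule SUP_least)
    fix \<delta> :: real assume "\<delta> \<in> {0<..}"
    then obtain M C where MC: "M \<ge> 1" "C \<ge> 1" "\<And>\<nu>. \<nu> > 0 \<Longrightarrow> sep_number X (D_sep shape F \<delta>) \<nu> \<le>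
        of_nat M * sep_number (W_class shape X ` X0) (class_dist shape F X0) (\<nu> / C)"
      using sep_number_upper[of \<delta>] by auto
    show "Limsup (at_right 0) (\<lambda>\<nu>. log_enat (sep_number X (D_sep shape F \<delta>) \<nu>) / ereal (- ln \<nu>))
        \<le> upper_box_dim (W_class shape X ` X0) (class_dist shape F X0)"
      unfolding upper_box_dim_def 
      by (rule log_enat_mult_le[where M = M and C = C and g = "sep_number (W_class shape X ` X0) (class_dist shape F X0)"])
        (use MC in auto)
  qed
  have "upper_box_dim (W_class shape X ` X0) (class_dist shape F X0) \<le>
      Limsup (at_right 0) (\<lambda>\<nu>. log_enat (sep_number X (D_sep shape F \<delta>0) \<nu>) / ereal (- ln \<nu>))"
    unfolding upper_box_dim_def
    by (rule log_enat_mult_le[where M = 1 and C = 1]) (use sep_number_lower in \<open>auto simp: one_enat_def[symmetric]\<close>)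
  also have "\<dots> \<le> OSD shape F X"
    unfolding OSD_def by (rule SUP_upper) (use \<delta>0(1) in simp)
  finally show "upper_box_dim (W_class shape X ` X0) (class_dist shape F X0) \<le> OSD shape F X" .
qed

end

theorem theorem3p16:
  fixes shape :: "'l::finite \<Rightarrow> 'a::euclidean_space set"
    and lam :: real
    and rho :: "'l \<Rightarrow> ('a, 'l) tile set"
    and X X0 :: "('a, 'l) tile set set"
    and \<mu> :: "('a, 'l) tile set measure"
    and cp :: "('a, 'l) tile \<Rightarrow> 'a"
    and F :: "nat \<Rightarrow> 'a set"
  assumes "prototiles shape"
    and "stone_inflation shape lam rho"
    and "primitive_inflation lam rho"
    and X: "X = inflation_hull shape lam rho"
    and "flc shape X"
    and "non_periodic X"
    and "unique_invariant_prob shape X \<mu>"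
    and "pure_point_spectrum \<mu>"
    and "control_points lam rho X cp"
    and X0: "X0 = transversal X cp"
    and "folner F"
  shows "OSD shape F X = upper_box_dim (W_class shape X ` X0) (class_dist shape F X0)"
proof -
  obtain r0 R0 cen where "prototile_shapes shape r0 R0 cen" by (rule prototiles_constants[OF assms(1)])
  then interpret stone_inflations shape r0 R0 cen lam rho
    using assms(2) by (simp add: stone_inflations_def stone_inflations_axioms_def)
  have XX: "stone_inflations.X shape lam rho = X" unfolding X_def X by (rule refl)
  have inv: "invariant_prob shape X \<mu>" using assms(7) by (simp add: unique_invariant_prob_def)
  \<comment> \<open>Nonemptiness comes from the invariant probability: its space is contained in
    \<open>X\<close> and cannot be empty.\<close>
  have "X \<noteq> {}"
  proof
    assume "X = {}"
    have ps: "prob_space \<mu>" and sets: "sets \<mu> = sigma_sets X {U. openin (Metric_space.mtopology X (tdist shape)) U}"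
      using inv by (auto simp: invariant_prob_def)
    interpret M: Metric_space X "tdist shape" using X_Metric_space unfolding XX .
    have "space \<mu> \<in> sigma_sets X {U. openin M.mtopology U}" using sets.top[of \<mu>] unfolding sets .
    then have "space \<mu> \<subseteq> X"
      by (rule sigma_sets_into_sp[rotated]) (use openin_subset[of M.mtopology] in auto)
    then show False using prob_space.not_empty[OF ps] \<open>X = {}\<close> by simp
  qed
  then interpret primitive_stone_inflations shape r0 R0 cen lam rho
    by unfold_locales (simp_all add: assms(3) XX)
  interpret pure_point_inflation_folner shape r0 R0 cen lam rho cp \<mu> F
    by unfold_locales (simp_all add: assms(5,7,9)[folded XX] assms(8,11))
  show ?thesis using OSD_eq unfolding XX X0 .
qed

end
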